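(* Let $\sigma\in\{1,-1\}$. For every $(u_0,v_0)\in \mathcal{E}\times\mathcal{E}$, there exists a unique solution $(u,v)\in \mathcal{C}^{\infty}(\mathbb{R},\mathcal{E}\times\mathcal{E})$ to the system $$i\partial_t u=\Pi(|v|^2u),\qquad i\partial_t v=\sigma\,\Pi(|u|^2v),\qquad u(0,\cdot)=u_0,\quad v(0,\cdot)=v_0,$$ and this solution depends smoothly on $(u_0,v_0)$. Moreover, for every $t\in\mathbb{R}$, $$\int_{\mathbb{C}}|u(t,z)|^2dL(z)=\int_{\mathbb{C}}|u_0(z)|^2dL(z),\qquad \int_{\mathbb{C}}|v(t,z)|^2dL(z)=\int_{\mathbb{C}}|v_0(z)|^2dL(z),$$ $$\int_{\mathbb{C}}|u(t,z)|^2|v(t,z)|^2dL(z)=\int_{\mathbb{C}}|u_0(z)|^2|v_0(z)|^2dL(z).$$ Furthermore, if $(zu_0,zv_0)\in L^2(\mathbb{C})\times L^2(\mathbb{C})$, then $(zu(t),zv(t))\in L^2(\mathbb{C})\times L^2(\mathbb{C})$ for every $t\in\mathbb{R}$, and $$\int_{\mathbb{C}}(|z|^2-1)\big(|u(t,z)|^2+\sigma|v(t,z)|^2\big)dL(z)=\int_{\mathbb{C}}(|z|^2-1)\big(|u_0(z)|^2+\sigma|v_0(z)|^2\big)dL(z),$$ $$\int_{\mathbb{C}}z\big(|u(t,z)|^2+\sigma|v(t,z)|^2\big)dL(z)=\int_{\mathbb{C}}z\big(|u_0(z)|^2+\sigma|v_0(z)|^2\big)dL(z).$$ More generally, if for some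 $s>0$ one has $(\langle z\rangle^su_0,\langle z\rangle^sv_0)\in L^2(\mathbb{C})\times L^2(\mathbb{C})$, then $(\langle z\rangle^su(t),\langle z\rangle^sv(t))\in L^2(\mathbb{C})\times L^2(\mathbb{C})$ for every $t\in\mathbb{R}$.
   Context: $L$ is Lebesgue measure on $\mathbb{C}$ and $\langle z\rangle=(1+|z|^2)^{1/2}$. The Bargmann-Fock space is $\mathcal{E}=\{u(z)=e^{-|z|^2/2}f(z):\ f \text{ entire holomorphic}\}\cap L^2(\mathbb{C})$, a closed subspace of $L^2(\mathbb{C})$, with the $L^2$ norm. $\Pi$ is the orthogonal projection onto $\mathcal{E}$, given by $[\Pi u](z)=\frac1\pi e^{-|z|^2/2}\int_{\mathbb{C}}e^{\overline{w}z-|w|^2/2}u(w)\,dL(w)$. *)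

theory Defs
  imports "HOL-Complex_Analysis.Complex_Analysis"
begin

definition L2 :: "(complex \<Rightarrow> complex) set"
  where "L2 = {u. u \<in> borel_measurable lborel \<and> integrable lborel (\<lambda>z. (norm (u z))\<^sup>2)}"

text \<open>Every class in the Bargmann--Fock space has exactly one representative of the form
  \<open>exp (- \<bar>z\<bar>\<^sup>2 / 2) f(z)\<close> with \<open>f\<close> entire, so its elements can be taken to be honest functions.\<close>

definition bargmann_fock :: "(complex \<Rightarrow> complex) set"
  where "bargmann_fock =
    {u. \<exists>f. f holomorphic_on UNIV \<and> u = (\<lambda>z. of_real (exp (- (norm z)\<^sup>2 / 2)) * f z)} \<inter> L2"

lemma bargmann_fockE:
  assumes "u \<in> bargmann_fock"
  obtains f where "f holomorphic_on UNIV" "u = (\<lambda>z. of_real (exp (- (norm z)\<^sup>2 / 2)) * f z)"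
  using assms by (auto simp: bargmann_fock_def)

lemma L2_add:
  assumes "u \<in> L2" "v \<in> L2"
  shows "(\<lambda>z. u z + v z) \<in> L2"
proof -
  have [measurable]: "u \<in> borel_measurable lborel" "v \<in> borel_measurable lborel"
    using assms by (auto simp: L2_def)
  have "integrable lborel (\<lambda>z. (norm (u z + v z))\<^sup>2)"
  proof (rule Bochner_Integration.integrable_bound)
    show "integrable lborel (\<lambda>z. 2 * (norm (u z))\<^sup>2 + 2 * (norm (v z))\<^sup>2)"
      using assms by (auto simp: L2_def)
    have "(norm (a + b))\<^sup>2 \<le> 2 * (norm a)\<^sup>2 + 2 * (norm b)\<^sup>2" for a b :: complex
    proof -
      have "(norm (a + b))\<^sup>2 \<le> (norm a + norm b)\<^sup>2"
        by (intro power_mono norm_triangle_ineq) auto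
      also have "\<dots> \<le> 2 * (norm a)\<^sup>2 + 2 * (norm b)\<^sup>2"
        using zero_le_power2[of "norm a - norm b"]
        by (simp add: power2_eq_square algebra_simps)
      finally show ?thesis .
    qed
    then show "AE z in lborel. norm ((norm (u z + v z))\<^sup>2)
        \<le> norm (2 * (norm (u z))\<^sup>2 + 2 * (norm (v z))\<^sup>2)"
      by (intro AE_I2) (simp add: abs_of_nonneg)
  qed measurable
  then show ?thesis by (simp add: L2_def)
qed

lemma L2_scaleR: "u \<in> L2 \<Longrightarrow> (\<lambda>z. r *\<^sub>R u z) \<in> L2"
  by (auto simp: L2_def power_mult_distrib)

lemma L2_integrable_inner:
  assumes "u \<in> L2" "v \<in> L2"
  shows "integrable lborel (\<lambda>z. u z \<bullet> v z)"
proof (rule Bochner_Integration.integrable_bound)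
  have [measurable]: "u \<in> borel_measurable lborel" "v \<in> borel_measurable lborel"
    using assms by (auto simp: L2_def)
  show "integrable lborel (\<lambda>z. (norm (u z))\<^sup>2 + (norm (v z))\<^sup>2)"
    using assms by (auto simp: L2_def)
  have "\<bar>a \<bullet> b\<bar> \<le> (norm a)\<^sup>2 + (norm b)\<^sup>2" for a b :: complex
  proof -
    have "\<bar>a \<bullet> b\<bar> \<le> norm a * norm b" by (rule Cauchy_Schwarz_ineq2)
    also have "\<dots> \<le> (norm a)\<^sup>2 + (norm b)\<^sup>2"
      using zero_le_power2[of "norm a - norm b"] mult_nonneg_nonneg[OF norm_ge_zero[of a] norm_ge_zero[of b]]
      unfolding power2_diff by linarith
    finally show ?thesis .
  qed
  then show "AE z in lborel. norm (u z \<bullet> v z) \<le> norm ((norm (u z))\<^sup>2 + (norm (v z))\<^sup>2)"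
    by (intro AE_I2) (simp add: abs_of_nonneg)
  show "(\<lambda>z. u z \<bullet> v z) \<in> borel_measurable lborel" by measurable
qed

lemma bargmann_fock_add:
  assumes "u \<in> bargmann_fock" "v \<in> bargmann_fock"
  shows "(\<lambda>z. u z + v z) \<in> bargmann_fock"
proof -
  obtain f where f: "f holomorphic_on UNIV" "u = (\<lambda>z. of_real (exp (- (norm z)\<^sup>2 / 2)) * f z)"
    using assms(1) by (rule bargmann_fockE)
  obtain g where g: "g holomorphic_on UNIV" "v = (\<lambda>z. of_real (exp (- (norm z)\<^sup>2 / 2)) * g z)"
    using assms(2) by (rule bargmann_fockE)
  have "(\<lambda>z. f z + g z) holomorphic_on UNIV"
    using f g by (intro holomorphic_intros)
  moreover have "(\<lambda>z. u z + v z) = (\<lambda>z. of_real (exp (- (norm z)\<^sup>2 / 2)) * (f z + g z))"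
    using f g by (simp add: algebra_simps)
  moreover have "(\<lambda>z. u z + v z) \<in> L2"
    using assms by (intro L2_add) (auto simp: bargmann_fock_def)
  ultimately show ?thesis unfolding bargmann_fock_def by blast
qed

lemma bargmann_fock_scaleR:
  assumes "u \<in> bargmann_fock"
  shows "(\<lambda>z. r *\<^sub>R u z) \<in> bargmann_fock"
proof -
  obtain f where f: "f holomorphic_on UNIV" "u = (\<lambda>z. of_real (exp (- (norm z)\<^sup>2 / 2)) * f z)"
    using assms(1) by (rule bargmann_fockE)
  have "(\<lambda>z. of_real r * f z) holomorphic_on UNIV"
    using f by (intro holomorphic_intros)
  moreover have "(\<lambda>z. r *\<^sub>R u z) = (\<lambda>z. of_real (exp (- (norm z)\<^sup>2 / 2)) * (of_real r * f z))"
    using f by (simp add: scaleR_conv_of_real algebra_simps)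
  moreover have "(\<lambda>z. r *\<^sub>R u z) \<in> L2"
    using assms by (intro L2_scaleR) (auto simp: bargmann_fock_def)
  ultimately show ?thesis unfolding bargmann_fock_def by blast
qed

lemma bargmann_fock_0: "(\<lambda>z. 0) \<in> bargmann_fock"
  unfolding bargmann_fock_def L2_def by (auto intro!: exI[of _ "\<lambda>z. 0"])

typedef fock = bargmann_fock morphisms fock_fun Abs_fock
  using bargmann_fock_0 by blast

lemma fock_fun_L2: "fock_fun u \<in> L2"
  using fock_fun[of u] by (simp add: bargmann_fock_def)

lemma continuous_on_fock_fun: "continuous_on UNIV (fock_fun u)"
proof -
  obtain f where f: "f holomorphic_on UNIV" 
    "fock_fun u = (\<lambda>z. of_real (exp (- (norm z)\<^sup>2 / 2)) * f z)"
    using fock_fun[of u] by (rule bargmann_fockE)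
  show ?thesis unfolding f(2)
    by (intro continuous_intros holomorphic_on_imp_continuous_on f) simp
qed

instantiation fock :: real_vector
begin

definition zero_fock where "0 = Abs_fock (\<lambda>z. 0)"
definition plus_fock where "u + v = Abs_fock (\<lambda>z. fock_fun u z + fock_fun v z)"
definition scaleR_fock where "r *\<^sub>R u = Abs_fock (\<lambda>z. r *\<^sub>R fock_fun u z)"
definition uminus_fock where "- u = (- 1) *\<^sub>R (u :: fock)"
definition minus_fock where "u - v = u + (- 1) *\<^sub>R (v :: fock)"

lemma fock_fun_zero [simp]: "fock_fun 0 = (\<lambda>z. 0)"
  by (simp add: zero_fock_def Abs_fock_inverse bargmann_fock_0)

lemma fock_fun_add [simp]: "fock_fun (u + v) = (\<lambda>z. fock_fun u z + fock_fun v z)"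
  by (simp add: plus_fock_def Abs_fock_inverse bargmann_fock_add fock_fun)

lemma fock_fun_scaleR [simp]: "fock_fun (r *\<^sub>R u) = (\<lambda>z. r *\<^sub>R fock_fun u z)"
  by (simp only: scaleR_fock_def Abs_fock_inverse bargmann_fock_scaleR fock_fun)

lemma fock_fun_uminus [simp]: "fock_fun (- u) = (\<lambda>z. - fock_fun u z)"
  by (simp add: uminus_fock_def)

lemma fock_fun_diff [simp]: "fock_fun (u - v) = (\<lambda>z. fock_fun u z - fock_fun v z)"
  by (simp add: minus_fock_def)

instance
  by standard (simp_all add: fock_fun_inject[symmetric] algebra_simps)

end

instantiation fock :: real_inner
begin

definition inner_fock :: "fock \<Rightarrow> fock \<Rightarrow> real"
  where "inner_fock u v = (\<integral>z. fock_fun u z \<bullet> fock_fun v z \<partial>lborel)"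
definition norm_fock :: "fock \<Rightarrow> real"
  where "norm_fock u = sqrt (\<integral>z. (norm (fock_fun u z))\<^sup>2 \<partial>lborel)"
definition sgn_fock :: "fock \<Rightarrow> fock" where "sgn_fock u = u /\<^sub>R norm u"
definition dist_fock :: "fock \<Rightarrow> fock \<Rightarrow> real" where "dist_fock u v = norm (u - v)"
definition uniformity_fock :: "(fock \<times> fock) filter"
  where "uniformity_fock = (INF e\<in>{0 <..}. principal {(u, v). dist u v < e})"
definition open_fock :: "fock set \<Rightarrow> bool"
  where "open_fock S = (\<forall>u\<in>S. \<forall>\<^sub>F (u', v) in uniformity. u' = u \<longrightarrow> v \<in> S)"

instance
proof
  fix u v w :: fock and r :: real
  note int = L2_integrable_inner[OF fock_fun_L2 fock_fun_L2]
  show "sgn u = u /\<^sub>R norm u" by (rule sgn_fock_def)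
  show "dist u v = norm (u - v)" by (rule dist_fock_def)
  show "uniformity = (INF e\<in>{0 <..}. principal {(u :: fock, v). dist u v < e})"
    by (rule uniformity_fock_def)
  show "open S = (\<forall>u\<in>S. \<forall>\<^sub>F (u', v) in uniformity. u' = u \<longrightarrow> v \<in> S)" for S :: "fock set"
    by (rule open_fock_def)
  show "u \<bullet> v = v \<bullet> u" by (simp add: inner_fock_def inner_commute)
  show "(u + v) \<bullet> w = u \<bullet> w + v \<bullet> w"
    by (simp add: inner_fock_def inner_add_left Bochner_Integration.integral_add int)
  show "(r *\<^sub>R u) \<bullet> v = r * (u \<bullet> v)" by (simp add: inner_fock_def)
  show "0 \<le> u \<bullet> u" by (simp add: inner_fock_def)
  show "norm u = sqrt (u \<bullet> u)"
    by (simp add: norm_fock_def inner_fock_def power2_norm_eq_inner)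
  show "u \<bullet> u = 0 \<longleftrightarrow> u = 0"
  proof
    assume "u \<bullet> u = 0"
    then have "AE z in lborel. fock_fun u z \<bullet> fock_fun u z = 0"
      unfolding inner_fock_def
      by (subst (asm) integral_nonneg_eq_0_iff_AE) (auto intro: int)
    then have "AE z in lebesgue. z \<in> {z. fock_fun u z = 0}"
      by (auto intro: AE_completion)
    moreover have "closed {z. fock_fun u z = 0}"
      by (intro closed_Collect_eq continuous_on_fock_fun continuous_on_const)
    ultimately have "fock_fun u z = 0" for z
      using mem_closed_if_AE_lebesgue by blast
    then show "u = 0" by (auto simp: fock_fun_inject[symmetric])
  qed (simp add: inner_fock_def)
qed

end

definition bargmann_proj :: "(complex \<Rightarrow> complex) \<Rightarrow> complex \<Rightarrow> complex"
  where "bargmann_proj u z = of_real (1 / pi * exp (- (norm z)\<^sup>2 / 2)) *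
    (\<integral>w. exp (cnj w * z - of_real ((norm w)\<^sup>2 / 2)) * u w \<partial>lborel)"

definition jbracket :: "complex \<Rightarrow> real"
  where "jbracket z = sqrt (1 + (norm z)\<^sup>2)"

text \<open>An \<open>n\<close>-linear map is represented by its values on lists of length \<open>n\<close>.\<close>

definition bounded_multilinear ::
    "nat \<Rightarrow> ('a::real_normed_vector list \<Rightarrow> 'b::real_normed_vector) \<Rightarrow> bool"
  where "bounded_multilinear n M \<longleftrightarrow>
    (\<forall>vs i. length vs = n \<longrightarrow> i < n \<longrightarrow> linear (\<lambda>v. M (vs[i := v]))) \<and>
    (\<exists>C. \<forall>vs. length vs = n \<longrightarrow> norm (M vs) \<le> C * prod_list (map norm vs))"

text \<open>Frechet smoothness: \<open>D n x\<close> is the \<open>n\<close>-th derivative at \<open>x\<close>, and \<open>D (Suc n)\<close> is the Frechet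
  derivative of \<open>D n\<close> for the operator norm on bounded \<open>n\<close>-linear maps, under the identification of
  linear maps into \<open>n\<close>-linear maps with \<open>Suc n\<close>-linear maps. Continuity of each \<open>D n\<close> follows from
  its differentiability.\<close>

definition C_infinity :: "('a::real_normed_vector \<Rightarrow> 'b::real_normed_vector) \<Rightarrow> bool"
  where "C_infinity f \<longleftrightarrow> (\<exists>D :: nat \<Rightarrow> 'a \<Rightarrow> 'a list \<Rightarrow> 'b.
    (\<forall>x. D 0 x [] = f x) \<and>
    (\<forall>n x. bounded_multilinear n (D n x)) \<and>
    (\<forall>n x. \<forall>e>0. \<exists>d>0. \<forall>h. norm h < d \<longrightarrow> (\<forall>vs. length vs = n \<longrightarrow>
       norm (D n (x + h) vs - D n x vs - D (Suc n) x (h # vs))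
         \<le> e * norm h * prod_list (map norm vs))))"

lemma C_infinity_imp_differentiable:
  assumes "C_infinity f"
  shows "f differentiable (at x)"
proof -
  obtain D where D0: "\<And>x. D 0 x [] = f x"
    and lin: "\<And>n x. bounded_multilinear n (D n x)"
    and der: "\<And>n x e. e > 0 \<Longrightarrow> \<exists>d>0. \<forall>h. norm h < d \<longrightarrow> (\<forall>vs. length vs = n \<longrightarrow>
       norm (D n (x + h) vs - D n x vs - D (Suc n) x (h # vs))
         \<le> e * norm h * prod_list (map norm vs))"
    using assms unfolding C_infinity_def by metis
  obtain C where C: "\<And>vs. length vs = 1 \<Longrightarrow> norm (D 1 x vs) \<le> C * prod_list (map norm vs)"
    using lin[of 1 x] unfolding bounded_multilinear_def by blast
  have "linear (\<lambda>v. D 1 x ([0][0 := v]))"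
    using lin[of 1 x] unfolding bounded_multilinear_def by (metis One_nat_def length_Cons less_one list.size(3))
  then have "linear (\<lambda>v. D 1 x [v])" by simp
  then have "bounded_linear (\<lambda>v. D 1 x [v])"
    using C[of "[_]"] by (auto intro!: bounded_linear.intro bounded_linear_axioms.intro
      exI[of _ C] simp: mult.commute)
  moreover have "\<exists>d>0. \<forall>y. norm (y - x) < d \<longrightarrow> norm (f y - f x - D 1 x [y - x]) \<le> e * norm (y - x)"
    if "e > 0" for e
  proof -
    obtain d where "d > 0" and d: "\<And>h vs. norm h < d \<Longrightarrow> length vs = 0 \<Longrightarrow>
       norm (D 0 (x + h) vs - D 0 x vs - D (Suc 0) x (h # vs)) \<le> e * norm h * prod_list (map norm vs)"
      using der[OF \<open>e > 0\<close>, of 0 x] by blast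
    show ?thesis
      using \<open>d > 0\<close> d[of "_ - x" "[]"] by (auto simp: D0)
  qed
  ultimately have "(f has_derivative (\<lambda>v. D 1 x [v])) (at x)"
    unfolding has_derivative_within_alt by auto
  then show ?thesis by (auto simp: differentiable_def)
qed

text \<open>The time derivatives are taken in the \<open>L\<^sup>2\<close> norm of \<^typ>\<open>fock\<close>; they exist since the curve
  is smooth. The equations are identities between the continuous representatives.\<close>

definition is_solution :: "real \<Rightarrow> fock \<Rightarrow> fock \<Rightarrow> (real \<Rightarrow> fock) \<Rightarrow> (real \<Rightarrow> fock) \<Rightarrow> bool"
  where "is_solution \<sigma> u0 v0 u v \<longleftrightarrow>
    C_infinity (\<lambda>t. (u t, v t)) \<and>
    (\<forall>t z. \<i> * fock_fun (vector_derivative u (at t)) z =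
       bargmann_proj (\<lambda>w. of_real ((norm (fock_fun (v t) w))\<^sup>2) * fock_fun (u t) w) z) \<and>
    (\<forall>t z. \<i> * fock_fun (vector_derivative v (at t)) z =
       of_real \<sigma> * bargmann_proj (\<lambda>w. of_real ((norm (fock_fun (u t) w))\<^sup>2) * fock_fun (v t) w) z) \<and>
    u 0 = u0 \<and> v 0 = v0"

end

theory Submission
  imports Defs "HOL-Probability.Distributions"
begin

text \<open>An \<open>L\<^sup>2\<close> bound on an element of the Fock space bounds its values pointwise, because the projection \<open>\<Pi>\<close> has
  the square integrable kernel \<open>bkernel\<close> and reproduces such functions (\<open>norm_fock_fun_le\<close>). Hence
  \<open>(a, b, c) \<mapsto> \<Pi> (a cnj b c)\<close> is bounded on the Fock space, and the system is an ordinary differential equation with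
  a homogeneous cubic vector field in a Hilbert space. As \<open>\<Pi>\<close> is self-adjoint and \<open>\<bar>v\<bar>\<^sup>2\<close> is real, each component of
  the field is orthogonal to the component it drives; so the masses are conserved, a cut-off of the field outside a ball is
  never felt, and solutions are global (\<open>solves_ex\<close>). The energy \<open>\<integral> \<bar>u\<bar>\<^sup>2 \<bar>v\<bar>\<^sup>2\<close> is conserved because its derivative
  pairs projected cubic terms with imaginary multiples of themselves.

  Smooth dependence on time and data is obtained at one stroke. With time rescaled to the unit interval, a solution is a
  curve \<open>y\<close> with \<open>y = x + \<tau> N y y y\<close>, where \<open>N\<close> is a trilinear Volterra operator and \<open>(\<tau>, x)\<close> are the
  parameters. Volterra operators of any size are contractions in a weighted norm, so the linearised equation has a
  resolvent \<open>A\<close>. The derivative of \<open>y\<close> in the parameters is a polynomial in \<open>y\<close> and \<open>A\<close>, and by the resolvent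
  identity so is the derivative of \<open>A\<close>. Thus \<open>k\<close> derivatives of the pair entail \<open>k + 1\<close>
  (\<open>smooth_trajectory_resolvent\<close>).

  The kernel of \<open>\<Pi>\<close> has modulus \<open>exp (- \<bar>z - w\<bar>\<^sup>2 / 2) / pi\<close>, so \<open>\<Pi>\<close> is bounded on \<open>L\<^sup>2\<close> with any weight of moderate
  growth. Truncated weights, Gronwall's inequality with constants uniform in the truncation, and Fatou's lemma propagate
  \<open>\<langle>z\<rangle>\<^sup>s u \<in> L\<^sup>2\<close> (\<open>weight_propagation\<close>).

  The last two conservation laws express invariance of the energy density under translations and rotations. Write
  \<open>u = exp (- \<bar>z\<bar>\<^sup>2 / 2) q\<close> with \<open>q\<close> entire and \<open>\<partial>u = exp (- \<bar>z\<bar>\<^sup>2 / 2) q'\<close>. Then \<open>\<Pi> (cnj z u) = \<partial>u\<close>, and the derivative of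
  \<open>\<bar>u\<bar>\<^sup>2\<close> in the direction \<open>\<xi>\<close> is \<open>2 Re (\<xi> (\<partial>u cnj u - cnj z \<bar>u\<bar>\<^sup>2))\<close>. When the time derivative of the moments
  \<open>\<integral> z \<bar>u\<bar>\<^sup>2\<close> and \<open>\<integral> (\<bar>z\<bar>\<^sup>2 - 1) \<bar>u\<bar>\<^sup>2\<close> is computed and \<open>\<Pi>\<close> is moved onto the other factor, exactly such
  directional derivatives appear, multiplied by \<open>\<bar>v\<bar>\<^sup>2\<close>, with \<open>\<xi>\<close> constant in the first case and \<open>\<xi> = \<i> z\<close> in the
  second. The contribution of \<open>v\<close>, weighted by \<open>\<sigma>\<close>, is the same with \<open>u\<close> and \<open>v\<close> exchanged, as \<open>\<sigma>\<^sup>2 = 1\<close>. The sum is the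
  integral of the derivative of \<open>\<bar>u\<bar>\<^sup>2 \<bar>v\<bar>\<^sup>2\<close> along \<open>\<xi>\<close>, which vanishes because the flow of \<open>\<xi>\<close> preserves Lebesgue
  measure (\<open>flux_balance\<close>, \<open>moment_conservation\<close>).\<close>

section \<open>Smooth families of multilinear maps\<close>

text \<open>Multilinear maps whose arguments are labelled by a finite set of numbers instead of positions in
  a list. In a bilinear combination of two such maps each factor takes its own arguments, so the
  product rule is a statement about disjoint label sets; with lists it would need shuffles.\<close>

definition multilinear_on :: "nat set \<Rightarrow> ((nat \<Rightarrow> 'a::real_normed_vector) \<Rightarrow> 'b::real_normed_vector) \<Rightarrow> bool"
  where "multilinear_on S f \<longleftrightarrow> finite S \<and>
    (\<forall>vs ws. (\<forall>i\<in>S. vs i = ws i) \<longrightarrow> f vs = f ws) \<and>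
    (\<forall>vs. \<forall>i\<in>S. linear (\<lambda>v. f (vs(i := v)))) \<and>
    (\<exists>C. \<forall>vs. norm (f vs) \<le> C * (\<Prod>i\<in>S. norm (vs i)))"

text \<open>The direction of differentiation receives the label \<open>0\<close> and the labels already in
  use move up by one, as for \<open>h # vs\<close> on lists.\<close>

definition has_family_derivative :: "nat set \<Rightarrow> ('a::real_normed_vector \<Rightarrow> (nat \<Rightarrow> 'a) \<Rightarrow> 'b::real_normed_vector) \<Rightarrow>
    ('a \<Rightarrow> (nat \<Rightarrow> 'a) \<Rightarrow> 'b) \<Rightarrow> bool" where
  "has_family_derivative S f f' \<longleftrightarrow>
    (\<forall>x. \<forall>e>0. \<exists>d>0. \<forall>h. norm h < d \<longrightarrow> (\<forall>vs.
       norm (f (x + h) vs - f x vs - f' x (case_nat h vs)) \<le> e * norm h * (\<Prod>i\<in>S. norm (vs i))))"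

text \<open>The number counts how many derivatives are asked for. The closure properties below are proved by
  induction on it with the label set generalised, because one differentiation adds a label.\<close>

primrec smooth_family :: "nat \<Rightarrow> nat set \<Rightarrow>
    ('a::real_normed_vector \<Rightarrow> (nat \<Rightarrow> 'a) \<Rightarrow> 'b::real_normed_vector) \<Rightarrow> bool" where
  "smooth_family 0 S f \<longleftrightarrow> (\<forall>x. multilinear_on S (f x))"
| "smooth_family (Suc k) S f \<longleftrightarrow> (\<forall>x. multilinear_on S (f x)) \<and>
    (\<exists>f'. has_family_derivative S f f' \<and> smooth_family k (insert 0 (Suc ` S)) f')"

lemma multilinear_onE:
  assumes "multilinear_on S f"
  obtains C where "C \<ge> 0" "\<And>vs. norm (f vs) \<le> C * (\<Prod>i\<in>S. norm (vs i))"
proof -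
  obtain C where C: "\<And>vs. norm (f vs) \<le> C * (\<Prod>i\<in>S. norm (vs i))"
    using assms unfolding multilinear_on_def by blast
  show thesis
    by (rule that[of "max C 0"]) (auto intro!: order_trans[OF C] mult_right_mono prod_nonneg)
qed

lemma smooth_family_multilinear: "smooth_family k S f \<Longrightarrow> multilinear_on S (f x)"
  by (cases k) auto

lemma smooth_family_SucI:
  assumes "\<And>x. multilinear_on S (f x)" "has_family_derivative S f f'" "smooth_family k (insert 0 (Suc ` S)) f'"
  shows "smooth_family (Suc k) S f"
  using assms by auto

lemma smooth_family_SucE:
  assumes "smooth_family (Suc k) S f"
  obtains f' where "has_family_derivative S f f'" "smooth_family k (insert 0 (Suc ` S)) f'"
  using assms by auto

lemma smooth_family_lessD: "smooth_family (Suc k) S f \<Longrightarrow> smooth_family k S f"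
proof (induction k arbitrary: S f)
  case 0
  then show ?case by simp
next
  case (Suc k)
  obtain f' where f': "has_family_derivative S f f'" "smooth_family (Suc k) (insert 0 (Suc ` S)) f'"
    using Suc.prems by (rule smooth_family_SucE)
  show ?case
    by (rule smooth_family_SucI[OF smooth_family_multilinear[OF Suc.prems] f'(1) Suc.IH[OF f'(2)]])
qed

lemma multilinear_on_cong_args:
  "multilinear_on S f \<Longrightarrow> (\<And>i. i \<in> S \<Longrightarrow> vs i = ws i) \<Longrightarrow> f vs = f ws"
  unfolding multilinear_on_def by blast

lemma multilinear_on_bilinear:
  assumes b: "bounded_bilinear b" and f: "multilinear_on S f" and g: "multilinear_on S' g" and "S \<inter> S' = {}"
  shows "multilinear_on (S \<union> S') (\<lambda>vs. b (f vs) (g vs))"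
  unfolding multilinear_on_def
proof (intro conjI allI impI ballI)
  interpret bounded_bilinear b by fact
  have fin: "finite S" "finite S'" using f g by (auto simp: multilinear_on_def)
  then show "finite (S \<union> S')" by simp
  show "b (f vs) (g vs) = b (f ws) (g ws)" if "\<forall>i\<in>S \<union> S'. vs i = ws i" for vs ws
    using that multilinear_on_cong_args[OF f, of vs ws] multilinear_on_cong_args[OF g, of vs ws] by simp
  show "linear (\<lambda>v. b (f (vs(i := v))) (g (vs(i := v))))" if "i \<in> S \<union> S'" for vs i
  proof (cases "i \<in> S")
    case True
    then have "g (vs(i := v)) = g vs" for v
      using assms(4) by (intro multilinear_on_cong_args[OF g]) auto
    moreover have "linear (\<lambda>v. f (vs(i := v)))" using f True by (auto simp: multilinear_on_def)
    from linear_compose[OF this bounded_linear.linear[OF bounded_linear_left]]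
    have "linear (\<lambda>v. b (f (vs(i := v))) (g vs))" by (simp add: o_def)
    ultimately show ?thesis by simp
  next
    case False
    then have "f (vs(i := v)) = f vs" for v
      by (intro multilinear_on_cong_args[OF f]) auto
    moreover have "linear (\<lambda>v. g (vs(i := v)))" using g False that by (auto simp: multilinear_on_def)
    from linear_compose[OF this bounded_linear.linear[OF bounded_linear_right]]
    have "linear (\<lambda>v. b (f vs) (g (vs(i := v))))" by (simp add: o_def)
    ultimately show ?thesis by simp
  qed
  obtain F where F: "F \<ge> 0" "\<And>vs. norm (f vs) \<le> F * (\<Prod>i\<in>S. norm (vs i))"
    using f by (rule multilinear_onE) blast
  obtain G where G: "G \<ge> 0" "\<And>vs. norm (g vs) \<le> G * (\<Prod>i\<in>S'. norm (vs i))"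
    using g by (rule multilinear_onE) blast
  obtain K where K: "K \<ge> 0" "\<And>x y. norm (b x y) \<le> norm x * norm y * K"
    using nonneg_bounded by blast
  have "norm (b (f vs) (g vs)) \<le> F * G * K * (\<Prod>i\<in>S \<union> S'. norm (vs i))" for vs
  proof -
    have "norm (b (f vs) (g vs)) \<le> (F * (\<Prod>i\<in>S. norm (vs i))) * (G * (\<Prod>i\<in>S'. norm (vs i))) * K"
      by (intro order_trans[OF K(2)] mult_right_mono mult_mono F G K) (auto intro!: mult_nonneg_nonneg prod_nonneg F)
    also have "\<dots> = F * G * K * (\<Prod>i\<in>S \<union> S'. norm (vs i))"
      using fin assms(4) by (simp add: prod.union_disjoint)
    finally show ?thesis .
  qed
  then show "\<exists>C. \<forall>vs. norm (b (f vs) (g vs)) \<le> C * (\<Prod>i\<in>S \<union> S'. norm (vs i))" by blast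
qed

lemma multilinear_on_add:
  assumes f: "multilinear_on S f" and g: "multilinear_on S g"
  shows "multilinear_on S (\<lambda>vs. f vs + g vs)"
proof -
  obtain F where F: "\<And>vs. norm (f vs) \<le> F * (\<Prod>i\<in>S. norm (vs i))"
    using f by (rule multilinear_onE) blast
  obtain G where G: "\<And>vs. norm (g vs) \<le> G * (\<Prod>i\<in>S. norm (vs i))"
    using g by (rule multilinear_onE) blast
  have "norm (f vs + g vs) \<le> (F + G) * (\<Prod>i\<in>S. norm (vs i))" for vs
    using norm_triangle_ineq[of "f vs" "g vs"] F[of vs] G[of vs] by (simp add: algebra_simps)
  then have "\<exists>C. \<forall>vs. norm (f vs + g vs) \<le> C * (\<Prod>i\<in>S. norm (vs i))" by blast
  moreover have "linear (\<lambda>v. f (vs(i := v)) + g (vs(i := v)))" if "i \<in> S" for vs i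
    using f g that unfolding multilinear_on_def by (intro linear_compose_add) auto
  moreover have "f vs + g vs = f ws + g ws" if "\<forall>i\<in>S. vs i = ws i" for vs ws
    using that multilinear_on_cong_args[OF f, of vs ws] multilinear_on_cong_args[OF g, of vs ws] by simp
  ultimately show ?thesis using f unfolding multilinear_on_def by blast
qed

lemma multilinear_on_reindex:
  assumes f: "multilinear_on S f" and "inj p"
  shows "multilinear_on (p ` S) (\<lambda>vs. f (vs \<circ> p))"
  unfolding multilinear_on_def
proof (intro conjI allI impI ballI)
  show "finite (p ` S)" using f by (auto simp: multilinear_on_def)
  show "f (vs \<circ> p) = f (ws \<circ> p)" if "\<forall>i\<in>p ` S. vs i = ws i" for vs ws
    using that by (intro multilinear_on_cong_args[OF f]) auto
  show "linear (\<lambda>v. f (vs(i := v) \<circ> p))" if i: "i \<in> p ` S" for vs i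
  proof -
    obtain j where j: "j \<in> S" "i = p j" using i by auto
    have "vs(i := v) \<circ> p = (vs \<circ> p)(j := v)" for v
      using \<open>inj p\<close> by (auto simp: fun_eq_iff j(2) inj_eq)
    then show ?thesis using f j(1) by (auto simp: multilinear_on_def)
  qed
  obtain C where "\<And>vs. norm (f vs) \<le> C * (\<Prod>i\<in>S. norm (vs i))"
    using f by (rule multilinear_onE) blast
  then have "norm (f (vs \<circ> p)) \<le> C * (\<Prod>i\<in>p ` S. norm (vs i))" for vs
    using \<open>inj p\<close> by (subst prod.reindex) (auto intro: inj_on_subset simp: o_def)
  then show "\<exists>C. \<forall>vs. norm (f (vs \<circ> p)) \<le> C * (\<Prod>i\<in>p ` S. norm (vs i))" by blast
qed

lemma has_family_derivative_add:
  fixes f :: "'a::real_normed_vector \<Rightarrow> (nat \<Rightarrow> 'a) \<Rightarrow> 'b::real_normed_vector"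
  assumes f: "has_family_derivative S f f'" and g: "has_family_derivative S g g'"
  shows "has_family_derivative S (\<lambda>x vs. f x vs + g x vs) (\<lambda>x vs. f' x vs + g' x vs)"
  unfolding has_family_derivative_def
proof (intro allI impI)
  fix x and e :: real assume "e > 0"
  then have e: "e / 2 > 0" by simp
  obtain d1 where d1: "d1 > 0" "\<And>h vs. norm h < d1 \<Longrightarrow>
      norm (f (x + h) vs - f x vs - f' x (case_nat h vs)) \<le> e / 2 * norm h * (\<Prod>i\<in>S. norm (vs i))"
    using f e unfolding has_family_derivative_def by metis
  obtain d2 where d2: "d2 > 0" "\<And>h vs. norm h < d2 \<Longrightarrow>
      norm (g (x + h) vs - g x vs - g' x (case_nat h vs)) \<le> e / 2 * norm h * (\<Prod>i\<in>S. norm (vs i))"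
    using g e unfolding has_family_derivative_def by metis
  show "\<exists>d>0. \<forall>h. norm h < d \<longrightarrow> (\<forall>vs. norm (f (x + h) vs + g (x + h) vs - (f x vs + g x vs)
      - (f' x (case_nat h vs) + g' x (case_nat h vs))) \<le> e * norm h * (\<Prod>i\<in>S. norm (vs i)))"
  proof (intro exI[of _ "min d1 d2"] conjI allI impI)
    fix h :: 'a and vs assume h: "norm h < min d1 d2"
    have "norm ((f (x + h) vs - f x vs - f' x (case_nat h vs)) + (g (x + h) vs - g x vs - g' x (case_nat h vs)))
      \<le> e / 2 * norm h * (\<Prod>i\<in>S. norm (vs i)) + e / 2 * norm h * (\<Prod>i\<in>S. norm (vs i))"
      using h by (intro norm_triangle_mono d1 d2) auto
    then show "norm (f (x + h) vs + g (x + h) vs - (f x vs + g x vs)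
      - (f' x (case_nat h vs) + g' x (case_nat h vs))) \<le> e * norm h * (\<Prod>i\<in>S. norm (vs i))"
      by (simp add: algebra_simps)
  qed (use d1 d2 in auto)
qed

lemma smooth_family_add:
  assumes "smooth_family k S f" "smooth_family k S g"
  shows "smooth_family k S (\<lambda>x vs. f x vs + g x vs)"
  using assms
proof (induction k arbitrary: S f g)
  case (Suc k)
  obtain f' where f': "has_family_derivative S f f'" "smooth_family k (insert 0 (Suc ` S)) f'"
    using Suc.prems(1) by auto
  obtain g' where g': "has_family_derivative S g g'" "smooth_family k (insert 0 (Suc ` S)) g'"
    using Suc.prems(2) by auto
  show ?case
    by (rule smooth_family_SucI[OF multilinear_on_add[OF smooth_family_multilinear[OF Suc.prems(1)]
        smooth_family_multilinear[OF Suc.prems(2)]] has_family_derivative_add[OF f'(1) g'(1)]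
        Suc.IH[OF f'(2) g'(2)]])
qed (auto intro!: multilinear_on_add)

text \<open>In the product rule the factor that is not differentiated keeps its arguments, but under shifted
  labels.\<close>

lemma smooth_family_reindex:
  fixes f :: "'a::real_normed_vector \<Rightarrow> (nat \<Rightarrow> 'a) \<Rightarrow> 'b::real_normed_vector"
  assumes "smooth_family k S f" "inj p"
  shows "smooth_family k (p ` S) (\<lambda>x vs. f x (vs \<circ> p))"
  using assms
proof (induction k arbitrary: S f p)
  case (Suc k)
  obtain f' where f': "has_family_derivative S f f'" "smooth_family k (insert 0 (Suc ` S)) f'"
    using Suc.prems(1) by auto
  define q where "q = case_nat 0 (Suc \<circ> p)"
  have "i = j" if "q i = q j" for i j
    using that injD[OF \<open>inj p\<close>] by (cases i; cases j) (auto simp: q_def)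
  then have "inj q" by (rule injI)
  from Suc.IH[OF f'(2) this]
  have sm: "smooth_family k (q ` insert 0 (Suc ` S)) (\<lambda>x vs. f' x (vs \<circ> q))" .
  have q: "q ` insert 0 (Suc ` S) = insert 0 (Suc ` p ` S)" by (auto simp: q_def image_image)
  have der: "has_family_derivative (p ` S) (\<lambda>x vs. f x (vs \<circ> p)) (\<lambda>x vs. f' x (vs \<circ> q))"
    unfolding has_family_derivative_def
  proof (intro allI impI)
    fix x and e :: real assume "e > 0"
    then obtain d where d: "d > 0" "\<And>h vs. norm h < d \<Longrightarrow>
        norm (f (x + h) vs - f x vs - f' x (case_nat h vs)) \<le> e * norm h * (\<Prod>i\<in>S. norm (vs i))"
      using f' unfolding has_family_derivative_def by metis
    have eq: "case_nat h vs \<circ> q = case_nat h (vs \<circ> p)" for h and vs :: "nat \<Rightarrow> 'a"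
      by (auto simp: fun_eq_iff q_def split: nat.split)
    have "norm (f (x + h) (vs \<circ> p) - f x (vs \<circ> p) - f' x (case_nat h vs \<circ> q))
         \<le> e * norm h * (\<Prod>i\<in>p ` S. norm (vs i))" if "norm h < d" for h vs
      using d(2)[OF that, of "vs \<circ> p"] \<open>inj p\<close> unfolding eq
      by (subst prod.reindex) (auto intro: inj_on_subset)
    with d(1) show "\<exists>d>0. \<forall>h. norm h < d \<longrightarrow> (\<forall>vs. norm (f (x + h) (vs \<circ> p) - f x (vs \<circ> p)
        - f' x (case_nat h vs \<circ> q)) \<le> e * norm h * (\<Prod>i\<in>p ` S. norm (vs i)))" by blast
  qed
  have "multilinear_on (p ` S) (\<lambda>vs. f x (vs \<circ> p))" for x
    by (rule multilinear_on_reindex[OF smooth_family_multilinear[OF Suc.prems(1)] Suc.prems(2)])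
  then show ?case by (rule smooth_family_SucI[OF _ der sm[unfolded q]])
next
  case 0
  then show ?case by (simp add: multilinear_on_reindex del: o_apply)
qed

text \<open>The product rule. The remainder of the product is \<open>b r g(x + h) + b f' (g(x + h) - g) + b
  f r'\<close>, where \<open>r\<close> and \<open>r'\<close> are the remainders of the two
  factors; the outer terms are small because the remainders are, and the middle one is quadratic
  in the increment.\<close>

lemma has_family_derivative_bilinear:
  fixes f :: "'a::real_normed_vector \<Rightarrow> (nat \<Rightarrow> 'a) \<Rightarrow> 'b::real_normed_vector" and g :: "'a::real_normed_vector \<Rightarrow> (nat \<Rightarrow> 'a) \<Rightarrow> 'c::real_normed_vector"
  assumes b: "bounded_bilinear b"
    and f: "has_family_derivative S f f'" and g: "has_family_derivative S' g g'"
    and mf: "\<And>x. multilinear_on S (f x)" and mg: "\<And>x. multilinear_on S' (g x)"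
    and mf': "\<And>x. multilinear_on (insert 0 (Suc ` S)) (f' x)"
    and mg': "\<And>x. multilinear_on (insert 0 (Suc ` S')) (g' x)"
    and disj: "S \<inter> S' = {}"
  shows "has_family_derivative (S \<union> S') (\<lambda>x vs. b (f x vs) (g x vs))
    (\<lambda>x vs. b (f' x vs) (g x (vs \<circ> Suc)) + b (f x (vs \<circ> Suc)) (g' x vs))"
  unfolding has_family_derivative_def
proof (intro allI impI)
  interpret bounded_bilinear b by fact
  fix x and e :: real assume "e > 0"
  define P where "P vs = (\<Prod>i\<in>S. norm (vs i))" for vs :: "nat \<Rightarrow> 'a"
  define Q where "Q vs = (\<Prod>i\<in>S'. norm (vs i))" for vs :: "nat \<Rightarrow> 'a"
  have PQ: "P vs \<ge> 0" "Q vs \<ge> 0" for vs by (auto simp: P_def Q_def intro: prod_nonneg)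
  have fin: "finite S" "finite S'" using mf mg by (auto simp: multilinear_on_def)
  obtain F where F: "F \<ge> 0" "\<And>vs. norm (f x vs) \<le> F * P vs"
    using mf[of x] unfolding P_def by (rule multilinear_onE) blast
  obtain G where G: "G \<ge> 0" "\<And>vs. norm (g x vs) \<le> G * Q vs"
    using mg[of x] unfolding Q_def by (rule multilinear_onE) blast
  obtain F' where F': "F' \<ge> 0" "\<And>vs. norm (f' x vs) \<le> F' * (\<Prod>i\<in>insert 0 (Suc ` S). norm (vs i))"
    using mf'[of x] by (rule multilinear_onE) blast
  obtain G' where G': "G' \<ge> 0" "\<And>vs. norm (g' x vs) \<le> G' * (\<Prod>i\<in>insert 0 (Suc ` S'). norm (vs i))"
    using mg'[of x] by (rule multilinear_onE) blast
  have F'': "norm (f' x (case_nat h vs)) \<le> F' * (norm h * P vs)" for h vs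
    using F'(2)[of "case_nat h vs"] fin by (simp add: prod.reindex P_def)
  have G'': "norm (g' x (case_nat h vs)) \<le> G' * (norm h * Q vs)" for h vs
    using G'(2)[of "case_nat h vs"] fin by (simp add: prod.reindex Q_def)
  obtain K where K: "K \<ge> 0" "\<And>x y. norm (b x y) \<le> norm x * norm y * K"
    using nonneg_bounded by blast
  \<comment> \<open>One constant above all bounds in play. The summand 1 leaves room for the remainder of
    \<open>g\<close>.\<close>
  define M where "M = 1 + K + F + G + F' + G'"
  have M: "M \<ge> 1" "K \<le> M" "F \<le> M" "F' \<le> M" "G' + 1 \<le> M" "G + G' + 1 \<le> M"
    using F G F' G' K by (auto simp: M_def)
  define \<eta> where "\<eta> = min 1 (e / (4 * M ^ 2))"
  have \<eta>: "\<eta> > 0" "\<eta> \<le> 1" "M ^ 2 * \<eta> \<le> e / 4"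
  proof -
    have "M ^ 2 * \<eta> \<le> M ^ 2 * (e / (4 * M ^ 2))" unfolding \<eta>_def by (intro mult_left_mono) auto
    also have "\<dots> = e / 4" using M(1) by simp
    finally show "M ^ 2 * \<eta> \<le> e / 4" .
  qed (use \<open>e > 0\<close> M(1) in \<open>simp_all add: \<eta>_def\<close>)
  obtain d1 where d1: "d1 > 0" "\<And>h vs. norm h < d1 \<Longrightarrow>
      norm (f (x + h) vs - f x vs - f' x (case_nat h vs)) \<le> \<eta> * norm h * P vs"
    using f \<eta>(1) unfolding has_family_derivative_def P_def by metis
  obtain d2 where d2: "d2 > 0" "\<And>h vs. norm h < d2 \<Longrightarrow>
      norm (g (x + h) vs - g x vs - g' x (case_nat h vs)) \<le> \<eta> * norm h * Q vs"
    using g \<eta>(1) unfolding has_family_derivative_def Q_def by metis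
  define d where "d = min (min d1 d2) (min 1 (e / (4 * M ^ 3)))"
  have d: "d > 0" "d \<le> d1" "d \<le> d2" "d \<le> 1" "M ^ 3 * d \<le> e / 4"
  proof -
    have "M ^ 3 * d \<le> M ^ 3 * (e / (4 * M ^ 3))" unfolding d_def using M(1) by (intro mult_left_mono) auto
    also have "\<dots> = e / 4" using M(1) by simp
    finally show "M ^ 3 * d \<le> e / 4" .
  qed (use \<open>e > 0\<close> M(1) d1 d2 in \<open>simp_all add: d_def\<close>)
  have "norm (b (f (x + h) vs) (g (x + h) vs) - b (f x vs) (g x vs) - (b (f' x (case_nat h vs)) (g x vs)
      + b (f x vs) (g' x (case_nat h vs)))) \<le> e * norm h * (P vs * Q vs)" if h: "norm h < d" for h :: 'a and vs :: "nat \<Rightarrow> 'a"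
  proof -
    note PQ[of vs, simp]
    let ?fh = "f' x (case_nat h vs)" and ?gh = "g' x (case_nat h vs)"
    let ?rf = "f (x + h) vs - f x vs - ?fh" and ?rg = "g (x + h) vs - g x vs - ?gh"
    have rf: "norm ?rf \<le> \<eta> * norm h * P vs" and rg: "norm ?rg \<le> \<eta> * norm h * Q vs"
      using h d d1(2)[of h vs] d2(2)[of h vs] by auto
    have dg: "norm (g (x + h) vs - g x vs) \<le> M * (norm h * Q vs)"
    proof -
      have "norm (g (x + h) vs - g x vs) \<le> norm ?rg + norm ?gh"
        using norm_triangle_ineq[of ?rg ?gh] by simp
      also have "\<dots> \<le> (\<eta> + G') * (norm h * Q vs)" using rg G''[of h vs] by (simp add: algebra_simps)
      also have "\<dots> \<le> M * (norm h * Q vs)" using \<eta> M by (intro mult_right_mono) auto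
      finally show ?thesis .
    qed
    have gh: "norm (g (x + h) vs) \<le> M * Q vs"
    proof -
      have "norm (g (x + h) vs) \<le> norm ?rg + norm ?gh + norm (g x vs)"
        using norm_triangle_ineq[of "?rg + ?gh" "g x vs"] norm_triangle_ineq[of ?rg ?gh] by simp
      also have "\<dots> \<le> \<eta> * norm h * Q vs + G' * (norm h * Q vs) + G * Q vs"
        using rg G''[of h vs] G(2)[of vs] by linarith
      also have "\<dots> = (\<eta> * norm h + G' * norm h + G) * Q vs" by (simp add: algebra_simps)
      also have "\<dots> \<le> M * Q vs"
      proof (intro mult_right_mono)
        have "\<eta> * norm h \<le> 1 * 1" using \<eta> h d by (intro mult_mono) auto
        moreover have "G' * norm h \<le> G' * 1" using h d G' by (intro mult_left_mono) auto
        ultimately show "\<eta> * norm h + G' * norm h + G \<le> M" using M by linarith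
      qed simp
      finally show ?thesis .
    qed
    have "norm (b ?rf (g (x + h) vs)) \<le> (\<eta> * norm h * P vs) * (M * Q vs) * M"
      using rf gh M K \<eta> by (intro order_trans[OF K(2)] mult_mono) (auto intro!: mult_nonneg_nonneg)
    moreover have "norm (b ?fh (g (x + h) vs - g x vs)) \<le> (M * (norm h * P vs)) * (M * (norm h * Q vs)) * M"
    proof -
      have "norm ?fh \<le> M * (norm h * P vs)"
        by (rule order_trans[OF F'']) (intro mult_right_mono M mult_nonneg_nonneg, auto)
      then show ?thesis using dg M K by (intro order_trans[OF K(2)] mult_mono) (auto intro!: mult_nonneg_nonneg)
    qed
    moreover have "norm (b (f x vs) ?rg) \<le> (M * P vs) * (\<eta> * norm h * Q vs) * M"
    proof -
      have "norm (f x vs) \<le> M * P vs"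
        by (rule order_trans[OF F(2)]) (intro mult_right_mono M, auto)
      then show ?thesis using rg M K \<eta> by (intro order_trans[OF K(2)] mult_mono) (auto intro!: mult_nonneg_nonneg)
    qed
    moreover have eq: "b (f (x + h) vs) (g (x + h) vs) - b (f x vs) (g x vs) - (b ?fh (g x vs) + b (f x vs) ?gh)
        = b ?rf (g (x + h) vs) + b ?fh (g (x + h) vs - g x vs) + b (f x vs) ?rg"
      by (simp add: diff_left diff_right)
    ultimately have "norm (b (f (x + h) vs) (g (x + h) vs) - b (f x vs) (g x vs) - (b ?fh (g x vs) + b (f x vs) ?gh))
      \<le> (\<eta> * norm h * P vs) * (M * Q vs) * M + (M * (norm h * P vs)) * (M * (norm h * Q vs)) * M
          + (M * P vs) * (\<eta> * norm h * Q vs) * M"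
      unfolding eq by (intro norm_triangle_mono)
    also have "\<dots> = (2 * (M ^ 2 * \<eta>) + M ^ 3 * norm h) * (norm h * (P vs * Q vs))"
      by (simp add: power2_eq_square power3_eq_cube algebra_simps)
    also have "\<dots> \<le> e * (norm h * (P vs * Q vs))"
    proof (intro mult_right_mono)
      have "M ^ 3 * norm h \<le> M ^ 3 * d" using h M by (intro mult_left_mono) auto
      then show "2 * (M ^ 2 * \<eta>) + M ^ 3 * norm h \<le> e" using \<eta>(3) d(5) \<open>e > 0\<close> by linarith
    qed simp
    finally show ?thesis by (simp add: mult.assoc)
  qed
  moreover have "P vs * Q vs = (\<Prod>i\<in>S \<union> S'. norm (vs i))" for vs
    using fin disj by (simp add: P_def Q_def prod.union_disjoint)
  moreover have "case_nat h vs \<circ> Suc = vs" for h and vs :: "nat \<Rightarrow> 'a" by auto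
  ultimately show "\<exists>d>0. \<forall>h. norm h < d \<longrightarrow> (\<forall>vs.
     norm (b (f (x + h) vs) (g (x + h) vs) - b (f x vs) (g x vs) - (b (f' x (case_nat h vs)) (g x (case_nat h vs \<circ> Suc))
      + b (f x (case_nat h vs \<circ> Suc)) (g' x (case_nat h vs)))) \<le> e * norm h * (\<Prod>i\<in>S \<union> S'. norm (vs i)))"
    using d(1) by (intro exI[of _ d]) simp
qed

text \<open>Both terms of the product rule are again bilinear combinations over disjoint label sets, now
  with one factor differentiated, so the induction reproduces its own statement.\<close>

lemma smooth_family_bilinear:
  assumes b: "bounded_bilinear b" and "smooth_family k S f" "smooth_family k S' g" "S \<inter> S' = {}"
  shows "smooth_family k (S \<union> S') (\<lambda>x vs. b (f x vs) (g x vs))"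
  using assms(2-)
proof (induction k arbitrary: S S' f g)
  case (Suc k)
  obtain f' where f': "has_family_derivative S f f'" "smooth_family k (insert 0 (Suc ` S)) f'"
    using Suc.prems(1) by auto
  obtain g' where g': "has_family_derivative S' g g'" "smooth_family k (insert 0 (Suc ` S')) g'"
    using Suc.prems(2) by auto
  have S: "smooth_family k (Suc ` S) (\<lambda>x vs. f x (vs \<circ> Suc))" "smooth_family k (Suc ` S') (\<lambda>x vs. g x (vs \<circ> Suc))"
    using Suc.prems by (simp_all add: smooth_family_reindex smooth_family_lessD del: smooth_family.simps o_apply)
  have "smooth_family k (insert 0 (Suc ` S) \<union> Suc ` S') (\<lambda>x vs. b (f' x vs) (g x (vs \<circ> Suc)))"
    using Suc.prems by (intro Suc.IH f' S) auto
  moreover have "smooth_family k (Suc ` S \<union> insert 0 (Suc ` S')) (\<lambda>x vs. b (f x (vs \<circ> Suc)) (g' x vs))"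
    using Suc.prems by (intro Suc.IH g' S) auto
  moreover have "insert 0 (Suc ` S) \<union> Suc ` S' = insert 0 (Suc ` (S \<union> S'))"
    "Suc ` S \<union> insert 0 (Suc ` S') = insert 0 (Suc ` (S \<union> S'))" by auto
  ultimately have sm: "smooth_family k (insert 0 (Suc ` (S \<union> S')))
      (\<lambda>x vs. b (f' x vs) (g x (vs \<circ> Suc)) + b (f x (vs \<circ> Suc)) (g' x vs))"
    by (intro smooth_family_add) auto
  have der: "has_family_derivative (S \<union> S') (\<lambda>x vs. b (f x vs) (g x vs))
      (\<lambda>x vs. b (f' x vs) (g x (vs \<circ> Suc)) + b (f x (vs \<circ> Suc)) (g' x vs))"
    using Suc.prems f' g' 
    by (intro has_family_derivative_bilinear[OF b f'(1) g'(1)]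
        smooth_family_multilinear[OF Suc.prems(1)] smooth_family_multilinear[OF Suc.prems(2)]
        smooth_family_multilinear[OF f'(2)] smooth_family_multilinear[OF g'(2)] Suc.prems(3))
  have "multilinear_on (S \<union> S') (\<lambda>vs. b (f x vs) (g x vs))" for x
    by (rule multilinear_on_bilinear[OF b smooth_family_multilinear[OF Suc.prems(1)]
        smooth_family_multilinear[OF Suc.prems(2)] Suc.prems(3)])
  then show ?case by (rule smooth_family_SucI[OF _ der sm])
qed (auto intro!: multilinear_on_bilinear[OF b])

lemma has_family_derivative_const_in_x: "has_family_derivative S (\<lambda>x. f) (\<lambda>x vs. 0)"
  unfolding has_family_derivative_def
proof (intro allI impI)
  fix e :: real assume "e > 0"
  then show "\<exists>d>0. \<forall>h. norm h < d \<longrightarrow> (\<forall>vs. norm (f vs - f vs - 0) \<le> e * norm h * (\<Prod>i\<in>S. norm (vs i)))"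
    by (intro exI[of _ 1]) (simp add: prod_nonneg)
qed

lemma multilinear_on_zero: "finite S \<Longrightarrow> multilinear_on S (\<lambda>vs. 0)"
  unfolding multilinear_on_def by (auto intro!: linearI exI[of _ 0])

lemma smooth_family_const_in_x:
  assumes "multilinear_on S f"
  shows "smooth_family k S (\<lambda>x. f)"
proof -
  have 0: "smooth_family k S (\<lambda>x vs. 0)" if "finite S" for k S
    using that
  proof (induction k arbitrary: S)
    case (Suc k)
    then show ?case
      using smooth_family_SucI[OF multilinear_on_zero has_family_derivative_const_in_x Suc.IH] by simp
  qed (simp add: multilinear_on_zero)
  have "finite S" using assms by (simp add: multilinear_on_def)
  then show ?thesis
  proof (cases k)
    case (Suc k')
    then show ?thesis
      using smooth_family_SucI[OF assms has_family_derivative_const_in_x 0] \<open>finite S\<close> by simp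
  qed (use assms in simp)
qed

lemma smooth_family_const: "smooth_family k {} (\<lambda>x vs. c)"
  by (rule smooth_family_const_in_x) (auto simp: multilinear_on_def)

text \<open>The direction enters a first derivative through such a slot: \<open>f' x (vs 0)\<close> is built
  from slots and from families that do not involve the direction.\<close>

lemma smooth_family_slot:
  assumes "bounded_linear L"
  shows "smooth_family k {i} (\<lambda>x vs. L (vs i))"
proof (rule smooth_family_const_in_x)
  interpret bounded_linear L by fact
  show "multilinear_on {i} (\<lambda>vs. L (vs i))"
    using linear_axioms bounded by (auto simp: multilinear_on_def mult.commute)
qed

lemma has_family_derivative_nullary:
  assumes "\<And>x. (f has_derivative f' x) (at x)"
  shows "has_family_derivative {} (\<lambda>x vs. f x) (\<lambda>x vs. f' x (vs 0))"
  unfolding has_family_derivative_def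
proof (intro allI impI)
  fix x and e :: real assume "e > 0"
  then obtain d where "d > 0" "\<And>y. norm (y - x) < d \<Longrightarrow> norm (f y - f x - f' x (y - x)) \<le> e * norm (y - x)"
    using assms[of x] unfolding has_derivative_at_alt by blast
  then show "\<exists>d>0. \<forall>h. norm h < d \<longrightarrow> (\<forall>vs. norm (f (x + h) - f x - f' x (case_nat h vs 0))
      \<le> e * norm h * (\<Prod>i\<in>{}. norm (vs i)))"
    by (intro exI[of _ d]) (metis (no_types, lifting) add_diff_cancel_left' nat.case(1) prod.empty mult_1_right)
qed

lemma smooth_family_linear:
  assumes "bounded_linear L"
  shows "smooth_family k {} (\<lambda>x vs. L x)"
proof (cases k)
  case (Suc k')
  have "has_family_derivative {} (\<lambda>x vs. L x) (\<lambda>x vs. L (vs 0))"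
    by (intro has_family_derivative_nullary bounded_linear_imp_has_derivative assms)
  moreover have "smooth_family k' {0} (\<lambda>x vs. L (vs 0))" by (rule smooth_family_slot) fact
  ultimately show ?thesis using Suc by (auto simp: multilinear_on_def)
qed (auto simp: multilinear_on_def)

lemma smooth_family_Suc_nullary:
  assumes "\<And>x. (f has_derivative f' x) (at x)" "smooth_family k {0} (\<lambda>x vs. f' x (vs 0))"
  shows "smooth_family (Suc k) {} (\<lambda>x vs. f x)"
  using has_family_derivative_nullary[OF assms(1)] assms(2) by (auto simp: multilinear_on_def)

text \<open>Two candidates differ by a multilinear map that is \<open>o(\<bar>h\<bar>)\<close> and linear in
  the direction \<open>h\<close>, hence zero. This makes the derivatives found for different
  orders agree.\<close>

lemma has_family_derivative_unique:
  fixes f :: "'a::real_normed_vector \<Rightarrow> (nat \<Rightarrow> 'a) \<Rightarrow> 'b::real_normed_vector"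
  assumes f': "has_family_derivative S f f'" and f'': "has_family_derivative S f f''"
    and m': "\<And>x. multilinear_on (insert 0 (Suc ` S)) (f' x)"
    and m'': "\<And>x. multilinear_on (insert 0 (Suc ` S)) (f'' x)"
  shows "f' = f''"
proof (intro ext)
  fix x and us :: "nat \<Rightarrow> 'a"
  define vs where "vs = us \<circ> Suc"
  define P where "P = (\<Prod>i\<in>S. norm (vs i))"
  have "P \<ge> 0" by (auto simp: P_def intro: prod_nonneg)
  have us: "us = case_nat (us 0) vs" by (auto simp: vs_def fun_eq_iff split: nat.split)
  have lin: "linear (\<lambda>h. f' x (case_nat h vs))" "linear (\<lambda>h. f'' x (case_nat h vs))"
  proof -
    have eq: "case_nat h vs = us(0 := h)" for h by (auto simp: vs_def fun_eq_iff split: nat.split)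
    show "linear (\<lambda>h. f' x (case_nat h vs))" "linear (\<lambda>h. f'' x (case_nat h vs))"
      unfolding eq using m'[of x] m''[of x] by (auto simp: multilinear_on_def)
  qed
  let ?g = "\<lambda>h. f' x (case_nat h vs) - f'' x (case_nat h vs)"
  have ling: "linear ?g" using lin by (intro linear_compose_sub)
  show "f' x us = f'' x us"
  proof (rule ccontr)
    assume "f' x us \<noteq> f'' x us"
    then have ne: "norm (?g (us 0)) > 0" using us by simp
    then have "us 0 \<noteq> 0" using linear_0[OF ling] by fastforce
    define e where "e = norm (?g (us 0)) / (4 * (norm (us 0) * (P + 1)))"
    have "e > 0" unfolding e_def using ne \<open>us 0 \<noteq> 0\<close> \<open>P \<ge> 0\<close> by (intro divide_pos_pos mult_pos_pos) auto
    obtain d1 where d1: "d1 > 0" "\<And>h vs. norm h < d1 \<Longrightarrow>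
        norm (f (x + h) vs - f x vs - f' x (case_nat h vs)) \<le> e * norm h * (\<Prod>i\<in>S. norm (vs i))"
      using f' \<open>e > 0\<close> unfolding has_family_derivative_def by metis
    obtain d2 where d2: "d2 > 0" "\<And>h vs. norm h < d2 \<Longrightarrow>
        norm (f (x + h) vs - f x vs - f'' x (case_nat h vs)) \<le> e * norm h * (\<Prod>i\<in>S. norm (vs i))"
      using f'' \<open>e > 0\<close> unfolding has_family_derivative_def by metis
    define r where "r = min d1 d2 / (2 * norm (us 0))"
    have r: "r > 0" using d1 d2 \<open>us 0 \<noteq> 0\<close> by (auto simp: r_def)
    define h where "h = r *\<^sub>R us 0"
    have "norm h = min d1 d2 / 2" using r \<open>us 0 \<noteq> 0\<close> d1(1) d2(1) by (simp add: h_def r_def)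
    then have h: "norm h < d1" "norm h < d2" using d1 d2 by auto
    have "norm (?g h) \<le> norm (f (x + h) vs - f x vs - f'' x (case_nat h vs)) + norm (f (x + h) vs - f x vs - f' x (case_nat h vs))"
      using norm_triangle_ineq4[of "f (x + h) vs - f x vs - f'' x (case_nat h vs)" "f (x + h) vs - f x vs - f' x (case_nat h vs)"]
      by (simp add: algebra_simps)
    also have "\<dots> \<le> e * norm h * P + e * norm h * P" unfolding P_def by (intro add_mono d1 d2 h)
    finally have "norm (?g h) \<le> 2 * (e * norm h * P)" by (simp only: mult_2)
    also have "?g h = r *\<^sub>R ?g (us 0)" unfolding h_def using linear_cmul[OF ling] by simp
    finally have "norm (?g (us 0)) \<le> 2 * e * norm (us 0) * P" using r by (simp add: h_def)
    also have "\<dots> = norm (?g (us 0)) / 2 * (P / (P + 1))"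
    proof -
      have "2 * (N / (4 * (a * (P + 1)))) * a * P = N / 2 * (P / (P + 1))" if "a \<noteq> 0" for a N :: real
        using that \<open>P \<ge> 0\<close> by (simp add: divide_simps)
      then show ?thesis unfolding e_def using \<open>us 0 \<noteq> 0\<close> by simp
    qed
    also have "\<dots> \<le> norm (?g (us 0)) / 2 * 1" using \<open>P \<ge> 0\<close> by (intro mult_left_mono) auto
    finally show False using ne by simp
  qed
qed

text \<open>For each order \<open>k\<close> the hypothesis supplies its own chain of \<open>k\<close>
  derivatives. By uniqueness these chains are initial segments of a single infinite one.\<close>

lemma C_infinity_if_smooth_family:
  fixes f :: "'a::real_normed_vector \<Rightarrow> 'b::real_normed_vector"
  assumes "\<And>k. smooth_family k {} (\<lambda>x vs. f x)"
  shows "C_infinity f"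
proof -
  \<comment> \<open>A derivative that is smooth to every order, not just to one prescribed order.\<close>
  define next_der where "next_der n g = (SOME g'. has_family_derivative {..<n} g g' \<and> (\<forall>k. smooth_family k {..<Suc n} g'))"
    for n and g :: "'a \<Rightarrow> (nat \<Rightarrow> 'a) \<Rightarrow> 'b"
  have ins: "insert 0 (Suc ` {..<n}) = {..<Suc n}" for n by (simp add: lessThan_Suc_eq_insert_0)
  have step: "has_family_derivative {..<n} g (next_der n g) \<and> (\<forall>k. smooth_family k {..<Suc n} (next_der n g))"
    if g: "\<And>k. smooth_family k {..<n} g" for n g
  proof -
    have ex: "\<exists>g'. has_family_derivative {..<n} g g' \<and> smooth_family k {..<Suc n} g'" for k
      using g[of "Suc k"] by (auto simp: ins)
    obtain g' where g': "has_family_derivative {..<n} g g'" "smooth_family 0 {..<Suc n} g'" using ex by blast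
    have "smooth_family k {..<Suc n} g'" for k
    proof -
      obtain g'' where g'': "has_family_derivative {..<n} g g''" "smooth_family k {..<Suc n} g''" using ex by blast
      have "g' = g''"
        using has_family_derivative_unique[OF g'(1) g''(1), unfolded ins]
          smooth_family_multilinear[OF g'(2)] smooth_family_multilinear[OF g''(2)] by blast
      then show ?thesis using g'' by simp
    qed
    with g' have "\<exists>g'. has_family_derivative {..<n} g g' \<and> (\<forall>k. smooth_family k {..<Suc n} g')" by blast
    from someI_ex[OF this] show ?thesis unfolding next_der_def .
  qed
  define E where "E = rec_nat (\<lambda>x vs. f x) next_der"
  have E: "E 0 = (\<lambda>x vs. f x)" "E (Suc n) = next_der n (E n)" for n by (auto simp: E_def)
  have "\<forall>k. smooth_family k {..<n} (E n)" for n
  proof (induction n)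
    case 0
    show ?case using assms by (simp add: E(1))
  next
    case (Suc n)
    then show ?case using step[of n "E n"] by (simp add: E(2))
  qed
  then have Es: "smooth_family k {..<n} (E n)" for n k by blast
  have Ed: "has_family_derivative {..<n} (E n) (E (Suc n))" for n
    using step[of n "E n"] Es by (simp add: E(2))
  have Em: "multilinear_on {..<n} (E n x)" for n x using Es smooth_family_multilinear by blast
  define D where "D n x vs = E n x (\<lambda>i. vs ! i)" for n x and vs :: "'a list"
  have prod: "prod_list (map norm vs) = (\<Prod>i<length vs. norm (vs ! i))" for vs :: "'a list"
  proof -
    have "prod_list (map norm vs) = prod (nth (map norm vs)) {..<length vs}"
      using prod.list_conv_set_nth[of "map norm vs"] by (simp add: atLeast0LessThan)
    then show ?thesis by (auto intro: prod.cong)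
  qed
  show ?thesis unfolding C_infinity_def
  proof (intro exI[of _ D] conjI allI impI)
    show "D 0 x [] = f x" for x by (simp add: D_def E)
    show "bounded_multilinear n (D n x)" for n x
      unfolding bounded_multilinear_def
    proof (intro conjI allI impI)
      fix vs :: "'a list" and i assume len: "length vs = n" "i < n"
      have "D n x (vs[i := v]) = E n x ((\<lambda>j. vs ! j)(i := v))" for v
        unfolding D_def by (intro multilinear_on_cong_args[OF Em]) (use len in auto)
      then show "linear (\<lambda>v. D n x (vs[i := v]))" using Em[of n x] len by (auto simp: multilinear_on_def)
    next
      obtain C where "C \<ge> 0" "\<And>vs. norm (E n x vs) \<le> C * (\<Prod>i<n. norm (vs i))" 
        using Em[of n x] by (rule multilinear_onE) blast
      then show "\<exists>C. \<forall>vs. length vs = n \<longrightarrow> norm (D n x vs) \<le> C * prod_list (map norm vs)"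
        by (intro exI[of _ C]) (auto simp: D_def prod)
    qed
    show "\<exists>d>0. \<forall>h. norm h < d \<longrightarrow> (\<forall>vs. length vs = n \<longrightarrow> norm (D n (x + h) vs - D n x vs - D (Suc n) x (h # vs))
         \<le> e * norm h * prod_list (map norm vs))" if "e > 0" for n x e
    proof -
      obtain d where d: "d > 0" "\<And>h vs. norm h < d \<Longrightarrow>
          norm (E n (x + h) vs - E n x vs - E (Suc n) x (case_nat h vs)) \<le> e * norm h * (\<Prod>i<n. norm (vs i))"
        using Ed[of n] \<open>e > 0\<close> unfolding has_family_derivative_def by metis
      have eq: "(\<lambda>i. (h # vs) ! i) = case_nat h (\<lambda>i. vs ! i)" for h and vs :: "'a list"
        by (auto simp: fun_eq_iff nth_Cons)
      show ?thesis using d by (intro exI[of _ d]) (auto simp: D_def eq prod)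
    qed
  qed
qed

text \<open>Restricts a smooth map to a line, in particular a flow to the trajectory of one datum. An
  isometric \<open>L\<close> leaves the constants in all estimates as they are.\<close>

lemma C_infinity_affine:
  fixes L :: "'c::real_normed_vector \<Rightarrow> 'a::real_normed_vector"
  assumes f: "C_infinity f" and L: "linear L" and iso: "\<And>t. norm (L t) = norm t"
  shows "C_infinity (\<lambda>t. f (a + L t))"
proof -
  obtain D where D0: "\<And>x. D 0 x [] = f x"
    and lin: "\<And>n x. bounded_multilinear n (D n x)"
    and der: "\<And>n x e. e > 0 \<Longrightarrow> \<exists>d>0. \<forall>h. norm h < d \<longrightarrow> (\<forall>vs. length vs = n \<longrightarrow>
       norm (D n (x + h) vs - D n x vs - D (Suc n) x (h # vs))
         \<le> e * norm h * prod_list (map norm vs))"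
    using f unfolding C_infinity_def by metis
  have nm: "map (norm \<circ> L) vs = map norm vs" for vs using iso by simp
  show ?thesis unfolding C_infinity_def
  proof (intro exI[of _ "\<lambda>n t vs. D n (a + L t) (map L vs)"] conjI allI impI)
    show "D 0 (a + L x) (map L []) = f (a + L x)" for x by (simp add: D0)
    show "bounded_multilinear n (\<lambda>vs. D n (a + L t) (map L vs))" for n t
      unfolding bounded_multilinear_def
    proof (intro conjI allI impI)
      fix vs :: "'c list" and i assume len: "length vs = n" "i < n"
      have "linear (\<lambda>v. D n (a + L t) ((map L vs)[i := v]))"
        using lin[of n "a + L t"] len unfolding bounded_multilinear_def by (metis length_map)
      from linear_compose[OF L this]
      show "linear (\<lambda>v. D n (a + L t) (map L (vs[i := v])))" by (simp add: map_update o_def)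
    next
      obtain C where "\<And>vs. length vs = n \<Longrightarrow> norm (D n (a + L t) vs) \<le> C * prod_list (map norm vs)"
        using lin[of n "a + L t"] unfolding bounded_multilinear_def by blast
      from this[of "map L _"]
      show "\<exists>C. \<forall>vs. length vs = n \<longrightarrow> norm (D n (a + L t) (map L vs)) \<le> C * prod_list (map norm vs)"
        by (intro exI[of _ C]) (auto simp: nm)
    qed
    show "\<exists>d>0. \<forall>h. norm h < d \<longrightarrow> (\<forall>vs. length vs = n \<longrightarrow>
       norm (D n (a + L (x + h)) (map L vs) - D n (a + L x) (map L vs) - D (Suc n) (a + L x) (map L (h # vs)))
         \<le> e * norm h * prod_list (map norm vs))" if "e > 0" for n x e
    proof -
      obtain d where d: "d > 0" "\<And>h vs. norm h < d \<Longrightarrow> length vs = n \<Longrightarrow>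
       norm (D n (a + L x + h) vs - D n (a + L x) vs - D (Suc n) (a + L x) (h # vs))
         \<le> e * norm h * prod_list (map norm vs)"
        using der[OF \<open>e > 0\<close>, of n "a + L x"] by blast
      show ?thesis
        using d(1) d(2)[of "L _" "map L _"]
        by (intro exI[of _ d]) (auto simp: nm iso linear_add[OF L] add.assoc)
    qed
  qed
qed

section \<open>Volterra equations for curves on the unit interval\<close>

text \<open>Curves on \<open>[0, 1]\<close> are continued by their end values to the whole line. They then
  live in the Banach space of bounded continuous functions, and an equation for them reads the
  same at every real time.\<close>

definition unit_clamp :: "real \<Rightarrow> real" where "unit_clamp t = max 0 (min 1 t)"

lemma unit_clamp_range: "0 \<le> unit_clamp t" "unit_clamp t \<le> 1"
  by (auto simp: unit_clamp_def)

lemma unit_clamp_id: "0 \<le> t \<Longrightarrow> t \<le> 1 \<Longrightarrow> unit_clamp t = t"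
  by (auto simp: unit_clamp_def)

lemma continuous_on_unit_clamp [continuous_intros]: "continuous_on S unit_clamp"
  unfolding unit_clamp_def by (intro continuous_intros)

lemma integral_exp_le:
  fixes c \<rho> :: real
  assumes "\<rho> > 0" "0 \<le> c"
  shows "integral {0..c} (\<lambda>s. exp (\<rho> * s)) \<le> exp (\<rho> * c) / \<rho>"
proof -
  have "((\<lambda>s. exp (\<rho> * s)) has_integral (\<lambda>s. exp (\<rho> * s) / \<rho>) c - (\<lambda>s. exp (\<rho> * s) / \<rho>) 0) {0..c}"
    using assms by (intro fundamental_theorem_of_calculus[where f = "\<lambda>s. exp (\<rho> * s) / \<rho>"])
      (auto intro!: derivative_eq_intros simp: has_real_derivative_iff_has_vector_derivative[symmetric])
  then show ?thesis using assms by (simp add: integral_unique)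
qed

text \<open>In the norm weighted by \<open>exp (- (2 L + 1) t)\<close> a Volterra operator with constant
  \<open>L\<close> has norm at most \<open>L / (2 L + 1) \<le> 1 / 2\<close>, however large
  \<open>L\<close> is. Both the Gronwall estimate and the fixed point theorem below rest on this.\<close>

lemma volterra_weight_bound:
  fixes d :: "real \<Rightarrow>\<^sub>C 'e::banach"
  assumes "L \<ge> 0" "m \<ge> 0" "\<And>s. norm (d s) \<le> exp ((2 * L + 1) * unit_clamp s) * m"
  shows "L * integral {0..unit_clamp t} (\<lambda>s. norm (d s)) \<le> exp ((2 * L + 1) * unit_clamp t) * (m / 2)"
proof -
  have "integral {0..unit_clamp t} (\<lambda>s. norm (d s)) \<le> integral {0..unit_clamp t} (\<lambda>s. exp ((2 * L + 1) * s) * m)"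
  proof (intro integral_le)
    show "norm (d s) \<le> exp ((2 * L + 1) * s) * m" if "s \<in> {0..unit_clamp t}" for s
      using assms(3)[of s] that unit_clamp_range[of t] by (simp add: unit_clamp_id)
  qed (intro integrable_continuous_interval continuous_intros continuous_on_apply_bcontfun)+
  also have "\<dots> = integral {0..unit_clamp t} (\<lambda>s. exp ((2 * L + 1) * s)) * m" by simp
  also have "\<dots> \<le> exp ((2 * L + 1) * unit_clamp t) / (2 * L + 1) * m"
    using assms unit_clamp_range by (intro mult_right_mono integral_exp_le) auto
  finally have "L * integral {0..unit_clamp t} (\<lambda>s. norm (d s)) \<le> L * (exp ((2 * L + 1) * unit_clamp t) / (2 * L + 1) * m)"
    using assms by (intro mult_left_mono)
  also have "\<dots> = (L / (2 * L + 1)) * (exp ((2 * L + 1) * unit_clamp t) * m)" by simp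
  also have "\<dots> \<le> (1 / 2) * (exp ((2 * L + 1) * unit_clamp t) * m)"
    using assms by (intro mult_right_mono) (auto simp: field_simps)
  finally show ?thesis by simp
qed

text \<open>The weighted supremum \<open>m\<close> of \<open>norm (d t)\<close> satisfies \<open>m \<le>
  \<alpha> + m / 2\<close>.\<close>

lemma volterra_gronwall:
  fixes d :: "real \<Rightarrow>\<^sub>C 'e::banach"
  assumes "L \<ge> 0" "\<alpha> \<ge> 0"
    and le: "\<And>t. norm (d t) \<le> \<alpha> + L * integral {0..unit_clamp t} (\<lambda>s. norm (d s))"
  shows "norm d \<le> 2 * exp (2 * L + 1) * \<alpha>"
proof -
  define \<rho> where "\<rho> = 2 * L + 1"
  have "\<rho> > 0" using assms by (simp add: \<rho>_def)
  define w where "w t = exp (- \<rho> * unit_clamp t) * norm (d t)" for t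
  have w_le: "w t \<le> norm d" for t
  proof -
    have "w t \<le> 1 * norm d" unfolding w_def
      using \<open>\<rho> > 0\<close> unit_clamp_range[of t] by (intro mult_mono norm_bounded) auto
    then show ?thesis by simp
  qed
  have bdd: "bdd_above (range w)" by (intro bdd_aboveI[of _ "norm d"]) (auto intro: w_le)
  define m where "m = (SUP t. w t)"
  have wm: "w t \<le> m" for t unfolding m_def by (rule cSUP_upper[OF _ bdd]) simp
  have m0: "m \<ge> 0" using wm[of 0] order_trans[of 0 "w 0" m] by (simp add: w_def)
  have dw: "norm (d t) = exp (\<rho> * unit_clamp t) * w t" for t
    by (simp add: w_def mult.assoc[symmetric] exp_add[symmetric])
  have dm: "norm (d s) \<le> exp (\<rho> * unit_clamp s) * m" for s
    unfolding dw using wm by (intro mult_left_mono) auto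
  have "w t \<le> \<alpha> + m / 2" for t
  proof -
    have "norm (d t) \<le> \<alpha> + exp (\<rho> * unit_clamp t) * (m / 2)"
      using le[of t] volterra_weight_bound[OF \<open>L \<ge> 0\<close> m0 dm[unfolded \<rho>_def], of t] by (simp add: \<rho>_def)
    also have "\<dots> \<le> exp (\<rho> * unit_clamp t) * \<alpha> + exp (\<rho> * unit_clamp t) * (m / 2)"
    proof -
      have "1 * \<alpha> \<le> exp (\<rho> * unit_clamp t) * \<alpha>"
        using \<open>\<rho> > 0\<close> \<open>\<alpha> \<ge> 0\<close> unit_clamp_range[of t] by (intro mult_right_mono) auto
      then show ?thesis by simp
    qed
    finally have "exp (\<rho> * unit_clamp t) * w t \<le> exp (\<rho> * unit_clamp t) * (\<alpha> + m / 2)"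
      unfolding dw by (simp add: distrib_left)
    then show ?thesis by simp
  qed
  then have "m \<le> \<alpha> + m / 2" unfolding m_def by (intro cSUP_least) auto
  then have m: "m \<le> 2 * \<alpha>" by simp
  show ?thesis
  proof (rule norm_bound)
    fix t
    have "norm (d t) \<le> exp (\<rho> * unit_clamp t) * m" by (rule dm)
    also have "\<dots> \<le> exp \<rho> * (2 * \<alpha>)"
      using m m0 \<open>\<rho> > 0\<close> unit_clamp_range[of t] by (intro mult_mono) auto
    finally show "norm (d t) \<le> 2 * exp (2 * L + 1) * \<alpha>" by (simp add: \<rho>_def)
  qed
qed

text \<open>Multiplication by the exponential weight as a map on curves; conjugation with it turns the
  weighted norm into the supremum norm.\<close>

definition reweight :: "real \<Rightarrow> (real \<Rightarrow>\<^sub>C 'e::real_normed_vector) \<Rightarrow> (real \<Rightarrow>\<^sub>C 'e)"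
  where "reweight \<mu> y = Bcontfun (\<lambda>t. exp (\<mu> * unit_clamp t) *\<^sub>R y t)"

lemma reweight_apply [simp]: "reweight \<mu> y t = exp (\<mu> * unit_clamp t) *\<^sub>R y t"
proof -
  have "(\<lambda>t. exp (\<mu> * unit_clamp t) *\<^sub>R y t) \<in> bcontfun"
  proof (rule bcontfun_normI)
    show "continuous_on UNIV (\<lambda>t. exp (\<mu> * unit_clamp t) *\<^sub>R y t)"
      by (intro continuous_intros continuous_on_apply_bcontfun)
    show "norm (exp (\<mu> * unit_clamp t) *\<^sub>R y t) \<le> exp \<bar>\<mu>\<bar> * norm y" for t
    proof -
      have "\<mu> * unit_clamp t \<le> \<bar>\<mu>\<bar> * unit_clamp t" using unit_clamp_range[of t] by (intro mult_right_mono) auto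
      also have "\<dots> \<le> \<bar>\<mu>\<bar> * 1" using unit_clamp_range[of t] by (intro mult_left_mono) auto
      finally show ?thesis by (auto intro!: mult_mono norm_bounded)
    qed
  qed
  then show ?thesis by (simp add: reweight_def Bcontfun_inverse)
qed

text \<open>After conjugation with the weight, \<open>G\<close> is a contraction with factor \<open>1 /
  2\<close> on the whole time interval, so no short time steps have to be glued together.\<close>

lemma volterra_fixed_point:
  fixes G :: "(real \<Rightarrow>\<^sub>C 'e::banach) \<Rightarrow> (real \<Rightarrow>\<^sub>C 'e)"
  assumes "L \<ge> 0"
    and lip: "\<And>y y' t. norm (G y t - G y' t) \<le> L * integral {0..unit_clamp t} (\<lambda>s. norm (y s - y' s))"
  shows "\<exists>y. G y = y"
proof -
  define \<rho> where "\<rho> = 2 * L + 1"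
  define H where "H g = reweight (- \<rho>) (G (reweight \<rho> g))" for g
  have "dist (H g) (H g') \<le> 1 / 2 * dist g g'" for g g'
  proof (rule dist_bound)
    fix t
    have "norm ((reweight \<rho> g - reweight \<rho> g') s) \<le> exp (\<rho> * unit_clamp s) * norm (g - g')" for s
      using norm_bounded[of "g - g'" s] by (simp add: scaleR_diff_right[symmetric])
    from volterra_weight_bound[OF \<open>L \<ge> 0\<close> norm_ge_zero this[unfolded \<rho>_def], of t]
    have "norm (G (reweight \<rho> g) t - G (reweight \<rho> g') t) \<le> exp (\<rho> * unit_clamp t) * (norm (g - g') / 2)"
      using lip[of "reweight \<rho> g" t "reweight \<rho> g'"] by (simp add: \<rho>_def)
    then have "exp (- \<rho> * unit_clamp t) * norm (G (reweight \<rho> g) t - G (reweight \<rho> g') t)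
       \<le> exp (- \<rho> * unit_clamp t) * (exp (\<rho> * unit_clamp t) * (norm (g - g') / 2))"
      by (intro mult_left_mono) auto
    also have "\<dots> = 1 / 2 * dist g g'"
      by (simp add: mult.assoc[symmetric] exp_add[symmetric] dist_norm)
    finally show "dist (H g t) (H g' t) \<le> 1 / 2 * dist g g'"
      by (simp add: H_def dist_norm scaleR_diff_right[symmetric])
  qed
  then have "\<exists>!g. H g = g" by (intro banach_fix_type[of "1 / 2"]) auto
  then obtain g where g: "H g = g" by blast
  have "reweight \<rho> (reweight (- \<rho>) y) = y" for y :: "real \<Rightarrow>\<^sub>C 'e"
    by (rule bcontfun_eqI) (simp add: exp_add[symmetric])
  then have "G (reweight \<rho> g) = reweight \<rho> g" using g unfolding H_def by metis
  then show ?thesis by blast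
qed

definition primitive_curve :: "(real \<Rightarrow>\<^sub>C 'e::banach) \<Rightarrow> (real \<Rightarrow>\<^sub>C 'e)"
  where "primitive_curve g = Bcontfun (\<lambda>t. integral {0..unit_clamp t} g)"

lemma integral_curve_norm_le:
  fixes g :: "real \<Rightarrow>\<^sub>C 'e::banach"
  shows "norm (integral {0..unit_clamp t} g) \<le> integral {0..unit_clamp t} (\<lambda>s. norm (g s))"
  by (intro integral_norm_bound_integral integrable_continuous_interval continuous_intros) auto

lemma integral_norm_curve_le:
  fixes g :: "real \<Rightarrow>\<^sub>C 'e::banach"
  shows "integral {0..unit_clamp t} (\<lambda>s. norm (g s)) \<le> norm g"
proof -
  have "integral {0..unit_clamp t} (\<lambda>s. norm (g s)) \<le> integral {0..unit_clamp t} (\<lambda>s. norm g)"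
    by (intro integral_le integrable_continuous_interval continuous_intros norm_bounded) auto
  also have "\<dots> \<le> norm g" using unit_clamp_range[of t] mult_right_mono[of "unit_clamp t" 1 "norm g"] by simp
  finally show ?thesis .
qed

lemma primitive_curve_apply [simp]: "primitive_curve g t = integral {0..unit_clamp t} g"
proof -
  have "(\<lambda>t. integral {0..unit_clamp t} g) \<in> bcontfun"
  proof (rule bcontfun_normI)
    have "continuous_on {0..1} (\<lambda>t. integral {0..t} g)"
      by (intro indefinite_integral_continuous_1 integrable_continuous_interval) auto
    then have "continuous_on UNIV ((\<lambda>t. integral {0..t} g) \<circ> unit_clamp)"
      by (intro continuous_on_compose continuous_intros) (auto elim: continuous_on_subset simp: unit_clamp_range)
    then show "continuous_on UNIV (\<lambda>t. integral {0..unit_clamp t} g)" by (simp add: o_def)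
    show "norm (integral {0..unit_clamp t} g) \<le> norm g" for t
      using integral_curve_norm_le[of t g] integral_norm_curve_le[of t g] by simp
  qed
  then show ?thesis by (simp add: primitive_curve_def Bcontfun_inverse)
qed

lemma primitive_curve_norm: "norm (primitive_curve g) \<le> norm g"
  by (intro norm_bound) (simp add: order_trans[OF integral_curve_norm_le integral_norm_curve_le])

lemma primitive_curve_add: "primitive_curve (f + g) = primitive_curve f + primitive_curve g"
  by (intro bcontfun_eqI) (simp add: integral_add integrable_continuous_interval)

lemma primitive_curve_scaleR: "primitive_curve (r *\<^sub>R f) = r *\<^sub>R primitive_curve f"
  by (intro bcontfun_eqI) simp

text \<open>The inverse of \<open>1 - V\<close>. The fixed point theorem yields a solution of \<open>d = g +
  V d\<close> for every \<open>g\<close>; the Gronwall estimate makes it unique, hence linear in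
  \<open>g\<close>, and bounds it.\<close>

lemma volterra_resolvent:
  fixes V :: "(real \<Rightarrow>\<^sub>C 'e::banach) \<Rightarrow>\<^sub>L (real \<Rightarrow>\<^sub>C 'e)"
  assumes "L \<ge> 0"
    and V: "\<And>d t. norm (V d t) \<le> L * integral {0..unit_clamp t} (\<lambda>s. norm (d s))"
  shows "\<exists>A :: (real \<Rightarrow>\<^sub>C 'e) \<Rightarrow>\<^sub>L (real \<Rightarrow>\<^sub>C 'e).
    (\<forall>g. blinfun_apply A g = g + V (blinfun_apply A g)) \<and> (\<forall>g. blinfun_apply A (g - V g) = g) \<and> norm A \<le> 2 * exp (2 * L + 1)"
proof -
  have ex: "\<exists>d. d = g + V d" for g
  proof -
    have "\<exists>y. g + V y = y"
    proof (rule volterra_fixed_point[OF \<open>L \<ge> 0\<close>])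
      show "norm ((g + V y) t - (g + V y') t) \<le> L * integral {0..unit_clamp t} (\<lambda>s. norm (y s - y' s))" for y y' t
        using V[of "y - y'" t] by (simp add: blinfun.diff_right)
    qed
    then show ?thesis by metis
  qed
  have bound: "norm d \<le> 2 * exp (2 * L + 1) * norm g" if "d = g + V d" for d g
  proof (rule volterra_gronwall[OF \<open>L \<ge> 0\<close> norm_ge_zero])
    fix t
    have "norm (d t) = norm (g t + V d t)" by (subst that) simp
    also have "\<dots> \<le> norm g + L * integral {0..unit_clamp t} (\<lambda>s. norm (d s))"
      by (intro norm_triangle_mono norm_bounded V)
    finally show "norm (d t) \<le> norm g + L * integral {0..unit_clamp t} (\<lambda>s. norm (d s))" .
  qed
  have unique: "d = d'" if "d = g + V d" "d' = g + V d'" for d d' g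
  proof -
    have "d - d' = 0 + V (d - d')" using that by (metis add_diff_cancel_left add.left_neutral blinfun.diff_right)
    from bound[OF this] show ?thesis by simp
  qed
  obtain A where A: "\<And>g. A g = g + V (A g)" using ex by metis
  have "bounded_linear A"
  proof (rule bounded_linear_intro)
    show "A (f + g) = A f + A g" for f g
      by (rule unique[of _ "f + g"]) (simp_all add: A[symmetric] blinfun.add_right, metis A add.assoc add.left_commute)
    show "A (r *\<^sub>R g) = r *\<^sub>R A g" for r g
      by (rule unique[of _ "r *\<^sub>R g"]) (simp_all add: A[symmetric] blinfun.scaleR_right, metis A scaleR_add_right)
    show "norm (A g) \<le> norm g * (2 * exp (2 * L + 1))" for g
      using bound[OF A[of g]] by (simp add: mult.commute)
  qed
  note app = bounded_linear_Blinfun_apply[OF this]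
  show ?thesis
  proof (intro exI[of _ "Blinfun A"] conjI allI)
    show "blinfun_apply (Blinfun A) g = g + V (blinfun_apply (Blinfun A) g)" for g unfolding app by (rule A)
    show "blinfun_apply (Blinfun A) (g - V g) = g" for g unfolding app
      by (rule unique[of _ "g - V g"]) (rule A, simp)
    show "norm (Blinfun A) \<le> 2 * exp (2 * L + 1)"
      by (rule norm_blinfun_bound) (use bound[OF A] in \<open>simp_all add: app\<close>)
  qed
qed

section \<open>The flow of a cubic vector field\<close>

lemma has_derivative_if_quadratic_remainder:
  fixes f :: "'a::real_normed_vector \<Rightarrow> 'b::real_normed_vector"
  assumes "bounded_linear D" "d > 0"
    and le: "\<And>h. norm h < d \<Longrightarrow> norm (f (p + h) - f p - D h) \<le> C * (norm h)\<^sup>2"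
  shows "(f has_derivative D) (at p)"
  unfolding has_derivative_at_alt
proof (intro conjI allI impI assms(1))
  fix e :: real assume "e > 0"
  define C' where "C' = max C 0 + 1"
  have C': "C' > 0" "C \<le> C'" by (auto simp: C'_def)
  show "\<exists>d>0. \<forall>y. norm (y - p) < d \<longrightarrow> norm (f y - f p - D (y - p)) \<le> e * norm (y - p)"
  proof (intro exI[of _ "min d (e / C')"] conjI allI impI)
    show "min d (e / C') > 0" using \<open>d > 0\<close> \<open>e > 0\<close> C' by simp
    fix y assume y: "norm (y - p) < min d (e / C')"
    have "norm (f y - f p - D (y - p)) \<le> C * (norm (y - p))\<^sup>2" using le[of "y - p"] y by simp
    also have "\<dots> \<le> C' * norm (y - p) * norm (y - p)"
      unfolding power2_eq_square mult.assoc using C' by (intro mult_right_mono) auto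
    also have "\<dots> \<le> e * norm (y - p)"
      using y C' by (intro mult_right_mono) (auto simp: field_simps)
    finally show "norm (f y - f p - D (y - p)) \<le> e * norm (y - p)" .
  qed
qed

text \<open>Where \<open>f\<close> vanishes, the product rule asks only continuity of the other factor. The
  resolvent identity has this shape, with the difference of two operators as the vanishing factor,
  and in this way continuity of the resolvent upgrades to differentiability.\<close>

lemma has_derivative_bilinear_vanishing:
  assumes b: "bounded_bilinear b" and g: "isCont g p" and f: "(f has_derivative f') (at p)" and "f p = 0"
  shows "((\<lambda>q. b (g q) (f q)) has_derivative (\<lambda>h. b (g p) (f' h))) (at p)"
proof -
  interpret bounded_bilinear b by fact
  obtain K where K: "K > 0" "\<And>x y. norm (b x y) \<le> norm x * norm y * K"
    using pos_bounded by blast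
  obtain C where C: "C > 0" "\<And>h. norm (f' h) \<le> norm h * C"
    using bounded_linear.pos_bounded[OF has_derivative_bounded_linear[OF f]] by blast
  have "((\<lambda>q. b (g q - g p) (f q)) has_derivative (\<lambda>h. 0)) (at p)"
    unfolding has_derivative_at_alt
  proof (intro conjI allI impI bounded_linear_zero)
    fix e :: real assume "e > 0"
    obtain d1 where d1: "d1 > 0" "\<And>y. norm (y - p) < d1 \<Longrightarrow> norm (f y - f p - f' (y - p)) \<le> 1 * norm (y - p)"
      using f zero_less_one unfolding has_derivative_at_alt by blast
    define e' where "e' = e / (K * (C + 1))"
    have "e' > 0" using \<open>e > 0\<close> K C by (simp add: e'_def)
    then obtain d2 where d2: "d2 > 0" "\<And>y. norm (y - p) < d2 \<Longrightarrow> norm (g y - g p) < e'"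
      using g unfolding continuous_at_eps_delta dist_norm by blast
    show "\<exists>d>0. \<forall>y. norm (y - p) < d \<longrightarrow> norm (b (g y - g p) (f y) - b (g p - g p) (f p) - 0) \<le> e * norm (y - p)"
    proof (intro exI[of _ "min d1 d2"] conjI allI impI)
      fix y assume y: "norm (y - p) < min d1 d2"
      have "norm (f y) \<le> norm (f y - f p - f' (y - p)) + norm (f' (y - p))"
        using norm_triangle_ineq[of "f y - f p - f' (y - p)" "f' (y - p)"] \<open>f p = 0\<close> by simp
      also have "\<dots> \<le> (C + 1) * norm (y - p)" using d1(2)[of y] C(2)[of "y - p"] y by (simp add: algebra_simps)
      finally have fy: "norm (f y) \<le> (C + 1) * norm (y - p)" .
      have "norm (b (g y - g p) (f y)) \<le> e' * ((C + 1) * norm (y - p)) * K"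
        using K C fy d2(2)[of y] y \<open>e' > 0\<close> by (intro order_trans[OF K(2)] mult_right_mono mult_mono) auto
      also have "\<dots> = e * norm (y - p)" using K C by (simp add: e'_def)
      finally show "norm (b (g y - g p) (f y) - b (g p - g p) (f p) - 0) \<le> e * norm (y - p)"
        by (simp add: zero_left)
    qed (use d1 d2 in auto)
  qed
  moreover have "((\<lambda>q. b (g p) (f q)) has_derivative (\<lambda>h. b (g p) (f' h))) (at p)"
    by (rule bounded_linear.has_derivative[OF bounded_linear_right f])
  ultimately have "((\<lambda>q. b (g q - g p) (f q) + b (g p) (f q)) has_derivative (\<lambda>h. 0 + b (g p) (f' h))) (at p)"
    by (rule has_derivative_add)
  then show ?thesis by (simp add: diff_left)
qed

text \<open>The retraction onto a ball makes a cubic field globally Lipschitz without changing it inside the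
  ball. The difference splits into a multiple of \<open>x - y\<close> and a multiple of
  \<open>y\<close> that measures the change of the scaling factor.\<close>

lemma radial_retraction_lipschitz:
  fixes x y :: "'a::real_normed_vector"
  assumes "R > 0"
  shows "norm ((R / max R (norm x)) *\<^sub>R x - (R / max R (norm y)) *\<^sub>R y) \<le> 2 * norm (x - y)"
proof -
  let ?m = "max R (norm x)" and ?n = "max R (norm y)"
  have pos: "?m > 0" "?n > 0" using assms by auto
  have "(R / ?m) *\<^sub>R x - (R / ?n) *\<^sub>R y = (R / ?m) *\<^sub>R (x - y) + (R * (?n - ?m) / (?m * ?n)) *\<^sub>R y"
  proof -
    have "R * (?n - ?m) / (?m * ?n) = R / ?m - R / ?n" using pos by (simp add: field_simps)
    then show ?thesis by (simp only: scaleR_diff_left scaleR_diff_right) simp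
  qed
  also have "norm \<dots> \<le> 1 * norm (x - y) + 1 * norm (x - y)"
  proof (intro norm_triangle_mono)
    show "norm ((R / ?m) *\<^sub>R (x - y)) \<le> 1 * norm (x - y)"
      unfolding norm_scaleR using assms pos by (intro mult_right_mono) (auto simp: divide_simps)
    have "norm ((R * (?n - ?m) / (?m * ?n)) *\<^sub>R y) = (R / ?m) * (norm y / ?n) * \<bar>?n - ?m\<bar>"
      using assms pos by (simp add: abs_mult)
    also have "\<dots> \<le> 1 * 1 * norm (x - y)"
    proof (intro mult_mono)
      show "\<bar>?n - ?m\<bar> \<le> norm (x - y)"
        using norm_triangle_ineq2[of x y] norm_triangle_ineq2[of y x] by (auto simp: norm_minus_commute max_def)
    qed (use assms pos in \<open>auto simp: divide_simps\<close>)
    finally show "norm ((R * (?n - ?m) / (?m * ?n)) *\<^sub>R y) \<le> 1 * norm (x - y)" by simp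
  qed
  finally show ?thesis by simp
qed

lemma norm_radial_retraction_le:
  assumes "R > 0" shows "norm ((R / max R (norm x)) *\<^sub>R x) \<le> R"
  using assms by (simp add: divide_simps max_def)

text \<open>A homogeneous cubic vector field \<open>y \<mapsto> T y y y\<close>, given by a symmetric
  trilinear map. Symmetry makes \<open>3 T y y\<close> the derivative of the field. Orthogonality
  of the field to the position conserves the norm, which is what excludes blow-up.\<close>

locale cubic_field =
  fixes T :: "'e::{real_inner,banach} \<Rightarrow> 'e \<Rightarrow> 'e \<Rightarrow> 'e" and K :: real
  assumes T_linear: "linear (\<lambda>a. T a b c)"
    and T_swap12: "T a b c = T b a c" and T_swap23: "T a b c = T a c b"
    and T_bound: "norm (T a b c) \<le> K * norm a * norm b * norm c"
    and K_nonneg: "K \<ge> 0"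
    and T_orth: "inner a (T a a a) = 0"
begin

lemma T_add1: "T (a + a') b c = T a b c + T a' b c" by (rule linear_add[OF T_linear])
lemma T_scale1: "T (r *\<^sub>R a) b c = r *\<^sub>R T a b c" by (rule linear_cmul[OF T_linear])
lemma T_add2: "T a (b + b') c = T a b c + T a b' c" by (simp add: T_swap12[of a] T_add1)
lemma T_scale2: "T a (r *\<^sub>R b) c = r *\<^sub>R T a b c" by (simp add: T_swap12[of a] T_scale1)
lemma T_add3: "T a b (c + c') = T a b c + T a b c'" by (simp add: T_swap23[of a b] T_add2)
lemma T_scale3: "T a b (r *\<^sub>R c) = r *\<^sub>R T a b c" by (simp add: T_swap23[of a b] T_scale2)

lemma T_diff3: "T a b (c - c') = T a b c - T a b c'"
  using T_add3[of a b c "- c'"] T_scale3[of a b "-1" c'] by simp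

lemma bounded_linear_T: "bounded_linear (T a b)"
  by (rule bounded_linear_intro[of _ "K * norm a * norm b"])
    (use T_bound[of a b] in \<open>simp_all add: T_add3 T_scale3 mult.commute mult.left_commute\<close>)

text \<open>The partial application of \<open>T\<close> as an operator, so that continuity of
  \<open>T\<close> in all arguments jointly follows from continuity of two bounded bilinear maps.\<close>

definition "T_op a b = Blinfun (T a b)"

lemma T_op_apply [simp]: "blinfun_apply (T_op a b) c = T a b c"
  by (simp add: T_op_def bounded_linear_Blinfun_apply bounded_linear_T)

lemma bounded_bilinear_T_op: "bounded_bilinear T_op"
proof
  show "\<exists>K. \<forall>a b. norm (T_op a b) \<le> norm a * norm b * K"
    by (intro exI[of _ K] allI norm_blinfun_bound)
      (use T_bound K_nonneg in \<open>auto simp: mult.commute mult.left_commute\<close>)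
qed (rule blinfun_eqI; simp add: blinfun.bilinear_simps T_add1 T_add2 T_scale1 T_scale2)+

lemma continuous_on_T [continuous_intros]:
  assumes "continuous_on S f" "continuous_on S g" "continuous_on S h"
  shows "continuous_on S (\<lambda>s. T (f s) (g s) (h s))"
proof -
  have "continuous_on S (\<lambda>s. blinfun_apply (T_op (f s) (g s)) (h s))"
    by (intro bounded_bilinear.continuous_on[OF bounded_bilinear_blinfun_apply]
        bounded_bilinear.continuous_on[OF bounded_bilinear_T_op] assms)
  then show ?thesis by simp
qed

lemma T_cube_lipschitz:
  assumes "norm a \<le> R" "norm b \<le> R"
  shows "norm (T a a a - T b b b) \<le> 3 * K * R\<^sup>2 * norm (a - b)"
proof -
  have R: "R \<ge> 0" using assms norm_ge_zero order_trans by blast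
  have "T a a a - T b b b = T a a (a - b) + T a b (a - b) + T b b (a - b)"
    by (simp add: T_diff3 T_swap23[of a b a] T_swap23[of b b a] T_swap12[of b a b])
  also have "norm \<dots> \<le> K * R * R * norm (a - b) + K * R * R * norm (a - b) + K * R * R * norm (a - b)"
    using assms K_nonneg R
    by (intro norm_triangle_mono order_trans[OF T_bound] mult_right_mono mult_mono) auto
  finally show ?thesis by (simp add: power2_eq_square)
qed

definition T_curve :: "(real \<Rightarrow>\<^sub>C 'e) \<Rightarrow> (real \<Rightarrow>\<^sub>C 'e) \<Rightarrow> (real \<Rightarrow>\<^sub>C 'e) \<Rightarrow> (real \<Rightarrow>\<^sub>C 'e)"
  where "T_curve a b d = Bcontfun (\<lambda>s. T (a s) (b s) (d s))"

lemma T_curve_apply [simp]: "T_curve a b d s = T (a s) (b s) (d s)"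
proof -
  have "(\<lambda>s. T (a s) (b s) (d s)) \<in> bcontfun"
  proof (rule bcontfun_normI)
    show "continuous_on UNIV (\<lambda>s. T (a s) (b s) (d s))"
      by (intro continuous_intros continuous_on_apply_bcontfun)
    show "norm (T (a s) (b s) (d s)) \<le> K * norm a * norm b * norm d" for s
      using K_nonneg by (intro order_trans[OF T_bound] mult_mono norm_bounded mult_nonneg_nonneg) auto
  qed
  then show ?thesis by (simp add: T_curve_def Bcontfun_inverse)
qed

lemma T_curve_norm: "norm (T_curve a b d) \<le> K * norm a * norm b * norm d"
proof (rule norm_bound)
  show "norm (T_curve a b d s) \<le> K * norm a * norm b * norm d" for s
    unfolding T_curve_apply
    using K_nonneg by (intro order_trans[OF T_bound] mult_mono norm_bounded mult_nonneg_nonneg) auto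
qed

text \<open>The field integrated in time. On curves, the equation \<open>y' = \<tau> T y y y\<close> with
  \<open>y 0 = x\<close> becomes the cubic equation \<open>y = x + \<tau> N y y y\<close>, in
  which \<open>N\<close> inherits multilinearity, symmetry and the bound from \<open>T\<close> and
  gains the Volterra property.\<close>

definition N :: "(real \<Rightarrow>\<^sub>C 'e) \<Rightarrow> (real \<Rightarrow>\<^sub>C 'e) \<Rightarrow> (real \<Rightarrow>\<^sub>C 'e) \<Rightarrow>\<^sub>L (real \<Rightarrow>\<^sub>C 'e)"
  where "N a b = Blinfun (\<lambda>d. primitive_curve (T_curve a b d))"

lemma N_eq: "blinfun_apply (N a b) d = primitive_curve (T_curve a b d)"
proof -
  have "bounded_linear (\<lambda>d. primitive_curve (T_curve a b d))"
  proof (rule bounded_linear_intro)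
    have "T_curve a b (c + d) = T_curve a b c + T_curve a b d" for c d
      by (rule bcontfun_eqI) (simp add: T_add3)
    then show "primitive_curve (T_curve a b (c + d)) = primitive_curve (T_curve a b c) + primitive_curve (T_curve a b d)" for c d
      by (simp add: primitive_curve_add)
    have "T_curve a b (r *\<^sub>R d) = r *\<^sub>R T_curve a b d" for r d
      by (rule bcontfun_eqI) (simp add: T_scale3)
    then show "primitive_curve (T_curve a b (r *\<^sub>R d)) = r *\<^sub>R primitive_curve (T_curve a b d)" for r d
      by (simp add: primitive_curve_scaleR)
    show "norm (primitive_curve (T_curve a b d)) \<le> norm d * (K * norm a * norm b)" for d
      using primitive_curve_norm[of "T_curve a b d"] T_curve_norm[of a b d] by (simp add: mult.commute mult.left_commute)
  qed
  then show ?thesis by (simp add: N_def bounded_linear_Blinfun_apply)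
qed

lemma N_apply: "blinfun_apply (N a b) d t = integral {0..unit_clamp t} (\<lambda>s. T (a s) (b s) (d s))"
proof -
  have "apply_bcontfun (T_curve a b d) = (\<lambda>s. T (a s) (b s) (d s))" by auto
  then show ?thesis by (simp add: N_eq)
qed

lemma N_norm: "norm (blinfun_apply (N a b) d) \<le> K * norm a * norm b * norm d"
  unfolding N_eq by (rule order_trans[OF primitive_curve_norm T_curve_norm])

lemma N_norm_apply:
  "norm (blinfun_apply (N a b) d t) \<le> K * norm a * norm b * integral {0..unit_clamp t} (\<lambda>s. norm (d s))"
proof -
  have "norm (blinfun_apply (N a b) d t) \<le> integral {0..unit_clamp t} (\<lambda>s. norm (T_curve a b d s))"
    unfolding N_eq primitive_curve_apply by (rule integral_curve_norm_le)
  also have "\<dots> \<le> integral {0..unit_clamp t} (\<lambda>s. (K * norm a * norm b) * norm (d s))"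
  proof (intro integral_le integrable_continuous_interval continuous_intros continuous_on_apply_bcontfun)
    show "norm (T_curve a b d s) \<le> (K * norm a * norm b) * norm (d s)" for s
      unfolding T_curve_apply
      using K_nonneg by (intro order_trans[OF T_bound] mult_mono norm_bounded mult_nonneg_nonneg) auto
  qed
  finally show ?thesis by simp
qed

lemma bounded_bilinear_N: "bounded_bilinear N"
proof
  show "\<exists>K. \<forall>a b. norm (N a b) \<le> norm a * norm b * K"
    by (intro exI[of _ K] allI norm_blinfun_bound)
      (use N_norm K_nonneg in \<open>auto simp: mult.commute mult.left_commute\<close>)
  have add: "T_curve (a + a') b d = T_curve a b d + T_curve a' b d" "T_curve a (b + b') d = T_curve a b d + T_curve a b' d"
    and scale: "T_curve (r *\<^sub>R a) b d = r *\<^sub>R T_curve a b d" "T_curve a (r *\<^sub>R b) d = r *\<^sub>R T_curve a b d" for a a' b b' d r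
    by (rule bcontfun_eqI; simp add: T_add1 T_add2 T_scale1 T_scale2)+
  show "N (a + a') b = N a b + N a' b" "N a (b + b') = N a b + N a b'"
    "N (r *\<^sub>R a) b = r *\<^sub>R N a b" "N a (r *\<^sub>R b) = r *\<^sub>R N a b" for a a' b b' r
    by (rule blinfun_eqI; simp add: blinfun.bilinear_simps N_eq add scale primitive_curve_add primitive_curve_scaleR)+
qed

lemma N_swap12: "N a b = N b a"
proof (rule blinfun_eqI)
  have "T_curve a b d = T_curve b a d" for d by (rule bcontfun_eqI) (simp add: T_swap12)
  then show "blinfun_apply (N a b) d = blinfun_apply (N b a) d" for d by (simp add: N_eq)
qed

lemma N_swap23: "blinfun_apply (N a b) d = blinfun_apply (N a d) b"
proof -
  have "T_curve a b d = T_curve a d b" by (rule bcontfun_eqI) (simp add: T_swap23)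
  then show ?thesis by (simp add: N_eq)
qed

lemma N_cube_diff:
  "blinfun_apply (N y y) y - blinfun_apply (N z z) z
    = blinfun_apply (N y y) (y - z) + blinfun_apply (N y z) (y - z) + blinfun_apply (N z z) (y - z)"
  by (simp add: blinfun.diff_right N_swap23[of y z y] N_swap23[of z z y] N_swap12[of z y])

lemma N_cube_lipschitz:
  assumes "norm y \<le> R" "norm z \<le> R"
  shows "norm ((blinfun_apply (N y y) y - blinfun_apply (N z z) z) t)
      \<le> 3 * K * R\<^sup>2 * integral {0..unit_clamp t} (\<lambda>s. norm ((y - z) s))"
proof -
  let ?I = "integral {0..unit_clamp t} (\<lambda>s. norm ((y - z) s))"
  have R: "R \<ge> 0" using assms norm_ge_zero order_trans by blast
  have I: "?I \<ge> 0" by (intro Henstock_Kurzweil_Integration.integral_nonneg integrable_continuous_interval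
        continuous_intros continuous_on_apply_bcontfun) auto
  have "norm ((blinfun_apply (N y y) y - blinfun_apply (N z z) z) t) \<le> K * R * R * ?I + K * R * R * ?I + K * R * R * ?I"
    unfolding N_cube_diff plus_bcontfun.rep_eq
    using assms K_nonneg R I
    by (intro norm_triangle_mono order_trans[OF N_norm_apply] mult_right_mono mult_mono) auto
  then show ?thesis by (simp add: power2_eq_square)
qed

text \<open>The scale \<open>\<tau>\<close> stands for the final time, rescaled to \<open>1\<close>. Thereby
  time becomes a parameter of the equation like the datum \<open>x\<close>, and smoothness in both
  comes out together.\<close>

definition solves :: "real \<Rightarrow> 'e \<Rightarrow> (real \<Rightarrow>\<^sub>C 'e) \<Rightarrow> bool"
  where "solves \<tau> x y \<longleftrightarrow> y = const_bcontfun x + \<tau> *\<^sub>R blinfun_apply (N y y) y"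

lemma solves_apply: "solves \<tau> x y \<Longrightarrow> y t = x + \<tau> *\<^sub>R integral {0..unit_clamp t} (\<lambda>s. T (y s) (y s) (y s))"
  unfolding solves_def
  by (drule arg_cong[where f = "\<lambda>f. apply_bcontfun f t"]) (simp add: N_apply)

text \<open>The difference of two solutions obeys a linear Volterra inequality whose inhomogeneity is the
  difference of the parameters.\<close>

lemma solves_stability:
  assumes y: "solves \<tau> x y" "norm y \<le> R" and z: "solves \<tau>' x' z" "norm z \<le> R"
  shows "norm (y - z) \<le> 2 * exp (6 * K * R\<^sup>2 * \<bar>\<tau>'\<bar> + 1) * (norm (x - x') + K * R ^ 3 * \<bar>\<tau> - \<tau>'\<bar>)"
proof -
  have R: "R \<ge> 0" using assms norm_ge_zero order_trans by blast
  have "norm (y - z) \<le> 2 * exp (2 * (\<bar>\<tau>'\<bar> * (3 * K * R\<^sup>2)) + 1) * (norm (x - x') + \<bar>\<tau> - \<tau>'\<bar> * (K * R ^ 3))"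
  proof (rule volterra_gronwall)
    fix t
    have eq: "y - z = const_bcontfun (x - x') + (\<tau> - \<tau>') *\<^sub>R blinfun_apply (N y y) y
        + \<tau>' *\<^sub>R (blinfun_apply (N y y) y - blinfun_apply (N z z) z)"
    proof -
      have a1: "const_bcontfun (x - x') = const_bcontfun x - (const_bcontfun x' :: real \<Rightarrow>\<^sub>C 'e)"
        by (rule bcontfun_eqI) simp
      have a2: "y - z = (const_bcontfun x + \<tau> *\<^sub>R blinfun_apply (N y y) y) - (const_bcontfun x' + \<tau>' *\<^sub>R blinfun_apply (N z z) z)"
        using y(1) z(1) unfolding solves_def by metis
      show ?thesis unfolding a1 by (subst a2) (simp add: scaleR_diff_left scaleR_diff_right)
    qed
    have "norm (blinfun_apply (N y y) y t) \<le> K * R ^ 3"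
    proof -
      have "norm (blinfun_apply (N y y) y t) \<le> K * norm y * norm y * norm y"
        by (rule order_trans[OF norm_bounded N_norm])
      also have "\<dots> \<le> K * R * R * R" using y K_nonneg R by (intro mult_mono) auto
      finally show ?thesis by (simp add: power3_eq_cube mult.assoc)
    qed
    then have "norm ((y - z) t) \<le> norm (x - x') + \<bar>\<tau> - \<tau>'\<bar> * (K * R ^ 3)
        + \<bar>\<tau>'\<bar> * (3 * K * R\<^sup>2 * integral {0..unit_clamp t} (\<lambda>s. norm ((y - z) s)))"
      using N_cube_lipschitz[OF y(2) z(2), of t]
      by (subst eq) (auto intro!: norm_triangle_mono mult_left_mono simp del: minus_bcontfun.rep_eq)
    then show "norm ((y - z) t) \<le> norm (x - x') + \<bar>\<tau> - \<tau>'\<bar> * (K * R ^ 3)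
        + \<bar>\<tau>'\<bar> * (3 * K * R\<^sup>2) * integral {0..unit_clamp t} (\<lambda>s. norm ((y - z) s))"
      by (simp add: mult.assoc)
  qed (use K_nonneg R in auto)
  then show ?thesis by (simp add: mult.commute mult.left_commute)
qed

lemma solves_unique: "solves \<tau> x y \<Longrightarrow> solves \<tau> x z \<Longrightarrow> y = z"
  using solves_stability[of \<tau> x y "max (norm y) (norm z)" \<tau> x z] by simp

lemma solves_has_vector_derivative:
  assumes "solves \<tau> x y" "t \<in> {0..1}"
  shows "(y has_vector_derivative \<tau> *\<^sub>R T (y t) (y t) (y t)) (at t within {0..1})"
proof -
  have "((\<lambda>t. integral {0..t} (\<lambda>s. T (y s) (y s) (y s))) has_vector_derivative T (y t) (y t) (y t)) (at t within {0..1})"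
    using assms by (intro integral_has_vector_derivative continuous_intros continuous_on_apply_bcontfun) auto
  then have der: "((\<lambda>t. x + \<tau> *\<^sub>R integral {0..t} (\<lambda>s. T (y s) (y s) (y s))) has_vector_derivative 0 + \<tau> *\<^sub>R T (y t) (y t) (y t)) (at t within {0..1})"
    by (intro has_vector_derivative_add has_vector_derivative_const
        bounded_linear.has_vector_derivative[OF bounded_linear_scaleR_right])
  have eq: "y s = x + \<tau> *\<^sub>R integral {0..s} (\<lambda>s. T (y s) (y s) (y s))" if "s \<in> {0..1}" for s
    using solves_apply[OF assms(1), of s] that by (simp add: unit_clamp_id)
  show ?thesis using has_vector_derivative_transform[OF assms(2) eq der] by (simp only: add_0)
qed

lemma solvesI:
  fixes y :: "real \<Rightarrow>\<^sub>C 'e"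
  assumes der: "\<And>t. t \<in> {0..1} \<Longrightarrow> (y has_vector_derivative \<tau> *\<^sub>R T (y t) (y t) (y t)) (at t within {0..1})"
    and "y 0 = x" and clamp: "\<And>t. y t = y (unit_clamp t)"
  shows "solves \<tau> x y"
  unfolding solves_def
proof (rule bcontfun_eqI)
  fix t
  let ?c = "unit_clamp t"
  have "((\<lambda>s. \<tau> *\<^sub>R T (y s) (y s) (y s)) has_integral (y ?c - y 0)) {0..?c}"
    using unit_clamp_range[of t]
    by (intro fundamental_theorem_of_calculus) (auto intro: has_vector_derivative_within_subset[OF der])
  from integral_unique[OF this]
  have "\<tau> *\<^sub>R integral {0..?c} (\<lambda>s. T (y s) (y s) (y s)) = y ?c - y 0" by (simp only: integral_cmul)
  then have "y ?c = (const_bcontfun x + \<tau> *\<^sub>R blinfun_apply (N y y) y) t"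
    using \<open>y 0 = x\<close> by (simp add: N_apply)
  with clamp[of t] show "y t = (const_bcontfun x + \<tau> *\<^sub>R blinfun_apply (N y y) y) t" by (rule trans)
qed

text \<open>The field is cut off radially and thus becomes globally Lipschitz, so that the truncated
  equation has a solution on all of \<open>[0, 1]\<close>. The truncated field is still orthogonal
  to the position. Hence the solution keeps the norm of its datum, never leaves the ball, and
  solves the original equation.\<close>

lemma solves_ex: "\<exists>y. solves \<tau> x y \<and> norm y \<le> norm x"
proof -
  \<comment> \<open>The summand 1 only serves to make the radius positive for \<open>x = 0\<close>.\<close>
  define R where "R = norm x + 1"
  have R: "R > 0" "norm x \<le> R" by (auto simp: R_def add_nonneg_pos)
  define r where "r z = (R / max R (norm z)) *\<^sub>R z" for z :: 'e
  have r_norm: "norm (r z) \<le> R" for z unfolding r_def by (rule norm_radial_retraction_le[OF R(1)])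
  have r_lip: "norm (r z - r z') \<le> 2 * norm (z - z')" for z z'
    unfolding r_def by (rule radial_retraction_lipschitz[OF R(1)])
  have r_cont: "continuous_on UNIV r"
    unfolding r_def using R by (intro continuous_intros) (auto simp: max_def)
  define F where "F z = T (r z) (r z) (r z)" for z
  have F_lip: "norm (F z - F z') \<le> 6 * K * R\<^sup>2 * norm (z - z')" for z z'
  proof -
    have "norm (F z - F z') \<le> 3 * K * R\<^sup>2 * norm (r z - r z')"
      unfolding F_def by (rule T_cube_lipschitz[OF r_norm r_norm])
    also have "\<dots> \<le> 3 * K * R\<^sup>2 * (2 * norm (z - z'))" using K_nonneg by (intro mult_left_mono r_lip) auto
    finally show ?thesis by simp
  qed
  have F_cont: "continuous_on UNIV (\<lambda>s. F (y s))" for y :: "real \<Rightarrow>\<^sub>C 'e"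
  proof -
    have "continuous_on UNIV (r \<circ> y)"
      by (intro continuous_on_compose continuous_on_apply_bcontfun) (rule continuous_on_subset[OF r_cont], auto)
    then show ?thesis unfolding F_def o_def by (intro continuous_intros)
  qed
  define Fc where "Fc y = Bcontfun (\<lambda>s. F (y s))" for y :: "real \<Rightarrow>\<^sub>C 'e"
  have Fc: "Fc y s = F (y s)" for y s
  proof -
    have "norm (F z) \<le> K * R * R * R" for z
      unfolding F_def using K_nonneg R r_norm[of z] by (intro order_trans[OF T_bound] mult_mono) auto
    then have "(\<lambda>s. F (y s)) \<in> bcontfun" by (intro bcontfun_normI F_cont)
    then show ?thesis by (simp add: Fc_def Bcontfun_inverse)
  qed
  have "\<exists>y. const_bcontfun x + \<tau> *\<^sub>R primitive_curve (Fc y) = y"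
  proof (rule volterra_fixed_point[of "\<bar>\<tau>\<bar> * (6 * K * R\<^sup>2)"])
    fix y y' :: "real \<Rightarrow>\<^sub>C 'e" and t
    have "(const_bcontfun x + \<tau> *\<^sub>R primitive_curve (Fc y)) t - (const_bcontfun x + \<tau> *\<^sub>R primitive_curve (Fc y')) t
        = \<tau> *\<^sub>R (primitive_curve (Fc y - Fc y') t)"
      by (simp add: scaleR_diff_right[symmetric] Henstock_Kurzweil_Integration.integral_diff integrable_continuous_interval)
    also have "norm \<dots> \<le> \<bar>\<tau>\<bar> * integral {0..unit_clamp t} (\<lambda>s. norm ((Fc y - Fc y') s))"
      unfolding norm_scaleR primitive_curve_apply by (intro mult_left_mono integral_curve_norm_le) auto
    also have "integral {0..unit_clamp t} (\<lambda>s. norm ((Fc y - Fc y') s)) \<le> integral {0..unit_clamp t} (\<lambda>s. 6 * K * R\<^sup>2 * norm (y s - y' s))"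
    proof (intro integral_le integrable_continuous_interval continuous_intros continuous_on_apply_bcontfun)
      show "norm ((Fc y - Fc y') s) \<le> 6 * K * R\<^sup>2 * norm (y s - y' s)" for s by (simp add: Fc F_lip)
    qed
    finally show "norm ((const_bcontfun x + \<tau> *\<^sub>R primitive_curve (Fc y)) t - (const_bcontfun x + \<tau> *\<^sub>R primitive_curve (Fc y')) t)
        \<le> \<bar>\<tau>\<bar> * (6 * K * R\<^sup>2) * integral {0..unit_clamp t} (\<lambda>s. norm (y s - y' s))"
      by (simp add: mult_left_mono mult.assoc)
  qed (use K_nonneg in auto)
  then obtain y where y: "y = const_bcontfun x + \<tau> *\<^sub>R primitive_curve (Fc y)" by metis
  have Fcy: "apply_bcontfun (Fc y) = (\<lambda>s. F (y s))" using Fc by auto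
  have y_apply: "y t = x + \<tau> *\<^sub>R integral {0..unit_clamp t} (\<lambda>s. F (y s))" for t
    by (subst y) (simp add: Fcy)
  have der: "(y has_vector_derivative \<tau> *\<^sub>R F (y t)) (at t within {0..1})" if "t \<in> {0..1}" for t
  proof -
    have "((\<lambda>t. integral {0..t} (\<lambda>s. F (y s))) has_vector_derivative F (y t)) (at t within {0..1})"
      using that by (intro integral_has_vector_derivative continuous_on_subset[OF F_cont]) auto
    then have der: "((\<lambda>t. x + \<tau> *\<^sub>R integral {0..t} (\<lambda>s. F (y s))) has_vector_derivative 0 + \<tau> *\<^sub>R F (y t)) (at t within {0..1})"
      by (intro has_vector_derivative_add has_vector_derivative_const
          bounded_linear.has_vector_derivative[OF bounded_linear_scaleR_right])
    have eq: "y s = x + \<tau> *\<^sub>R integral {0..s} (\<lambda>s. F (y s))" if "s \<in> {0..1}" for s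
      using y_apply[of s] that by (simp add: unit_clamp_id)
    show ?thesis using has_vector_derivative_transform[OF that eq der] by (simp only: add_0)
  qed
  have orth: "inner (y t) (F (y t)) = 0" for t
    by (simp add: F_def r_def T_scale1 T_scale2 T_scale3 T_orth)
  have "inner (y t) (y t) = inner x x" if "t \<in> {0..1}" for t
  proof -
    have "((\<lambda>t. inner (y t) (y t)) has_vector_derivative 0) (at t within {0..1})" if "t \<in> {0..1}" for t
      using bounded_bilinear.has_vector_derivative[OF bounded_bilinear_inner der[OF that] der[OF that]] orth[of t]
      by (simp add: inner_commute[of "F (y t)"])
    then obtain c where c: "\<And>t. t \<in> {0..1} \<Longrightarrow> inner (y t) (y t) = c"
      using has_vector_derivative_zero_constant[of "{0..1}" "\<lambda>t. inner (y t) (y t)"] by auto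
    have "y 0 = x" using y_apply[of 0] by (simp add: unit_clamp_def)
    then show ?thesis using c[of 0] c[OF that] by simp
  qed
  then have ny: "norm (y t) = norm x" if "t \<in> {0..1}" for t using that by (simp add: norm_eq_sqrt_inner)
  have y_clamp: "y t = y (unit_clamp t)" for t
    using unit_clamp_range[of t] by (subst (1 2) y_apply) (simp add: unit_clamp_id)
  have ny': "norm (y t) = norm x" for t
    using ny[of "unit_clamp t"] y_clamp[of t] unit_clamp_range[of t] by simp
  then have "r (y t) = y t" for t using R by (simp add: r_def max_def)
  then have FT: "F (y t) = T (y t) (y t) (y t)" for t by (simp add: F_def)
  have "solves \<tau> x y"
  proof (rule solvesI)
    show "y 0 = x" using y_apply[of 0] by (simp add: unit_clamp_def)
  qed (use der y_clamp in \<open>auto simp: FT\<close>)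
  moreover have "norm y \<le> norm x" by (rule norm_bound) (simp add: ny')
  ultimately show ?thesis by blast
qed

definition trajectory :: "real \<times> 'e \<Rightarrow> (real \<Rightarrow>\<^sub>C 'e)"
  where "trajectory p = (SOME y. solves (fst p) (snd p) y \<and> norm y \<le> norm (snd p))"

lemma trajectory: "solves (fst p) (snd p) (trajectory p)" and norm_trajectory: "norm (trajectory p) \<le> norm (snd p)"
  using someI_ex[OF solves_ex[of "fst p" "snd p"]] unfolding trajectory_def by auto

lemma trajectory_eqI: "solves \<tau> x y \<Longrightarrow> trajectory (\<tau>, x) = y"
  using solves_unique trajectory[of "(\<tau>, x)"] by simp

text \<open>The derivative with respect to \<open>y\<close> of the right-hand side \<open>x + \<tau> N y y
  y\<close> at the solution; the factor 3 comes from the symmetry of \<open>N\<close>.\<close>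

definition linearised :: "real \<times> 'e \<Rightarrow> (real \<Rightarrow>\<^sub>C 'e) \<Rightarrow>\<^sub>L (real \<Rightarrow>\<^sub>C 'e)"
  where "linearised p = (3 * fst p) *\<^sub>R N (trajectory p) (trajectory p)"

text \<open>An explicit bound, continuous in the parameters: continuity of the resolvent is deduced from the
  resolvent identity together with local boundedness.\<close>

definition resolvent_bound :: "real \<times> 'e \<Rightarrow> real"
  where "resolvent_bound p = 2 * exp (6 * K * (norm p)\<^sup>2 * norm p + 1)"

lemma resolvent_ex:
  "\<exists>A :: (real \<Rightarrow>\<^sub>C 'e) \<Rightarrow>\<^sub>L (real \<Rightarrow>\<^sub>C 'e).
    (\<forall>g. blinfun_apply A g = g + linearised p (blinfun_apply A g)) \<and>
    (\<forall>g. blinfun_apply A (g - linearised p g) = g) \<and> norm A \<le> resolvent_bound p"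
proof -
  let ?n = "norm p"
  have "\<exists>A :: (real \<Rightarrow>\<^sub>C 'e) \<Rightarrow>\<^sub>L (real \<Rightarrow>\<^sub>C 'e).
    (\<forall>g. blinfun_apply A g = g + linearised p (blinfun_apply A g)) \<and>
    (\<forall>g. blinfun_apply A (g - linearised p g) = g) \<and> norm A \<le> 2 * exp (2 * (3 * ?n * (K * ?n * ?n)) + 1)"
  proof (rule volterra_resolvent)
    fix d :: "real \<Rightarrow>\<^sub>C 'e" and t
    let ?I = "integral {0..unit_clamp t} (\<lambda>s. norm (d s))" and ?y = "trajectory p"
    have I: "?I \<ge> 0" by (intro Henstock_Kurzweil_Integration.integral_nonneg integrable_continuous_interval
        continuous_intros continuous_on_apply_bcontfun) auto
    have y: "norm ?y \<le> ?n" using norm_trajectory[of p] norm_snd_le[of "snd p" "fst p"] by simp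
    have "norm (linearised p d t) = 3 * \<bar>fst p\<bar> * norm (blinfun_apply (N ?y ?y) d t)"
      by (simp add: linearised_def blinfun.scaleR_left abs_mult)
    also have "\<dots> \<le> 3 * ?n * (K * ?n * ?n * ?I)"
      using y norm_fst_le[of "fst p" "snd p"] I K_nonneg
      by (intro mult_mono order_trans[OF N_norm_apply] mult_right_mono mult_nonneg_nonneg) auto
    finally show "norm (linearised p d t) \<le> 3 * ?n * (K * ?n * ?n) * ?I" by (simp add: mult.assoc)
  qed (use K_nonneg in auto)
  then show ?thesis unfolding resolvent_bound_def by (simp add: power2_eq_square mult.assoc mult.left_commute)
qed

definition resolvent :: "real \<times> 'e \<Rightarrow> (real \<Rightarrow>\<^sub>C 'e) \<Rightarrow>\<^sub>L (real \<Rightarrow>\<^sub>C 'e)"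
  where "resolvent p = (SOME A. (\<forall>g. blinfun_apply A g = g + linearised p (blinfun_apply A g)) \<and>
    (\<forall>g. blinfun_apply A (g - linearised p g) = g) \<and> norm A \<le> resolvent_bound p)"

lemma resolvent_right: "blinfun_apply (resolvent p) g = g + linearised p (blinfun_apply (resolvent p) g)"
  and resolvent_left: "blinfun_apply (resolvent p) (g - linearised p g) = g"
  and resolvent_norm: "norm (resolvent p) \<le> resolvent_bound p"
  using someI_ex[OF resolvent_ex[of p]] unfolding resolvent_def[symmetric] by blast+

lemma trajectory_local_lipschitz:
  "\<exists>C\<ge>0. \<forall>h. norm h < 1 \<longrightarrow> norm (trajectory (p + h) - trajectory p) \<le> C * norm h"
proof -
  define R where "R = norm p + 1"
  have R: "R \<ge> 0" by (simp add: R_def)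
  define C where "C = 2 * exp (6 * K * R\<^sup>2 * \<bar>fst p\<bar> + 1) * (1 + K * R ^ 3)"
  have "C \<ge> 0" using K_nonneg R by (simp add: C_def)
  moreover have "norm (trajectory (p + h) - trajectory p) \<le> C * norm h" if h: "norm h < 1" for h
  proof -
    have "norm (p + h) \<le> R" using norm_triangle_ineq[of p h] h by (simp add: R_def)
    then have y: "norm (trajectory (p + h)) \<le> R"
      using norm_trajectory[of "p + h"] norm_snd_le[of "snd (p + h)" "fst (p + h)"]
      unfolding prod.collapse by linarith
    have z: "norm (trajectory p) \<le> R"
      using norm_trajectory[of p] norm_snd_le[of "snd p" "fst p"] by (simp add: R_def)
    have "norm (trajectory (p + h) - trajectory p) \<le> 2 * exp (6 * K * R\<^sup>2 * \<bar>fst p\<bar> + 1) *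
       (norm (snd h) + K * R ^ 3 * \<bar>fst h\<bar>)"
      using solves_stability[OF trajectory y trajectory z] by simp
    also have "\<dots> \<le> 2 * exp (6 * K * R\<^sup>2 * \<bar>fst p\<bar> + 1) * (norm h + K * R ^ 3 * norm h)"
      using K_nonneg R norm_fst_le[of "fst h" "snd h"] norm_snd_le[of "snd h" "fst h"]
      by (intro mult_left_mono add_mono) auto
    also have "\<dots> = C * norm h" by (simp add: C_def algebra_simps)
    finally show ?thesis .
  qed
  ultimately show ?thesis by blast
qed

text \<open>What formal differentiation of \<open>y = x + \<tau> N y y y\<close> in the direction
  \<open>h\<close> gives after solving for the derivative of \<open>y\<close>. It is a polynomial
  expression in the trajectory and the resolvent.\<close>

definition trajectory_deriv :: "real \<times> 'e \<Rightarrow> real \<times> 'e \<Rightarrow> (real \<Rightarrow>\<^sub>C 'e)"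
  where "trajectory_deriv p h = blinfun_apply (resolvent p)
    (const_bcontfun (snd h) + fst h *\<^sub>R blinfun_apply (N (trajectory p) (trajectory p)) (trajectory p))"

lemma bounded_linear_const_bcontfun:
  "bounded_linear (const_bcontfun :: 'b::real_normed_vector \<Rightarrow> (real \<Rightarrow>\<^sub>C 'b))"
proof (rule bounded_linear_intro)
  show "norm (const_bcontfun x :: real \<Rightarrow>\<^sub>C 'b) \<le> norm x * 1" for x :: 'b
    by (rule norm_bound) simp
qed (rule bcontfun_eqI; simp)+

lemma bounded_linear_trajectory_deriv: "bounded_linear (trajectory_deriv p)"
  unfolding trajectory_deriv_def
  by (intro bounded_linear_compose[OF blinfun.bounded_linear_right] bounded_linear_add
      bounded_linear_compose[OF bounded_linear_const_bcontfun] bounded_linear_snd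
      bounded_linear_compose[OF bounded_linear_scaleR_left] bounded_linear_fst)

lemma N_cube_expand:
  "blinfun_apply (N (y + d) (y + d)) (y + d) = blinfun_apply (N y y) y + 3 *\<^sub>R blinfun_apply (N y y) d
    + (3 *\<^sub>R blinfun_apply (N y d) d + blinfun_apply (N d d) d)"
proof -
  have "blinfun_apply (N d y) y = blinfun_apply (N y y) d" "blinfun_apply (N y d) y = blinfun_apply (N y y) d"
    "blinfun_apply (N d y) d = blinfun_apply (N y d) d" "blinfun_apply (N d d) y = blinfun_apply (N y d) d"
    using N_swap12[of d y] N_swap23[of y d y] N_swap23[of d d y] by simp_all
  moreover have "3 *\<^sub>R v = v + v + v" for v :: "real \<Rightarrow>\<^sub>C 'e"
    using scaleR_add_left[of 2 1 v] by (simp add: scaleR_2)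
  ultimately show ?thesis
    by (simp add: bounded_bilinear.add_left[OF bounded_bilinear_N] bounded_bilinear.add_right[OF bounded_bilinear_N]
        blinfun.add_left blinfun.add_right)
qed

text \<open>Subtraction of the equations at \<open>p + h\<close> and \<open>p\<close> shows that the
  increment \<open>\<delta>\<close> satisfies \<open>\<delta> - linearised p \<delta> = l +
  \<rho>\<close>, where \<open>l\<close> is linear in \<open>h\<close>. The remainder
  \<open>\<rho>\<close> is quadratic in \<open>h\<close>, because \<open>\<delta>\<close> is of
  order \<open>h\<close> by stability. Applying the resolvent concludes.\<close>

lemma trajectory_has_derivative: "(trajectory has_derivative trajectory_deriv p) (at p)"
proof -
  obtain C where C: "C \<ge> 0" "\<And>h. norm h < 1 \<Longrightarrow> norm (trajectory (p + h) - trajectory p) \<le> C * norm h"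
    using trajectory_local_lipschitz by blast
  define R where "R = norm p"
  define y where "y = trajectory p"
  have y: "norm y \<le> R" using norm_trajectory[of p] norm_snd_le[of "snd p" "fst p"] by (simp add: y_def R_def)
  have R: "R \<ge> 0" by (simp add: R_def)
  define Q where "Q d = 3 *\<^sub>R blinfun_apply (N y d) d + blinfun_apply (N d d) d" for d
  define B where "B = (3 * K * R + K * C) * C\<^sup>2"
  have B: "B \<ge> 0" using K_nonneg R C by (simp add: B_def)
  define D where "D = resolvent_bound p * (3 * K * R\<^sup>2 * C + B + R * B)"
  have A0: "resolvent_bound p \<ge> 0" by (simp add: resolvent_bound_def)
  show ?thesis
  proof (rule has_derivative_if_quadratic_remainder[OF bounded_linear_trajectory_deriv zero_less_one])
    fix h :: "real \<times> 'e" assume h: "norm h < 1"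
    define \<delta> where "\<delta> = trajectory (p + h) - y"
    have \<delta>: "norm \<delta> \<le> C * norm h" using C(2)[OF h] by (simp add: \<delta>_def y_def)
    have \<delta>': "norm \<delta> \<le> C" using \<delta> h C(1) mult_left_mono[of "norm h" 1 C] by simp
    define \<rho> where "\<rho> = fst h *\<^sub>R (3 *\<^sub>R blinfun_apply (N y y) \<delta> + Q \<delta>) + fst p *\<^sub>R Q \<delta>"
    have "y + \<delta> = const_bcontfun (snd p + snd h) + (fst p + fst h) *\<^sub>R blinfun_apply (N (y + \<delta>) (y + \<delta>)) (y + \<delta>)"
      using trajectory[of "p + h"] unfolding solves_def by (simp add: \<delta>_def)
    moreover have "y = const_bcontfun (snd p) + fst p *\<^sub>R blinfun_apply (N y y) y"
      using trajectory[of p] unfolding solves_def y_def .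
    moreover have "const_bcontfun (snd p + snd h) = const_bcontfun (snd p) + (const_bcontfun (snd h) :: real \<Rightarrow>\<^sub>C 'e)"
      by (rule bcontfun_eqI) simp
    ultimately have "\<delta> = (const_bcontfun (snd p) + const_bcontfun (snd h) + (fst p + fst h) *\<^sub>R
        (blinfun_apply (N y y) y + 3 *\<^sub>R blinfun_apply (N y y) \<delta> + Q \<delta>))
        - (const_bcontfun (snd p) + fst p *\<^sub>R blinfun_apply (N y y) y)"
      unfolding N_cube_expand Q_def by (metis add_diff_cancel_left')
    then have "\<delta> - linearised p \<delta> = (const_bcontfun (snd h) + fst h *\<^sub>R blinfun_apply (N y y) y) + \<rho>"
      by (simp add: linearised_def y_def[symmetric] \<rho>_def blinfun.scaleR_left algebra_simps)
    then have "\<delta> = blinfun_apply (resolvent p) ((const_bcontfun (snd h) + fst h *\<^sub>R blinfun_apply (N y y) y) + \<rho>)"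
      using resolvent_left[of p \<delta>] by simp
    then have "trajectory (p + h) - trajectory p - trajectory_deriv p h = blinfun_apply (resolvent p) \<rho>"
      by (simp add: trajectory_deriv_def \<delta>_def y_def blinfun.add_right)
    also have "norm \<dots> \<le> resolvent_bound p * norm \<rho>"
      by (rule order_trans[OF norm_blinfun]) (intro mult_right_mono resolvent_norm, simp)
    also have "norm \<rho> \<le> (3 * K * R\<^sup>2 * C + B + R * B) * (norm h)\<^sup>2"
    proof -
      have Q: "norm (Q \<delta>) \<le> B * (norm h)\<^sup>2"
      proof -
        have "norm (Q \<delta>) \<le> 3 * (K * R * norm \<delta> * norm \<delta>) + K * C * norm \<delta> * norm \<delta>"
          unfolding Q_def norm_scaleR
          using y \<delta>' K_nonneg R C
          by (intro norm_triangle_mono) (auto intro!: order_trans[OF N_norm] mult_right_mono mult_left_mono)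
        also have "\<dots> = (3 * K * R + K * C) * (norm \<delta> * norm \<delta>)" by (simp add: algebra_simps)
        also have "\<dots> \<le> (3 * K * R + K * C) * ((C * norm h) * (C * norm h))"
          using \<delta> K_nonneg R C by (intro mult_left_mono mult_mono) auto
        finally show ?thesis by (simp add: B_def power2_eq_square algebra_simps)
      qed
      have Nyy: "norm (3 *\<^sub>R blinfun_apply (N y y) \<delta>) \<le> 3 * K * R\<^sup>2 * C * norm h"
      proof -
        have "norm (blinfun_apply (N y y) \<delta>) \<le> K * norm y * norm y * norm \<delta>" by (rule N_norm)
        also have "\<dots> \<le> K * R * R * (C * norm h)"
          using y \<delta> K_nonneg R C by (intro mult_mono) auto
        finally show ?thesis by (simp add: power2_eq_square algebra_simps)
      qed
      have fh: "\<bar>fst h\<bar> \<le> norm h" using norm_fst_le[of "fst h" "snd h"] by simp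
      have fp: "\<bar>fst p\<bar> \<le> R" using norm_fst_le[of "fst p" "snd p"] by (simp add: R_def)
      have h2: "(norm h)\<^sup>2 \<le> norm h" using h by (simp add: power2_eq_square mult_left_le_one_le)
      have QB: "norm (Q \<delta>) \<le> B * norm h" using Q h2 mult_left_mono[OF h2 B] by simp
      have "norm \<rho> \<le> norm h * (3 * K * R\<^sup>2 * C * norm h + B * norm h) + R * (B * (norm h)\<^sup>2)"
        unfolding \<rho>_def
        by (intro norm_triangle_mono)
          (auto simp del: scaleR_add_right simp: norm_scaleR intro!: mult_mono norm_triangle_mono Nyy[simplified] QB Q fh fp R)
      also have "\<dots> = (3 * K * R\<^sup>2 * C + B + R * B) * (norm h)\<^sup>2" by (simp add: power2_eq_square algebra_simps)
      finally show ?thesis .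
    qed
    finally show "norm (trajectory (p + h) - trajectory p - trajectory_deriv p h) \<le> D * (norm h)\<^sup>2"
      using A0 by (simp add: D_def mult_left_mono mult.assoc)
  qed
qed

definition linearised_deriv :: "real \<times> 'e \<Rightarrow> real \<times> 'e \<Rightarrow> (real \<Rightarrow>\<^sub>C 'e) \<Rightarrow>\<^sub>L (real \<Rightarrow>\<^sub>C 'e)"
  where "linearised_deriv p h = (3 * fst h) *\<^sub>R N (trajectory p) (trajectory p)
      + (6 * fst p) *\<^sub>R N (trajectory_deriv p h) (trajectory p)"

lemma linearised_has_derivative: "(linearised has_derivative linearised_deriv p) (at p)"
proof -
  have 1: "((\<lambda>q. N (trajectory q) (trajectory q)) has_derivative
      (\<lambda>h. N (trajectory p) (trajectory_deriv p h) + N (trajectory_deriv p h) (trajectory p))) (at p)"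
    by (rule bounded_bilinear.FDERIV[OF bounded_bilinear_N trajectory_has_derivative trajectory_has_derivative])
  have 2: "((\<lambda>q. 3 * fst q) has_derivative (\<lambda>h. 3 * fst h)) (at p)"
    by (intro derivative_intros)
  have "((\<lambda>q. (3 * fst q) *\<^sub>R N (trajectory q) (trajectory q)) has_derivative
      (\<lambda>h. (3 * fst p) *\<^sub>R (N (trajectory p) (trajectory_deriv p h) + N (trajectory_deriv p h) (trajectory p))
         + (3 * fst h) *\<^sub>R N (trajectory p) (trajectory p))) (at p)"
    by (rule bounded_bilinear.FDERIV[OF bounded_bilinear_scaleR 2 1])
  moreover have "(3 * fst p) *\<^sub>R (N (trajectory p) (trajectory_deriv p h) + N (trajectory_deriv p h) (trajectory p))
         + (3 * fst h) *\<^sub>R N (trajectory p) (trajectory p) = linearised_deriv p h" for h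
    unfolding N_swap12[of "trajectory p" "trajectory_deriv p h"] linearised_deriv_def
    by (simp add: scaleR_add_left[symmetric] scaleR_2[symmetric])
  ultimately show ?thesis unfolding linearised_def[abs_def] by simp
qed

text \<open>The second resolvent identity.\<close>

lemma resolvent_diff:
  "resolvent q - resolvent p = (resolvent q o\<^sub>L (linearised q - linearised p)) o\<^sub>L resolvent p"
proof (rule blinfun_eqI)
  fix g
  define w where "w = blinfun_apply (resolvent p) g"
  have "g = w - linearised p w" using resolvent_right[of p g] unfolding w_def[symmetric] by (simp add: eq_diff_eq)
  then have "linearised q w - linearised p w = g - (w - linearised q w)" by simp
  then have "blinfun_apply (resolvent q) (linearised q w - linearised p w) = blinfun_apply (resolvent q) g - w"
    by (simp only: blinfun.diff_right[of _ g] resolvent_left)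
  then show "blinfun_apply (resolvent q - resolvent p) g
      = blinfun_apply ((resolvent q o\<^sub>L (linearised q - linearised p)) o\<^sub>L resolvent p) g"
    by (simp add: blinfun.diff_left w_def)
qed

lemma isCont_resolvent: "isCont resolvent p"
proof -
  have 1: "((\<lambda>q. resolvent_bound q * norm (linearised q - linearised p) * norm (resolvent p)) \<longlongrightarrow>
      resolvent_bound p * norm (linearised p - linearised p) * norm (resolvent p)) (at p)"
    unfolding resolvent_bound_def
    using has_derivative_continuous[OF linearised_has_derivative[of p]] unfolding isCont_def
    by (intro tendsto_intros)
  have "((\<lambda>q. resolvent q - resolvent p) \<longlongrightarrow> 0) (at p)"
  proof (rule Lim_null_comparison)
    show "\<forall>\<^sub>F q in at p. norm (resolvent q - resolvent p) \<le> resolvent_bound q * norm (linearised q - linearised p) * norm (resolvent p)"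
    proof (intro always_eventually allI)
      fix q
      have "norm (resolvent q - resolvent p) \<le> norm (resolvent q o\<^sub>L (linearised q - linearised p)) * norm (resolvent p)"
        unfolding resolvent_diff by (rule norm_blinfun_compose)
      also have "\<dots> \<le> norm (resolvent q) * norm (linearised q - linearised p) * norm (resolvent p)"
        by (intro mult_right_mono norm_blinfun_compose) auto
      also have "\<dots> \<le> resolvent_bound q * norm (linearised q - linearised p) * norm (resolvent p)"
        by (intro mult_right_mono resolvent_norm) auto
      finally show "norm (resolvent q - resolvent p) \<le> resolvent_bound q * norm (linearised q - linearised p) * norm (resolvent p)" .
    qed
  qed (use 1 in simp)
  then show ?thesis unfolding isCont_def by (rule LIM_zero_cancel)
qed

lemma resolvent_has_derivative:
  "(resolvent has_derivative (\<lambda>h. (resolvent p o\<^sub>L linearised_deriv p h) o\<^sub>L resolvent p)) (at p)"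
proof -
  have "((\<lambda>q. linearised q - linearised p) has_derivative (\<lambda>h. linearised_deriv p h - 0)) (at p)"
    by (intro has_derivative_diff linearised_has_derivative has_derivative_const)
  then have 1: "((\<lambda>q. linearised q - linearised p) has_derivative linearised_deriv p) (at p)" by simp
  have "((\<lambda>q. (resolvent q o\<^sub>L (linearised q - linearised p)) o\<^sub>L resolvent p) has_derivative
      (\<lambda>h. (resolvent p o\<^sub>L linearised_deriv p h) o\<^sub>L resolvent p)) (at p)"
    by (intro bounded_linear.has_derivative[OF bounded_bilinear.bounded_linear_left[OF bounded_bilinear_blinfun_compose]]
        has_derivative_bilinear_vanishing[OF bounded_bilinear_blinfun_compose isCont_resolvent 1]) simp
  then have "((\<lambda>q. resolvent p + (resolvent q - resolvent p)) has_derivative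
      (\<lambda>h. 0 + ((resolvent p o\<^sub>L linearised_deriv p h) o\<^sub>L resolvent p))) (at p)"
    unfolding resolvent_diff[symmetric] by (intro has_derivative_add has_derivative_const)
  then show ?thesis by simp
qed

text \<open>Bootstrapping. The derivatives of the trajectory and of the resolvent are multilinear
  expressions in trajectory and resolvent themselves; so if both have \<open>k\<close>
  derivatives, both have \<open>Suc k\<close>.\<close>

lemma smooth_trajectory_resolvent:
  "smooth_family k {} (\<lambda>p vs. trajectory p) \<and> smooth_family k {} (\<lambda>p vs. resolvent p)"
proof (induction k)
  case 0
  show ?case by (auto simp: multilinear_on_def)
next
  case (Suc k)
  then have Y: "smooth_family k {} (\<lambda>p vs. trajectory p)" and A: "smooth_family k {} (\<lambda>p vs. resolvent p)" by auto
  have NY: "smooth_family k {} (\<lambda>p vs. N (trajectory p) (trajectory p))"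
    using smooth_family_bilinear[OF bounded_bilinear_N Y Y] by simp
  have NYY: "smooth_family k {} (\<lambda>p vs. blinfun_apply (N (trajectory p) (trajectory p)) (trajectory p))"
    using smooth_family_bilinear[OF bounded_bilinear_blinfun_apply NY Y] by simp
  have "smooth_family k {0} (\<lambda>(p :: real \<times> 'e) vs. fst (vs 0))"
    by (rule smooth_family_slot) (rule bounded_linear_fst)
  from smooth_family_bilinear[OF bounded_bilinear_scaleR this NYY]
  have 1: "smooth_family k {0} (\<lambda>p vs. fst (vs 0) *\<^sub>R blinfun_apply (N (trajectory p) (trajectory p)) (trajectory p))"
    by simp
  have 2: "smooth_family k {0} (\<lambda>(p :: real \<times> 'e) vs. const_bcontfun (snd (vs 0)) :: real \<Rightarrow>\<^sub>C 'e)"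
    by (rule smooth_family_slot[of "\<lambda>h. const_bcontfun (snd h)"])
      (rule bounded_linear_compose[OF bounded_linear_const_bcontfun bounded_linear_snd])
  from smooth_family_bilinear[OF bounded_bilinear_blinfun_apply A smooth_family_add[OF 2 1]]
  have DY: "smooth_family k {0} (\<lambda>p vs. trajectory_deriv p (vs 0))"
    unfolding trajectory_deriv_def by simp
  have "smooth_family k {0} (\<lambda>(p :: real \<times> 'e) vs. 3 * fst (vs 0))"
    by (rule smooth_family_slot[of "\<lambda>h. 3 * fst h"]) (intro bounded_linear_intros)
  from smooth_family_bilinear[OF bounded_bilinear_scaleR this NY]
  have 3: "smooth_family k {0} (\<lambda>p vs. (3 * fst (vs 0)) *\<^sub>R N (trajectory p) (trajectory p))" by simp
  have 4: "smooth_family k {} (\<lambda>(p :: real \<times> 'e) vs. 6 * fst p)"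
    by (rule smooth_family_linear[of "\<lambda>h. 6 * fst h"]) (intro bounded_linear_intros)
  have 5: "smooth_family k {0} (\<lambda>p vs. N (trajectory_deriv p (vs 0)) (trajectory p))"
    using smooth_family_bilinear[OF bounded_bilinear_N DY Y] by simp
  have 6: "smooth_family k {0} (\<lambda>p vs. (6 * fst p) *\<^sub>R N (trajectory_deriv p (vs 0)) (trajectory p))"
    using smooth_family_bilinear[OF bounded_bilinear_scaleR 4 5] by simp
  have 7: "smooth_family k {0} (\<lambda>p vs. linearised_deriv p (vs 0))"
    using smooth_family_add[OF 3 6] unfolding linearised_deriv_def .
  have 8: "smooth_family k {0} (\<lambda>p vs. resolvent p o\<^sub>L linearised_deriv p (vs 0))"
    using smooth_family_bilinear[OF bounded_bilinear_blinfun_compose A 7] by simp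
  have DA: "smooth_family k {0} (\<lambda>p vs. (resolvent p o\<^sub>L linearised_deriv p (vs 0)) o\<^sub>L resolvent p)"
    using smooth_family_bilinear[OF bounded_bilinear_blinfun_compose 8 A] by simp
  show ?case
    using smooth_family_Suc_nullary[OF trajectory_has_derivative DY]
      smooth_family_Suc_nullary[OF resolvent_has_derivative DA] by blast
qed

definition flow :: "real \<times> 'e \<Rightarrow> 'e" where "flow p = trajectory p 1"

lemma C_infinity_flow: "C_infinity flow"
proof (rule C_infinity_if_smooth_family)
  fix k
  have "bounded_linear (\<lambda>y :: real \<Rightarrow>\<^sub>C 'e. y 1)"
    by (rule bounded_linear_intro[of _ 1]) (auto simp: norm_bounded)
  note app = bounded_linear_Blinfun_apply[OF this]
  have Y: "smooth_family k {} (\<lambda>p vs. trajectory p)" using smooth_trajectory_resolvent by blast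
  have "smooth_family k {} (\<lambda>p vs. blinfun_apply (Blinfun (\<lambda>y :: real \<Rightarrow>\<^sub>C 'e. y 1)) (trajectory p))"
    using smooth_family_bilinear[OF bounded_bilinear_blinfun_apply smooth_family_const Y] by simp
  then show "smooth_family k {} (\<lambda>p vs. flow p)" unfolding app flow_def .
qed

lemma trajectory_at_0: "trajectory p 0 = snd p"
  using solves_apply[OF trajectory[of p], of 0] by (simp add: unit_clamp_def)

text \<open>Uniqueness for the integral equation, phrased for curves that satisfy the differential equation
  on \<open>[0, 1]\<close> only.\<close>

lemma trajectory_end_eqI:
  assumes der: "\<And>s. s \<in> {0..1} \<Longrightarrow> (X has_vector_derivative \<tau> *\<^sub>R T (X s) (X s) (X s)) (at s within {0..1})"
  shows "trajectory (\<tau>, X 0) 1 = X 1"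
proof -
  have cont: "continuous_on {0..1} X"
    unfolding continuous_on_eq_continuous_within using has_vector_derivative_continuous[OF der] by blast
  have "(\<lambda>t. X (unit_clamp t)) \<in> bcontfun"
  proof -
    have "bounded (X ` {0..1})" by (intro compact_imp_bounded compact_continuous_image cont) simp
    moreover have "range (\<lambda>t. X (unit_clamp t)) \<subseteq> X ` {0..1}" using unit_clamp_range by auto
    moreover have "continuous_on UNIV (X \<circ> unit_clamp)"
      by (intro continuous_on_compose continuous_intros) (auto intro: continuous_on_subset[OF cont] simp: unit_clamp_range)
    ultimately show ?thesis unfolding bcontfun_def o_def by (auto intro: bounded_subset)
  qed
  then obtain y where y: "\<And>t. apply_bcontfun y t = X (unit_clamp t)" by (metis Bcontfun_inverse)
  have "solves \<tau> (X 0) y"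
  proof (rule solvesI)
    show "(y has_vector_derivative \<tau> *\<^sub>R T (y t) (y t) (y t)) (at t within {0..1})" if "t \<in> {0..1}" for t
    proof -
      have "y t = X t" using that by (simp add: y unit_clamp_id)
      with has_vector_derivative_transform[OF that _ der[OF that], of y] show ?thesis by (auto simp: y unit_clamp_id)
    qed
    show "y 0 = X 0" by (simp add: y unit_clamp_id)
    show "y t = y (unit_clamp t)" for t using unit_clamp_range[of t] by (simp add: y unit_clamp_id)
  qed
  then show ?thesis using trajectory_eqI y[of 1] by (simp add: unit_clamp_id)
qed

lemma flow_unique:
  assumes "\<And>t. (X has_vector_derivative T (X t) (X t) (X t)) (at t)"
  shows "X t = flow (t, X 0)"
proof -
  have "((\<lambda>s. X (t * s)) has_vector_derivative t *\<^sub>R T (X (t * s)) (X (t * s)) (X (t * s))) (at s within {0..1})" for s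
  proof -
    have "((X \<circ> (\<lambda>s. t * s)) has_vector_derivative t *\<^sub>R T (X (t * s)) (X (t * s)) (X (t * s))) (at s within {0..1})"
      by (rule vector_diff_chain_within)
        (auto intro!: derivative_eq_intros has_vector_derivative_at_within[OF assms]
          simp: has_real_derivative_iff_has_vector_derivative[symmetric])
    then show ?thesis by (simp add: o_def)
  qed
  from trajectory_end_eqI[of "\<lambda>s. X (t * s)", OF this] show ?thesis by (simp add: flow_def)
qed

text \<open>A rescaled initial piece of a trajectory is itself a trajectory.\<close>

lemma trajectory_eq_flow:
  assumes "s \<in> {0..1}" shows "trajectory (\<tau>, x) s = flow (\<tau> * s, x)"
proof -
  let ?y = "trajectory (\<tau>, x)"
  have "((\<lambda>r. ?y (s * r)) has_vector_derivative (\<tau> * s) *\<^sub>R T (?y (s * r)) (?y (s * r)) (?y (s * r))) (at r within {0..1})"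
    if "r \<in> {0..1}" for r
  proof -
    have sr: "s * r \<in> {0..1}" using assms that by (auto intro: mult_le_one)
    have "(*) s ` {0..1} \<subseteq> {0..1}" using assms by (auto intro: mult_le_one)
    then have "(?y has_vector_derivative \<tau> *\<^sub>R T (?y (s * r)) (?y (s * r)) (?y (s * r))) (at (s * r) within (*) s ` {0..1})"
      using solves_has_vector_derivative[OF trajectory[of "(\<tau>, x)"] sr] by (auto intro: has_vector_derivative_within_subset)
    then have "((?y \<circ> (\<lambda>r. s * r)) has_vector_derivative s *\<^sub>R (\<tau> *\<^sub>R T (?y (s * r)) (?y (s * r)) (?y (s * r)))) (at r within {0..1})"
      by (intro vector_diff_chain_within)
        (auto intro!: derivative_eq_intros simp: has_real_derivative_iff_has_vector_derivative[symmetric])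
    then show ?thesis by (simp add: o_def mult.commute)
  qed
  from trajectory_end_eqI[of "\<lambda>r. ?y (s * r)", OF this] show ?thesis
    by (simp add: flow_def trajectory_at_0)
qed

lemma flow_0: "flow (0, x) = x"
  using trajectory_eq_flow[of 0 0 x] trajectory_at_0[of "(0, x)"] by simp

text \<open>Differentiability in time is known from smoothness of the flow, but the value of the derivative
  is not. It is read off from a trajectory whose final time lies beyond \<open>t\<close>.\<close>

lemma flow_has_vector_derivative:
  "((\<lambda>t. flow (t, x)) has_vector_derivative T (flow (t, x)) (flow (t, x)) (flow (t, x))) (at t)"
proof -
  have "C_infinity (\<lambda>t. flow ((0, x) + (t, 0)))"
    by (rule C_infinity_affine[OF C_infinity_flow, of "\<lambda>t. (t, 0)"]) (auto intro!: linearI)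
  then have "(\<lambda>t. flow (t, x)) differentiable (at t)"
    using C_infinity_imp_differentiable by fastforce
  then obtain D where D: "((\<lambda>t. flow (t, x)) has_vector_derivative D) (at t)"
    by (auto simp: vector_derivative_works)
  \<comment> \<open>A final time on the same side of zero as \<open>t\<close> and beyond it, nonzero also for
    \<open>t = 0\<close>.\<close>
  define \<tau> where "\<tau> = (if t \<ge> 0 then t + 1 else t - 1)"
  define s where "s = t / \<tau>"
  have \<tau>: "\<tau> \<noteq> 0" "\<tau> * s = t" by (auto simp: \<tau>_def s_def)
  have s: "s \<in> {0..1}" by (auto simp: \<tau>_def s_def divide_simps)
  let ?y = "trajectory (\<tau>, x)"
  have "((\<lambda>t. flow (t, x)) has_vector_derivative D) (at (\<tau> * s) within (*) \<tau> ` {0..1})"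
    using D unfolding \<tau>(2) by (rule has_vector_derivative_at_within)
  then have "(((\<lambda>t. flow (t, x)) \<circ> (\<lambda>s. \<tau> * s)) has_vector_derivative \<tau> *\<^sub>R D) (at s within {0..1})"
    by (intro vector_diff_chain_within)
      (auto intro!: derivative_eq_intros simp: has_real_derivative_iff_has_vector_derivative[symmetric])
  from has_vector_derivative_transform[OF s _ this, of ?y]
  have "(?y has_vector_derivative \<tau> *\<^sub>R D) (at s within {0..1})" by (simp add: trajectory_eq_flow)
  moreover have "(?y has_vector_derivative \<tau> *\<^sub>R T (?y s) (?y s) (?y s)) (at s within {0..1})"
    using solves_has_vector_derivative[OF trajectory[of "(\<tau>, x)"] s] by simp
  ultimately have "\<tau> *\<^sub>R D = \<tau> *\<^sub>R T (?y s) (?y s) (?y s)"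
    using vector_derivative_unique_within_closed_interval[of 0 1 s ?y] s by (simp del: scaleR_cancel_left)
  then have "D = T (?y s) (?y s) (?y s)" using \<tau> by simp
  with D show ?thesis using trajectory_eq_flow[OF s, of \<tau> x] \<tau> by simp
qed

end

section \<open>Lebesgue measure and Gaussian integrals on the complex plane\<close>

text \<open>Real and imaginary part are independent coordinates, which opens Fubini's theorem for the plane.\<close>

lemma lborel_complex: "distr (lborel \<Otimes>\<^sub>M lborel) borel (\<lambda>(x, y). Complex x y) = lborel"
proof (rule lborel_eqI[symmetric])
  have [measurable]: "(\<lambda>(x, y). Complex x y) \<in> lborel \<Otimes>\<^sub>M lborel \<rightarrow>\<^sub>M borel"
    unfolding lborel_prod case_prod_beta
    by (simp add: borel_measurable_continuous_onI continuous_on_Complex continuous_on_fst continuous_on_snd)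
  fix l u :: complex assume lu: "\<And>b. b \<in> Basis \<Longrightarrow> l \<bullet> b \<le> u \<bullet> b"
  have le: "Re l \<le> Re u" "Im l \<le> Im u" using lu[of 1] lu[of \<i>] by (simp_all add: Basis_complex_def)
  have "(\<lambda>(x, y). Complex x y) -` box l u \<inter> space (lborel \<Otimes>\<^sub>M lborel) = {Re l<..<Re u} \<times> {Im l<..<Im u}"
    by (auto simp: box_def Basis_complex_def space_pair_measure)
  then show "emeasure (distr (lborel \<Otimes>\<^sub>M lborel) borel (\<lambda>(x, y). Complex x y)) (box l u) = (\<Prod>b\<in>Basis. (u - l) \<bullet> b)"
    using le by (simp add: emeasure_distr lborel.emeasure_pair_measure_Times Basis_complex_def ennreal_mult)
qed simp

lemma measurable_Complex [measurable]:
  assumes [measurable]: "f \<in> borel_measurable M" "g \<in> borel_measurable M"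
  shows "(\<lambda>x. Complex (f x) (g x)) \<in> borel_measurable M"
  unfolding Complex_eq by measurable

lemma nn_integral_complex:
  assumes [measurable]: "f \<in> borel_measurable borel"
  shows "(\<integral>\<^sup>+z. f z \<partial>lborel) = (\<integral>\<^sup>+y. \<integral>\<^sup>+x. f (Complex x y) \<partial>lborel \<partial>lborel)"
    and "(\<integral>\<^sup>+z. f z \<partial>lborel) = (\<integral>\<^sup>+x. \<integral>\<^sup>+y. f (Complex x y) \<partial>lborel \<partial>lborel)"
proof -
  have eq: "(\<integral>\<^sup>+z. f z \<partial>lborel) = (\<integral>\<^sup>+p. f (Complex (fst p) (snd p)) \<partial>(lborel \<Otimes>\<^sub>M lborel))"
    by (subst lborel_complex[symmetric]) (simp add: nn_integral_distr case_prod_beta)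
  then show "(\<integral>\<^sup>+z. f z \<partial>lborel) = (\<integral>\<^sup>+y. \<integral>\<^sup>+x. f (Complex x y) \<partial>lborel \<partial>lborel)"
    by (simp add: lborel_pair.nn_integral_snd[symmetric])
  show "(\<integral>\<^sup>+z. f z \<partial>lborel) = (\<integral>\<^sup>+x. \<integral>\<^sup>+y. f (Complex x y) \<partial>lborel \<partial>lborel)"
    using eq by (simp add: lborel.nn_integral_fst[symmetric])
qed

lemma distr_lborelI:
  fixes \<phi> :: "'a::euclidean_space \<Rightarrow> 'a"
  assumes [measurable]: "\<phi> \<in> borel_measurable borel"
    and "\<And>f :: 'a \<Rightarrow> ennreal. f \<in> borel_measurable borel \<Longrightarrow> (\<integral>\<^sup>+z. f (\<phi> z) \<partial>lborel) = (\<integral>\<^sup>+z. f z \<partial>lborel)"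
  shows "distr lborel lborel \<phi> = lborel"
proof (rule measure_eqI)
  fix A assume "A \<in> sets (distr lborel lborel \<phi>)"
  then have [measurable]: "A \<in> sets borel" by simp
  have "emeasure (distr lborel lborel \<phi>) A = (\<integral>\<^sup>+z. indicator A z \<partial>distr lborel lborel \<phi>)" by simp
  also have "\<dots> = (\<integral>\<^sup>+z. indicator A (\<phi> z) \<partial>lborel)" by (subst nn_integral_distr) simp_all
  also have "\<dots> = emeasure lborel A" by (subst assms(2)) simp_all
  finally show "emeasure (distr lborel lborel \<phi>) A = emeasure lborel A" .
qed simp

lemma nn_integral_real_translate:
  fixes f :: "real \<Rightarrow> ennreal"
  assumes "f \<in> borel_measurable borel"
  shows "(\<integral>\<^sup>+x. f (x + c) \<partial>lborel) = (\<integral>\<^sup>+x. f x \<partial>lborel)"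
  using nn_integral_real_affine[OF assms, of 1 c] by (simp add: add.commute)

text \<open>On each horizontal line a shear is a translation.\<close>

lemma distr_lborel_horizontal_shear: "distr lborel lborel (\<lambda>z. z + of_real (a * Im z)) = lborel"
proof (rule distr_lborelI)
  fix f :: "complex \<Rightarrow> ennreal" assume [measurable]: "f \<in> borel_measurable borel"
  have "Complex x y + of_real (a * Im (Complex x y)) = Complex (x + a * y) y" for x y by (simp add: complex_eq_iff)
  then have "(\<integral>\<^sup>+z. f (z + of_real (a * Im z)) \<partial>lborel) = (\<integral>\<^sup>+y. \<integral>\<^sup>+x. f (Complex (x + a * y) y) \<partial>lborel \<partial>lborel)"
    by (subst nn_integral_complex(1)) simp_all
  also have "\<dots> = (\<integral>\<^sup>+y. \<integral>\<^sup>+x. f (Complex x y) \<partial>lborel \<partial>lborel)"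
    by (intro nn_integral_cong nn_integral_real_translate[of "\<lambda>x. f (Complex x _)"]) measurable
  also have "\<dots> = (\<integral>\<^sup>+z. f z \<partial>lborel)" by (simp add: nn_integral_complex(1))
  finally show "(\<integral>\<^sup>+z. f (z + of_real (a * Im z)) \<partial>lborel) = (\<integral>\<^sup>+z. f z \<partial>lborel)" .
qed measurable

lemma distr_lborel_vertical_shear: "distr lborel lborel (\<lambda>z. z + \<i> * of_real (a * Re z)) = lborel"
proof (rule distr_lborelI)
  fix f :: "complex \<Rightarrow> ennreal" assume [measurable]: "f \<in> borel_measurable borel"
  have "Complex x y + \<i> * of_real (a * Re (Complex x y)) = Complex x (y + a * x)" for x y by (simp add: complex_eq_iff)
  then have "(\<integral>\<^sup>+z. f (z + \<i> * of_real (a * Re z)) \<partial>lborel) = (\<integral>\<^sup>+x. \<integral>\<^sup>+y. f (Complex x (y + a * x)) \<partial>lborel \<partial>lborel)"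
    by (subst nn_integral_complex(2)) simp_all
  also have "\<dots> = (\<integral>\<^sup>+x. \<integral>\<^sup>+y. f (Complex x y) \<partial>lborel \<partial>lborel)"
    by (intro nn_integral_cong nn_integral_real_translate[of "\<lambda>y. f (Complex _ y)"]) measurable
  also have "\<dots> = (\<integral>\<^sup>+z. f z \<partial>lborel)" by (simp add: nn_integral_complex(2))
  finally show "(\<integral>\<^sup>+z. f (z + \<i> * of_real (a * Re z)) \<partial>lborel) = (\<integral>\<^sup>+z. f z \<partial>lborel)" .
qed measurable

lemma distr_lborel_compose:
  fixes \<phi> \<psi> :: "'a::euclidean_space \<Rightarrow> 'a"
  assumes [measurable]: "\<phi> \<in> borel_measurable borel" "\<psi> \<in> borel_measurable borel"
    and "distr lborel lborel \<phi> = lborel" "distr lborel lborel \<psi> = lborel"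
  shows "distr lborel lborel (\<lambda>z. \<phi> (\<psi> z)) = lborel"
  using distr_distr[of \<phi> lborel lborel \<psi> lborel] assms by (simp add: o_def)

text \<open>A rotation that is not a half turn or the identity is a product of three shears, and shears
  preserve area by Fubini's theorem; the half turn is the square of a quarter turn.\<close>

lemma distr_lborel_rotation:
  assumes "norm c = 1"
  shows "distr lborel lborel (\<lambda>z. c * z) = (lborel :: complex measure)"
proof -
  have rot: "distr lborel lborel (\<lambda>z. c * z) = (lborel :: complex measure)" if c: "norm c = 1" "Im c \<noteq> 0" for c
  proof -
    \<comment> \<open>The outer shear factor, \<open>- tan (\<theta> / 2)\<close> for the angle
      \<open>\<theta>\<close>; the middle one is \<open>sin \<theta> = Im c\<close>.\<close>
    define a where "a = (Re c - 1) / Im c"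
    have sq: "(Re c)\<^sup>2 + (Im c)\<^sup>2 = 1" using c(1) by (simp add: cmod_def)
    have ab: "a * Im c = Re c - 1" using c(2) by (simp add: a_def)
    have aab: "a * (1 + Re c) = - Im c"
      using sq c(2) by (simp add: a_def field_simps power2_eq_square)
    let ?S = "\<lambda>z::complex. z + of_real (a * Im z)" and ?V = "\<lambda>z::complex. z + \<i> * of_real (Im c * Re z)"
    have eq: "c * z = ?S (?V (?S z))" for z
    proof (rule complex_eqI)
      have "Re (?S (?V (?S z))) = Re z + a * Im z + a * (Im z + Im c * (Re z + a * Im z))" by simp
      also have "\<dots> = Re z * (1 + a * Im c) + Im z * (a * (1 + (1 + a * Im c)))" by (simp add: algebra_simps)
      also have "\<dots> = Re (c * z)" unfolding ab using aab by (simp add: algebra_simps)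
      finally show "Re (c * z) = Re (?S (?V (?S z)))" by simp
      have "Im (?S (?V (?S z))) = Im z * (1 + a * Im c) + Im c * Re z" by (simp add: algebra_simps)
      then show "Im (c * z) = Im (?S (?V (?S z)))" unfolding ab by simp
    qed
    have m: "?S \<in> borel_measurable borel" "?V \<in> borel_measurable borel" by measurable
    have m2: "(\<lambda>z. ?V (?S z)) \<in> borel_measurable borel" by measurable
    show ?thesis unfolding eq
      by (rule distr_lborel_compose[of ?S "\<lambda>z. ?V (?S z)", OF m(1) m2 distr_lborel_horizontal_shear
            distr_lborel_compose[of ?V ?S, OF m(2) m(1) distr_lborel_vertical_shear distr_lborel_horizontal_shear]])
  qed
  show ?thesis
  proof (cases "Im c = 0")
    case True
    then have "Re c = 1 \<or> Re c = -1" using assms by (auto simp: cmod_def abs_if split: if_splits)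
    then have "c = 1 \<or> c = \<i> * \<i>" using True by (auto simp: complex_eq_iff)
    then show ?thesis
    proof
      assume "c = \<i> * \<i>"
      then show ?thesis
        using distr_lborel_compose[of "\<lambda>z. \<i> * z" "\<lambda>z. \<i> * z"] rot[of \<i>] by (simp add: mult.assoc)
    qed (simp add: distr_id2)
  qed (use rot assms in blast)
qed

lemma distr_lborel_translation: "distr lborel lborel (\<lambda>z. z + c) = (lborel :: 'a::euclidean_space measure)"
  using lborel_distr_plus[of c] by (simp add: add.commute cong: distr_cong)

lemma distr_lborel_reflection: "distr lborel lborel (\<lambda>z. c - z) = (lborel :: complex measure)"
  using distr_lborel_compose[of "\<lambda>z. z + c" "\<lambda>z. -1 * z", OF _ _ distr_lborel_translation distr_lborel_rotation]
  by simp

lemma nn_integral_reflect: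
  assumes [measurable]: "f \<in> borel_measurable borel"
  shows "(\<integral>\<^sup>+z. f (c - z) \<partial>lborel) = (\<integral>\<^sup>+z. f (z :: complex) \<partial>lborel)"
  by (subst (2) distr_lborel_reflection[of c, symmetric]) (simp add: nn_integral_distr)

lemma nn_integral_translate:
  fixes f :: "complex \<Rightarrow> ennreal"
  assumes [measurable]: "f \<in> borel_measurable borel"
  shows "(\<integral>\<^sup>+z. f (z - c) \<partial>lborel) = (\<integral>\<^sup>+z. f z \<partial>lborel)"
proof -
  have "(\<integral>\<^sup>+z. f z \<partial>lborel) = (\<integral>\<^sup>+z. f z \<partial>distr lborel lborel (\<lambda>z. z + - c))"
    by (simp only: distr_lborel_translation)
  then show ?thesis by (simp add: nn_integral_distr)
qed

lemma integral_gaussian_real: "has_bochner_integral lborel (\<lambda>x::real. exp (- x\<^sup>2)) (sqrt pi)"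
  using has_bochner_integral_even_function[OF gaussian_moment_0] by simp

lemma integral_gaussian_complex: "has_bochner_integral lborel (\<lambda>z::complex. exp (- (norm z)\<^sup>2)) pi"
proof (rule has_bochner_integral_nn_integral)
  have real: "(\<integral>\<^sup>+x. ennreal (exp (- (x::real)\<^sup>2)) \<partial>lborel) = ennreal (sqrt pi)"
    using integral_gaussian_real by (intro nn_integral_eq_integral[THEN trans])
      (auto simp: has_bochner_integral_iff)
  have "(\<integral>\<^sup>+z. ennreal (exp (- (norm (z::complex))\<^sup>2)) \<partial>lborel)
      = (\<integral>\<^sup>+y. \<integral>\<^sup>+x. ennreal (exp (- y\<^sup>2)) * ennreal (exp (- x\<^sup>2)) \<partial>lborel \<partial>lborel)"
    by (subst nn_integral_complex(1)) (simp_all add: ennreal_mult[symmetric] exp_add[symmetric] cmod_power2 add.commute)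
  also have "\<dots> = ennreal (sqrt pi) * ennreal (sqrt pi)"
    by (simp add: nn_integral_cmult nn_integral_multc real)
  also have "\<dots> = ennreal pi" by (simp add: ennreal_mult[symmetric])
  finally show "(\<integral>\<^sup>+z. ennreal (exp (- (norm (z::complex))\<^sup>2)) \<partial>lborel) = ennreal pi" .
qed auto

lemma integrable_gaussian_complex:
  assumes "c > 0" shows "integrable lborel (\<lambda>z::complex. exp (- c * (norm z)\<^sup>2))"
proof -
  define r where "r = sqrt c"
  have r: "r \<noteq> 0" "r\<^sup>2 = c" using assms by (auto simp: r_def)
  have *: "integrable lborel (\<lambda>z::complex. exp (- (norm z)\<^sup>2))"
    using integral_gaussian_complex by (simp add: has_bochner_integral_iff)
  have d: "lborel = density (distr lborel borel (\<lambda>z::complex. 0 + r *\<^sub>R z)) (\<lambda>_. ennreal (\<bar>r\<bar> ^ DIM(complex)))"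
    by (rule lborel_affine[OF r(1)])
  have "integrable (density (distr lborel borel (\<lambda>z::complex. 0 + r *\<^sub>R z)) (\<lambda>_. ennreal (\<bar>r\<bar> ^ DIM(complex)))) (\<lambda>z::complex. exp (- (norm z)\<^sup>2))"
    using * d by simp
  then have "integrable (distr lborel borel (\<lambda>z::complex. 0 + r *\<^sub>R z)) (\<lambda>z. \<bar>r\<bar> ^ DIM(complex) *\<^sub>R exp (- (norm z)\<^sup>2))"
    by (subst (asm) integrable_density) auto
  then have "integrable lborel (\<lambda>z::complex. \<bar>r\<bar> ^ DIM(complex) *\<^sub>R exp (- (norm (0 + r *\<^sub>R z))\<^sup>2))"
    by (subst (asm) integrable_distr_eq) auto
  then have "integrable lborel (\<lambda>z::complex. (\<bar>r\<bar> ^ DIM(complex)) * exp (- (norm (0 + r *\<^sub>R z))\<^sup>2))" by simp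
  then show ?thesis using r assms by (simp add: power_mult_distrib)
qed

text \<open>The power is absorbed into an exponential, and completing the square absorbs that into half of
  the Gaussian exponent.\<close>

lemma integrable_gaussian_weight:
  assumes "c > 0"
  shows "integrable lborel (\<lambda>z::complex. (1 + norm z) ^ m * exp (R * norm z) * exp (- c * (norm z)\<^sup>2))"
proof (rule Bochner_Integration.integrable_bound)
  define A where "A = fact m * exp (1 + (R + 1)\<^sup>2 / (2 * c))"
  show "integrable lborel (\<lambda>z::complex. A * exp (- (c / 2) * (norm z)\<^sup>2))"
    using integrable_gaussian_complex[of "c / 2"] assms by simp
  show "AE z in lborel. norm ((1 + norm (z::complex)) ^ m * exp (R * norm z) * exp (- c * (norm z)\<^sup>2)) \<le> norm (A * exp (- (c / 2) * (norm z)\<^sup>2))"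
  proof (rule AE_I2)
    fix z :: complex
    define r where "r = norm z"
    have "r \<ge> 0" by (simp add: r_def)
    have "(1 + r) ^ m / fact m \<le> exp (1 + r)"
    proof -
      have "(\<lambda>n. (1 + r) ^ n / fact n) sums exp (1 + r)"
        using exp_converges[of "1 + r"] by (simp add: divide_inverse mult.commute)
      then have "(\<Sum>n\<in>{m}. (1 + r) ^ n / fact n) \<le> exp (1 + r)"
        using \<open>r \<ge> 0\<close> sum_le_suminf[of "\<lambda>n. (1 + r) ^ n / fact n" "{m}"] by (auto simp: sums_iff)
      then show ?thesis by simp
    qed
    then have 1: "(1 + r) ^ m \<le> fact m * exp (1 + r)" by (simp add: field_simps)
    have 2: "1 + r + R * r - c * r\<^sup>2 \<le> 1 + (R + 1)\<^sup>2 / (2 * c) - c / 2 * r\<^sup>2"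
    proof -
      have "0 \<le> (c * r - (R + 1))\<^sup>2 / (2 * c)" using assms by simp
      also have "\<dots> = (R + 1)\<^sup>2 / (2 * c) - (R + 1) * r + c / 2 * r\<^sup>2"
        using assms by (simp add: field_simps power2_eq_square)
      finally show ?thesis by (simp add: algebra_simps)
    qed
    have "(1 + r) ^ m * exp (R * r) * exp (- c * r\<^sup>2) \<le> fact m * exp (1 + r) * exp (R * r) * exp (- c * r\<^sup>2)"
      using 1 by (intro mult_right_mono) auto
    also have "\<dots> = fact m * exp (1 + r + R * r - c * r\<^sup>2)" by (simp add: exp_add[symmetric] mult.assoc)
    also have "\<dots> \<le> fact m * exp (1 + (R + 1)\<^sup>2 / (2 * c) - c / 2 * r\<^sup>2)" using 2 by simp
    also have "\<dots> = A * exp (- (c / 2) * r\<^sup>2)" by (simp add: A_def mult.assoc exp_add[symmetric])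
    finally show "norm ((1 + norm z) ^ m * exp (R * norm z) * exp (- c * (norm z)\<^sup>2)) \<le> norm (A * exp (- (c / 2) * (norm z)\<^sup>2))"
      using \<open>r \<ge> 0\<close> by (simp add: r_def[symmetric] abs_mult A_def)
  qed
qed measurable

lemma mult_le_sum_squares: "a * b \<le> a\<^sup>2 + b\<^sup>2" for a b :: real
  using sum_squares_bound[of a b] zero_le_power2[of a] zero_le_power2[of b] by linarith

text \<open>Young's inequality for the convolution of an \<open>L\<^sup>1\<close> with an
  \<open>L\<^sup>2\<close> function: Cauchy-Schwarz with respect to the measure with density
  \<open>k (z - w)\<close>, followed by Fubini's theorem.\<close>

lemma convolution_L2_bound:
  fixes k g :: "complex \<Rightarrow> ennreal"
  assumes [measurable]: "k \<in> borel_measurable borel" "g \<in> borel_measurable borel"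
  shows "(\<integral>\<^sup>+z. (\<integral>\<^sup>+w. k (z - w) * g w \<partial>lborel)\<^sup>2 \<partial>lborel) \<le> (\<integral>\<^sup>+z. k z \<partial>lborel)\<^sup>2 * (\<integral>\<^sup>+z. (g z)\<^sup>2 \<partial>lborel)"
proof -
  let ?I = "\<integral>\<^sup>+z. k z \<partial>lborel"
  have cs: "(\<integral>\<^sup>+w. k (z - w) * g w \<partial>lborel)\<^sup>2 \<le> ?I * (\<integral>\<^sup>+w. k (z - w) * (g w)\<^sup>2 \<partial>lborel)" for z
  proof -
    let ?M = "density lborel (\<lambda>w. k (z - w))"
    have "(\<integral>\<^sup>+w. 1 * g w \<partial>?M)\<^sup>2 \<le> (\<integral>\<^sup>+w. 1\<^sup>2 \<partial>?M) * (\<integral>\<^sup>+w. (g w)\<^sup>2 \<partial>?M)"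
      by (rule Cauchy_Schwarz_nn_integral) measurable
    then show ?thesis by (simp add: nn_integral_density emeasure_density nn_integral_reflect[of k])
  qed
  have "(\<integral>\<^sup>+z. (\<integral>\<^sup>+w. k (z - w) * g w \<partial>lborel)\<^sup>2 \<partial>lborel) \<le> (\<integral>\<^sup>+z. ?I * (\<integral>\<^sup>+w. k (z - w) * (g w)\<^sup>2 \<partial>lborel) \<partial>lborel)"
    by (intro nn_integral_mono cs)
  also have "\<dots> = ?I * (\<integral>\<^sup>+z. \<integral>\<^sup>+w. k (z - w) * (g w)\<^sup>2 \<partial>lborel \<partial>lborel)"
    by (rule nn_integral_cmult) measurable
  also have "(\<integral>\<^sup>+z. \<integral>\<^sup>+w. k (z - w) * (g w)\<^sup>2 \<partial>lborel \<partial>lborel) = (\<integral>\<^sup>+w. \<integral>\<^sup>+z. k (z - w) * (g w)\<^sup>2 \<partial>lborel \<partial>lborel)"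
    by (rule lborel_pair.Fubini') measurable
  also have "\<dots> = (\<integral>\<^sup>+w. ?I * (g w)\<^sup>2 \<partial>lborel)"
    by (intro nn_integral_cong) (simp add: nn_integral_multc nn_integral_translate)
  also have "\<dots> = ?I * (\<integral>\<^sup>+w. (g w)\<^sup>2 \<partial>lborel)" by (rule nn_integral_cmult) measurable
  finally show ?thesis by (simp add: power2_eq_square mult.assoc)
qed

text \<open>By Fubini's theorem the average over \<open>t\<close> may be taken outside, where measure
  preservation makes every integral the same. Rotations turn this into the mean value property of
  entire functions, flows of vector fields into conservation laws.\<close>

lemma integral_eq_integral_average:
  fixes h :: "complex \<Rightarrow> complex" and \<phi> :: "real \<Rightarrow> complex \<Rightarrow> complex"
  assumes int: "integrable lborel h" and cont: "continuous_on UNIV h"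
    and \<phi>: "continuous_on UNIV (\<lambda>(t, z). \<phi> t z)" and pres: "\<And>t. distr lborel lborel (\<phi> t) = lborel"
  shows "(\<integral>z. h z \<partial>lborel) = (\<integral>z. (LBINT t:{0..1}. h (\<phi> t z)) \<partial>lborel)"
proof -
  have [measurable]: "h \<in> borel_measurable borel" using int by simp
  have [measurable]: "(\<lambda>(t, z). \<phi> t z) \<in> borel_measurable (borel \<Otimes>\<^sub>M borel)"
    unfolding borel_prod by (rule borel_measurable_continuous_onI[OF \<phi>])
  have \<phi>m [measurable]: "\<phi> t \<in> borel_measurable borel" for t by measurable
  let ?f = "\<lambda>t z. indicator {0..1} t *\<^sub>R h (\<phi> t z)"
  have nn: "(\<integral>\<^sup>+z. norm (h (\<phi> t z)) \<partial>lborel) = (\<integral>\<^sup>+z. norm (h z) \<partial>lborel)" for t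
    by (subst (2) pres[of t, symmetric]) (simp add: nn_integral_distr)
  have "integrable (lborel \<Otimes>\<^sub>M lborel) (\<lambda>(t, z). ?f t z)"
    unfolding integrable_iff_bounded
  proof
    show "(\<lambda>(t, z). ?f t z) \<in> borel_measurable (lborel \<Otimes>\<^sub>M lborel)" by measurable
    have "(\<integral>\<^sup>+p. norm (case p of (t, z) \<Rightarrow> ?f t z) \<partial>(lborel \<Otimes>\<^sub>M lborel)) = (\<integral>\<^sup>+t. \<integral>\<^sup>+z. norm (?f t z) \<partial>lborel \<partial>lborel)"
      by (subst lborel.nn_integral_fst[symmetric]) auto
    also have "\<dots> = (\<integral>\<^sup>+t. indicator {0..1} t * (\<integral>\<^sup>+z. norm (h z) \<partial>lborel) \<partial>(lborel :: real measure))"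
      by (intro nn_integral_cong) (auto simp: nn split: split_indicator)
    also have "\<dots> = (\<integral>\<^sup>+z. norm (h z) \<partial>lborel)" by (subst nn_integral_multc) auto
    also have "\<dots> < \<infinity>" using int by (simp add: integrable_iff_bounded)
    finally show "(\<integral>\<^sup>+p. norm (case p of (t, z) \<Rightarrow> ?f t z) \<partial>(lborel \<Otimes>\<^sub>M lborel)) < \<infinity>" .
  qed
  from lborel_pair.Fubini_integral[OF this]
  have "(\<integral>z. (\<integral>t. ?f t z \<partial>lborel) \<partial>lborel) = (\<integral>t. (\<integral>z. ?f t z \<partial>lborel) \<partial>lborel)" .
  also have "\<dots> = (\<integral>t. indicator {0..1} t *\<^sub>R (\<integral>z. h z \<partial>lborel) \<partial>(lborel :: real measure))"
  proof (intro Bochner_Integration.integral_cong refl)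
    fix t :: real
    have "(\<integral>z. h (\<phi> t z) \<partial>lborel) = (\<integral>z. h z \<partial>lborel)"
      by (subst (2) pres[of t, symmetric]) (simp add: integral_distr)
    then show "(\<integral>z. ?f t z \<partial>lborel) = indicator {0..1} t *\<^sub>R (\<integral>z. h z \<partial>lborel)" by simp
  qed
  also have "\<dots> = (\<integral>z. h z \<partial>lborel)" by (subst integral_scaleR_left) auto
  finally show ?thesis unfolding set_lebesgue_integral_def by simp
qed

section \<open>The Bargmann projection\<close>

definition bkernel :: "complex \<Rightarrow> complex \<Rightarrow> complex"
  where "bkernel z w = of_real (1 / pi * exp (- (norm z)\<^sup>2 / 2)) * exp (cnj w * z - of_real ((norm w)\<^sup>2 / 2))"

lemma bargmann_proj_eq: "bargmann_proj u z = (\<integral>w. bkernel z w * u w \<partial>lborel)"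
  unfolding bargmann_proj_def bkernel_def by (simp add: mult.assoc)

lemma norm_diff_square: "(norm (z - w))\<^sup>2 = (norm z)\<^sup>2 + (norm w)\<^sup>2 - 2 * Re (cnj w * z)"
  unfolding cmod_power2 by (simp add: power2_eq_square algebra_simps)

text \<open>Although the kernel is not of convolution type, its modulus is, with a Gaussian profile.\<close>

lemma norm_bkernel: "norm (bkernel z w) = exp (- (norm (z - w))\<^sup>2 / 2) / pi"
proof -
  have "norm (bkernel z w) = exp (- (norm z)\<^sup>2 / 2) * exp (Re (cnj w * z) - (norm w)\<^sup>2 / 2) / pi"
    unfolding bkernel_def norm_mult norm_exp_eq_Re norm_of_real by simp
  also have "\<dots> = exp (- (norm (z - w))\<^sup>2 / 2) / pi"
    unfolding norm_diff_square by (simp add: exp_add[symmetric] field_simps)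
  finally show ?thesis .
qed

lemma cnj_bkernel: "cnj (bkernel z w) = bkernel w z"
  unfolding bkernel_def by (simp add: exp_cnj[symmetric] exp_of_real[symmetric] exp_add[symmetric] mult.commute) (simp add: exp_cnj exp_of_real mult.commute exp_diff)

lemma measurable_cnj [measurable]: "cnj \<in> borel_measurable borel"
  by (intro borel_measurable_continuous_onI continuous_intros)

lemma measurable_bkernel [measurable]: "(\<lambda>(z, w). bkernel z w) \<in> borel_measurable (borel \<Otimes>\<^sub>M borel)"
  unfolding borel_prod case_prod_beta bkernel_def
  by (intro borel_measurable_continuous_onI continuous_intros) auto

lemma measurable_bargmann_proj [measurable]:
  assumes [measurable]: "G \<in> borel_measurable borel"
  shows "bargmann_proj G \<in> borel_measurable borel"
  unfolding bargmann_proj_eq[abs_def] by measurable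

text \<open>Estimates on the projection are made for this majorant, which is meaningful before integrability
  is known; where it is infinite the projection is \<open>0\<close> by convention and the bounds
  persist.\<close>

definition proj_major :: "(complex \<Rightarrow> complex) \<Rightarrow> complex \<Rightarrow> ennreal"
  where "proj_major G z = (\<integral>\<^sup>+w. norm (bkernel z w * G w) \<partial>lborel)"

lemma measurable_proj_major [measurable]:
  assumes [measurable]: "G \<in> borel_measurable borel"
  shows "proj_major G \<in> borel_measurable borel"
  unfolding proj_major_def[abs_def] by measurable

lemma norm_bargmann_proj_le: "ennreal (norm (bargmann_proj G z)) \<le> proj_major G z"
  unfolding bargmann_proj_eq proj_major_def
  by (cases "integrable lborel (\<lambda>w. bkernel z w * G w)")
    (auto simp: integral_norm_bound_ennreal not_integrable_integral_eq)

text \<open>Weights that vary at most polynomially under translation, so that the Gaussian decay of the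
  kernel compensates them. The factor \<open>sqrt 2\<close> is that of Peetre's inequality.\<close>

definition moderate :: "real \<Rightarrow> (complex \<Rightarrow> real) \<Rightarrow> bool"
  where "moderate s \<omega> \<longleftrightarrow> \<omega> \<in> borel_measurable borel \<and> (\<forall>z. 0 \<le> \<omega> z) \<and>
    (\<forall>z w. \<omega> z \<le> (sqrt 2 * jbracket (z - w)) powr s * \<omega> w)"

lemma jbracket_ge_1: "1 \<le> jbracket z" by (simp add: jbracket_def)

lemma jbracket_pos: "0 < jbracket z" using jbracket_ge_1[of z] by linarith

lemma measurable_jbracket [measurable]: "jbracket \<in> borel_measurable borel"
  unfolding jbracket_def by measurable

text \<open>Peetre's inequality.\<close>

lemma jbracket_peetre: "jbracket z \<le> sqrt 2 * jbracket (z - w) * jbracket w"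
proof -
  have "(norm z)\<^sup>2 \<le> 2 * (norm (z - w))\<^sup>2 + 2 * (norm w)\<^sup>2"
  proof -
    have "(norm z)\<^sup>2 \<le> (norm (z - w) + norm w)\<^sup>2"
      using norm_triangle_ineq[of "z - w" w] by (intro power_mono) auto
    also have "\<dots> \<le> 2 * (norm (z - w))\<^sup>2 + 2 * (norm w)\<^sup>2"
      using zero_le_power2[of "norm (z - w) - norm w"] by (simp add: power2_eq_square algebra_simps)
    finally show ?thesis .
  qed
  then have "1 + (norm z)\<^sup>2 \<le> 2 * (1 + (norm (z - w))\<^sup>2) * (1 + (norm w)\<^sup>2)"
  proof -
    have "0 \<le> (norm (z - w))\<^sup>2 * (norm w)\<^sup>2" by simp
    then have "1 + (2 * (norm (z - w))\<^sup>2 + 2 * (norm w)\<^sup>2) \<le> 2 * (1 + (norm (z - w))\<^sup>2) * (1 + (norm w)\<^sup>2)"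
      unfolding distrib_left distrib_right by simp
    with \<open>(norm z)\<^sup>2 \<le> 2 * (norm (z - w))\<^sup>2 + 2 * (norm w)\<^sup>2\<close> show ?thesis by linarith
  qed
  then show ?thesis unfolding jbracket_def real_sqrt_mult[symmetric] by (rule real_sqrt_le_mono)
qed

lemma sqrt2_jbracket_ge_1: "1 \<le> sqrt 2 * jbracket z"
  using mult_mono[of 1 "sqrt 2" 1 "jbracket z"] jbracket_ge_1[of z] by simp

lemma moderate_const: "s \<ge> 0 \<Longrightarrow> moderate s (\<lambda>z. 1)"
  using sqrt2_jbracket_ge_1 by (auto simp: moderate_def ge_one_powr_ge_zero)

lemma moderate_jbracket:
  assumes "s \<ge> 0" shows "moderate s (\<lambda>z. jbracket z powr s)"
  unfolding moderate_def
proof (intro conjI allI)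
  show "(\<lambda>z. jbracket z powr s) \<in> borel_measurable borel" by measurable
  fix z w
  have "jbracket z powr s \<le> (sqrt 2 * jbracket (z - w) * jbracket w) powr s"
    using assms jbracket_pos[of z] jbracket_peetre[of z w] by (intro powr_mono2) auto
  also have "\<dots> = (sqrt 2 * jbracket (z - w)) powr s * jbracket w powr s"
    using jbracket_pos[of "z - w"] jbracket_pos[of w] by (simp add: powr_mult)
  finally show "jbracket z powr s \<le> (sqrt 2 * jbracket (z - w)) powr s * jbracket w powr s" .
qed simp

text \<open>The truncations of a weight are moderate with the same exponent, so that all estimates for them
  are uniform in the level \<open>c\<close>.\<close>

lemma moderate_min:
  assumes "moderate s \<omega>" "s \<ge> 0" "c \<ge> 0"
  shows "moderate s (\<lambda>z. min (\<omega> z) c)"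
  unfolding moderate_def
proof (intro conjI allI)
  have [measurable]: "\<omega> \<in> borel_measurable borel" using assms by (simp add: moderate_def)
  show "(\<lambda>z. min (\<omega> z) c) \<in> borel_measurable borel" by measurable
  show "0 \<le> min (\<omega> z) c" for z using assms by (auto simp: moderate_def)
  show "min (\<omega> z) c \<le> (sqrt 2 * jbracket (z - w)) powr s * min (\<omega> w) c" for z w
  proof -
    let ?k = "(sqrt 2 * jbracket (z - w)) powr s"
    have "1 \<le> ?k" using sqrt2_jbracket_ge_1 assms by (intro ge_one_powr_ge_zero)
    then have "c \<le> ?k * c" using assms mult_right_mono[of 1 ?k c] by simp
    moreover have "\<omega> z \<le> ?k * \<omega> w" using assms by (simp add: moderate_def)
    ultimately show ?thesis by (simp add: min_mult_distrib_left min.coboundedI1 min.coboundedI2)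
  qed
qed

text \<open>The mass of the Gaussian profile of the kernel after it has absorbed the weight.\<close>

definition schur_const :: "real \<Rightarrow> real"
  where "schur_const s = (\<integral>z. (sqrt 2 * jbracket z) powr s * (exp (- (norm z)\<^sup>2 / 2) / pi) \<partial>lborel)"

lemma jbracket_le: "jbracket z \<le> 1 + norm z"
  unfolding jbracket_def by (rule real_le_lsqrt) (auto simp: power2_eq_square algebra_simps)

lemma integrable_schur:
  assumes "s \<ge> 0"
  shows "integrable lborel (\<lambda>z. (sqrt 2 * jbracket z) powr s * (exp (- (norm z)\<^sup>2 / 2) / pi))"
proof (rule Bochner_Integration.integrable_bound)
  define m where "m = nat \<lceil>s\<rceil>"
  have m: "s \<le> real m" unfolding m_def by linarith
  show "integrable lborel (\<lambda>z::complex. (2 ^ m / pi) * ((1 + norm z) ^ m * exp (0 * norm z) * exp (- (1 / 2) * (norm z)\<^sup>2)))"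
    by (intro integrable_mult_right integrable_gaussian_weight) simp
  show "AE z in lborel. norm ((sqrt 2 * jbracket z) powr s * (exp (- (norm z)\<^sup>2 / 2) / pi))
      \<le> norm ((2 ^ m / pi) * ((1 + norm z) ^ m * exp (0 * norm z) * exp (- (1 / 2) * (norm z)\<^sup>2)))"
  proof (rule AE_I2)
    fix z
    have "(sqrt 2 * jbracket z) powr s \<le> (sqrt 2 * jbracket z) powr (real m)"
      by (intro powr_mono m sqrt2_jbracket_ge_1)
    also have "\<dots> = (sqrt 2 * jbracket z) ^ m" using jbracket_pos[of z] by (intro powr_realpow) auto
    also have "\<dots> \<le> (2 * (1 + norm z)) ^ m"
      using jbracket_le[of z] jbracket_pos[of z] by (intro power_mono mult_mono) (auto intro: real_le_lsqrt)
    also have "\<dots> = 2 ^ m * (1 + norm z) ^ m" by (rule power_mult_distrib)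
    finally have "(sqrt 2 * jbracket z) powr s * (exp (- (norm z)\<^sup>2 / 2) / pi)
        \<le> 2 ^ m * (1 + norm z) ^ m * (exp (- (norm z)\<^sup>2 / 2) / pi)" by (intro mult_right_mono) auto
    then show "norm ((sqrt 2 * jbracket z) powr s * (exp (- (norm z)\<^sup>2 / 2) / pi))
      \<le> norm ((2 ^ m / pi) * ((1 + norm z) ^ m * exp (0 * norm z) * exp (- (1 / 2) * (norm z)\<^sup>2)))"
      by (simp add: abs_mult)
  qed
qed measurable

text \<open>Moderateness trades the weight at \<open>z\<close> for the weight at \<open>w\<close> and a
  factor that depends on \<open>z - w\<close>; what remains is a convolution.\<close>

lemma proj_major_weighted:
  assumes "s \<ge> 0" and \<omega>: "moderate s \<omega>" and G [measurable]: "G \<in> borel_measurable borel"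
  shows "(\<integral>\<^sup>+z. (ennreal (\<omega> z) * proj_major G z)\<^sup>2 \<partial>lborel)
    \<le> ennreal ((schur_const s)\<^sup>2) * (\<integral>\<^sup>+z. ennreal ((\<omega> z * norm (G z))\<^sup>2) \<partial>lborel)"
proof -
  have [measurable]: "\<omega> \<in> borel_measurable borel" and \<omega>0: "\<And>z. 0 \<le> \<omega> z"
    and \<omega>m: "\<And>z w. \<omega> z \<le> (sqrt 2 * jbracket (z - w)) powr s * \<omega> w"
    using \<omega> by (auto simp: moderate_def)
  let ?k = "\<lambda>z. ennreal ((sqrt 2 * jbracket z) powr s * (exp (- (norm z)\<^sup>2 / 2) / pi))"
  let ?g = "\<lambda>w. ennreal (\<omega> w * norm (G w))"
  have major: "ennreal (\<omega> z) * proj_major G z \<le> (\<integral>\<^sup>+w. ?k (z - w) * ?g w \<partial>lborel)" for z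
  proof -
    have "ennreal (\<omega> z) * proj_major G z = (\<integral>\<^sup>+w. ennreal (\<omega> z) * norm (bkernel z w * G w) \<partial>lborel)"
      unfolding proj_major_def by (subst nn_integral_cmult) auto
    also have "\<dots> \<le> (\<integral>\<^sup>+w. ?k (z - w) * ?g w \<partial>lborel)"
    proof (intro nn_integral_mono)
      fix w
      have "\<omega> z * (norm (bkernel z w) * norm (G w))
          \<le> ((sqrt 2 * jbracket (z - w)) powr s * \<omega> w) * (norm (bkernel z w) * norm (G w))"
        by (intro mult_right_mono \<omega>m) auto
      also have "\<dots> = ((sqrt 2 * jbracket (z - w)) powr s * (exp (- (norm (z - w))\<^sup>2 / 2) / pi)) * (\<omega> w * norm (G w))"
        unfolding norm_bkernel by simp
      finally show "ennreal (\<omega> z) * norm (bkernel z w * G w) \<le> ?k (z - w) * ?g w"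
        using \<omega>0 by (simp add: ennreal_mult[symmetric] norm_mult)
    qed
    finally show ?thesis .
  qed
  have "(\<integral>\<^sup>+z. (ennreal (\<omega> z) * proj_major G z)\<^sup>2 \<partial>lborel) \<le> (\<integral>\<^sup>+z. (\<integral>\<^sup>+w. ?k (z - w) * ?g w \<partial>lborel)\<^sup>2 \<partial>lborel)"
    by (intro nn_integral_mono power_mono major) auto
  also have "\<dots> \<le> (\<integral>\<^sup>+z. ?k z \<partial>lborel)\<^sup>2 * (\<integral>\<^sup>+z. (?g z)\<^sup>2 \<partial>lborel)"
    by (rule convolution_L2_bound) measurable
  also have "(\<integral>\<^sup>+z. ?k z \<partial>lborel) = ennreal (schur_const s)"
    unfolding schur_const_def by (intro nn_integral_eq_integral integrable_schur \<open>s \<ge> 0\<close>) auto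
  also have "0 \<le> schur_const s" unfolding schur_const_def by (intro Bochner_Integration.integral_nonneg) auto
  then have "(ennreal (schur_const s))\<^sup>2 = ennreal ((schur_const s)\<^sup>2)" by (simp add: ennreal_power)
  also have "(\<integral>\<^sup>+z. (?g z)\<^sup>2 \<partial>lborel) = (\<integral>\<^sup>+z. ennreal ((\<omega> z * norm (G z))\<^sup>2) \<partial>lborel)"
    using \<omega>0 by (intro nn_integral_cong) (simp add: ennreal_power)
  finally show ?thesis .
qed

lemma proj_major_weighted_finite:
  assumes "s \<ge> 0" "moderate s \<omega>" "G \<in> borel_measurable borel" "integrable lborel (\<lambda>z. (\<omega> z * norm (G z))\<^sup>2)"
  shows "(\<integral>\<^sup>+z. (ennreal (\<omega> z) * proj_major G z)\<^sup>2 \<partial>lborel)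
    \<le> ennreal ((schur_const s)\<^sup>2 * (\<integral>z. (\<omega> z * norm (G z))\<^sup>2 \<partial>lborel))"
proof -
  have "(\<integral>\<^sup>+z. ennreal ((\<omega> z * norm (G z))\<^sup>2) \<partial>lborel) = ennreal (\<integral>z. (\<omega> z * norm (G z))\<^sup>2 \<partial>lborel)"
    by (intro nn_integral_eq_integral assms) auto
  then show ?thesis using proj_major_weighted[OF assms(1-3)] by (simp add: ennreal_mult)
qed

lemma bargmann_proj_weighted:
  assumes "s \<ge> 0" and \<omega>: "moderate s \<omega>" and G [measurable]: "G \<in> borel_measurable borel"
    and int: "integrable lborel (\<lambda>z. (\<omega> z * norm (G z))\<^sup>2)"
  shows "integrable lborel (\<lambda>z. (\<omega> z * norm (bargmann_proj G z))\<^sup>2)"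
    and "(\<integral>z. (\<omega> z * norm (bargmann_proj G z))\<^sup>2 \<partial>lborel) \<le> (schur_const s)\<^sup>2 * (\<integral>z. (\<omega> z * norm (G z))\<^sup>2 \<partial>lborel)"
proof -
  have [measurable]: "\<omega> \<in> borel_measurable borel" and \<omega>0: "\<And>z. 0 \<le> \<omega> z" using \<omega> by (auto simp: moderate_def)
  let ?B = "(schur_const s)\<^sup>2 * (\<integral>z. (\<omega> z * norm (G z))\<^sup>2 \<partial>lborel)"
  have "(\<integral>\<^sup>+z. ennreal ((\<omega> z * norm (bargmann_proj G z))\<^sup>2) \<partial>lborel) \<le> (\<integral>\<^sup>+z. (ennreal (\<omega> z) * proj_major G z)\<^sup>2 \<partial>lborel)"
  proof (intro nn_integral_mono)
    fix z
    have "ennreal ((\<omega> z * norm (bargmann_proj G z))\<^sup>2) = (ennreal (\<omega> z) * ennreal (norm (bargmann_proj G z)))\<^sup>2"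
      using \<omega>0 by (simp add: ennreal_mult[symmetric] ennreal_power)
    also have "\<dots> \<le> (ennreal (\<omega> z) * proj_major G z)\<^sup>2"
      by (intro power_mono mult_left_mono norm_bargmann_proj_le) auto
    finally show "ennreal ((\<omega> z * norm (bargmann_proj G z))\<^sup>2) \<le> (ennreal (\<omega> z) * proj_major G z)\<^sup>2" .
  qed
  also have "\<dots> \<le> ennreal ?B" by (rule proj_major_weighted_finite[OF assms])
  finally have le: "(\<integral>\<^sup>+z. ennreal ((\<omega> z * norm (bargmann_proj G z))\<^sup>2) \<partial>lborel) \<le> ennreal ?B" .
  then show int': "integrable lborel (\<lambda>z. (\<omega> z * norm (bargmann_proj G z))\<^sup>2)"
    unfolding integrable_iff_bounded by (auto simp: order_le_less_trans[OF _ ennreal_less_top])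
  have "0 \<le> ?B" by (intro mult_nonneg_nonneg Bochner_Integration.integral_nonneg) auto
  moreover have "(\<integral>\<^sup>+z. ennreal ((\<omega> z * norm (bargmann_proj G z))\<^sup>2) \<partial>lborel) = ennreal (\<integral>z. (\<omega> z * norm (bargmann_proj G z))\<^sup>2 \<partial>lborel)"
    by (intro nn_integral_eq_integral int') auto
  ultimately show "(\<integral>z. (\<omega> z * norm (bargmann_proj G z))\<^sup>2 \<partial>lborel) \<le> ?B"
    using le by simp
qed

text \<open>The kernel is Hermitian, so this is Fubini's theorem. The two functions are allowed to lie in
  the dual weighted spaces given by \<open>\<omega>\<close> and \<open>1 / \<omega>\<close>, since
  for the second moment the function \<open>H\<close> is \<open>\<bar>z\<bar>\<^sup>2 u\<close>,
  which need not be square integrable.\<close>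

lemma bargmann_proj_self_adjoint:
  assumes "s \<ge> 0" and \<omega>: "moderate s \<omega>" and pos: "\<And>z. 0 < \<omega> z"
    and G [measurable]: "G \<in> borel_measurable borel" and H [measurable]: "H \<in> borel_measurable borel"
    and intG: "integrable lborel (\<lambda>z. (\<omega> z * norm (G z))\<^sup>2)"
    and intH: "integrable lborel (\<lambda>z. (norm (H z) / \<omega> z)\<^sup>2)"
  shows "(\<integral>z. bargmann_proj G z * cnj (H z) \<partial>lborel) = (\<integral>z. G z * cnj (bargmann_proj H z) \<partial>lborel)"
proof -
  have [measurable]: "\<omega> \<in> borel_measurable borel" using \<omega> by (auto simp: moderate_def)
  let ?F = "\<lambda>z w. bkernel z w * G w * cnj (H z)"
  have "integrable (lborel \<Otimes>\<^sub>M lborel) (\<lambda>(z, w). ?F z w)"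
    unfolding integrable_iff_bounded
  proof
    show "(\<lambda>(z, w). ?F z w) \<in> borel_measurable (lborel \<Otimes>\<^sub>M lborel)" by measurable
    have "(\<integral>\<^sup>+p. norm (case p of (z, w) \<Rightarrow> ?F z w) \<partial>(lborel \<Otimes>\<^sub>M lborel)) = (\<integral>\<^sup>+z. \<integral>\<^sup>+w. norm (?F z w) \<partial>lborel \<partial>lborel)"
      by (subst lborel.nn_integral_fst[symmetric]) auto
    also have "\<dots> = (\<integral>\<^sup>+z. proj_major G z * norm (H z) \<partial>lborel)"
      unfolding proj_major_def
      by (intro nn_integral_cong) (subst nn_integral_multc[symmetric], auto simp: norm_mult ennreal_mult)
    also have "\<dots> \<le> (\<integral>\<^sup>+z. (ennreal (\<omega> z) * proj_major G z)\<^sup>2 + ennreal ((norm (H z) / \<omega> z)\<^sup>2) \<partial>lborel)"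
    proof (intro nn_integral_mono)
      fix z
      show "proj_major G z * norm (H z) \<le> (ennreal (\<omega> z) * proj_major G z)\<^sup>2 + ennreal ((norm (H z) / \<omega> z)\<^sup>2)"
      proof (cases "proj_major G z" rule: ennreal_cases)
        case (real r)
        have "r * norm (H z) = (\<omega> z * r) * (norm (H z) / \<omega> z)" using pos[of z] by simp
        also have "\<dots> \<le> (\<omega> z * r)\<^sup>2 + (norm (H z) / \<omega> z)\<^sup>2" by (rule mult_le_sum_squares)
        finally show ?thesis
          using real pos[of z] by (simp add: ennreal_mult[symmetric] ennreal_power ennreal_plus[symmetric] del: ennreal_plus)
      next
        case top
        then show ?thesis using pos[of z] by (simp add: ennreal_mult_top power2_eq_square)
      qed
    qed
    also have "\<dots> = (\<integral>\<^sup>+z. (ennreal (\<omega> z) * proj_major G z)\<^sup>2 \<partial>lborel) + (\<integral>\<^sup>+z. ennreal ((norm (H z) / \<omega> z)\<^sup>2) \<partial>lborel)"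
      by (rule nn_integral_add) measurable
    also have "\<dots> < \<infinity>"
    proof -
      have "(\<integral>\<^sup>+z. (ennreal (\<omega> z) * proj_major G z)\<^sup>2 \<partial>lborel) < \<infinity>"
        using proj_major_weighted_finite[OF \<open>s \<ge> 0\<close> \<omega> G intG] by (simp add: order_le_less_trans[OF _ ennreal_less_top])
      moreover have "(\<integral>\<^sup>+z. ennreal ((norm (H z) / \<omega> z)\<^sup>2) \<partial>lborel) < \<infinity>"
        using intH unfolding integrable_iff_bounded by simp
      ultimately show ?thesis by simp
    qed
    finally show "(\<integral>\<^sup>+p. norm (case p of (z, w) \<Rightarrow> ?F z w) \<partial>(lborel \<Otimes>\<^sub>M lborel)) < \<infinity>" .
  qed
  from lborel_pair.Fubini_integral[OF this]
  have "(\<integral>w. (\<integral>z. ?F z w \<partial>lborel) \<partial>lborel) = (\<integral>z. (\<integral>w. ?F z w \<partial>lborel) \<partial>lborel)" .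
  moreover have "(\<integral>w. ?F z w \<partial>lborel) = bargmann_proj G z * cnj (H z)" for z
    by (simp add: bargmann_proj_eq)
  moreover have "(\<integral>z. ?F z w \<partial>lborel) = G w * cnj (bargmann_proj H w)" for w
  proof -
    have "cnj (bargmann_proj H w) = (\<integral>z. cnj (bkernel w z * H z) \<partial>lborel)"
      unfolding bargmann_proj_eq by (simp only: Bochner_Integration.integral_cnj)
    also have "\<dots> = (\<integral>z. bkernel z w * cnj (H z) \<partial>lborel)" by (simp add: cnj_bkernel)
    finally have "G w * cnj (bargmann_proj H w) = (\<integral>z. G w * (bkernel z w * cnj (H z)) \<partial>lborel)" by simp
    then show ?thesis by (auto simp: mult.assoc mult.left_commute)
  qed
  ultimately show ?thesis by (simp only:)
qed

subsection \<open>Holomorphy of projected functions\<close>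

text \<open>Dominates, for \<open>z\<close> in a disc of radius \<open>R\<close>, the integrand of the
  transform and the factor \<open>\<bar>w\<bar>\<^sup>2\<close> that the Taylor remainder of the
  exponential produces.\<close>

lemma L2_gaussian_integrable:
  assumes "G \<in> L2"
  shows "integrable lborel (\<lambda>w. (1 + norm w)\<^sup>2 * exp (R * norm w) * exp (- (norm w)\<^sup>2 / 2) * norm (G w))"
proof (rule Bochner_Integration.integrable_bound)
  have [measurable]: "G \<in> borel_measurable borel" using assms by (simp add: L2_def)
  let ?a = "\<lambda>w::complex. (1 + norm w)\<^sup>2 * exp (R * norm w) * exp (- (norm w)\<^sup>2 / 2)"
  show "integrable lborel (\<lambda>w. (1 + norm w) ^ 4 * exp (2 * R * norm w) * exp (- 1 * (norm w)\<^sup>2) + (norm (G w))\<^sup>2)"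
    using assms by (intro Bochner_Integration.integrable_add integrable_gaussian_weight) (auto simp: L2_def)
  show "(\<lambda>w. ?a w * norm (G w)) \<in> borel_measurable lborel" by measurable
  have "(?a w)\<^sup>2 = (1 + norm w) ^ 4 * exp (2 * R * norm w) * exp (- 1 * (norm w)\<^sup>2)" for w
    unfolding power_mult_distrib power_mult[symmetric] exp_double[symmetric] by (simp add: mult.assoc)
  then show "AE w in lborel. norm (?a w * norm (G w))
      \<le> norm ((1 + norm w) ^ 4 * exp (2 * R * norm w) * exp (- 1 * (norm w)\<^sup>2) + (norm (G w))\<^sup>2)"
    using mult_le_sum_squares[of "?a _" "norm (G _)"] by (intro AE_I2) (simp add: abs_mult)
qed

text \<open>The holomorphic factor of the projection, up to the constant \<open>1 / pi\<close>.\<close>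

definition bargmann_transform :: "(complex \<Rightarrow> complex) \<Rightarrow> complex \<Rightarrow> complex"
  where "bargmann_transform G z = (\<integral>w. exp (cnj w * z - of_real ((norm w)\<^sup>2 / 2)) * G w \<partial>lborel)"

lemma norm_exp_cnj_le: "norm (exp (cnj w * z - of_real ((norm w)\<^sup>2 / 2))) \<le> exp (norm z * norm w) * exp (- (norm w)\<^sup>2 / 2)"
proof -
  have "Re (cnj w * z) \<le> norm (cnj w * z)" by (rule complex_Re_le_cmod)
  then have "Re (cnj w * z - of_real ((norm w)\<^sup>2 / 2)) \<le> norm z * norm w + - (norm w)\<^sup>2 / 2"
    by (simp add: norm_mult mult.commute)
  then show ?thesis unfolding norm_exp_eq_Re exp_add[symmetric] by simp
qed

lemma L2_transform_integrable:
  assumes "G \<in> L2"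
  shows "integrable lborel (\<lambda>w. exp (cnj w * z - of_real ((norm w)\<^sup>2 / 2)) * G w)"
    and "integrable lborel (\<lambda>w. exp (cnj w * z - of_real ((norm w)\<^sup>2 / 2)) * (cnj w * G w))"
proof -
  have [measurable]: "G \<in> borel_measurable borel" using assms by (simp add: L2_def)
  have le: "norm (exp (cnj w * z - of_real ((norm w)\<^sup>2 / 2))) * c
      \<le> (1 + norm w)\<^sup>2 * exp (norm z * norm w) * exp (- (norm w)\<^sup>2 / 2) * norm (G w)"
    if "0 \<le> c" "c \<le> (1 + norm w) * norm (G w)" for w c
  proof -
    have "norm (exp (cnj w * z - of_real ((norm w)\<^sup>2 / 2))) * c
        \<le> (exp (norm z * norm w) * exp (- (norm w)\<^sup>2 / 2)) * ((1 + norm w) * norm (G w))"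
      using that by (intro mult_mono norm_exp_cnj_le) auto
    also have "\<dots> \<le> (exp (norm z * norm w) * exp (- (norm w)\<^sup>2 / 2)) * ((1 + norm w)\<^sup>2 * norm (G w))"
      by (intro mult_left_mono mult_right_mono) (auto simp: power2_eq_square algebra_simps)
    finally show ?thesis by (simp add: ac_simps)
  qed
  show "integrable lborel (\<lambda>w. exp (cnj w * z - of_real ((norm w)\<^sup>2 / 2)) * G w)"
  proof (rule Bochner_Integration.integrable_bound[OF L2_gaussian_integrable[OF assms, of "norm z"]])
    show "AE w in lborel. norm (exp (cnj w * z - of_real ((norm w)\<^sup>2 / 2)) * G w)
        \<le> norm ((1 + norm w)\<^sup>2 * exp (norm z * norm w) * exp (- (norm w)\<^sup>2 / 2) * norm (G w))"
    proof (rule AE_I2)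
      fix w
      show "norm (exp (cnj w * z - of_real ((norm w)\<^sup>2 / 2)) * G w)
        \<le> norm ((1 + norm w)\<^sup>2 * exp (norm z * norm w) * exp (- (norm w)\<^sup>2 / 2) * norm (G w))"
        using le[of "norm (G w)" w] by (simp add: norm_mult abs_mult distrib_right)
    qed
  qed measurable
  show "integrable lborel (\<lambda>w. exp (cnj w * z - of_real ((norm w)\<^sup>2 / 2)) * (cnj w * G w))"
  proof (rule Bochner_Integration.integrable_bound[OF L2_gaussian_integrable[OF assms, of "norm z"]])
    show "AE w in lborel. norm (exp (cnj w * z - of_real ((norm w)\<^sup>2 / 2)) * (cnj w * G w))
        \<le> norm ((1 + norm w)\<^sup>2 * exp (norm z * norm w) * exp (- (norm w)\<^sup>2 / 2) * norm (G w))"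
    proof (rule AE_I2)
      fix w
      show "norm (exp (cnj w * z - of_real ((norm w)\<^sup>2 / 2)) * (cnj w * G w))
        \<le> norm ((1 + norm w)\<^sup>2 * exp (norm z * norm w) * exp (- (norm w)\<^sup>2 / 2) * norm (G w))"
        using le[of "norm w * norm (G w)" w] by (simp add: norm_mult abs_mult distrib_right)
    qed
  qed measurable
qed

text \<open>Differentiation under the integral sign: the Taylor remainder of the exponential is quadratic in
  the increment with an integrable factor.\<close>

lemma bargmann_transform_has_derivative:
  assumes "G \<in> L2"
  shows "(bargmann_transform G has_field_derivative bargmann_transform (\<lambda>w. cnj w * G w) z) (at z)"
  unfolding has_field_derivative_def
proof (rule has_derivative_if_quadratic_remainder[OF bounded_linear_mult_right zero_less_one])
  have [measurable]: "G \<in> borel_measurable borel" using assms by (simp add: L2_def)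
  let ?M = "\<lambda>w. (1 + norm w)\<^sup>2 * exp ((norm z + 1) * norm w) * exp (- (norm w)\<^sup>2 / 2) * norm (G w)"
  note int = L2_transform_integrable[OF assms]
  fix h :: complex assume h: "norm h < 1"
  let ?E = "\<lambda>w z. exp (cnj w * z - of_real ((norm w)\<^sup>2 / 2))"
  have eq: "bargmann_transform G (z + h) - bargmann_transform G z - bargmann_transform (\<lambda>w. cnj w * G w) z * h
      = (\<integral>w. ?E w (z + h) * G w - ?E w z * G w - ?E w z * (cnj w * G w) * h \<partial>lborel)"
    unfolding bargmann_transform_def
    by (simp only: int Bochner_Integration.integral_diff Bochner_Integration.integrable_diff integrable_mult_left integral_mult_left_zero)
  have "norm (\<integral>w. ?E w (z + h) * G w - ?E w z * G w - ?E w z * (cnj w * G w) * h \<partial>lborel)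
      \<le> (\<integral>w. (norm h)\<^sup>2 * ?M w \<partial>lborel)"
  proof (rule Bochner_Integration.integral_norm_bound_integral)
    show "integrable lborel (\<lambda>w. (norm h)\<^sup>2 * ?M w)" by (intro integrable_mult_right L2_gaussian_integrable assms)
    fix w
    have "?E w (z + h) * G w - ?E w z * G w - ?E w z * (cnj w * G w) * h
        = ?E w z * (exp (cnj w * h) - (\<Sum>k\<le>1. (cnj w * h) ^ k / fact k)) * G w"
    proof -
      have "?E w (z + h) = ?E w z * exp (cnj w * h)" by (simp add: exp_add[symmetric] algebra_simps)
      then show ?thesis by (simp add: algebra_simps)
    qed
    also have "norm \<dots> \<le> (exp (norm z * norm w) * exp (- (norm w)\<^sup>2 / 2)) * (exp (norm w) * (norm w * norm h)\<^sup>2) * norm (G w)"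
      unfolding norm_mult
    proof (intro mult_mono norm_exp_cnj_le)
      have "\<bar>Re (cnj w * h)\<bar> \<le> norm w * norm h" using abs_Re_le_cmod[of "cnj w * h"] by (simp add: norm_mult)
      also have "\<dots> \<le> norm w" using h by (simp add: mult_left_le)
      finally have "exp \<bar>Re (cnj w * h)\<bar> \<le> exp (norm w)" by simp
      have "norm (exp (cnj w * h) - (\<Sum>k\<le>1. (cnj w * h) ^ k / fact k)) \<le> exp \<bar>Re (cnj w * h)\<bar> * norm (cnj w * h) ^ Suc 1 / fact 1"
        by (rule Taylor_exp)
      also have "\<dots> \<le> exp (norm w) * (norm w * norm h)\<^sup>2"
        using \<open>exp \<bar>Re (cnj w * h)\<bar> \<le> exp (norm w)\<close>
        by (simp add: norm_mult power2_eq_square mult_right_mono)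
      finally show "norm (exp (cnj w * h) - (\<Sum>k\<le>1. (cnj w * h) ^ k / fact k)) \<le> exp (norm w) * (norm w * norm h)\<^sup>2" .
    qed auto
    also have "\<dots> = (norm h)\<^sup>2 * ((norm w)\<^sup>2 * (exp ((norm z + 1) * norm w) * exp (- (norm w)\<^sup>2 / 2) * norm (G w)))"
    proof -
      have "exp ((norm z + 1) * norm w) = exp (norm z * norm w) * exp (norm w)" by (simp add: distrib_right exp_add)
      then show ?thesis by (simp only: power_mult_distrib ac_simps)
    qed
    also have "\<dots> \<le> (norm h)\<^sup>2 * ((1 + norm w)\<^sup>2 * (exp ((norm z + 1) * norm w) * exp (- (norm w)\<^sup>2 / 2) * norm (G w)))"
      by (intro mult_left_mono mult_right_mono power_mono) auto
    finally show "norm (?E w (z + h) * G w - ?E w z * G w - ?E w z * (cnj w * G w) * h) \<le> (norm h)\<^sup>2 * ?M w"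
      by (simp add: mult.assoc)
  qed (rule Bochner_Integration.integrable_diff[OF Bochner_Integration.integrable_diff[OF int(1) int(1)]
        integrable_mult_left[OF int(2)]])
  then show "norm (bargmann_transform G (z + h) - bargmann_transform G z - bargmann_transform (\<lambda>w. cnj w * G w) z * h)
      \<le> (\<integral>w. ?M w \<partial>lborel) * (norm h)\<^sup>2"
    unfolding eq integral_mult_right_zero by (simp only: mult.commute)
qed

lemma bargmann_proj_transform:
  "bargmann_proj G z = of_real (exp (- (norm z)\<^sup>2 / 2)) * (of_real (1 / pi) * bargmann_transform G z)"
  by (simp add: bargmann_proj_def bargmann_transform_def)

lemma bargmann_proj_in_fock:
  assumes "G \<in> L2" shows "bargmann_proj G \<in> bargmann_fock"
proof -
  have [measurable]: "G \<in> borel_measurable borel" using assms by (simp add: L2_def)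
  have "bargmann_transform G holomorphic_on UNIV"
    using bargmann_transform_has_derivative[OF assms]
    by (auto simp: holomorphic_on_open)
  then have "(\<lambda>z. of_real (1 / pi) * bargmann_transform G z) holomorphic_on UNIV" by (intro holomorphic_intros)
  moreover have "bargmann_proj G = (\<lambda>z. of_real (exp (- (norm z)\<^sup>2 / 2)) * (of_real (1 / pi) * bargmann_transform G z))"
    using bargmann_proj_transform by blast
  moreover have "bargmann_proj G \<in> L2"
    using bargmann_proj_weighted(1)[OF order_refl moderate_const, of G] assms by (simp add: L2_def)
  ultimately show ?thesis unfolding bargmann_fock_def by blast
qed

subsection \<open>Reproduction of the Fock space\<close>

text \<open>Cauchy's integral formula on the unit circle, applied to \<open>w \<mapsto> g (w z)\<close>.\<close>

lemma entire_circle_average: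
  assumes "g holomorphic_on UNIV"
  shows "(LBINT t:{0..1}. g (exp (2 * of_real pi * \<i> * of_real t) * z)) = g 0"
proof -
  let ?e = "\<lambda>t::real. exp (2 * of_real pi * \<i> * of_real t)"
  have hol: "(\<lambda>w. g (w * z)) holomorphic_on UNIV"
  proof -
    have "(\<lambda>w. w * z) holomorphic_on UNIV" by (intro holomorphic_intros)
    from holomorphic_on_compose_gen[OF this assms] show ?thesis by (simp add: o_def)
  qed
  have cont: "continuous_on UNIV (\<lambda>w. g (w * z))" by (rule holomorphic_on_imp_continuous_on[OF hol])
  have "((\<lambda>u. g (u * z) / (u - 0)) has_contour_integral (2 * of_real pi * \<i> * g (0 * z))) (circlepath 0 1)"
    by (rule Cauchy_integral_circlepath) (use hol cont in \<open>auto intro: holomorphic_on_subset continuous_on_subset\<close>)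
  then have "((\<lambda>t. g (circlepath 0 1 t * z) / circlepath 0 1 t * vector_derivative (circlepath 0 1) (at t within {0..1}))
      has_integral (2 * of_real pi * \<i> * g 0)) {0..1}"
    unfolding has_contour_integral_def by simp
  then have "((\<lambda>t. (2 * of_real pi * \<i>) * g (?e t * z)) has_integral (2 * of_real pi * \<i> * g 0)) {0..1}"
  proof (rule has_integral_eq[rotated])
    fix t :: real assume "t \<in> {0..1}"
    then have "vector_derivative (circlepath 0 1) (at t within {0..1}) = 2 * of_real pi * \<i> * ?e t"
      using vector_derivative_circlepath01[of t 0 1] by simp
    moreover have "circlepath 0 1 t = ?e t" by (simp add: circlepath)
    ultimately show "g (circlepath 0 1 t * z) / circlepath 0 1 t * vector_derivative (circlepath 0 1) (at t within {0..1})
        = (2 * of_real pi * \<i>) * g (?e t * z)" by simp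
  qed
  then have "((\<lambda>t. (1 / (2 * of_real pi * \<i>)) * ((2 * of_real pi * \<i>) * g (?e t * z))) has_integral
      (1 / (2 * of_real pi * \<i>)) * (2 * of_real pi * \<i> * g 0)) {0..1}"
    by (rule has_integral_mult_right)
  then have "((\<lambda>t. g (?e t * z)) has_integral g 0) {0..1}" by simp
  moreover have "set_integrable lborel {0..1} (\<lambda>t. g (?e t * z))"
    by (intro borel_integrable_atLeastAtMost' continuous_on_compose2[OF cont] continuous_intros) auto
  ultimately show ?thesis by (simp add: set_borel_integral_eq_integral integral_unique)
qed

text \<open>The Gaussian is invariant under rotations, so \<open>g\<close> may be replaced by its averages
  over circles, which equal \<open>g 0\<close>.\<close>

lemma gaussian_mean_value:
  assumes g: "g holomorphic_on UNIV" and int: "integrable lborel (\<lambda>z. of_real (exp (- (norm z)\<^sup>2)) * g z)"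
  shows "(\<integral>z. of_real (exp (- (norm z)\<^sup>2)) * g z \<partial>lborel) = of_real pi * g 0"
proof -
  let ?e = "\<lambda>t::real. exp (2 * of_real pi * \<i> * of_real t)"
  have [simp]: "norm (?e t) = 1" for t by (simp add: norm_exp_eq_Re)
  have gc: "continuous_on UNIV g" by (rule holomorphic_on_imp_continuous_on[OF g])
  have "(\<integral>z. of_real (exp (- (norm z)\<^sup>2)) * g z \<partial>lborel)
      = (\<integral>z. (LBINT t:{0..1}. of_real (exp (- (norm (?e t * z))\<^sup>2)) * g (?e t * z)) \<partial>lborel)"
  proof (rule integral_eq_integral_average[OF int])
    show "continuous_on UNIV (\<lambda>z. of_real (exp (- (norm z)\<^sup>2)) * g z)" by (intro continuous_intros gc)
    show "continuous_on UNIV (\<lambda>(t, z). ?e t * z)" unfolding case_prod_beta by (intro continuous_intros)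
    show "distr lborel lborel ((*) (?e t)) = lborel" for t by (rule distr_lborel_rotation) simp
  qed
  also have "\<dots> = (\<integral>z. of_real (exp (- (norm (z::complex))\<^sup>2)) * g 0 \<partial>lborel)"
    by (intro Bochner_Integration.integral_cong refl)
      (simp add: norm_mult set_integral_mult_right entire_circle_average[OF g])
  also have "\<dots> = of_real (\<integral>z. exp (- (norm (z::complex))\<^sup>2) \<partial>lborel) * g 0" by simp
  also have "(\<integral>z. exp (- (norm (z::complex))\<^sup>2) \<partial>lborel) = pi"
    using integral_gaussian_complex by (simp add: has_bochner_integral_iff)
  finally show ?thesis .
qed

text \<open>Translated by \<open>z\<close>, the integrand is the Gaussian \<open>exp (-
  \<bar>\<zeta>\<bar>\<^sup>2)\<close> times an entire function of \<open>\<zeta>\<close>, so the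
  Gaussian mean value property evaluates it.\<close>

lemma bargmann_proj_fock:
  assumes "u \<in> bargmann_fock" shows "bargmann_proj u z = u z"
proof -
  obtain f where f: "f holomorphic_on UNIV" and u: "u = (\<lambda>z. of_real (exp (- (norm z)\<^sup>2 / 2)) * f z)"
    using assms by (rule bargmann_fockE)
  have L2: "u \<in> L2" using assms by (simp add: bargmann_fock_def)
  then have [measurable]: "u \<in> borel_measurable borel" by (simp add: L2_def)
  define c :: complex where "c = of_real (1 / pi * exp (- (norm z)\<^sup>2 / 2))"
  \<comment> \<open>The entire factor of the integrand after the substitution \<open>w = \<zeta> + z\<close>.\<close>
  define g where "g \<zeta> = exp (- \<zeta> * cnj z) * f (\<zeta> + z)" for \<zeta>
  have "(\<lambda>\<zeta>. f (\<zeta> + z)) holomorphic_on UNIV"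
  proof -
    have "(\<lambda>\<zeta>. \<zeta> + z) holomorphic_on UNIV" by (intro holomorphic_intros)
    from holomorphic_on_compose_gen[OF this f] show ?thesis by (simp add: o_def)
  qed
  then have g: "g holomorphic_on UNIV" unfolding g_def by (intro holomorphic_intros)
  have eq: "bkernel z (\<zeta> + z) * u (\<zeta> + z) = c * (of_real (exp (- (norm \<zeta>)\<^sup>2)) * g \<zeta>)" for \<zeta>
  proof -
    have n: "complex_of_real ((norm w)\<^sup>2) = w * cnj w" for w by (rule complex_norm_square)
    have "exp (cnj (\<zeta> + z) * z - of_real ((norm (\<zeta> + z))\<^sup>2 / 2)) * of_real (exp (- (norm (\<zeta> + z))\<^sup>2 / 2))
        = exp (cnj (\<zeta> + z) * z - of_real ((norm (\<zeta> + z))\<^sup>2 / 2) + of_real (- (norm (\<zeta> + z))\<^sup>2 / 2))"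
      by (simp only: exp_add exp_of_real)
    also have "cnj (\<zeta> + z) * z - of_real ((norm (\<zeta> + z))\<^sup>2 / 2) + of_real (- (norm (\<zeta> + z))\<^sup>2 / 2)
        = of_real (- (norm \<zeta>)\<^sup>2) + - \<zeta> * cnj z"
    proof -
      have "cnj (\<zeta> + z) * z - of_real ((norm (\<zeta> + z))\<^sup>2 / 2) + of_real (- (norm (\<zeta> + z))\<^sup>2 / 2)
          = cnj (\<zeta> + z) * z - complex_of_real ((norm (\<zeta> + z))\<^sup>2)" by (simp add: field_simps)
      also have "\<dots> = - complex_of_real ((norm \<zeta>)\<^sup>2) + - \<zeta> * cnj z" unfolding n by (simp add: algebra_simps)
      finally show ?thesis by simp
    qed
    also have "exp \<dots> = of_real (exp (- (norm \<zeta>)\<^sup>2)) * exp (- \<zeta> * cnj z)" by (simp only: exp_add exp_of_real)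
    finally show ?thesis unfolding bkernel_def u g_def c_def by (simp add: ac_simps)
  qed
  have tr: "distr lborel lborel (\<lambda>\<zeta>. \<zeta> + z) = lborel" by (rule distr_lborel_translation)
  have "integrable lborel (\<lambda>w. bkernel z w * u w)"
    using integrable_mult_right[OF L2_transform_integrable(1)[OF L2, of z], of c]
    by (simp add: bkernel_def c_def mult.assoc)
  then have "integrable lborel (\<lambda>\<zeta>. bkernel z (\<zeta> + z) * u (\<zeta> + z))"
    using integrable_distr_eq[of "\<lambda>\<zeta>. \<zeta> + z" lborel lborel "\<lambda>w. bkernel z w * u w"] tr by simp
  then have "integrable lborel (\<lambda>\<zeta>. inverse c * (c * (of_real (exp (- (norm \<zeta>)\<^sup>2)) * g \<zeta>)))"
    unfolding eq by (rule integrable_mult_right)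
  moreover have "c \<noteq> 0" by (simp add: c_def)
  ultimately have int: "integrable lborel (\<lambda>\<zeta>. of_real (exp (- (norm \<zeta>)\<^sup>2)) * g \<zeta>)"
    by (simp add: mult.assoc[symmetric])
  have "bargmann_proj u z = (\<integral>\<zeta>. bkernel z (\<zeta> + z) * u (\<zeta> + z) \<partial>lborel)"
    unfolding bargmann_proj_eq
    using integral_distr[of "\<lambda>\<zeta>. \<zeta> + z" lborel lborel "\<lambda>w. bkernel z w * u w"] tr by simp
  also have "\<dots> = c * (of_real pi * g 0)" unfolding eq by (simp add: gaussian_mean_value[OF g int])
  also have "\<dots> = u z" by (simp add: c_def g_def u)
  finally show ?thesis .
qed

text \<open>The annihilation operator. By the reproducing formula \<open>q\<close> is the transform of
  \<open>u\<close>, and differentiation of the transform produces the factor \<open>cnj w\<close>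
  under the integral.\<close>

lemma bargmann_proj_cnj_mult:
  assumes q: "q holomorphic_on UNIV" and u: "u = (\<lambda>z. of_real (exp (- (norm z)\<^sup>2 / 2)) * q z)" and L2: "u \<in> L2"
  shows "bargmann_proj (\<lambda>w. cnj w * u w) z = of_real (exp (- (norm z)\<^sup>2 / 2)) * deriv q z"
proof -
  have uf: "u \<in> bargmann_fock" using q u L2 unfolding bargmann_fock_def by blast
  have "of_real (exp (- (norm z)\<^sup>2 / 2)) * (of_real (1 / pi) * bargmann_transform u z)
      = of_real (exp (- (norm z)\<^sup>2 / 2)) * q z" for z
    unfolding bargmann_proj_transform[symmetric] by (rule trans[OF bargmann_proj_fock[OF uf] fun_cong[OF u]])
  then have "q = (\<lambda>z. of_real (1 / pi) * bargmann_transform u z)" unfolding mult_cancel_left by auto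
  moreover have "((\<lambda>z. of_real (1 / pi) * bargmann_transform u z) has_field_derivative
      of_real (1 / pi) * bargmann_transform (\<lambda>w. cnj w * u w) z) (at z)"
    by (intro DERIV_cmult bargmann_transform_has_derivative L2)
  ultimately have "deriv q z = of_real (1 / pi) * bargmann_transform (\<lambda>w. cnj w * u w) z"
    using DERIV_imp_deriv by metis
  then show ?thesis by (simp add: bargmann_proj_transform)
qed

section \<open>The Bargmann-Fock space as a Hilbert space\<close>

lemma measurable_fock_fun [measurable]: "fock_fun u \<in> borel_measurable borel"
  using fock_fun_L2[of u] by (simp add: L2_def)

lemma integrable_fock_square: "integrable lborel (\<lambda>z. (norm (fock_fun u z))\<^sup>2)"
  using fock_fun_L2[of u] by (simp add: L2_def)

lemma norm_fock_square: "(norm u)\<^sup>2 = (\<integral>z. (norm (fock_fun u z))\<^sup>2 \<partial>lborel)"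
  unfolding norm_fock_def by (rule real_sqrt_pow2) (intro Bochner_Integration.integral_nonneg, simp)

lemma bargmann_proj_integrable:
  assumes "G \<in> L2" shows "integrable lborel (\<lambda>w. bkernel z w * G w)"
  using integrable_mult_right[OF L2_transform_integrable(1)[OF assms, of z],
      of "of_real (1 / pi * exp (- (norm z)\<^sup>2 / 2))"]
  by (simp only: bkernel_def mult.assoc)

lemma bargmann_proj_add:
  "G \<in> L2 \<Longrightarrow> H \<in> L2 \<Longrightarrow> bargmann_proj (\<lambda>w. G w + H w) z = bargmann_proj G z + bargmann_proj H z"
  unfolding bargmann_proj_eq distrib_left
  by (rule Bochner_Integration.integral_add; rule bargmann_proj_integrable)

lemma bargmann_proj_cmult: "bargmann_proj (\<lambda>w. c * G w) z = c * bargmann_proj G z"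
  unfolding bargmann_proj_eq by (simp only: mult.left_commute[of _ c] integral_mult_right_zero)

lemma L2_cmult: "G \<in> L2 \<Longrightarrow> (\<lambda>w. c * G w) \<in> L2"
  by (auto simp: L2_def norm_mult power_mult_distrib)

text \<open>Cauchy-Schwarz, as \<open>\<integral> \<bar>bkernel z w\<bar>\<^sup>2 dw = 1 / pi\<close> for
  every \<open>z\<close>.\<close>

lemma norm_bargmann_proj_pointwise:
  assumes "G \<in> L2"
  shows "(norm (bargmann_proj G z))\<^sup>2 \<le> (\<integral>w. (norm (G w))\<^sup>2 \<partial>lborel) / pi"
proof -
  have [measurable]: "G \<in> borel_measurable borel" and int: "integrable lborel (\<lambda>w. (norm (G w))\<^sup>2)"
    using assms by (auto simp: L2_def)
  have k: "(\<integral>\<^sup>+w. (ennreal (norm (bkernel z w)))\<^sup>2 \<partial>lborel) = ennreal (1 / pi)"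
  proof -
    have "(\<integral>\<^sup>+w. (ennreal (norm (bkernel z w)))\<^sup>2 \<partial>lborel) = (\<integral>\<^sup>+w. ennreal (exp (- (norm (z - w))\<^sup>2) / pi\<^sup>2) \<partial>lborel)"
    proof (intro nn_integral_cong)
      fix w
      have "(exp (- (norm (z - w))\<^sup>2 / 2) / pi)\<^sup>2 = exp (- (norm (z - w))\<^sup>2) / pi\<^sup>2"
        by (simp add: power_divide exp_double[symmetric])
      then show "(ennreal (norm (bkernel z w)))\<^sup>2 = ennreal (exp (- (norm (z - w))\<^sup>2) / pi\<^sup>2)"
        by (simp only: norm_bkernel) (simp add: ennreal_power)
    qed
    also have "\<dots> = (\<integral>\<^sup>+w. ennreal (exp (- (norm (w::complex))\<^sup>2) / pi\<^sup>2) \<partial>lborel)"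
      by (rule nn_integral_reflect[of "\<lambda>w. ennreal (exp (- (norm w)\<^sup>2) / pi\<^sup>2)"]) measurable
    also have "\<dots> = ennreal (\<integral>w. exp (- (norm (w::complex))\<^sup>2) / pi\<^sup>2 \<partial>lborel)"
      using integral_gaussian_complex by (intro nn_integral_eq_integral) (auto simp: has_bochner_integral_iff)
    also have "(\<integral>w. exp (- (norm (w::complex))\<^sup>2) / pi\<^sup>2 \<partial>lborel) = 1 / pi"
      using integral_gaussian_complex by (simp add: has_bochner_integral_iff power2_eq_square)
    finally show ?thesis .
  qed
  have "ennreal ((norm (bargmann_proj G z))\<^sup>2) = (ennreal (norm (bargmann_proj G z)))\<^sup>2" by (simp add: ennreal_power)
  also have "\<dots> \<le> (proj_major G z)\<^sup>2" by (intro power_mono norm_bargmann_proj_le) auto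
  also have "proj_major G z = (\<integral>\<^sup>+w. ennreal (norm (bkernel z w)) * ennreal (norm (G w)) \<partial>lborel)"
    unfolding proj_major_def by (simp add: norm_mult ennreal_mult)
  also have "\<dots>\<^sup>2 \<le> (\<integral>\<^sup>+w. (ennreal (norm (bkernel z w)))\<^sup>2 \<partial>lborel) * (\<integral>\<^sup>+w. (ennreal (norm (G w)))\<^sup>2 \<partial>lborel)"
    by (rule Cauchy_Schwarz_nn_integral) measurable
  also have "(\<integral>\<^sup>+w. (ennreal (norm (G w)))\<^sup>2 \<partial>lborel) = ennreal (\<integral>w. (norm (G w))\<^sup>2 \<partial>lborel)"
    by (subst nn_integral_eq_integral[OF int, symmetric]) (auto simp: ennreal_power)
  also have "(\<integral>\<^sup>+w. (ennreal (norm (bkernel z w)))\<^sup>2 \<partial>lborel) * ennreal (\<integral>w. (norm (G w))\<^sup>2 \<partial>lborel)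
      = ennreal ((\<integral>w. (norm (G w))\<^sup>2 \<partial>lborel) / pi)"
    unfolding k by (simp add: ennreal_mult[symmetric] Bochner_Integration.integral_nonneg)
  finally show ?thesis by (simp add: Bochner_Integration.integral_nonneg)
qed

text \<open>The \<open>L\<^sup>2\<close> norm controls point values, because elements of the Fock space
  reproduce themselves. This is the property that makes the cubic nonlinearity bounded.\<close>

lemma norm_fock_fun_le: "norm (fock_fun u z) \<le> norm u / sqrt pi"
proof -
  have "(norm (fock_fun u z))\<^sup>2 \<le> (norm u)\<^sup>2 / pi"
    using norm_bargmann_proj_pointwise[OF fock_fun_L2[of u], of z] bargmann_proj_fock[OF fock_fun[of u]]
    by (simp add: norm_fock_square)
  also have "\<dots> = (norm u / sqrt pi)\<^sup>2" by (simp add: power_divide)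
  finally show ?thesis by (rule power2_le_imp_le) simp
qed

lemma norm_fock_fun_square_le: "(norm (fock_fun u z))\<^sup>2 \<le> (norm u)\<^sup>2 / pi"
  using power_mono[OF norm_fock_fun_le[of u z] norm_ge_zero, of 2] by (simp add: power_divide)

lemma L2_Fatou:
  assumes meas: "\<And>n. G n \<in> borel_measurable borel" and lim: "\<And>z. (\<lambda>n. G n z) \<longlonglongrightarrow> H z"
    and le: "\<forall>\<^sub>F n in sequentially. G n \<in> L2 \<and> (\<integral>z. (norm (G n z))\<^sup>2 \<partial>lborel) \<le> B"
  shows "H \<in> L2" "(\<integral>z. (norm (H z))\<^sup>2 \<partial>lborel) \<le> B"
proof -
  note meas [measurable]
  have H [measurable]: "H \<in> borel_measurable borel" by (rule borel_measurable_LIMSEQ_metric[OF meas lim])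
  obtain n0 where n0: "G n0 \<in> L2" "(\<integral>z. (norm (G n0 z))\<^sup>2 \<partial>lborel) \<le> B" using eventually_happens[OF le] by auto
  have "0 \<le> (\<integral>z. (norm (G n0 z))\<^sup>2 \<partial>lborel)" by (intro Bochner_Integration.integral_nonneg) simp
  then have B: "B \<ge> 0" using n0 by linarith
  have "(\<integral>\<^sup>+z. ennreal ((norm (H z))\<^sup>2) \<partial>lborel) = (\<integral>\<^sup>+z. liminf (\<lambda>n. ennreal ((norm (G n z))\<^sup>2)) \<partial>lborel)"
  proof (intro nn_integral_cong)
    fix z
    have "(\<lambda>n. ennreal ((norm (G n z))\<^sup>2)) \<longlonglongrightarrow> ennreal ((norm (H z))\<^sup>2)" by (intro tendsto_intros lim)
    from lim_imp_Liminf[OF sequentially_bot this]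
    show "ennreal ((norm (H z))\<^sup>2) = liminf (\<lambda>n. ennreal ((norm (G n z))\<^sup>2))" by simp
  qed
  also have "\<dots> \<le> liminf (\<lambda>n. \<integral>\<^sup>+z. ennreal ((norm (G n z))\<^sup>2) \<partial>lborel)"
    by (rule nn_integral_liminf) measurable
  also have "\<dots> \<le> liminf (\<lambda>n. ennreal B)"
  proof (rule Liminf_mono)
    show "\<forall>\<^sub>F n in sequentially. (\<integral>\<^sup>+z. ennreal ((norm (G n z))\<^sup>2) \<partial>lborel) \<le> ennreal B"
      using le
    proof eventually_elim
      case (elim n)
      then have "(\<integral>\<^sup>+z. ennreal ((norm (G n z))\<^sup>2) \<partial>lborel) = ennreal (\<integral>z. (norm (G n z))\<^sup>2 \<partial>lborel)"
        by (intro nn_integral_eq_integral) (auto simp: L2_def)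
      then show ?case using elim by (simp add: ennreal_leI)
    qed
  qed
  also have "\<dots> = ennreal B" by (simp add: Liminf_const)
  finally have le': "(\<integral>\<^sup>+z. ennreal ((norm (H z))\<^sup>2) \<partial>lborel) \<le> ennreal B" .
  then have int: "integrable lborel (\<lambda>z. (norm (H z))\<^sup>2)"
    unfolding integrable_iff_bounded by (auto simp: order_le_less_trans[OF _ ennreal_less_top])
  then show "H \<in> L2" by (simp add: L2_def)
  have "(\<integral>\<^sup>+z. ennreal ((norm (H z))\<^sup>2) \<partial>lborel) = ennreal (\<integral>z. (norm (H z))\<^sup>2 \<partial>lborel)"
    by (intro nn_integral_eq_integral int) auto
  then show "(\<integral>z. (norm (H z))\<^sup>2 \<partial>lborel) \<le> B" using le' B by simp
qed

text \<open>A Cauchy sequence converges pointwise, because the norm controls point values. By Fatou's lemma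
  the limit is square integrable and the convergence holds in \<open>L\<^sup>2\<close> as well.
  The projection of a square integrable function at a point depends continuously on that function,
  so the reproducing formula passes to the limit and places it in the Fock space.\<close>

instance fock :: complete_space
proof
  fix X :: "nat \<Rightarrow> fock" assume X: "Cauchy X"
  have pt: "norm (fock_fun (X m) z - fock_fun (X n) z) \<le> norm (X m - X n)" for m n z
  proof -
    have "norm (fock_fun (X m - X n) z) \<le> norm (X m - X n) / sqrt pi" by (rule norm_fock_fun_le)
    also have "\<dots> \<le> norm (X m - X n)"
      using pi_ge_two by (simp add: divide_le_eq real_le_rsqrt mult_le_cancel_left1)
    finally show ?thesis by simp
  qed
  have "Cauchy (\<lambda>n. fock_fun (X n) z)" for z
    unfolding Cauchy_def
  proof (intro allI impI)
    fix e :: real assume "e > 0"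
    then obtain M where "\<And>m n. m \<ge> M \<Longrightarrow> n \<ge> M \<Longrightarrow> dist (X m) (X n) < e" using X unfolding Cauchy_def by metis
    then show "\<exists>M. \<forall>m\<ge>M. \<forall>n\<ge>M. dist (fock_fun (X m) z) (fock_fun (X n) z) < e"
      using pt order_le_less_trans unfolding dist_norm by blast
  qed
  then have "\<exists>l. (\<lambda>n. fock_fun (X n) z) \<longlonglongrightarrow> l" for z
    using Cauchy_convergent by (auto simp: convergent_def)
  then obtain U where U: "\<And>z. (\<lambda>n. fock_fun (X n) z) \<longlonglongrightarrow> U z" by metis
  have close: "(\<lambda>z. U z - fock_fun (X n) z) \<in> L2 \<and> (\<integral>z. (norm (U z - fock_fun (X n) z))\<^sup>2 \<partial>lborel) \<le> e\<^sup>2"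
    if n: "\<And>m. m \<ge> n \<Longrightarrow> norm (X m - X n) \<le> e" for n e
  proof -
    have lim: "(\<lambda>m. fock_fun (X m - X n) z) \<longlonglongrightarrow> U z - fock_fun (X n) z" for z
      by (simp, intro tendsto_intros U)
    have "\<forall>\<^sub>F m in sequentially. fock_fun (X m - X n) \<in> L2 \<and> (\<integral>z. (norm (fock_fun (X m - X n) z))\<^sup>2 \<partial>lborel) \<le> e\<^sup>2"
      using eventually_ge_at_top[of n]
    proof eventually_elim
      case (elim m)
      have "(norm (X m - X n))\<^sup>2 \<le> e\<^sup>2" using n[OF elim] by (intro power_mono) auto
      then show ?case using fock_fun_L2 unfolding norm_fock_square by blast
    qed
    from L2_Fatou[OF measurable_fock_fun lim this] show ?thesis by blast
  qed
  have ev: "\<exists>n0. \<forall>n\<ge>n0. \<forall>m\<ge>n. norm (X m - X n) \<le> e" if "e > 0" for e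
    using X that unfolding Cauchy_def dist_norm by (meson less_imp_le order_trans)
  obtain n1 where "\<forall>m\<ge>n1. norm (X m - X n1) \<le> 1" using ev[of 1] by auto
  then have "(\<lambda>z. U z - fock_fun (X n1) z) \<in> L2" using close[of n1 1] by blast
  then have UL2: "U \<in> L2" using L2_add[OF _ fock_fun_L2[of "X n1"]] by fastforce
  have "bargmann_proj U z = U z" for z
  proof (rule LIMSEQ_unique[OF _ U])
    show "(\<lambda>n. fock_fun (X n) z) \<longlonglongrightarrow> bargmann_proj U z"
    proof (rule LIMSEQ_I)
      fix r :: real assume "r > 0"
      then obtain n0 where n0: "\<forall>n\<ge>n0. \<forall>m\<ge>n. norm (X m - X n) \<le> r / 2" using ev[of "r / 2"] by auto
      have "norm (fock_fun (X n) z - bargmann_proj U z) < r" if "n \<ge> n0" for n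
      proof -
        have c: "(\<lambda>z. U z - fock_fun (X n) z) \<in> L2" "(\<integral>z. (norm (U z - fock_fun (X n) z))\<^sup>2 \<partial>lborel) \<le> (r / 2)\<^sup>2"
          using close[of n "r / 2"] n0 that by auto
        have "bargmann_proj U z = bargmann_proj (\<lambda>z. U z - fock_fun (X n) z) z + fock_fun (X n) z"
          using bargmann_proj_add[OF c(1) fock_fun_L2[of "X n"], of z] bargmann_proj_fock[OF fock_fun[of "X n"], of z] by simp
        then have "norm (fock_fun (X n) z - bargmann_proj U z) = norm (bargmann_proj (\<lambda>z. U z - fock_fun (X n) z) z)"
          by (simp add: norm_minus_commute)
        moreover have "(norm (bargmann_proj (\<lambda>z. U z - fock_fun (X n) z) z))\<^sup>2 \<le> (r / 2)\<^sup>2"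
        proof -
          have "(norm (bargmann_proj (\<lambda>z. U z - fock_fun (X n) z) z))\<^sup>2 \<le> (\<integral>z. (norm (U z - fock_fun (X n) z))\<^sup>2 \<partial>lborel) / pi"
            by (rule norm_bargmann_proj_pointwise[OF c(1)])
          also have "\<dots> \<le> (\<integral>z. (norm (U z - fock_fun (X n) z))\<^sup>2 \<partial>lborel) / 1"
            using pi_ge_two by (intro divide_left_mono Bochner_Integration.integral_nonneg) auto
          finally show ?thesis using c(2) by simp
        qed
        then have "norm (bargmann_proj (\<lambda>z. U z - fock_fun (X n) z) z) \<le> r / 2"
          by (rule power2_le_imp_le) (use \<open>r > 0\<close> in simp)
        ultimately show ?thesis using \<open>r > 0\<close> by simp
      qed
      then show "\<exists>no. \<forall>n\<ge>no. norm (fock_fun (X n) z - bargmann_proj U z) < r" by blast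
    qed
  qed
  then have "U = bargmann_proj U" by auto
  then have UF: "U \<in> bargmann_fock" using bargmann_proj_in_fock[OF UL2] by simp
  have "X \<longlonglongrightarrow> Abs_fock U"
  proof (rule LIMSEQ_I)
    fix r :: real assume "r > 0"
    then obtain n0 where n0: "\<forall>n\<ge>n0. \<forall>m\<ge>n. norm (X m - X n) \<le> r / 2" using ev[of "r / 2"] by auto
    have "norm (X n - Abs_fock U) < r" if "n \<ge> n0" for n
    proof -
      have "(norm (Abs_fock U - X n))\<^sup>2 \<le> (r / 2)\<^sup>2"
        using close[of n "r / 2"] n0 that by (simp add: norm_fock_square Abs_fock_inverse[OF UF])
      then have "norm (Abs_fock U - X n) \<le> r / 2" by (rule power2_le_imp_le) (use \<open>r > 0\<close> in simp)
      then show ?thesis using \<open>r > 0\<close> by (simp add: norm_minus_commute)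
    qed
    then show "\<exists>no. \<forall>n\<ge>no. norm (X n - Abs_fock U) < r" by blast
  qed
  then show "convergent X" by (auto simp: convergent_def)
qed

instance fock :: banach ..

text \<open>The type is a real vector space only; multiplication by \<open>\<i>\<close> has to be added.\<close>

definition fock_cmult :: "complex \<Rightarrow> fock \<Rightarrow> fock"
  where "fock_cmult c u = Abs_fock (\<lambda>z. c * fock_fun u z)"

lemma fock_fun_cmult [simp]: "fock_fun (fock_cmult c u) = (\<lambda>z. c * fock_fun u z)"
proof -
  obtain f where f: "f holomorphic_on UNIV" "fock_fun u = (\<lambda>z. of_real (exp (- (norm z)\<^sup>2 / 2)) * f z)"
    using fock_fun[of u] by (rule bargmann_fockE)
  have "(\<lambda>z. c * f z) holomorphic_on UNIV" using f by (intro holomorphic_intros)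
  moreover have "(\<lambda>z. c * fock_fun u z) = (\<lambda>z. of_real (exp (- (norm z)\<^sup>2 / 2)) * (c * f z))"
    unfolding f(2) by (simp add: ac_simps)
  moreover have "(\<lambda>z. c * fock_fun u z) \<in> L2" by (rule L2_cmult[OF fock_fun_L2])
  ultimately have "(\<lambda>z. c * fock_fun u z) \<in> bargmann_fock" unfolding bargmann_fock_def by blast
  then show ?thesis by (simp add: fock_cmult_def Abs_fock_inverse)
qed

lemma fock_eqI: "(\<And>z. fock_fun u z = fock_fun v z) \<Longrightarrow> u = v"
  by (auto simp: fock_fun_inject[symmetric])

lemma norm_fock_cmult: "norm (fock_cmult c u) = norm c * norm u"
proof -
  have "(norm (fock_cmult c u))\<^sup>2 = (norm c * norm u)\<^sup>2"
    unfolding norm_fock_square power_mult_distrib by (simp add: norm_mult power_mult_distrib)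
  then show ?thesis by simp
qed

definition fock_proj :: "(complex \<Rightarrow> complex) \<Rightarrow> fock" where "fock_proj G = Abs_fock (bargmann_proj G)"

lemma fock_fun_proj: "G \<in> L2 \<Longrightarrow> fock_fun (fock_proj G) = bargmann_proj G"
  by (simp add: fock_proj_def Abs_fock_inverse bargmann_proj_in_fock)

lemma norm_fock_proj_le:
  assumes "G \<in> L2" shows "(norm (fock_proj G))\<^sup>2 \<le> (schur_const 0)\<^sup>2 * (\<integral>z. (norm (G z))\<^sup>2 \<partial>lborel)"
  using bargmann_proj_weighted(2)[OF order_refl moderate_const, of G] assms
  by (simp add: norm_fock_square fock_fun_proj) (simp add: L2_def)

lemma integrable_L2_mult:
  assumes "G \<in> L2" "H \<in> L2" shows "integrable lborel (\<lambda>z. G z * cnj (H z))"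
proof (rule Bochner_Integration.integrable_bound)
  have [measurable]: "G \<in> borel_measurable borel" "H \<in> borel_measurable borel" using assms by (auto simp: L2_def)
  show "integrable lborel (\<lambda>z. (norm (G z))\<^sup>2 + (norm (H z))\<^sup>2)" using assms by (auto simp: L2_def)
  show "(\<lambda>z. G z * cnj (H z)) \<in> borel_measurable lborel" by measurable
  show "AE z in lborel. norm (G z * cnj (H z)) \<le> norm ((norm (G z))\<^sup>2 + (norm (H z))\<^sup>2)"
    by (intro AE_I2) (simp add: norm_mult mult_le_sum_squares)
qed

lemma inner_fock_eq: "inner u v = Re (\<integral>z. fock_fun u z * cnj (fock_fun v z) \<partial>lborel)"
proof -
  have "inner u v = (\<integral>z. Re (fock_fun u z * cnj (fock_fun v z)) \<partial>lborel)"
    unfolding inner_fock_def by (simp add: inner_complex_def)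
  also have "\<dots> = Re (\<integral>z. fock_fun u z * cnj (fock_fun v z) \<partial>lborel)"
    by (rule integral_Re[OF integrable_L2_mult[OF fock_fun_L2 fock_fun_L2]])
  finally show ?thesis .
qed

lemma integral_proj_mult_cnj:
  assumes "G \<in> L2"
  shows "(\<integral>z. bargmann_proj G z * cnj (fock_fun u z) \<partial>lborel) = (\<integral>z. G z * cnj (fock_fun u z) \<partial>lborel)"
  using bargmann_proj_self_adjoint[OF order_refl moderate_const, of G "fock_fun u"] assms
    integrable_fock_square[of u] bargmann_proj_fock[OF fock_fun[of u]]
  by (simp add: L2_def)

lemma inner_fock_proj:
  "G \<in> L2 \<Longrightarrow> inner (fock_proj G) u = Re (\<integral>z. G z * cnj (fock_fun u z) \<partial>lborel)"
  by (simp add: inner_fock_eq fock_fun_proj integral_proj_mult_cnj)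

section \<open>The cubic nonlinearity\<close>

text \<open>The conjugate in the middle makes \<open>triple v v u\<close> equal to
  \<open>\<bar>v\<bar>\<^sup>2 u\<close> and keeps real linearity in each argument.\<close>

definition triple :: "fock \<Rightarrow> fock \<Rightarrow> fock \<Rightarrow> complex \<Rightarrow> complex"
  where "triple a b c z = fock_fun a z * cnj (fock_fun b z) * fock_fun c z"

lemma measurable_triple [measurable]: "triple a b c \<in> borel_measurable borel"
  unfolding triple_def[abs_def] by measurable

lemma norm_triple_le: "norm (triple a b c z) \<le> norm a * norm b / pi * norm (fock_fun c z)"
proof -
  have "norm (triple a b c z) = norm (fock_fun a z) * norm (fock_fun b z) * norm (fock_fun c z)"
    by (simp add: triple_def norm_mult)
  also have "\<dots> \<le> (norm a / sqrt pi) * (norm b / sqrt pi) * norm (fock_fun c z)"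
    by (intro mult_mono norm_fock_fun_le mult_nonneg_nonneg) auto
  also have "\<dots> = norm a * norm b / pi * norm (fock_fun c z)" by (simp add: field_simps real_sqrt_mult_self)
  finally show ?thesis .
qed

text \<open>The last factor carries the weight, the other two are bounded by their norms.\<close>

lemma triple_weighted:
  assumes [measurable]: "\<omega> \<in> borel_measurable borel" and "\<And>z. 0 \<le> \<omega> z"
    and int: "integrable lborel (\<lambda>z. (\<omega> z * norm (fock_fun c z))\<^sup>2)"
  shows "integrable lborel (\<lambda>z. (\<omega> z * norm (triple a b c z))\<^sup>2)"
    and "(\<integral>z. (\<omega> z * norm (triple a b c z))\<^sup>2 \<partial>lborel) \<le> (norm a * norm b / pi)\<^sup>2 * (\<integral>z. (\<omega> z * norm (fock_fun c z))\<^sup>2 \<partial>lborel)"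
proof -
  have le: "(\<omega> z * norm (triple a b c z))\<^sup>2 \<le> (norm a * norm b / pi)\<^sup>2 * (\<omega> z * norm (fock_fun c z))\<^sup>2" for z
  proof -
    have "\<omega> z * norm (triple a b c z) \<le> \<omega> z * (norm a * norm b / pi * norm (fock_fun c z))"
      using assms(2) by (intro mult_left_mono norm_triple_le)
    then have "(\<omega> z * norm (triple a b c z))\<^sup>2 \<le> (\<omega> z * (norm a * norm b / pi * norm (fock_fun c z)))\<^sup>2"
      using assms(2) by (intro power_mono) auto
    also have "\<dots> = (norm a * norm b / pi)\<^sup>2 * (\<omega> z * norm (fock_fun c z))\<^sup>2" by (simp only: power_mult_distrib ac_simps)
    finally show ?thesis .
  qed
  show int': "integrable lborel (\<lambda>z. (\<omega> z * norm (triple a b c z))\<^sup>2)"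
  proof (rule Bochner_Integration.integrable_bound)
    show "integrable lborel (\<lambda>z. (norm a * norm b / pi)\<^sup>2 * (\<omega> z * norm (fock_fun c z))\<^sup>2)" by (intro integrable_mult_right int)
    show "AE z in lborel. norm ((\<omega> z * norm (triple a b c z))\<^sup>2) \<le> norm ((norm a * norm b / pi)\<^sup>2 * (\<omega> z * norm (fock_fun c z))\<^sup>2)"
      using le by (intro AE_I2) (simp only: real_norm_def abs_of_nonneg zero_le_power2 mult_nonneg_nonneg)
  qed measurable
  have "(\<integral>z. (\<omega> z * norm (triple a b c z))\<^sup>2 \<partial>lborel) \<le> (\<integral>z. (norm a * norm b / pi)\<^sup>2 * (\<omega> z * norm (fock_fun c z))\<^sup>2 \<partial>lborel)"
    by (intro integral_mono int' integrable_mult_right int le)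
  then show "(\<integral>z. (\<omega> z * norm (triple a b c z))\<^sup>2 \<partial>lborel) \<le> (norm a * norm b / pi)\<^sup>2 * (\<integral>z. (\<omega> z * norm (fock_fun c z))\<^sup>2 \<partial>lborel)"
    by (simp only: integral_mult_right_zero)
qed

lemma triple_L2: "triple a b c \<in> L2"
  using triple_weighted(1)[of "\<lambda>z. 1" c a b] integrable_fock_square[of c] by (simp add: L2_def)

definition cubic :: "fock \<Rightarrow> fock \<Rightarrow> fock \<Rightarrow> fock" where "cubic a b c = fock_proj (triple a b c)"

lemma fock_fun_cubic: "fock_fun (cubic a b c) = bargmann_proj (triple a b c)"
  by (simp add: cubic_def fock_fun_proj triple_L2)

lemma norm_cubic_le: "norm (cubic a b c) \<le> \<bar>schur_const 0\<bar> / pi * norm a * norm b * norm c"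
proof -
  have "(norm (cubic a b c))\<^sup>2 \<le> (schur_const 0)\<^sup>2 * (\<integral>z. (norm (triple a b c z))\<^sup>2 \<partial>lborel)"
    unfolding cubic_def by (rule norm_fock_proj_le[OF triple_L2])
  also have "\<dots> \<le> (schur_const 0)\<^sup>2 * ((norm a * norm b / pi)\<^sup>2 * (norm c)\<^sup>2)"
    using triple_weighted(2)[of "\<lambda>z. 1" c a b] integrable_fock_square[of c]
    by (intro mult_left_mono) (auto simp: norm_fock_square)
  also have "\<dots> = (\<bar>schur_const 0\<bar> / pi * norm a * norm b * norm c)\<^sup>2" by (simp add: power_mult_distrib power_divide)
  finally show ?thesis by (rule power2_le_imp_le) simp
qed

lemma cubic_addI:
  assumes "triple a b c = (\<lambda>w. triple a' b' c' w + triple a'' b'' c'' w)"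
  shows "cubic a b c = cubic a' b' c' + cubic a'' b'' c''"
proof (rule fock_eqI)
  show "fock_fun (cubic a b c) z = fock_fun (cubic a' b' c' + cubic a'' b'' c'') z" for z
    unfolding fock_fun_add fock_fun_cubic assms by (rule bargmann_proj_add[OF triple_L2 triple_L2])
qed

lemma cubic_add: "cubic (a + a') b c = cubic a b c + cubic a' b c" "cubic a (b + b') c = cubic a b c + cubic a b' c"
    "cubic a b (c + c') = cubic a b c + cubic a b c'"
  by (rule cubic_addI, simp add: fun_eq_iff triple_def distrib_left distrib_right)+

lemma cubic_scaleRI:
  assumes "triple a b c = (\<lambda>w. of_real r * triple a' b' c' w)"
  shows "cubic a b c = r *\<^sub>R cubic a' b' c'"
proof (rule fock_eqI)
  show "fock_fun (cubic a b c) z = fock_fun (r *\<^sub>R cubic a' b' c') z" for z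
    unfolding fock_fun_scaleR fock_fun_cubic assms scaleR_conv_of_real by (rule bargmann_proj_cmult)
qed

lemma cubic_scaleR: "cubic (r *\<^sub>R a) b c = r *\<^sub>R cubic a b c" "cubic a (r *\<^sub>R b) c = r *\<^sub>R cubic a b c"
    "cubic a b (r *\<^sub>R c) = r *\<^sub>R cubic a b c"
  by (rule cubic_scaleRI, simp add: fun_eq_iff triple_def scaleR_conv_of_real)+

lemma inner_cubic: "inner (cubic a b c) u = Re (\<integral>z. triple a b c z * cnj (fock_fun u z) \<partial>lborel)"
  unfolding cubic_def by (rule inner_fock_proj[OF triple_L2])

lemma inner_cmult_cubic:
  "inner (fock_cmult k (cubic a b c)) u = Re (k * (\<integral>z. triple a b c z * cnj (fock_fun u z) \<partial>lborel))"
  by (simp add: inner_fock_eq fock_fun_cubic mult.assoc integral_proj_mult_cnj[OF triple_L2])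

section \<open>The system as an ordinary differential equation\<close>

text \<open>Averaging over the permutations of the arguments changes neither the diagonal, and with it the
  vector field, nor the bound.\<close>

lemma cubic_field_symmetrised:
  fixes S :: "'e::{real_inner,banach} \<Rightarrow> 'e \<Rightarrow> 'e \<Rightarrow> 'e"
  assumes add: "\<And>a a' b c. S (a + a') b c = S a b c + S a' b c" "\<And>a b b' c. S a (b + b') c = S a b c + S a b' c"
      "\<And>a b c c'. S a b (c + c') = S a b c + S a b c'"
    and scale: "\<And>r a b c. S (r *\<^sub>R a) b c = r *\<^sub>R S a b c" "\<And>r a b c. S a (r *\<^sub>R b) c = r *\<^sub>R S a b c"
      "\<And>r a b c. S a b (r *\<^sub>R c) = r *\<^sub>R S a b c"
    and bound: "\<And>a b c. norm (S a b c) \<le> K * norm a * norm b * norm c" and "K \<ge> 0"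
    and orth: "\<And>a. inner a (S a a a) = 0"
  obtains T where "cubic_field T K" "\<And>a. T a a a = S a a a"
proof -
  define T where "T a b c = (1 / 6) *\<^sub>R (S a b c + S a c b + S b a c + S b c a + S c a b + S c b a)" for a b c
  have diag: "T a a a = S a a a" for a
  proof -
    have "(1 + 1 + 1 + 1 + 1 + 1 :: real) *\<^sub>R S a a a = S a a a + S a a a + S a a a + S a a a + S a a a + S a a a"
      by (simp only: scaleR_add_left scaleR_one)
    then have "S a a a + S a a a + S a a a + S a a a + S a a a + S a a a = 6 *\<^sub>R S a a a" by simp
    then show ?thesis by (simp add: T_def)
  qed
  have "cubic_field T K"
  proof (rule cubic_field.intro)
    show "linear (\<lambda>a. T a b c)" for b c
      by (rule linearI) (simp_all add: T_def add scale algebra_simps)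
    show "T a b c = T b a c" "T a b c = T a c b" for a b c
      unfolding T_def by (simp_all add: add.commute add.left_commute)
    show "norm (T a b c) \<le> K * norm a * norm b * norm c" for a b c
    proof -
      let ?B = "K * norm a * norm b * norm c"
      have "norm (S a b c + S a c b + S b a c + S b c a + S c a b + S c b a) \<le> ?B + ?B + ?B + ?B + ?B + ?B"
        by (intro norm_triangle_mono order_trans[OF bound]) (simp_all add: ac_simps)
      then show ?thesis by (simp add: T_def)
    qed
  qed (use \<open>K \<ge> 0\<close> orth diag in auto)
  then show thesis using diag by (rule that)
qed

text \<open>A trilinear form whose diagonal is the right-hand side of the system, solved for the time
  derivative.\<close>

definition nls_form :: "real \<Rightarrow> fock \<times> fock \<Rightarrow> fock \<times> fock \<Rightarrow> fock \<times> fock \<Rightarrow> fock \<times> fock"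
  where "nls_form \<sigma> p q r = (fock_cmult (- \<i>) (cubic (snd p) (snd q) (fst r)),
     fock_cmult (- \<i> * of_real \<sigma>) (cubic (fst p) (fst q) (snd r)))"

lemma fock_cmult_add: "fock_cmult c (u + v) = fock_cmult c u + fock_cmult c v"
  by (rule fock_eqI) (simp add: distrib_left)

lemma fock_cmult_scaleR: "fock_cmult c (r *\<^sub>R u) = r *\<^sub>R fock_cmult c u"
  by (rule fock_eqI) simp

lemma inner_fock_cmult_imaginary: "Re k = 0 \<Longrightarrow> inner u (fock_cmult k u) = 0"
proof -
  assume "Re k = 0"
  have eq: "fock_fun u z * cnj (k * fock_fun u z) = cnj k * of_real ((norm (fock_fun u z))\<^sup>2)" for z
    unfolding complex_norm_square by (simp add: ac_simps)
  have "inner u (fock_cmult k u) = Re (\<integral>z. cnj k * of_real ((norm (fock_fun u z))\<^sup>2) \<partial>lborel)"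
    unfolding inner_fock_eq fock_fun_cmult eq ..
  also have "(\<integral>z. cnj k * of_real ((norm (fock_fun u z))\<^sup>2) \<partial>lborel) = cnj k * of_real (\<integral>z. (norm (fock_fun u z))\<^sup>2 \<partial>lborel)"
    by (simp only: integral_mult_right_zero integral_complex_of_real)
  finally show ?thesis using \<open>Re k = 0\<close> by simp
qed

lemma inner_cubic_cong:
  assumes "\<And>z. Re (triple a b c z * cnj (fock_fun d z)) = Re (triple a' b' c' z * cnj (fock_fun d' z))"
  shows "inner (cubic a b c) d = inner (cubic a' b' c') d'"
  unfolding inner_cubic integral_Re[OF integrable_L2_mult[OF triple_L2 fock_fun_L2], symmetric] assms ..

text \<open>The projection moves onto \<open>u\<close>, which it fixes. What remains is an imaginary
  multiple of the integral of \<open>\<bar>u\<bar>\<^sup>2 \<bar>v\<bar>\<^sup>2\<close>.\<close>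

lemma inner_cubic_self:
  assumes "Re k = 0" shows "inner (fock_cmult k (cubic v v u)) u = 0"
proof -
  have eq: "triple v v u z * cnj (fock_fun u z) = of_real ((norm (fock_fun v z))\<^sup>2 * (norm (fock_fun u z))\<^sup>2)" for z
    unfolding triple_def of_real_mult complex_norm_square by (simp add: ac_simps)
  show ?thesis unfolding inner_cmult_cubic eq using assms by (simp add: integral_complex_of_real del: of_real_mult of_real_power)
qed

text \<open>Each component of the right-hand side is orthogonal to the corresponding component of the
  position.\<close>

lemma nls_form_cubic_field:
  obtains T K where "cubic_field T K" "\<And>a. T a a a = nls_form \<sigma> a a a"
proof -
  define C where "C = \<bar>schur_const 0\<bar> / pi"
  define K where "K = C + \<bar>\<sigma>\<bar> * C"
  have C0: "C \<ge> 0" by (simp add: C_def)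
  obtain T where "cubic_field T K" "\<And>a. T a a a = nls_form \<sigma> a a a"
  proof (rule cubic_field_symmetrised[of "nls_form \<sigma>" K])
    show "norm (nls_form \<sigma> a b c) \<le> K * norm a * norm b * norm c" for a b c
    proof -
      have f: "norm (fst p) \<le> norm p" "norm (snd p) \<le> norm p" for p :: "fock \<times> fock"
        using norm_fst_le[of "fst p" "snd p"] norm_snd_le[of "snd p" "fst p"] by simp_all
      have "norm (nls_form \<sigma> a b c) \<le> norm (cubic (snd a) (snd b) (fst c)) + \<bar>\<sigma>\<bar> * norm (cubic (fst a) (fst b) (snd c))"
        unfolding nls_form_def norm_Pair by (rule order_trans[OF sqrt_sum_squares_le_sum]) (auto simp: norm_fock_cmult norm_mult)
      also have "\<dots> \<le> C * norm a * norm b * norm c + \<bar>\<sigma>\<bar> * (C * norm a * norm b * norm c)"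
        using C0 f
        by (intro add_mono mult_left_mono order_trans[OF norm_cubic_le[folded C_def]] mult_mono) auto
      finally show ?thesis by (simp add: K_def algebra_simps)
    qed
    show "inner a (nls_form \<sigma> a a a) = 0" for a
      using inner_cubic_self[of "- \<i>" "snd a" "fst a"] inner_cubic_self[of "- \<i> * of_real \<sigma>" "fst a" "snd a"]
      by (simp add: nls_form_def inner_prod_def inner_commute)
  qed (use C0 in \<open>simp_all add: nls_form_def cubic_add cubic_scaleR fock_cmult_add fock_cmult_scaleR K_def\<close>)
  then show ?thesis using that by blast
qed

lemma nls_flow:
  obtains \<Phi> :: "real \<times> fock \<times> fock \<Rightarrow> fock \<times> fock" where "C_infinity \<Phi>" "\<And>x. \<Phi> (0, x) = x"
    "\<And>x t. ((\<lambda>t. \<Phi> (t, x)) has_vector_derivative nls_form \<sigma> (\<Phi> (t, x)) (\<Phi> (t, x)) (\<Phi> (t, x))) (at t)"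
    "\<And>X t. (\<And>t. (X has_vector_derivative nls_form \<sigma> (X t) (X t) (X t)) (at t)) \<Longrightarrow> X t = \<Phi> (t, X 0)"
proof -
  obtain T K where T: "cubic_field T K" and diag: "\<And>a. T a a a = nls_form \<sigma> a a a"
    using nls_form_cubic_field[of \<sigma>] by blast
  interpret cubic_field T K by (rule T)
  show thesis
  proof (rule that[of flow])
    show "((\<lambda>t. flow (t, x)) has_vector_derivative nls_form \<sigma> (flow (t, x)) (flow (t, x)) (flow (t, x))) (at t)" for x t
      unfolding diag[symmetric] by (rule flow_has_vector_derivative)
    show "X t = flow (t, X 0)" if "\<And>t. (X has_vector_derivative nls_form \<sigma> (X t) (X t) (X t)) (at t)" for X t
      by (rule flow_unique) (simp add: diag that)
  qed (rule C_infinity_flow flow_0)+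
qed

lemma has_vector_derivative_Pair_iff:
  "((\<lambda>t. (u t, v t)) has_vector_derivative (u', v')) (at t) \<longleftrightarrow>
    (u has_vector_derivative u') (at t) \<and> (v has_vector_derivative v') (at t)"
proof
  assume "((\<lambda>t. (u t, v t)) has_vector_derivative (u', v')) (at t)"
  from bounded_linear.has_vector_derivative[OF bounded_linear_fst this]
    bounded_linear.has_vector_derivative[OF bounded_linear_snd this]
  show "(u has_vector_derivative u') (at t) \<and> (v has_vector_derivative v') (at t)" by simp
next
  assume "(u has_vector_derivative u') (at t) \<and> (v has_vector_derivative v') (at t)"
  then show "((\<lambda>t. (u t, v t)) has_vector_derivative (u', v')) (at t)"
    by (intro has_vector_derivative_Pair) auto
qed

lemma nls_equation_iff:
  "(\<forall>z. \<i> * fock_fun w z = k * bargmann_proj (\<lambda>y. of_real ((norm (fock_fun b y))\<^sup>2) * fock_fun a y) z) \<longleftrightarrow>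
    w = fock_cmult (- \<i> * k) (cubic b b a)"
proof -
  have eq: "(\<lambda>y. of_real ((norm (fock_fun b y))\<^sup>2) * fock_fun a y) = triple b b a"
    unfolding complex_norm_square by (simp add: triple_def fun_eq_iff)
  have "\<i> * x = k * y \<longleftrightarrow> x = - \<i> * k * y" for x y :: complex
  proof
    assume "\<i> * x = k * y"
    then have "- \<i> * (\<i> * x) = - \<i> * (k * y)" by simp
    then show "x = - \<i> * k * y" by (simp add: mult.assoc[symmetric])
  qed (simp add: mult.assoc[symmetric])
  then show ?thesis unfolding eq fock_fun_cubic[symmetric]
    by (auto intro: fock_eqI)
qed

text \<open>The vector derivatives in the definition exist because the curve is smooth, so that the
  pointwise identities become differential equations in the Fock space.\<close>

lemma is_solution_iff:
  "is_solution \<sigma> u0 v0 u v \<longleftrightarrow> C_infinity (\<lambda>t. (u t, v t)) \<and>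
    (\<forall>t. (u has_vector_derivative fock_cmult (- \<i>) (cubic (v t) (v t) (u t))) (at t)) \<and>
    (\<forall>t. (v has_vector_derivative fock_cmult (- \<i> * of_real \<sigma>) (cubic (u t) (u t) (v t))) (at t)) \<and>
    u 0 = u0 \<and> v 0 = v0"
proof -
  have eq: "(\<forall>t z. \<i> * fock_fun (vector_derivative u (at t)) z =
       bargmann_proj (\<lambda>w. of_real ((norm (fock_fun (v t) w))\<^sup>2) * fock_fun (u t) w) z) \<longleftrightarrow>
       (\<forall>t. vector_derivative u (at t) = fock_cmult (- \<i>) (cubic (v t) (v t) (u t)))"
    using nls_equation_iff[of "vector_derivative u (at _)" 1 "v _" "u _"] by simp
  have eq': "(\<forall>t z. \<i> * fock_fun (vector_derivative v (at t)) z =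
       of_real \<sigma> * bargmann_proj (\<lambda>w. of_real ((norm (fock_fun (u t) w))\<^sup>2) * fock_fun (v t) w) z) \<longleftrightarrow>
       (\<forall>t. vector_derivative v (at t) = fock_cmult (- \<i> * of_real \<sigma>) (cubic (u t) (u t) (v t)))"
    using nls_equation_iff[of "vector_derivative v (at _)" "of_real \<sigma>" "u _" "v _"] by simp
  have der: "(u has_vector_derivative vector_derivative u (at t)) (at t) \<and> (v has_vector_derivative vector_derivative v (at t)) (at t)"
    if "C_infinity (\<lambda>t. (u t, v t))" for t
  proof -
    have "((\<lambda>t. (u t, v t)) has_vector_derivative vector_derivative (\<lambda>t. (u t, v t)) (at t)) (at t)"
      using C_infinity_imp_differentiable[OF that] vector_derivative_works by blast
    then have "(u has_vector_derivative fst (vector_derivative (\<lambda>t. (u t, v t)) (at t))) (at t)"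
       "(v has_vector_derivative snd (vector_derivative (\<lambda>t. (u t, v t)) (at t))) (at t)"
      using has_vector_derivative_Pair_iff[of u v] by (metis prod.collapse)+
    then show ?thesis using vector_derivative_at by metis
  qed
  have iff: "(\<forall>t. vector_derivative w (at t) = f t) \<longleftrightarrow> (\<forall>t. (w has_vector_derivative f t) (at t))"
    if "\<And>t. (w has_vector_derivative vector_derivative w (at t)) (at t)" for w :: "real \<Rightarrow> fock" and f
    using that vector_derivative_at by metis
  show ?thesis
  proof (cases "C_infinity (\<lambda>t. (u t, v t))")
    case True
    then show ?thesis
      unfolding is_solution_def eq eq' using iff[of u] iff[of v] der[OF True] by simp
  qed (simp add: is_solution_def)
qed

section \<open>Conservation of mass and energy\<close>

lemma constant_if_zero_derivative:
  fixes f :: "real \<Rightarrow> real"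
  assumes "\<And>t. (f has_vector_derivative 0) (at t)" shows "f t = f 0"
  using DERIV_isconst_all[of f t 0] assms by (simp add: has_real_derivative_iff_has_vector_derivative)

lemma mass_conservation:
  fixes u y :: "real \<Rightarrow> fock"
  assumes "\<And>t. (u has_vector_derivative fock_cmult k (cubic (y t) (y t) (u t))) (at t)" "Re k = 0"
  shows "norm (u t) = norm (u 0)"
proof -
  have "((\<lambda>t. inner (u t) (u t)) has_vector_derivative 0) (at t)" for t
    using bounded_bilinear.has_vector_derivative[OF bounded_bilinear_inner assms(1)[of t] assms(1)[of t]]
      inner_cubic_self[OF assms(2), of "y t" "u t"]
    by (simp add: inner_commute)
  from constant_if_zero_derivative[OF this, of t] show ?thesis by (simp add: norm_eq_sqrt_inner)
qed

lemma bounded_linear_cubic: "bounded_linear (cubic a b)"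
  by (rule bounded_linear_intro[of _ "\<bar>schur_const 0\<bar> / pi * norm a * norm b"])
    (use norm_cubic_le[of a b] in \<open>auto simp: cubic_add cubic_scaleR ac_simps\<close>)

lemma bounded_bilinear_cubic: "bounded_bilinear (\<lambda>a b. Blinfun (cubic a b))"
proof
  note app = bounded_linear_Blinfun_apply[OF bounded_linear_cubic]
  show "\<exists>K. \<forall>a b. norm (Blinfun (cubic a b)) \<le> norm a * norm b * K"
    by (intro exI[of _ "\<bar>schur_const 0\<bar> / pi"] allI norm_blinfun_bound)
      (use norm_cubic_le in \<open>auto simp: app ac_simps\<close>)
  show "Blinfun (cubic (a + a') b) = Blinfun (cubic a b) + Blinfun (cubic a' b)"
    "Blinfun (cubic a (b + b')) = Blinfun (cubic a b) + Blinfun (cubic a b')"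
    "Blinfun (cubic (r *\<^sub>R a) b) = r *\<^sub>R Blinfun (cubic a b)"
    "Blinfun (cubic a (r *\<^sub>R b)) = r *\<^sub>R Blinfun (cubic a b)" for a a' b b' r
    by (rule blinfun_eqI; simp add: app blinfun.bilinear_simps cubic_add cubic_scaleR)+
qed

lemma cubic_has_vector_derivative:
  assumes "(a has_vector_derivative a') (at t)" "(b has_vector_derivative b') (at t)" "(c has_vector_derivative c') (at t)"
  shows "((\<lambda>t. cubic (a t) (b t) (c t)) has_vector_derivative
    cubic (a t) (b t) c' + (cubic (a t) b' (c t) + cubic a' (b t) (c t))) (at t)"
  using bounded_bilinear.has_vector_derivative[OF bounded_bilinear_blinfun_apply
      bounded_bilinear.has_vector_derivative[OF bounded_bilinear_cubic assms(1,2)] assms(3)]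
  by (simp add: bounded_linear_Blinfun_apply[OF bounded_linear_cubic] blinfun.add_left)

lemma energy_eq: "(\<integral>z. (norm (fock_fun u z))\<^sup>2 * (norm (fock_fun v z))\<^sup>2 \<partial>lborel) = inner (cubic v v u) u"
proof -
  have eq: "triple v v u z * cnj (fock_fun u z) = of_real ((norm (fock_fun u z))\<^sup>2 * (norm (fock_fun v z))\<^sup>2)" for z
    unfolding triple_def of_real_mult complex_norm_square by (simp add: ac_simps)
  show ?thesis unfolding inner_cubic eq by (simp only: integral_complex_of_real Re_complex_of_real)
qed

text \<open>In the time derivative of the energy, each term can be rewritten, by the symmetries of the
  integrand, as the inner product of a projected cubic term with an imaginary multiple of itself.\<close>

lemma energy_conservation:
  fixes u v :: "real \<Rightarrow> fock"
  assumes u: "\<And>t. (u has_vector_derivative fock_cmult k (cubic (v t) (v t) (u t))) (at t)" "Re k = 0"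
    and v: "\<And>t. (v has_vector_derivative fock_cmult l (cubic (u t) (u t) (v t))) (at t)" "Re l = 0"
  shows "inner (cubic (v t) (v t) (u t)) (u t) = inner (cubic (v 0) (v 0) (u 0)) (u 0)"
proof -
  have "((\<lambda>t. inner (cubic (v t) (v t) (u t)) (u t)) has_vector_derivative 0) (at t)" for t
  proof -
    let ?w = "cubic (v t) (v t) (u t)" and ?y = "cubic (u t) (u t) (v t)"
    have "inner (cubic (v t) (v t) (fock_cmult k ?w)) (u t) = inner ?w (fock_cmult k ?w)"
      by (rule inner_cubic_cong) (simp add: triple_def algebra_simps)
    moreover have "inner (cubic (v t) (fock_cmult l ?y) (u t)) (u t) = inner ?y (fock_cmult l ?y)"
      by (rule inner_cubic_cong) (simp add: triple_def algebra_simps)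
    moreover have "inner (cubic (fock_cmult l ?y) (v t) (u t)) (u t) = inner ?y (fock_cmult l ?y)"
      by (rule inner_cubic_cong) (simp add: triple_def algebra_simps)
    ultimately show ?thesis
      using bounded_bilinear.has_vector_derivative[OF bounded_bilinear_inner
          cubic_has_vector_derivative[OF v(1)[of t] v(1)[of t] u(1)[of t]] u(1)[of t]]
        inner_fock_cmult_imaginary[OF u(2)] inner_fock_cmult_imaginary[OF v(2)]
      by (simp add: inner_add_left)
  qed
  then show ?thesis by (rule constant_if_zero_derivative)
qed

section \<open>Propagation of weights\<close>

lemma L2_Cauchy_Schwarz:
  assumes "G \<in> L2" "H \<in> L2"
  shows "integrable lborel (\<lambda>z. norm (G z) * norm (H z))"
    and "(\<integral>z. norm (G z) * norm (H z) \<partial>lborel) \<le> sqrt (\<integral>z. (norm (G z))\<^sup>2 \<partial>lborel) * sqrt (\<integral>z. (norm (H z))\<^sup>2 \<partial>lborel)"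
proof -
  have [measurable]: "G \<in> borel_measurable borel" "H \<in> borel_measurable borel" using assms by (auto simp: L2_def)
  have "integrable lborel (\<lambda>z. norm (G z * cnj (H z)))" by (intro integrable_norm integrable_L2_mult assms)
  then show int: "integrable lborel (\<lambda>z. norm (G z) * norm (H z))" by (simp add: norm_mult)
  let ?I = "\<integral>z. norm (G z) * norm (H z) \<partial>lborel"
  have I0: "?I \<ge> 0" by (intro Bochner_Integration.integral_nonneg) simp
  have sq: "(\<integral>\<^sup>+z. (ennreal (norm (F z)))\<^sup>2 \<partial>lborel) = ennreal (\<integral>z. (norm (F z))\<^sup>2 \<partial>lborel)" if "F \<in> L2" for F :: "complex \<Rightarrow> complex"
    using that by (subst nn_integral_eq_integral[symmetric]) (auto simp: ennreal_power L2_def)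
  have "ennreal (?I\<^sup>2) = (\<integral>\<^sup>+z. ennreal (norm (G z)) * ennreal (norm (H z)) \<partial>lborel)\<^sup>2"
    using nn_integral_eq_integral[OF int] I0 by (simp add: ennreal_mult[symmetric] ennreal_power)
  also have "\<dots> \<le> (\<integral>\<^sup>+z. (ennreal (norm (G z)))\<^sup>2 \<partial>lborel) * (\<integral>\<^sup>+z. (ennreal (norm (H z)))\<^sup>2 \<partial>lborel)"
    by (rule Cauchy_Schwarz_nn_integral) measurable
  also have "\<dots> = ennreal ((\<integral>z. (norm (G z))\<^sup>2 \<partial>lborel) * (\<integral>z. (norm (H z))\<^sup>2 \<partial>lborel))"
    unfolding sq[OF assms(1)] sq[OF assms(2)] by (simp add: ennreal_mult[symmetric] Bochner_Integration.integral_nonneg)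
  finally have "?I\<^sup>2 \<le> (\<integral>z. (norm (G z))\<^sup>2 \<partial>lborel) * (\<integral>z. (norm (H z))\<^sup>2 \<partial>lborel)"
    by (simp add: Bochner_Integration.integral_nonneg)
  then show "?I \<le> sqrt (\<integral>z. (norm (G z))\<^sup>2 \<partial>lborel) * sqrt (\<integral>z. (norm (H z))\<^sup>2 \<partial>lborel)"
    unfolding real_sqrt_mult[symmetric] by (rule real_le_rsqrt)
qed

text \<open>The quadratic form of multiplication by \<open>m\<close>; every moment in question is of this
  kind.\<close>

definition wform :: "(complex \<Rightarrow> real) \<Rightarrow> fock \<Rightarrow> fock \<Rightarrow> real"
  where "wform m u v = (\<integral>z. m z * inner (fock_fun u z) (fock_fun v z) \<partial>lborel)"

lemma wform_integrable:
  assumes [measurable]: "m \<in> borel_measurable borel" and M: "\<And>z. \<bar>m z\<bar> \<le> M"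
  shows "integrable lborel (\<lambda>z. m z * inner (fock_fun u z) (fock_fun v z))"
proof (rule Bochner_Integration.integrable_bound)
  show "integrable lborel (\<lambda>z. M * (norm (fock_fun u z) * norm (fock_fun v z)))"
    by (intro integrable_mult_right L2_Cauchy_Schwarz fock_fun_L2)
  have "\<bar>m z * inner (fock_fun u z) (fock_fun v z)\<bar> \<le> M * (norm (fock_fun u z) * norm (fock_fun v z))" for z
    unfolding abs_mult using M[of z] by (intro mult_mono Cauchy_Schwarz_ineq2) auto
  then show "AE z in lborel. norm (m z * inner (fock_fun u z) (fock_fun v z)) \<le> norm (M * (norm (fock_fun u z) * norm (fock_fun v z)))"
    by (intro AE_I2) (metis real_norm_def abs_ge_self order_trans)
qed measurable

lemma bounded_bilinear_wform:
  assumes [measurable]: "m \<in> borel_measurable borel" and M: "\<And>z. \<bar>m z\<bar> \<le> M"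
  shows "bounded_bilinear (wform m)"
proof
  note int = wform_integrable[OF assms]
  have add: "m z * inner (fock_fun (u + u') z) (fock_fun v z) = m z * inner (fock_fun u z) (fock_fun v z) + m z * inner (fock_fun u' z) (fock_fun v z)"
    "m z * inner (fock_fun v z) (fock_fun (u + u') z) = m z * inner (fock_fun v z) (fock_fun u z) + m z * inner (fock_fun v z) (fock_fun u' z)"
    for u u' v z by (simp_all add: inner_add_left inner_add_right distrib_left)
  have scale: "m z * inner (fock_fun (r *\<^sub>R u) z) (fock_fun v z) = r * (m z * inner (fock_fun u z) (fock_fun v z))"
    "m z * inner (fock_fun v z) (fock_fun (r *\<^sub>R u) z) = r * (m z * inner (fock_fun v z) (fock_fun u z))" for u v z r by simp_all
  show "wform m (u + u') v = wform m u v + wform m u' v" "wform m v (u + u') = wform m v u + wform m v u'" for u u' v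
    unfolding wform_def add by (rule Bochner_Integration.integral_add[OF int int])+
  show "wform m (r *\<^sub>R u) v = r *\<^sub>R wform m u v" "wform m v (r *\<^sub>R u) = r *\<^sub>R wform m v u" for r u v
    unfolding wform_def scale by simp_all
  have "norm (wform m u v) \<le> norm u * norm v * M" for u v
  proof -
    have "norm (wform m u v) \<le> (\<integral>z. M * (norm (fock_fun u z) * norm (fock_fun v z)) \<partial>lborel)"
      unfolding wform_def
    proof (rule Bochner_Integration.integral_norm_bound_integral[OF int])
      show "integrable lborel (\<lambda>z. M * (norm (fock_fun u z) * norm (fock_fun v z)))"
        by (intro integrable_mult_right L2_Cauchy_Schwarz fock_fun_L2)
      show "norm (m z * inner (fock_fun u z) (fock_fun v z)) \<le> M * (norm (fock_fun u z) * norm (fock_fun v z))" for z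
        unfolding real_norm_def abs_mult using M[of z] by (intro mult_mono Cauchy_Schwarz_ineq2) auto
    qed
    also have "\<dots> = M * (\<integral>z. norm (fock_fun u z) * norm (fock_fun v z) \<partial>lborel)" by (rule integral_mult_right_zero)
    also have "\<dots> \<le> M * (norm u * norm v)"
      using L2_Cauchy_Schwarz(2)[OF fock_fun_L2[of u] fock_fun_L2[of v]] M[of 0]
      by (intro mult_left_mono) (simp_all add: norm_fock_def)
    finally show ?thesis by (simp add: ac_simps)
  qed
  then show "\<exists>K. \<forall>u v. norm (wform m u v) \<le> norm u * norm v * K" by blast
qed

lemma wform_commute: "wform m u v = wform m v u"
  unfolding wform_def by (simp add: inner_commute)

lemma wform_has_derivative:
  assumes "m \<in> borel_measurable borel" "\<And>z. \<bar>m z\<bar> \<le> M" "(u has_vector_derivative u') (at t)"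
  shows "((\<lambda>t. wform m (u t) (u t)) has_real_derivative 2 * wform m u' (u t)) (at t)"
  using bounded_bilinear.has_vector_derivative[OF bounded_bilinear_wform[OF assms(1,2)] assms(3,3)]
  by (simp add: has_real_derivative_iff_has_vector_derivative wform_commute[of m "u t" u'])

text \<open>The bound on \<open>\<bar>q'\<bar>\<close> is invariant under time reversal.\<close>

lemma gronwall_two_sided:
  fixes q :: "real \<Rightarrow> real"
  assumes der: "\<And>t. (q has_real_derivative q' t) (at t)" and le: "\<And>t. \<bar>q' t\<bar> \<le> \<kappa> * q t"
  shows "q t \<le> exp (\<kappa> * \<bar>t\<bar>) * q 0"
proof -
  have pos: "q t \<le> exp (\<kappa> * t) * q 0" if "t \<ge> 0" "\<And>t. (q has_real_derivative q' t) (at t)" "\<And>t. q' t \<le> \<kappa> * q t" for t q q'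
  proof -
    have "exp (- \<kappa> * t) * q t \<le> exp (- \<kappa> * 0) * q 0"
    proof (rule DERIV_nonpos_imp_nonincreasing[OF that(1)])
      fix x
      have "((\<lambda>t. exp (- \<kappa> * t) * q t) has_real_derivative exp (- \<kappa> * x) * (- \<kappa>) * q x + q' x * exp (- \<kappa> * x)) (at x)"
        by (rule DERIV_mult[OF _ that(2)]) (auto intro!: derivative_eq_intros)
      moreover have "exp (- \<kappa> * x) * (- \<kappa>) * q x + q' x * exp (- \<kappa> * x) = exp (- \<kappa> * x) * (q' x - \<kappa> * q x)"
        by (simp add: algebra_simps)
      moreover have "\<dots> \<le> 0" using that(3)[of x] by (intro mult_nonneg_nonpos) auto
      ultimately show "\<exists>y. ((\<lambda>t. exp (- \<kappa> * t) * q t) has_real_derivative y) (at x) \<and> y \<le> 0" by metis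
    qed
    then have "exp (\<kappa> * t) * (exp (- \<kappa> * t) * q t) \<le> exp (\<kappa> * t) * q 0" by (intro mult_left_mono) auto
    then show ?thesis by (simp add: mult.assoc[symmetric] exp_add[symmetric])
  qed
  show ?thesis
  proof (cases "t \<ge> 0")
    case True
    have "q' s \<le> \<kappa> * q s" for s using le[of s] by linarith
    from pos[OF True der this] show ?thesis using True by simp
  next
    case False
    have "((\<lambda>t. q (- t)) has_real_derivative - q' (- s)) (at s)" for s
      using DERIV_mirror[of q "q' (- s)" s] der[of "- s"] by simp
    moreover have "- q' (- s) \<le> \<kappa> * q (- s)" for s using le[of "- s"] by linarith
    ultimately have "q (- (- t)) \<le> exp (\<kappa> * (- t)) * q (- 0)" using False by (intro pos[of "- t" "\<lambda>t. q (- t)"]) auto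
    then show ?thesis using False by simp
  qed
qed

lemma cubic_weighted:
  assumes "s \<ge> 0" and \<omega>: "moderate s \<omega>" and int: "integrable lborel (\<lambda>z. (\<omega> z * norm (fock_fun u z))\<^sup>2)" and k: "norm k \<le> 1"
  shows "integrable lborel (\<lambda>z. (\<omega> z * norm (fock_fun (fock_cmult k (cubic y y u)) z))\<^sup>2)"
    and "(\<integral>z. (\<omega> z * norm (fock_fun (fock_cmult k (cubic y y u)) z))\<^sup>2 \<partial>lborel)
      \<le> (schur_const s * (norm y)\<^sup>2 / pi)\<^sup>2 * (\<integral>z. (\<omega> z * norm (fock_fun u z))\<^sup>2 \<partial>lborel)"
proof -
  have [measurable]: "\<omega> \<in> borel_measurable borel" and \<omega>0: "\<And>z. 0 \<le> \<omega> z" using \<omega> by (auto simp: moderate_def)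
  note t = triple_weighted[OF \<open>\<omega> \<in> borel_measurable borel\<close> \<omega>0 int, of y y]
  note p = bargmann_proj_weighted[OF \<open>s \<ge> 0\<close> \<omega> measurable_triple t(1)]
  have le: "(\<omega> z * norm (fock_fun (fock_cmult k (cubic y y u)) z))\<^sup>2 \<le> (\<omega> z * norm (bargmann_proj (triple y y u) z))\<^sup>2" for z
  proof -
    have "norm k * norm (bargmann_proj (triple y y u) z) \<le> 1 * norm (bargmann_proj (triple y y u) z)"
      by (intro mult_right_mono k) auto
    then show ?thesis using \<omega>0
      by (intro power_mono mult_left_mono) (auto simp: fock_fun_cubic norm_mult)
  qed
  show int': "integrable lborel (\<lambda>z. (\<omega> z * norm (fock_fun (fock_cmult k (cubic y y u)) z))\<^sup>2)"
    by (rule Bochner_Integration.integrable_bound[OF p(1)]) (measurable, intro AE_I2, use le in simp)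
  have "(\<integral>z. (\<omega> z * norm (fock_fun (fock_cmult k (cubic y y u)) z))\<^sup>2 \<partial>lborel) \<le> (\<integral>z. (\<omega> z * norm (bargmann_proj (triple y y u) z))\<^sup>2 \<partial>lborel)"
    by (intro integral_mono int' p(1) le)
  also note p(2)
  also have "(schur_const s)\<^sup>2 * (\<integral>z. (\<omega> z * norm (triple y y u z))\<^sup>2 \<partial>lborel)
      \<le> (schur_const s)\<^sup>2 * ((norm y * norm y / pi)\<^sup>2 * (\<integral>z. (\<omega> z * norm (fock_fun u z))\<^sup>2 \<partial>lborel))"
    by (intro mult_left_mono t(2)) simp
  also have "\<dots> = (schur_const s * (norm y)\<^sup>2 / pi)\<^sup>2 * (\<integral>z. (\<omega> z * norm (fock_fun u z))\<^sup>2 \<partial>lborel)"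
    by (simp add: power_mult_distrib power_divide power2_eq_square)
  finally show "(\<integral>z. (\<omega> z * norm (fock_fun (fock_cmult k (cubic y y u)) z))\<^sup>2 \<partial>lborel)
      \<le> (schur_const s * (norm y)\<^sup>2 / pi)\<^sup>2 * (\<integral>z. (\<omega> z * norm (fock_fun u z))\<^sup>2 \<partial>lborel)" .
qed

text \<open>Here \<open>Y\<close> is the conserved norm of the other component. The two summands arise from
  \<open>2 a b \<le> a\<^sup>2 + b\<^sup>2\<close>, applied to the weighted solution and its
  weighted time derivative.\<close>

definition growth_rate :: "real \<Rightarrow> real \<Rightarrow> real"
  where "growth_rate s Y = 1 + (schur_const s * Y\<^sup>2 / pi)\<^sup>2"

text \<open>For a bounded weight the weighted norm is differentiable in time, and the growth rate depends on
  the weight through its exponent alone, not through its bound.\<close>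

lemma bounded_weight_growth:
  assumes "s \<ge> 0" and \<omega>: "moderate s \<omega>" and bd: "\<And>z. \<omega> z \<le> c"
    and u: "\<And>t. (u has_vector_derivative fock_cmult k (cubic (y t) (y t) (u t))) (at t)"
    and k: "norm k \<le> 1" and y: "\<And>t. norm (y t) = Y"
  shows "(\<integral>z. (\<omega> z * norm (fock_fun (u t) z))\<^sup>2 \<partial>lborel) \<le> exp (growth_rate s Y * \<bar>t\<bar>) * (\<integral>z. (\<omega> z * norm (fock_fun (u 0) z))\<^sup>2 \<partial>lborel)"
proof -
  have [measurable]: "\<omega> \<in> borel_measurable borel" and \<omega>0: "\<And>z. 0 \<le> \<omega> z" using \<omega> by (auto simp: moderate_def)
  let ?m = "\<lambda>z. (\<omega> z)\<^sup>2"
  have mm: "?m \<in> borel_measurable borel" by measurable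
  have mb: "\<bar>?m z\<bar> \<le> c\<^sup>2" for z using bd[of z] \<omega>0[of z] by (simp add: power_mono)
  have eq: "wform ?m x x = (\<integral>z. (\<omega> z * norm (fock_fun x z))\<^sup>2 \<partial>lborel)" for x
    unfolding wform_def by (simp add: power_mult_distrib power2_norm_eq_inner)
  have int: "integrable lborel (\<lambda>z. (\<omega> z * norm (fock_fun x z))\<^sup>2)" for x
    using wform_integrable[OF mm mb, of x x] by (simp add: power_mult_distrib power2_norm_eq_inner)
  have der: "((\<lambda>t. wform ?m (u t) (u t)) has_real_derivative 2 * wform ?m (fock_cmult k (cubic (y t) (y t) (u t))) (u t)) (at t)" for t
    by (rule wform_has_derivative[OF mm mb u])
  have "\<bar>2 * wform ?m (fock_cmult k (cubic (y t) (y t) (u t))) (u t)\<bar> \<le> growth_rate s Y * wform ?m (u t) (u t)" for t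
  proof -
    let ?x = "fock_cmult k (cubic (y t) (y t) (u t))"
    have "\<bar>2 * wform ?m ?x (u t)\<bar> = norm (\<integral>z. 2 * (?m z * inner (fock_fun ?x z) (fock_fun (u t) z)) \<partial>lborel)"
      unfolding wform_def by simp
    also have "\<dots> \<le> (\<integral>z. (\<omega> z * norm (fock_fun ?x z))\<^sup>2 + (\<omega> z * norm (fock_fun (u t) z))\<^sup>2 \<partial>lborel)"
    proof (rule Bochner_Integration.integral_norm_bound_integral)
      show "integrable lborel (\<lambda>z. 2 * (?m z * inner (fock_fun ?x z) (fock_fun (u t) z)))"
        by (intro integrable_mult_right wform_integrable[OF mm mb])
      show "integrable lborel (\<lambda>z. (\<omega> z * norm (fock_fun ?x z))\<^sup>2 + (\<omega> z * norm (fock_fun (u t) z))\<^sup>2)"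
        by (intro Bochner_Integration.integrable_add int)
      fix z
      let ?a = "\<omega> z * norm (fock_fun ?x z)" and ?b = "\<omega> z * norm (fock_fun (u t) z)"
      have "norm (2 * (?m z * inner (fock_fun ?x z) (fock_fun (u t) z))) = 2 * (?m z * \<bar>inner (fock_fun ?x z) (fock_fun (u t) z)\<bar>)"
        by (simp add: abs_mult)
      also have "\<dots> \<le> 2 * (?m z * (norm (fock_fun ?x z) * norm (fock_fun (u t) z)))"
        by (intro mult_left_mono Cauchy_Schwarz_ineq2) auto
      also have "\<dots> = 2 * ?a * ?b" by (simp add: power2_eq_square)
      also have "\<dots> \<le> ?a\<^sup>2 + ?b\<^sup>2" by (rule sum_squares_bound)
      finally show "norm (2 * (?m z * inner (fock_fun ?x z) (fock_fun (u t) z))) \<le> ?a\<^sup>2 + ?b\<^sup>2" .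
    qed
    also have "\<dots> = (\<integral>z. (\<omega> z * norm (fock_fun ?x z))\<^sup>2 \<partial>lborel) + (\<integral>z. (\<omega> z * norm (fock_fun (u t) z))\<^sup>2 \<partial>lborel)"
      by (rule Bochner_Integration.integral_add[OF int int])
    also have "\<dots> \<le> growth_rate s Y * wform ?m (u t) (u t)"
      using cubic_weighted(2)[OF \<open>s \<ge> 0\<close> \<omega> int k, of "y t" "u t"] unfolding eq growth_rate_def y by (simp add: algebra_simps)
    finally show ?thesis .
  qed
  from gronwall_two_sided[OF der this, of t] show ?thesis unfolding eq .
qed

text \<open>The weight is truncated at height \<open>n\<close>. The growth estimate is uniform in
  \<open>n\<close>, so Fatou's lemma carries it over to the full weight.\<close>

lemma weight_propagation:
  assumes "s \<ge> 0"
    and u: "\<And>t. (u has_vector_derivative fock_cmult k (cubic (y t) (y t) (u t))) (at t)"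
    and k: "norm k \<le> 1" and y: "\<And>t. norm (y t) = Y"
    and L2: "(\<lambda>z. of_real (jbracket z powr s) * fock_fun (u 0) z) \<in> L2"
  shows "(\<lambda>z. of_real (jbracket z powr s) * fock_fun (u t) z) \<in> L2"
    and "(\<integral>z. (jbracket z powr s * norm (fock_fun (u t) z))\<^sup>2 \<partial>lborel)
      \<le> exp (growth_rate s Y * \<bar>t\<bar>) * (\<integral>z. (jbracket z powr s * norm (fock_fun (u 0) z))\<^sup>2 \<partial>lborel)"
proof -
  let ?\<omega> = "\<lambda>n z. min (jbracket z powr s) (real n)"
  let ?B = "exp (growth_rate s Y * \<bar>t\<bar>) * (\<integral>z. (jbracket z powr s * norm (fock_fun (u 0) z))\<^sup>2 \<partial>lborel)"
  let ?G = "\<lambda>n z. of_real (?\<omega> n z) * fock_fun (u t) z"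
  have mod: "moderate s (?\<omega> n)" for n by (intro moderate_min moderate_jbracket assms) simp
  have normG: "norm (of_real (?\<omega> n z) * fock_fun x z) = ?\<omega> n z * norm (fock_fun x z)" for n z x
    by (simp add: norm_mult)
  have int0: "integrable lborel (\<lambda>z. (jbracket z powr s * norm (fock_fun (u 0) z))\<^sup>2)"
    using L2 by (simp add: L2_def norm_mult)
  have int: "integrable lborel (\<lambda>z. (?\<omega> n z * norm (fock_fun x z))\<^sup>2)" for n x
  proof (rule Bochner_Integration.integrable_bound)
    show "integrable lborel (\<lambda>z. (real n)\<^sup>2 * (norm (fock_fun x z))\<^sup>2)" by (intro integrable_mult_right integrable_fock_square)
    have "(?\<omega> n z * norm (fock_fun x z))\<^sup>2 \<le> (real n)\<^sup>2 * (norm (fock_fun x z))\<^sup>2" for z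
      unfolding power_mult_distrib by (intro mult_right_mono power_mono) auto
    then show "AE z in lborel. norm ((?\<omega> n z * norm (fock_fun x z))\<^sup>2) \<le> norm ((real n)\<^sup>2 * (norm (fock_fun x z))\<^sup>2)"
      by (intro AE_I2) simp
  qed measurable
  have le: "(\<integral>z. (norm (?G n z))\<^sup>2 \<partial>lborel) \<le> ?B" for n
  proof -
    have "(\<integral>z. (norm (?G n z))\<^sup>2 \<partial>lborel) \<le> exp (growth_rate s Y * \<bar>t\<bar>) * (\<integral>z. (?\<omega> n z * norm (fock_fun (u 0) z))\<^sup>2 \<partial>lborel)"
      unfolding normG by (rule bounded_weight_growth[OF \<open>s \<ge> 0\<close> mod _ u k y, of n "real n"]) simp
    also have "\<dots> \<le> ?B"
      by (intro mult_left_mono integral_mono int int0 power_mono mult_right_mono) auto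
    finally show ?thesis .
  qed
  have "?G n \<in> L2" for n using int[of n "u t"] by (simp add: L2_def normG)
  then have ev: "\<forall>\<^sub>F n in sequentially. ?G n \<in> L2 \<and> (\<integral>z. (norm (?G n z))\<^sup>2 \<partial>lborel) \<le> ?B" using le by auto
  have meas: "?G n \<in> borel_measurable borel" for n by measurable
  have lim: "(\<lambda>n. ?G n z) \<longlonglongrightarrow> of_real (jbracket z powr s) * fock_fun (u t) z" for z
  proof (rule tendsto_eventually)
    obtain N where N: "jbracket z powr s \<le> real N" using real_arch_simple by blast
    show "\<forall>\<^sub>F n in sequentially. ?G n z = of_real (jbracket z powr s) * fock_fun (u t) z"
      using eventually_ge_at_top[of N]
    proof eventually_elim
      case (elim n)
      then have "real N \<le> real n" by simp
      with N have "jbracket z powr s \<le> real n" by linarith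
      then show ?case by (simp add: min_def)
    qed
  qed
  from L2_Fatou[OF meas lim ev]
  show "(\<lambda>z. of_real (jbracket z powr s) * fock_fun (u t) z) \<in> L2"
    and "(\<integral>z. (jbracket z powr s * norm (fock_fun (u t) z))\<^sup>2 \<partial>lborel) \<le> ?B" by (simp_all add: norm_mult)
qed

section \<open>Balance of momentum and angular momentum\<close>

text \<open>For \<open>u = exp (- \<bar>z\<bar>\<^sup>2 / 2) q\<close> this is \<open>exp (-
  \<bar>z\<bar>\<^sup>2 / 2)\<close> times the derivative of \<open>q\<close>.\<close>

definition dfock :: "fock \<Rightarrow> complex \<Rightarrow> complex"
  where "dfock u = bargmann_proj (\<lambda>w. cnj w * fock_fun u w)"

text \<open>Under the identification of the plane with \<open>\<complex>\<close>, half of the gradient of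
  \<open>\<bar>u\<bar>\<^sup>2\<close>.\<close>

definition flux :: "fock \<Rightarrow> complex \<Rightarrow> complex"
  where "flux u z = fock_fun u z * cnj (dfock u z) - z * of_real ((norm (fock_fun u z))\<^sup>2)"

lemma fock_entire:
  obtains q where "q holomorphic_on UNIV" "fock_fun u = (\<lambda>z. of_real (exp (- (norm z)\<^sup>2 / 2)) * q z)"
    "dfock u = (\<lambda>z. of_real (exp (- (norm z)\<^sup>2 / 2)) * deriv q z)"
proof -
  obtain q where q: "q holomorphic_on UNIV" "fock_fun u = (\<lambda>z. of_real (exp (- (norm z)\<^sup>2 / 2)) * q z)"
    using fock_fun[of u] by (rule bargmann_fockE)
  have "dfock u z = of_real (exp (- (norm z)\<^sup>2 / 2)) * deriv q z" for z
    unfolding dfock_def by (rule bargmann_proj_cnj_mult[OF q fock_fun_L2])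
  then show thesis using that q by blast
qed

lemma continuous_on_dfock: "continuous_on UNIV (dfock u)"
proof -
  obtain q where q: "q holomorphic_on UNIV" "dfock u = (\<lambda>z. of_real (exp (- (norm z)\<^sup>2 / 2)) * deriv q z)"
    by (rule fock_entire)
  have "deriv q holomorphic_on UNIV" by (rule holomorphic_deriv[OF q(1) open_UNIV])
  then show ?thesis unfolding q(2) by (intro continuous_intros holomorphic_on_imp_continuous_on) auto
qed

lemma continuous_on_flux: "continuous_on UNIV (flux u)"
  unfolding flux_def by (intro continuous_intros continuous_on_dfock continuous_on_fock_fun)

lemma norm_square_has_derivative:
  assumes \<gamma>: "(\<gamma> has_vector_derivative \<xi>) (at t)"
  shows "((\<lambda>t. (norm (fock_fun u (\<gamma> t)))\<^sup>2) has_real_derivative 2 * Re (\<xi> * cnj (flux u (\<gamma> t)))) (at t)"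
proof -
  obtain q where q: "q holomorphic_on UNIV" "fock_fun u = (\<lambda>z. of_real (exp (- (norm z)\<^sup>2 / 2)) * q z)"
    "dfock u = (\<lambda>z. of_real (exp (- (norm z)\<^sup>2 / 2)) * deriv q z)"
    by (rule fock_entire)
  have "(q has_field_derivative deriv q (\<gamma> t)) (at (\<gamma> t))"
    using holomorphic_derivI[OF q(1) open_UNIV] by simp
  from field_vector_diff_chain_at[OF \<gamma> this]
  have q\<gamma>: "((\<lambda>t. q (\<gamma> t)) has_vector_derivative \<xi> * deriv q (\<gamma> t)) (at t)" by (simp add: o_def)
  have 1: "((\<lambda>t. inner (q (\<gamma> t)) (q (\<gamma> t))) has_real_derivative 2 * inner (q (\<gamma> t)) (\<xi> * deriv q (\<gamma> t))) (at t)"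
    using bounded_bilinear.has_vector_derivative[OF bounded_bilinear_inner q\<gamma> q\<gamma>]
    by (simp add: has_real_derivative_iff_has_vector_derivative inner_commute[of "\<xi> * deriv q (\<gamma> t)"])
  have 2: "((\<lambda>t. inner (\<gamma> t) (\<gamma> t)) has_real_derivative 2 * inner (\<gamma> t) \<xi>) (at t)"
    using bounded_bilinear.has_vector_derivative[OF bounded_bilinear_inner \<gamma> \<gamma>]
    by (simp add: has_real_derivative_iff_has_vector_derivative inner_commute[of \<xi>])
  have eq: "(norm (fock_fun u z))\<^sup>2 = exp (- inner z z) * inner (q z) (q z)" for z
    unfolding q(2) norm_mult power_mult_distrib norm_of_real power2_norm_eq_inner[symmetric]
    by (simp add: exp_double[symmetric])
  have "((\<lambda>t. exp (- inner (\<gamma> t) (\<gamma> t)) * inner (q (\<gamma> t)) (q (\<gamma> t))) has_real_derivative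
      exp (- inner (\<gamma> t) (\<gamma> t)) * (- (2 * inner (\<gamma> t) \<xi>)) * inner (q (\<gamma> t)) (q (\<gamma> t))
      + 2 * inner (q (\<gamma> t)) (\<xi> * deriv q (\<gamma> t)) * exp (- inner (\<gamma> t) (\<gamma> t))) (at t)"
    by (intro DERIV_mult 1 DERIV_fun_exp DERIV_minus 2)
  moreover have "exp (- inner z z) * (- (2 * inner z \<xi>)) * inner (q z) (q z)
      + 2 * inner (q z) (\<xi> * deriv q z) * exp (- inner z z) = 2 * Re (\<xi> * cnj (flux u z))" for z
  proof -
    let ?e = "exp (- (norm z)\<^sup>2 / 2)"
    have e: "exp (- inner z z) = ?e * ?e" unfolding power2_norm_eq_inner exp_add[symmetric] by simp
    have A1: "Re (\<xi> * cnj (flux u z)) = Re (\<xi> * cnj (fock_fun u z) * dfock u z) - Re (\<xi> * cnj z) * (norm (fock_fun u z))\<^sup>2"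
      by (simp add: flux_def algebra_simps)
    have A2: "Re (\<xi> * cnj (fock_fun u z) * dfock u z) = ?e * ?e * inner (q z) (\<xi> * deriv q z)"
      unfolding q(2,3) by (simp add: inner_complex_def algebra_simps)
    have A3: "Re (\<xi> * cnj z) = inner z \<xi>" by (simp add: inner_complex_def algebra_simps)
    show ?thesis unfolding A1 A2 A3 eq e by (simp add: algebra_simps)
  qed
  ultimately show ?thesis unfolding eq by simp
qed

text \<open>For the flow \<open>\<phi>\<close> of a divergence free field, \<open>h'\<close> is the
  derivative of \<open>h\<close> along the field. Its average over the time interval \<open>[0,
  1]\<close> is \<open>h \<circ> \<phi> 1 - h\<close>, which has integral zero since \<open>\<phi>
  1\<close> preserves the measure.\<close>

lemma transport_integral_zero:
  fixes h h' :: "complex \<Rightarrow> real" and \<phi> :: "real \<Rightarrow> complex \<Rightarrow> complex"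
  assumes h: "integrable lborel h" and h': "integrable lborel h'" "continuous_on UNIV h'"
    and \<phi>: "continuous_on UNIV (\<lambda>(t, z). \<phi> t z)" and pres: "\<And>t. distr lborel lborel (\<phi> t) = lborel"
    and \<phi>0: "\<And>z. \<phi> 0 z = z"
    and der: "\<And>t z. ((\<lambda>t. h (\<phi> t z)) has_real_derivative h' (\<phi> t z)) (at t)"
  shows "(\<integral>z. h' z \<partial>lborel) = 0"
proof -
  have [measurable]: "h \<in> borel_measurable borel" using h by simp
  have \<phi>c': "continuous_on UNIV (\<lambda>t. \<phi> t z)" for z
  proof -
    have "continuous_on UNIV (\<lambda>t :: real. (t, z))" by (intro continuous_intros)
    from continuous_on_compose2[OF \<phi> this] show ?thesis by simp
  qed
  have "continuous_on UNIV (\<phi> t)" for t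
  proof -
    have "continuous_on UNIV (\<lambda>z :: complex. (t, z))" by (intro continuous_intros)
    from continuous_on_compose2[OF \<phi> this] show ?thesis by simp
  qed
  then have [measurable]: "\<phi> t \<in> borel_measurable borel" for t by (intro borel_measurable_continuous_onI)
  have avg: "(LBINT t:{0..1}. complex_of_real (h' (\<phi> t z))) = of_real (h (\<phi> 1 z) - h z)" for z
  proof -
    have "((\<lambda>t. h' (\<phi> t z)) has_integral (h (\<phi> 1 z) - h (\<phi> 0 z))) {0..1}"
      using der by (intro fundamental_theorem_of_calculus)
        (auto simp: has_real_derivative_iff_has_vector_derivative intro: has_vector_derivative_at_within)
    from has_integral_linear[OF this bounded_linear_of_real]
    have "((\<lambda>t. complex_of_real (h' (\<phi> t z))) has_integral of_real (h (\<phi> 1 z) - h z)) {0..1}"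
      by (simp add: o_def \<phi>0)
    moreover have "set_integrable lborel {0..1} (\<lambda>t. complex_of_real (h' (\<phi> t z)))"
      by (intro borel_integrable_atLeastAtMost' continuous_intros continuous_on_compose2[OF h'(2)]
          continuous_on_subset[OF \<phi>c']) auto
    ultimately show ?thesis by (simp only: set_borel_integral_eq_integral integral_unique)
  qed
  have "(\<integral>z. complex_of_real (h' z) \<partial>lborel) = (\<integral>z. (LBINT t:{0..1}. complex_of_real (h' (\<phi> t z))) \<partial>lborel)"
    by (rule integral_eq_integral_average[OF _ _ \<phi> pres]) (use h' in \<open>auto intro!: continuous_intros\<close>)
  also have "\<dots> = of_real (\<integral>z. h (\<phi> 1 z) - h z \<partial>lborel)" unfolding avg by (rule integral_complex_of_real)
  also have "(\<integral>z. h (\<phi> 1 z) - h z \<partial>lborel) = (\<integral>z. h (\<phi> 1 z) \<partial>lborel) - (\<integral>z. h z \<partial>lborel)"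
    using integrable_distr_eq[of "\<phi> 1" lborel lborel h] pres[of 1] h
    by (intro Bochner_Integration.integral_diff) auto
  also have "(\<integral>z. h (\<phi> 1 z) \<partial>lborel) = (\<integral>z. h z \<partial>lborel)"
    using integral_distr[of "\<phi> 1" lborel lborel h] pres[of 1] by simp
  finally show ?thesis by (simp add: integral_complex_of_real)
qed

lemma dfock_L2:
  assumes "(\<lambda>z. z * fock_fun u z) \<in> L2" shows "dfock u \<in> L2"
proof -
  have "(\<lambda>z. cnj z * fock_fun u z) \<in> L2"
    using assms by (auto simp: L2_def norm_mult)
  from bargmann_proj_in_fock[OF this] show ?thesis unfolding dfock_def bargmann_fock_def by blast
qed

lemma flux_integrable:
  assumes zu: "(\<lambda>z. z * fock_fun u z) \<in> L2" and \<xi>: "continuous_on UNIV \<xi>" "\<And>z. norm (\<xi> z) \<le> 1 + norm z"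
  shows "integrable lborel (\<lambda>z. of_real ((norm (fock_fun v z))\<^sup>2) * (\<xi> z * cnj (flux u z)))"
proof (rule Bochner_Integration.integrable_bound)
  have [measurable]: "\<xi> \<in> borel_measurable borel" "flux u \<in> borel_measurable borel"
    by (intro borel_measurable_continuous_onI \<xi> continuous_on_flux)+
  let ?U = "\<lambda>z. norm (fock_fun u z) + norm (z * fock_fun u z)"
  have U: "(\<lambda>z. complex_of_real (?U z)) \<in> L2"
  proof -
    have "(\<lambda>z. complex_of_real (norm (fock_fun u z))) \<in> L2" "(\<lambda>z. complex_of_real (norm (z * fock_fun u z))) \<in> L2"
      using fock_fun_L2[of u] zu by (auto simp: L2_def)
    from L2_add[OF this] show ?thesis by simp
  qed
  note D = dfock_L2[OF zu]
  have nU: "norm (complex_of_real (?U z)) = ?U z" for z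
    unfolding norm_of_real by (intro abs_of_nonneg add_nonneg_nonneg norm_ge_zero)
  show "integrable lborel (\<lambda>z. ((norm v)\<^sup>2 / pi) * (?U z * norm (dfock u z) + ?U z * norm (z * fock_fun u z)))"
    using L2_Cauchy_Schwarz(1)[OF U D] L2_Cauchy_Schwarz(1)[OF U zu] unfolding nU
    by (intro integrable_mult_right Bochner_Integration.integrable_add)
  show "AE z in lborel. norm (of_real ((norm (fock_fun v z))\<^sup>2) * (\<xi> z * cnj (flux u z)))
      \<le> norm (((norm v)\<^sup>2 / pi) * (?U z * norm (dfock u z) + ?U z * norm (z * fock_fun u z)))"
  proof (rule AE_I2)
    fix z
    have "norm (\<xi> z) * norm (flux u z) \<le> (1 + norm z) * (norm (fock_fun u z) * norm (dfock u z) + norm z * (norm (fock_fun u z))\<^sup>2)"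
      unfolding flux_def using \<xi>(2)[of z]
      by (intro mult_mono order_trans[OF norm_triangle_ineq4]) (auto simp: norm_mult norm_power)
    also have "\<dots> = ?U z * norm (dfock u z) + ?U z * norm (z * fock_fun u z)"
      by (simp add: norm_mult power2_eq_square algebra_simps)
    finally have 1: "norm (\<xi> z) * norm (flux u z) \<le> ?U z * norm (dfock u z) + ?U z * norm (z * fock_fun u z)" .
    have "norm (of_real ((norm (fock_fun v z))\<^sup>2) * (\<xi> z * cnj (flux u z))) = (norm (fock_fun v z))\<^sup>2 * (norm (\<xi> z) * norm (flux u z))"
      by (simp add: norm_mult norm_power)
    also have "\<dots> \<le> ((norm v)\<^sup>2 / pi) * (?U z * norm (dfock u z) + ?U z * norm (z * fock_fun u z))"
      by (intro mult_mono 1 norm_fock_fun_square_le) auto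
    also have "\<dots> \<le> norm (((norm v)\<^sup>2 / pi) * (?U z * norm (dfock u z) + ?U z * norm (z * fock_fun u z)))" by simp
    finally show "norm (of_real ((norm (fock_fun v z))\<^sup>2) * (\<xi> z * cnj (flux u z)))
      \<le> norm (((norm v)\<^sup>2 / pi) * (?U z * norm (dfock u z) + ?U z * norm (z * fock_fun u z)))" .
  qed
  show "(\<lambda>z. of_real ((norm (fock_fun v z))\<^sup>2) * (\<xi> z * cnj (flux u z))) \<in> borel_measurable lborel"
    by measurable
qed

lemma energy_density_integrable: "integrable lborel (\<lambda>z. (norm (fock_fun u z))\<^sup>2 * (norm (fock_fun v z))\<^sup>2)"
proof (rule Bochner_Integration.integrable_bound)
  show "integrable lborel (\<lambda>z. (norm (fock_fun u z))\<^sup>2 * ((norm v)\<^sup>2 / pi))"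
    by (intro integrable_mult_left integrable_fock_square)
  have "(norm (fock_fun u z))\<^sup>2 * (norm (fock_fun v z))\<^sup>2 \<le> (norm (fock_fun u z))\<^sup>2 * ((norm v)\<^sup>2 / pi)" for z
    by (intro mult_left_mono norm_fock_fun_square_le) simp
  then show "AE z in lborel. norm ((norm (fock_fun u z))\<^sup>2 * (norm (fock_fun v z))\<^sup>2) \<le> norm ((norm (fock_fun u z))\<^sup>2 * ((norm v)\<^sup>2 / pi))"
    by (intro AE_I2) simp
qed measurable

text \<open>The two integrals add up to half the integral of the derivative of \<open>\<bar>u\<bar>\<^sup>2
  \<bar>v\<bar>\<^sup>2\<close> along the field \<open>\<xi>\<close>, whose flow preserves the
  measure.\<close>

lemma flux_balance:
  assumes zu: "(\<lambda>z. z * fock_fun u z) \<in> L2" and zv: "(\<lambda>z. z * fock_fun v z) \<in> L2"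
    and \<xi>: "continuous_on UNIV \<xi>" "\<And>z. norm (\<xi> z) \<le> 1 + norm z"
    and \<phi>: "continuous_on UNIV (\<lambda>(t, z). \<phi> t z)" "\<And>t. distr lborel lborel (\<phi> t) = lborel" "\<And>z. \<phi> 0 z = z"
    and der: "\<And>t z. ((\<lambda>t. \<phi> t z) has_vector_derivative \<xi> (\<phi> t z)) (at t)"
  shows "Re (\<integral>z. of_real ((norm (fock_fun v z))\<^sup>2) * (\<xi> z * cnj (flux u z)) \<partial>lborel)
    + Re (\<integral>z. of_real ((norm (fock_fun u z))\<^sup>2) * (\<xi> z * cnj (flux v z)) \<partial>lborel) = 0"
proof -
  let ?A = "\<lambda>u v z. of_real ((norm (fock_fun v z))\<^sup>2) * (\<xi> z * cnj (flux u z))"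
  note intu = flux_integrable[OF zu \<xi>, of v] and intv = flux_integrable[OF zv \<xi>, of u]
  let ?h' = "\<lambda>z. 2 * Re (?A u v z) + 2 * Re (?A v u z)"
  have int': "integrable lborel ?h'"
    by (intro Bochner_Integration.integrable_add integrable_mult_right integrable_Re intu intv)
  have "(\<integral>z. ?h' z \<partial>lborel) = 0"
  proof (rule transport_integral_zero[OF energy_density_integrable[of u v] int' _ \<phi>])
    show "continuous_on UNIV ?h'"
      by (intro continuous_intros \<xi> continuous_on_flux continuous_on_fock_fun)
    fix t z
    have "((\<lambda>t. (norm (fock_fun u (\<phi> t z)))\<^sup>2 * (norm (fock_fun v (\<phi> t z)))\<^sup>2) has_real_derivative
        2 * Re (\<xi> (\<phi> t z) * cnj (flux u (\<phi> t z))) * (norm (fock_fun v (\<phi> t z)))\<^sup>2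
        + 2 * Re (\<xi> (\<phi> t z) * cnj (flux v (\<phi> t z))) * (norm (fock_fun u (\<phi> t z)))\<^sup>2) (at t)"
      by (intro DERIV_mult norm_square_has_derivative der)
    moreover have "2 * Re (a * b) * c = 2 * Re (of_real c * (a * b))" for a b :: complex and c :: real
      by simp
    ultimately show "((\<lambda>t. (norm (fock_fun u (\<phi> t z)))\<^sup>2 * (norm (fock_fun v (\<phi> t z)))\<^sup>2) has_real_derivative ?h' (\<phi> t z)) (at t)"
      by metis
  qed
  moreover have "(\<integral>z. ?h' z \<partial>lborel) = 2 * Re (\<integral>z. ?A u v z \<partial>lborel) + 2 * Re (\<integral>z. ?A v u z \<partial>lborel)"
    by (subst Bochner_Integration.integral_add)
      (intro integrable_mult_right integrable_Re intu intv, intro integrable_mult_right integrable_Re intu intv,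
       simp only: integral_mult_right_zero integral_Re[OF intu] integral_Re[OF intv])
  ultimately show ?thesis by simp
qed

lemma flux_balance_translation:
  assumes zu: "(\<lambda>z. z * fock_fun u z) \<in> L2" and zv: "(\<lambda>z. z * fock_fun v z) \<in> L2" and "norm e = 1"
  shows "Re (\<integral>z. of_real ((norm (fock_fun v z))\<^sup>2) * (e * cnj (flux u z)) \<partial>lborel)
    + Re (\<integral>z. of_real ((norm (fock_fun u z))\<^sup>2) * (e * cnj (flux v z)) \<partial>lborel) = 0"
proof (rule flux_balance[OF zu zv, where \<phi> = "\<lambda>t z. z + of_real t * e"])
  show "((\<lambda>t. z + of_real t * e) has_vector_derivative e) (at t)" for t z
    by (auto intro!: derivative_eq_intros)
qed (use \<open>norm e = 1\<close> in \<open>auto simp: case_prod_beta distr_lborel_translation intro!: continuous_intros\<close>)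

lemma flux_balance_rotation:
  assumes zu: "(\<lambda>z. z * fock_fun u z) \<in> L2" and zv: "(\<lambda>z. z * fock_fun v z) \<in> L2"
  shows "Re (\<integral>z. of_real ((norm (fock_fun v z))\<^sup>2) * (\<i> * z * cnj (flux u z)) \<partial>lborel)
    + Re (\<integral>z. of_real ((norm (fock_fun u z))\<^sup>2) * (\<i> * z * cnj (flux v z)) \<partial>lborel) = 0"
proof (rule flux_balance[OF zu zv, where \<phi> = "\<lambda>t z. exp (of_real t * \<i>) * z"])
  show "((\<lambda>t. exp (of_real t * \<i>) * z) has_vector_derivative \<i> * (exp (of_real t * \<i>) * z)) (at t)" for t z
    by (auto intro!: derivative_eq_intros has_vector_derivative_real_field simp: ac_simps)
  show "distr lborel lborel ((*) (exp (of_real t * \<i>))) = lborel" for t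
    by (rule distr_lborel_rotation) (simp add: norm_exp_eq_Re)
qed (auto simp: case_prod_beta norm_mult intro!: continuous_intros)

lemma jbracket_square: "(jbracket z)\<^sup>2 = 1 + (norm z)\<^sup>2"
  by (simp add: jbracket_def)

text \<open>Links the moment \<open>z u\<close> to the scale of weights; the exponent \<open>powr 1\<close>
  is kept in the form in which the results on weights produce it.\<close>

lemma jbracket_weight_L2_iff:
  "(\<lambda>z. of_real (jbracket z powr 1) * fock_fun u z) \<in> L2 \<longleftrightarrow> (\<lambda>z. z * fock_fun u z) \<in> L2"
proof -
  have eq: "(norm (of_real (jbracket z powr 1) * fock_fun u z))\<^sup>2 = (norm (fock_fun u z))\<^sup>2 + (norm (z * fock_fun u z))\<^sup>2" for z
    using jbracket_pos[of z] jbracket_square[of z] by (simp add: norm_mult power_mult_distrib distrib_right)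
  have m: "(\<lambda>z. of_real (jbracket z powr 1) * fock_fun u z) \<in> borel_measurable borel" "(\<lambda>z. z * fock_fun u z) \<in> borel_measurable borel"
    by measurable
  have "integrable lborel (\<lambda>z. (norm (fock_fun u z))\<^sup>2 + (norm (z * fock_fun u z))\<^sup>2) \<longleftrightarrow> integrable lborel (\<lambda>z. (norm (z * fock_fun u z))\<^sup>2)"
    using Bochner_Integration.integrable_add[OF integrable_fock_square[of u], of "\<lambda>z. (norm (z * fock_fun u z))\<^sup>2"]
      Bochner_Integration.integrable_diff[OF _ integrable_fock_square[of u], of "\<lambda>z. (norm (fock_fun u z))\<^sup>2 + (norm (z * fock_fun u z))\<^sup>2"]
    by auto
  then show ?thesis using m unfolding L2_def mem_Collect_eq eq by simp
qed

lemma cnj_mult_L2: "(\<lambda>z. z * fock_fun u z) \<in> L2 \<Longrightarrow> (\<lambda>z. cnj z * fock_fun u z) \<in> L2"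
  by (auto simp: L2_def norm_mult)

text \<open>The multiplier is moved onto \<open>u\<close>, and then the projection from the cubic term onto
  \<open>u\<close>. On one side the factor \<open>cnj z\<close> turns into a derivative of
  \<open>u\<close> under the projection; on the other side \<open>z u\<close> lies in the Fock
  space and is fixed. Together the two terms form the flux.\<close>

lemma first_moment_cubic:
  assumes zu: "(\<lambda>z. z * fock_fun u z) \<in> L2"
  shows "(\<integral>z. z * (fock_fun (cubic v v u) z * cnj (fock_fun u z) - cnj (fock_fun (cubic v v u) z) * fock_fun u z) \<partial>lborel)
    = (\<integral>z. of_real ((norm (fock_fun v z))\<^sup>2) * flux u z \<partial>lborel)"
proof -
  let ?g = "fock_fun (cubic v v u)" and ?G = "triple v v u"
  have czu: "(\<lambda>z. cnj z * fock_fun u z) \<in> L2" by (rule cnj_mult_L2[OF zu])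
  have sa: "(\<integral>z. bargmann_proj ?G z * cnj (H z) \<partial>lborel) = (\<integral>z. ?G z * cnj (bargmann_proj H z) \<partial>lborel)" if "H \<in> L2" for H
    using bargmann_proj_self_adjoint[OF order_refl moderate_const, of ?G H] triple_L2[of v v u] that by (simp add: L2_def)
  have Dint: "integrable lborel (\<lambda>z. ?G z * cnj (dfock u z))" by (rule integrable_L2_mult[OF triple_L2 dfock_L2[OF zu]])
  have Uint: "integrable lborel (\<lambda>z. ?G z * cnj (cnj z * fock_fun u z))"
    by (rule integrable_L2_mult[OF triple_L2 czu])
  have zint: "integrable lborel (\<lambda>z. ?g z * cnj (H z))" if "H \<in> L2" for H by (rule integrable_L2_mult[OF fock_fun_L2 that])
  have 1: "(\<integral>z. ?g z * cnj (cnj z * fock_fun u z) \<partial>lborel) = (\<integral>z. ?G z * cnj (dfock u z) \<partial>lborel)"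
    unfolding fock_fun_cubic dfock_def by (rule sa[OF czu])
  have zuF: "\<exists>w. fock_fun w = (\<lambda>z. z * fock_fun u z)"
  proof -
    obtain f where f: "f holomorphic_on UNIV" "fock_fun u = (\<lambda>z. of_real (exp (- (norm z)\<^sup>2 / 2)) * f z)"
      using fock_fun[of u] by (rule bargmann_fockE)
    have "(\<lambda>z. z * f z) holomorphic_on UNIV" using f by (intro holomorphic_intros)
    moreover have "(\<lambda>z. z * fock_fun u z) = (\<lambda>z. of_real (exp (- (norm z)\<^sup>2 / 2)) * (z * f z))"
      unfolding f(2) by (simp add: ac_simps)
    ultimately have "(\<lambda>z. z * fock_fun u z) \<in> bargmann_fock" using zu unfolding bargmann_fock_def by blast
    then show ?thesis using Abs_fock_inverse by metis
  qed
  then obtain w where w: "fock_fun w = (\<lambda>z. z * fock_fun u z)" by blast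
  have "(\<integral>z. ?g z * cnj (z * fock_fun u z) \<partial>lborel) = (\<integral>z. ?G z * cnj (z * fock_fun u z) \<partial>lborel)"
    using integral_proj_mult_cnj[OF triple_L2, of v v u w] unfolding w fock_fun_cubic .
  then have "cnj (\<integral>z. ?g z * cnj (z * fock_fun u z) \<partial>lborel) = cnj (\<integral>z. ?G z * cnj (z * fock_fun u z) \<partial>lborel)" by simp
  then have 2: "(\<integral>z. cnj (?g z * cnj (z * fock_fun u z)) \<partial>lborel) = (\<integral>z. cnj (?G z * cnj (z * fock_fun u z)) \<partial>lborel)"
    by (simp only: Bochner_Integration.integral_cnj)
  have i2: "integrable lborel (\<lambda>z. cnj (?g z * cnj (z * fock_fun u z)))" "integrable lborel (\<lambda>z. cnj (?G z * cnj (z * fock_fun u z)))"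
    by (rule integrable_cnj[OF zint[OF zu]]) (rule integrable_cnj[OF integrable_L2_mult[OF triple_L2 zu]])
  have "(\<integral>z. z * (?g z * cnj (fock_fun u z) - cnj (?g z) * fock_fun u z) \<partial>lborel)
    = (\<integral>z. ?g z * cnj (cnj z * fock_fun u z) - cnj (?g z * cnj (z * fock_fun u z)) \<partial>lborel)"
    by (intro Bochner_Integration.integral_cong refl) (simp add: algebra_simps)
  also have "\<dots> = (\<integral>z. ?g z * cnj (cnj z * fock_fun u z) \<partial>lborel) - (\<integral>z. cnj (?g z * cnj (z * fock_fun u z)) \<partial>lborel)"
    by (rule Bochner_Integration.integral_diff[OF zint[OF czu] i2(1)])
  also have "\<dots> = (\<integral>z. ?G z * cnj (dfock u z) \<partial>lborel) - (\<integral>z. cnj (?G z * cnj (z * fock_fun u z)) \<partial>lborel)"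
    unfolding 1 2 ..
  also have "\<dots> = (\<integral>z. ?G z * cnj (dfock u z) - cnj (?G z * cnj (z * fock_fun u z)) \<partial>lborel)"
    by (rule Bochner_Integration.integral_diff[OF Dint i2(2), symmetric])
  also have "\<dots> = (\<integral>z. of_real ((norm (fock_fun v z))\<^sup>2) * flux u z \<partial>lborel)"
    unfolding flux_def triple_def complex_norm_square
    by (intro Bochner_Integration.integral_cong refl) (simp add: algebra_simps)
  finally show ?thesis .
qed

lemma triple_moment_L2:
  assumes "(\<lambda>z. z * fock_fun u z) \<in> L2"
  shows "integrable lborel (\<lambda>z. (jbracket z powr 1 * norm (triple v v u z))\<^sup>2)"
  using assms unfolding jbracket_weight_L2_iff[symmetric]
  by (intro triple_weighted(1)) (simp_all add: L2_def norm_mult)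

text \<open>As for the first moment, now with the multiplier \<open>\<bar>z\<bar>\<^sup>2 = cnj z z\<close>.
  The projection of \<open>cnj z (z u)\<close> is the derivative of a product, \<open>u + z
  \<partial>u\<close>, and subtracting 1 from the multiplier removes the term \<open>u\<close>.\<close>

lemma second_moment_cubic:
  assumes zu: "(\<lambda>z. z * fock_fun u z) \<in> L2"
  shows "(\<integral>z. of_real ((norm z)\<^sup>2 - 1) * (fock_fun (cubic v v u) z * cnj (fock_fun u z)) \<partial>lborel)
    = (\<integral>z. of_real ((norm (fock_fun v z))\<^sup>2) * (cnj z * fock_fun u z * cnj (dfock u z)) \<partial>lborel)"
proof -
  let ?g = "fock_fun (cubic v v u)" and ?G = "triple v v u"
  obtain q where q: "q holomorphic_on UNIV" "fock_fun u = (\<lambda>z. of_real (exp (- (norm z)\<^sup>2 / 2)) * q z)"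
    "dfock u = (\<lambda>z. of_real (exp (- (norm z)\<^sup>2 / 2)) * deriv q z)"
    by (rule fock_entire)
  have mod: "moderate 1 (\<lambda>z. jbracket z powr 1)" by (rule moderate_jbracket) simp
  define H where "H z = cnj z * (z * fock_fun u z)" for z
  have H [measurable]: "H \<in> borel_measurable borel" unfolding H_def by measurable
  have intH: "integrable lborel (\<lambda>z. (norm (H z) / jbracket z powr 1)\<^sup>2)"
  proof (rule Bochner_Integration.integrable_bound)
    show "integrable lborel (\<lambda>z. (norm (z * fock_fun u z))\<^sup>2)" using zu by (simp add: L2_def)
    have "norm (H z) / jbracket z powr 1 \<le> norm (z * fock_fun u z)" for z
    proof -
      have "norm z \<le> jbracket z" unfolding jbracket_def by (rule real_le_rsqrt) simp
      then have "norm z * norm (z * fock_fun u z) \<le> jbracket z * norm (z * fock_fun u z)" by (rule mult_right_mono) simp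
      then show ?thesis using jbracket_pos[of z] by (simp add: H_def norm_mult divide_le_eq mult.commute)
    qed
    then have "(norm (H z) / jbracket z powr 1)\<^sup>2 \<le> (norm (z * fock_fun u z))\<^sup>2" for z by (rule power_mono) simp
    then show "AE z in lborel. norm ((norm (H z) / jbracket z powr 1)\<^sup>2) \<le> norm ((norm (z * fock_fun u z))\<^sup>2)"
      by (intro AE_I2) (simp only: real_norm_def abs_of_nonneg zero_le_power2)
  qed measurable
  have intG: "integrable lborel (\<lambda>z. (jbracket z powr 1 * norm (?G z))\<^sup>2)" by (rule triple_moment_L2[OF zu])
  have sa: "(\<integral>z. ?g z * cnj (H z) \<partial>lborel) = (\<integral>z. ?G z * cnj (bargmann_proj H z) \<partial>lborel)"
    unfolding fock_fun_cubic
    by (rule bargmann_proj_self_adjoint[OF _ mod _ measurable_triple H intG intH])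
      (simp_all add: less_imp_neq[OF jbracket_pos, symmetric])
  have ProjH: "bargmann_proj H z = fock_fun u z + z * dfock u z" for z
  proof -
    have "(\<lambda>z. z * q z) holomorphic_on UNIV" using q by (intro holomorphic_intros)
    moreover have "(\<lambda>z. z * fock_fun u z) = (\<lambda>z. of_real (exp (- (norm z)\<^sup>2 / 2)) * (z * q z))"
      unfolding q(2) by (simp add: ac_simps)
    ultimately have "bargmann_proj H z = of_real (exp (- (norm z)\<^sup>2 / 2)) * deriv (\<lambda>z. z * q z) z"
      unfolding H_def by (rule bargmann_proj_cnj_mult[OF _ _ zu])
    also have "deriv (\<lambda>z. z * q z) z = q z + z * deriv q z"
      using holomorphic_derivI[OF q(1) open_UNIV, of z]
      by (intro DERIV_imp_deriv) (auto intro!: derivative_eq_intros)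
    finally show ?thesis unfolding q(2,3) by (simp add: algebra_simps)
  qed
  have gint: "integrable lborel (\<lambda>z. ?g z * cnj (fock_fun u z))" by (rule integrable_L2_mult[OF fock_fun_L2 fock_fun_L2])
  have Gint: "integrable lborel (\<lambda>z. ?G z * cnj (fock_fun u z))" by (rule integrable_L2_mult[OF triple_L2 fock_fun_L2])
  have gu: "(\<integral>z. ?g z * cnj (fock_fun u z) \<partial>lborel) = (\<integral>z. ?G z * cnj (fock_fun u z) \<partial>lborel)"
    unfolding fock_fun_cubic by (rule integral_proj_mult_cnj[OF triple_L2])
  have zG: "(\<lambda>z. cnj z * ?G z) \<in> L2"
  proof -
    have "integrable lborel (\<lambda>z. (norm (cnj z * ?G z))\<^sup>2)"
    proof (rule Bochner_Integration.integrable_bound[OF intG])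
      have "(norm (cnj z * ?G z))\<^sup>2 \<le> (jbracket z powr 1 * norm (?G z))\<^sup>2" for z
        using jbracket_pos[of z] jbracket_square[of z]
        by (simp add: norm_mult power_mult_distrib mult_right_mono)
      then show "AE z in lborel. norm ((norm (cnj z * ?G z))\<^sup>2) \<le> norm ((jbracket z powr 1 * norm (?G z))\<^sup>2)"
        by (intro AE_I2) (simp only: real_norm_def abs_of_nonneg zero_le_power2)
    qed measurable
    then show ?thesis by (simp add: L2_def)
  qed
  have zg: "(\<lambda>z. z * ?g z) \<in> L2"
  proof -
    have "integrable lborel (\<lambda>z. (norm (z * ?g z))\<^sup>2)"
    proof (rule Bochner_Integration.integrable_bound[OF bargmann_proj_weighted(1)[OF _ mod measurable_triple intG]])
      have "(norm (z * ?g z))\<^sup>2 \<le> (jbracket z powr 1 * norm (bargmann_proj ?G z))\<^sup>2" for z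
        using jbracket_pos[of z] jbracket_square[of z] unfolding fock_fun_cubic
        by (simp add: norm_mult power_mult_distrib mult_right_mono)
      then show "AE z in lborel. norm ((norm (z * ?g z))\<^sup>2) \<le> norm ((jbracket z powr 1 * norm (bargmann_proj ?G z))\<^sup>2)"
        by (intro AE_I2) (simp only: real_norm_def abs_of_nonneg zero_le_power2)
    qed (simp, measurable)
    then show ?thesis by (simp add: L2_def)
  qed
  have gH: "integrable lborel (\<lambda>z. ?g z * cnj (H z))"
  proof -
    have "(\<lambda>z. ?g z * cnj (H z)) = (\<lambda>z. (z * ?g z) * cnj (z * fock_fun u z))"
      by (simp add: H_def fun_eq_iff ac_simps)
    then show ?thesis using integrable_L2_mult[OF zg zu] by simp
  qed
  have GH: "integrable lborel (\<lambda>z. ?G z * cnj (z * dfock u z))"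
  proof -
    have "(\<lambda>z. ?G z * cnj (z * dfock u z)) = (\<lambda>z. (cnj z * ?G z) * cnj (dfock u z))"
      by (simp add: fun_eq_iff ac_simps)
    then show ?thesis using integrable_L2_mult[OF zG dfock_L2[OF zu]] by simp
  qed
  have "(\<integral>z. of_real ((norm z)\<^sup>2 - 1) * (?g z * cnj (fock_fun u z)) \<partial>lborel)
      = (\<integral>z. ?g z * cnj (H z) - ?g z * cnj (fock_fun u z) \<partial>lborel)"
    unfolding H_def of_real_diff complex_norm_square
    by (intro Bochner_Integration.integral_cong refl) (simp add: algebra_simps)
  also have "\<dots> = (\<integral>z. ?g z * cnj (H z) \<partial>lborel) - (\<integral>z. ?g z * cnj (fock_fun u z) \<partial>lborel)"
    by (rule Bochner_Integration.integral_diff[OF gH gint])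
  also have "\<dots> = (\<integral>z. ?G z * cnj (fock_fun u z) + ?G z * cnj (z * dfock u z) \<partial>lborel) - (\<integral>z. ?G z * cnj (fock_fun u z) \<partial>lborel)"
    unfolding sa gu ProjH complex_cnj_add distrib_left ..
  also have "(\<integral>z. ?G z * cnj (fock_fun u z) + ?G z * cnj (z * dfock u z) \<partial>lborel)
      = (\<integral>z. ?G z * cnj (fock_fun u z) \<partial>lborel) + (\<integral>z. ?G z * cnj (z * dfock u z) \<partial>lborel)"
    by (rule Bochner_Integration.integral_add[OF Gint GH])
  finally have "(\<integral>z. of_real ((norm z)\<^sup>2 - 1) * (?g z * cnj (fock_fun u z)) \<partial>lborel) = (\<integral>z. ?G z * cnj (z * dfock u z) \<partial>lborel)"
    by simp
  also have "\<dots> = (\<integral>z. of_real ((norm (fock_fun v z))\<^sup>2) * (cnj z * fock_fun u z * cnj (dfock u z)) \<partial>lborel)"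
    unfolding triple_def complex_norm_square
    by (intro Bochner_Integration.integral_cong refl) (simp add: algebra_simps)
  finally show ?thesis .
qed

section \<open>Conservation of the moments\<close>

definition finite_moment :: "fock \<Rightarrow> bool"
  where "finite_moment u \<longleftrightarrow> (\<lambda>z. z * fock_fun u z) \<in> L2"

text \<open>The square of the norm in which the truncated moments are dominated, locally uniformly in time.\<close>

definition moment :: "fock \<Rightarrow> real"
  where "moment u = (\<integral>z. (jbracket z powr 1 * norm (fock_fun u z))\<^sup>2 \<partial>lborel)"

lemma finite_moment_integrable:
  "finite_moment u \<longleftrightarrow> integrable lborel (\<lambda>z. (jbracket z powr 1 * norm (fock_fun u z))\<^sup>2)"
  unfolding finite_moment_def jbracket_weight_L2_iff[symmetric] by (simp add: L2_def norm_mult)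

lemma moment_nonneg: "moment u \<ge> 0"
  unfolding moment_def by (intro Bochner_Integration.integral_nonneg) simp

lemma moment_cubic:
  assumes "finite_moment u" "norm k \<le> 1"
  shows "finite_moment (fock_cmult k (cubic y y u))"
    and "moment (fock_cmult k (cubic y y u)) \<le> (schur_const 1 * (norm y)\<^sup>2 / pi)\<^sup>2 * moment u"
  using cubic_weighted[OF _ moderate_jbracket _ assms(2), of 1 u y] assms(1)
  unfolding finite_moment_integrable moment_def by simp_all

text \<open>Splits a multiplier of quadratic growth evenly between the two factors.\<close>

lemma moment_product_bound:
  assumes "norm c \<le> (jbracket z)\<^sup>2"
  shows "norm c * (norm a * norm b) \<le> (jbracket z powr 1 * norm a)\<^sup>2 + (jbracket z powr 1 * norm (b :: complex))\<^sup>2"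
proof -
  let ?j = "jbracket z"
  have "norm c * (norm a * norm b) \<le> ?j\<^sup>2 * (norm a * norm b)" by (intro mult_right_mono assms) simp
  also have "\<dots> = (?j * norm a) * (?j * norm b)" by (simp add: power2_eq_square)
  also have "\<dots> \<le> (?j * norm a)\<^sup>2 + (?j * norm b)\<^sup>2" by (rule mult_le_sum_squares)
  finally show ?thesis using jbracket_pos[of z] by simp
qed

lemma moment_integrable:
  assumes "finite_moment y" "finite_moment w" and [measurable]: "m \<in> borel_measurable borel"
    and m: "\<And>z. norm (m z) \<le> (jbracket z)\<^sup>2"
  shows "integrable lborel (\<lambda>z. m z * (fock_fun y z * cnj (fock_fun w z)))"
proof (rule Bochner_Integration.integrable_bound)
  show "integrable lborel (\<lambda>z. (jbracket z powr 1 * norm (fock_fun y z))\<^sup>2 + (jbracket z powr 1 * norm (fock_fun w z))\<^sup>2)"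
    using assms unfolding finite_moment_integrable by (intro Bochner_Integration.integrable_add)
  have "norm (m z * (fock_fun y z * cnj (fock_fun w z)))
      \<le> (jbracket z powr 1 * norm (fock_fun y z))\<^sup>2 + (jbracket z powr 1 * norm (fock_fun w z))\<^sup>2" for z
    using moment_product_bound[OF m[of z], of "fock_fun y z" "fock_fun w z"] by (simp add: norm_mult)
  then show "AE z in lborel. norm (m z * (fock_fun y z * cnj (fock_fun w z)))
      \<le> norm ((jbracket z powr 1 * norm (fock_fun y z))\<^sup>2 + (jbracket z powr 1 * norm (fock_fun w z))\<^sup>2)"
    by (intro AE_I2) simp
  show "(\<lambda>z. m z * (fock_fun y z * cnj (fock_fun w z))) \<in> borel_measurable lborel" by measurable
qed

lemma wform_moment_integrable:
  assumes "finite_moment y" "finite_moment w" and [measurable]: "m \<in> borel_measurable borel"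
    and m: "\<And>z. \<bar>m z\<bar> \<le> (jbracket z)\<^sup>2"
  shows "integrable lborel (\<lambda>z. m z * inner (fock_fun y z) (fock_fun w z))"
proof -
  have "integrable lborel (\<lambda>z. Re (of_real (m z) * (fock_fun y z * cnj (fock_fun w z))))"
    by (intro integrable_Re moment_integrable assms(1,2)) (use m in simp_all)
  moreover have "Re (of_real (m z) * (fock_fun y z * cnj (fock_fun w z))) = m z * inner (fock_fun y z) (fock_fun w z)" for z
    by (simp add: inner_complex_def)
  ultimately show ?thesis by (simp only:)
qed

lemma wform_moment_le:
  assumes "finite_moment y" "finite_moment w" "m \<in> borel_measurable borel" "\<And>z. \<bar>m z\<bar> \<le> (jbracket z)\<^sup>2"
  shows "\<bar>wform m y w\<bar> \<le> moment y + moment w"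
proof -
  have iy: "integrable lborel (\<lambda>z. (jbracket z powr 1 * norm (fock_fun y z))\<^sup>2)"
    and iw: "integrable lborel (\<lambda>z. (jbracket z powr 1 * norm (fock_fun w z))\<^sup>2)"
    using assms by (simp_all add: finite_moment_integrable)
  have "norm (wform m y w) \<le> (\<integral>z. (jbracket z powr 1 * norm (fock_fun y z))\<^sup>2 + (jbracket z powr 1 * norm (fock_fun w z))\<^sup>2 \<partial>lborel)"
    unfolding wform_def
  proof (rule Bochner_Integration.integral_norm_bound_integral[OF wform_moment_integrable[OF assms]])
    show "integrable lborel (\<lambda>z. (jbracket z powr 1 * norm (fock_fun y z))\<^sup>2 + (jbracket z powr 1 * norm (fock_fun w z))\<^sup>2)"
      by (rule Bochner_Integration.integrable_add[OF iy iw])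
    fix z
    have "norm (m z * inner (fock_fun y z) (fock_fun w z)) \<le> norm (m z) * (norm (fock_fun y z) * norm (fock_fun w z))"
      unfolding real_norm_def abs_mult by (intro mult_left_mono Cauchy_Schwarz_ineq2) simp
    also have "\<dots> \<le> (jbracket z powr 1 * norm (fock_fun y z))\<^sup>2 + (jbracket z powr 1 * norm (fock_fun w z))\<^sup>2"
      by (rule moment_product_bound) (use assms(4) in simp)
    finally show "norm (m z * inner (fock_fun y z) (fock_fun w z)) \<le> (jbracket z powr 1 * norm (fock_fun y z))\<^sup>2 + (jbracket z powr 1 * norm (fock_fun w z))\<^sup>2" .
  qed
  also have "\<dots> = moment y + moment w" unfolding moment_def by (rule Bochner_Integration.integral_add[OF iy iw])
  finally show ?thesis by simp
qed

text \<open>The cut-off makes the quadratic form of a multiplier of polynomial growth bounded, and hence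
  differentiable along every differentiable curve.\<close>

definition truncate :: "nat \<Rightarrow> (complex \<Rightarrow> real) \<Rightarrow> complex \<Rightarrow> real"
  where "truncate n m z = (if norm z \<le> real n then m z else 0)"

lemma measurable_truncate [measurable]:
  assumes [measurable]: "m \<in> borel_measurable borel" shows "truncate n m \<in> borel_measurable borel"
  unfolding truncate_def[abs_def] by measurable

lemma wform_truncate_limit:
  assumes yw: "finite_moment y" "finite_moment w" and [measurable]: "m \<in> borel_measurable borel"
    and m: "\<And>z. \<bar>m z\<bar> \<le> (jbracket z)\<^sup>2"
  shows "(\<lambda>n. wform (truncate n m) y w) \<longlonglongrightarrow> wform m y w"
  unfolding wform_def
proof (rule integral_dominated_convergence)
  show "integrable lborel (\<lambda>z. norm (m z * inner (fock_fun y z) (fock_fun w z)))"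
    by (intro integrable_norm wform_moment_integrable assms)
  show "(\<lambda>z. m z * inner (fock_fun y z) (fock_fun w z)) \<in> borel_measurable lborel" by measurable
  show "(\<lambda>z. truncate n m z * inner (fock_fun y z) (fock_fun w z)) \<in> borel_measurable lborel" for n by measurable
  show "AE z in lborel. norm (truncate n m z * inner (fock_fun y z) (fock_fun w z)) \<le> norm (m z * inner (fock_fun y z) (fock_fun w z))" for n
    by (intro AE_I2) (simp add: truncate_def)
  have "(\<lambda>n. truncate n m z * inner (fock_fun y z) (fock_fun w z)) \<longlonglongrightarrow> m z * inner (fock_fun y z) (fock_fun w z)" for z
  proof (rule tendsto_eventually)
    obtain N where N: "norm z \<le> real N" using real_arch_simple by blast
    show "\<forall>\<^sub>F n in sequentially. truncate n m z * inner (fock_fun y z) (fock_fun w z) = m z * inner (fock_fun y z) (fock_fun w z)"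
      using eventually_ge_at_top[of N]
    proof eventually_elim
      case (elim n)
      then have "real N \<le> real n" by simp
      with N have "norm z \<le> real n" by linarith
      then show ?case by (simp add: truncate_def)
    qed
  qed
  then show "AE z in lborel. (\<lambda>n. truncate n m z * inner (fock_fun y z) (fock_fun w z)) \<longlonglongrightarrow> m z * inner (fock_fun y z) (fock_fun w z)"
    by (intro AE_I2)
qed

lemma moment_growth:
  assumes "\<And>t. (u has_vector_derivative fock_cmult k (cubic (y t) (y t) (u t))) (at t)"
    and "norm k \<le> 1" "\<And>t. norm (y t) = Y" and fm: "finite_moment (u 0)"
  shows "finite_moment (u t)" "moment (u t) \<le> exp (growth_rate 1 Y * \<bar>t\<bar>) * moment (u 0)"
proof -
  have 0: "(\<lambda>z. of_real (jbracket z powr 1) * fock_fun (u 0) z) \<in> L2"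
    using fm by (simp only: finite_moment_def jbracket_weight_L2_iff)
  note wp = weight_propagation[OF zero_le_one assms(1-3) 0, of t]
  show "finite_moment (u t)" using wp(1) by (simp only: finite_moment_def jbracket_weight_L2_iff)
  show "moment (u t) \<le> exp (growth_rate 1 Y * \<bar>t\<bar>) * moment (u 0)" using wp(2) by (simp only: moment_def)
qed

text \<open>For a truncated multiplier the moment is differentiable in time. As the truncation is removed,
  its derivative tends to the balance, which is zero, and it is dominated on compact time
  intervals by the growth of the weighted norms. Integration in time and dominated convergence
  give the claim.\<close>

lemma moment_conservation:
  fixes u v :: "real \<Rightarrow> fock" and k l :: complex and \<sigma> :: real and m :: "complex \<Rightarrow> real"
  defines "u' \<equiv> \<lambda>t. fock_cmult k (cubic (v t) (v t) (u t))" and "v' \<equiv> \<lambda>t. fock_cmult l (cubic (u t) (u t) (v t))"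
  assumes u: "\<And>t. (u has_vector_derivative u' t) (at t)" and v: "\<And>t. (v has_vector_derivative v' t) (at t)"
    and kl: "Re k = 0" "Re l = 0" "norm k \<le> 1" "norm l \<le> 1"
    and fm: "finite_moment (u 0)" "finite_moment (v 0)"
    and meas: "m \<in> borel_measurable borel" and m: "\<And>z. \<bar>m z\<bar> \<le> (jbracket z)\<^sup>2"
    and balance: "\<And>t. wform m (u' t) (u t) + \<sigma> * wform m (v' t) (v t) = 0"
  shows "wform m (u t) (u t) + \<sigma> * wform m (v t) (v t) = wform m (u 0) (u 0) + \<sigma> * wform m (v 0) (v 0)"
proof -
  note [measurable] = meas
  have nu: "norm (u t) = norm (u 0)" and nv: "norm (v t) = norm (v 0)" for t
    using mass_conservation[OF u[unfolded u'_def] kl(1)] mass_conservation[OF v[unfolded v'_def] kl(2)] by blast+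
  note mu = moment_growth[OF u[unfolded u'_def] kl(3) nv fm(1)]
  note mv = moment_growth[OF v[unfolded v'_def] kl(4) nu fm(2)]
  have fu': "finite_moment (u' t)" and fv': "finite_moment (v' t)" for t
    unfolding u'_def v'_def by (rule moment_cubic(1)[OF mu(1) kl(3)], rule moment_cubic(1)[OF mv(1) kl(4)])
  define Q where "Q n t = wform (truncate n m) (u t) (u t) + \<sigma> * wform (truncate n m) (v t) (v t)" for n t
  define D where "D n t = 2 * wform (truncate n m) (u' t) (u t) + \<sigma> * (2 * wform (truncate n m) (v' t) (v t))" for n t
  have tm: "truncate n m \<in> borel_measurable borel" for n by measurable
  have tb: "\<bar>truncate n m z\<bar> \<le> (jbracket z)\<^sup>2" for n z using m[of z] by (simp add: truncate_def)
  have tbd: "\<bar>truncate n m z\<bar> \<le> 1 + (real n)\<^sup>2" for n z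
  proof (cases "norm z \<le> real n")
    case True
    then have "(norm z)\<^sup>2 \<le> (real n)\<^sup>2" by (intro power_mono) auto
    moreover have "\<bar>truncate n m z\<bar> \<le> 1 + (norm z)\<^sup>2" using tb[of n z] unfolding jbracket_square .
    ultimately show ?thesis by linarith
  qed (simp add: truncate_def)
  have QD: "(Q n has_real_derivative D n t) (at t)" for n t
    unfolding Q_def D_def
    by (intro DERIV_add DERIV_cmult wform_has_derivative[OF tm tbd u] wform_has_derivative[OF tm tbd v])
  have Qlim: "(\<lambda>n. Q n t) \<longlonglongrightarrow> wform m (u t) (u t) + \<sigma> * wform m (v t) (v t)" for t
    unfolding Q_def by (intro tendsto_intros wform_truncate_limit mu mv meas m)
  have Dlim: "(\<lambda>n. D n t) \<longlonglongrightarrow> 0" for t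
  proof -
    have "(\<lambda>n. D n t) \<longlonglongrightarrow> 2 * wform m (u' t) (u t) + \<sigma> * (2 * wform m (v' t) (v t))"
      unfolding D_def by (intro tendsto_intros wform_truncate_limit mu mv fu' fv' meas m)
    moreover have "2 * wform m (u' t) (u t) + \<sigma> * (2 * wform m (v' t) (v t)) = 2 * (wform m (u' t) (u t) + \<sigma> * wform m (v' t) (v t))"
      by (simp add: algebra_simps)
    ultimately show ?thesis by (simp add: balance)
  qed
  have const: "wform m (u a) (u a) + \<sigma> * wform m (v a) (v a) = wform m (u b) (u b) + \<sigma> * wform m (v b) (v b)"
    if "a \<le> b" for a b
  proof -
    define T where "T = \<bar>a\<bar> + \<bar>b\<bar>"
    \<comment> \<open>Bounds, uniform on the time interval, for the weighted norms of the solution and its time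
      derivative.\<close>
    define Cu where "Cu = (1 + (schur_const 1 * (norm (v 0))\<^sup>2 / pi)\<^sup>2) * (exp (growth_rate 1 (norm (v 0)) * T) * moment (u 0))"
    define Cv where "Cv = (1 + (schur_const 1 * (norm (u 0))\<^sup>2 / pi)\<^sup>2) * (exp (growth_rate 1 (norm (u 0)) * T) * moment (v 0))"
    have growth_pos: "growth_rate 1 Y \<ge> 0" for Y by (simp add: growth_rate_def)
    have Cu: "moment (u' s) + moment (u s) \<le> Cu" and Cv: "moment (v' s) + moment (v s) \<le> Cv" if "s \<in> {a..b}" for s
    proof -
      have sT: "\<bar>s\<bar> \<le> T" using that by (auto simp: T_def)
      have "moment (u s) \<le> exp (growth_rate 1 (norm (v 0)) * \<bar>s\<bar>) * moment (u 0)" by (rule mu(2))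
      also have "\<dots> \<le> exp (growth_rate 1 (norm (v 0)) * T) * moment (u 0)"
        by (intro mult_right_mono moment_nonneg) (simp add: mult_left_mono[OF sT growth_pos])
      finally have 1: "moment (u s) \<le> exp (growth_rate 1 (norm (v 0)) * T) * moment (u 0)" .
      have "moment (u' s) \<le> (schur_const 1 * (norm (v 0))\<^sup>2 / pi)\<^sup>2 * moment (u s)"
        using moment_cubic(2)[OF mu(1)[of s] kl(3), of "v s"] unfolding u'_def nv[of s] .
      then have "moment (u' s) + moment (u s) \<le> (1 + (schur_const 1 * (norm (v 0))\<^sup>2 / pi)\<^sup>2) * moment (u s)" by (simp add: algebra_simps)
      also have "\<dots> \<le> Cu" unfolding Cu_def by (intro mult_left_mono 1) simp
      finally show "moment (u' s) + moment (u s) \<le> Cu" .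
      have "moment (v s) \<le> exp (growth_rate 1 (norm (u 0)) * \<bar>s\<bar>) * moment (v 0)" by (rule mv(2))
      also have "\<dots> \<le> exp (growth_rate 1 (norm (u 0)) * T) * moment (v 0)"
        by (intro mult_right_mono moment_nonneg) (simp add: mult_left_mono[OF sT growth_pos])
      finally have 2: "moment (v s) \<le> exp (growth_rate 1 (norm (u 0)) * T) * moment (v 0)" .
      have "moment (v' s) \<le> (schur_const 1 * (norm (u 0))\<^sup>2 / pi)\<^sup>2 * moment (v s)"
        using moment_cubic(2)[OF mv(1)[of s] kl(4), of "u s"] unfolding v'_def nu[of s] .
      then have "moment (v' s) + moment (v s) \<le> (1 + (schur_const 1 * (norm (u 0))\<^sup>2 / pi)\<^sup>2) * moment (v s)" by (simp add: algebra_simps)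
      also have "\<dots> \<le> Cv" unfolding Cv_def by (intro mult_left_mono 2) simp
      finally show "moment (v' s) + moment (v s) \<le> Cv" .
    qed
    have int: "(D n has_integral Q n b - Q n a) {a..b}" for n
      using that QD by (intro fundamental_theorem_of_calculus)
        (auto simp: has_real_derivative_iff_has_vector_derivative[symmetric] intro: has_field_derivative_at_within)
    have "(\<lambda>n. integral {a..b} (D n)) \<longlonglongrightarrow> integral {a..b} (\<lambda>s. 0)"
    proof (rule dominated_convergence(2))
      show "D n integrable_on {a..b}" for n using int by blast
      show "(\<lambda>s. 2 * Cu + \<bar>\<sigma>\<bar> * (2 * Cv)) integrable_on {a..b}" by (rule integrable_const_ivl)
      show "norm (D n s) \<le> 2 * Cu + \<bar>\<sigma>\<bar> * (2 * Cv)" if "s \<in> {a..b}" for n s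
      proof -
        have "\<bar>wform (truncate n m) (u' s) (u s)\<bar> \<le> Cu"
          by (rule order_trans[OF wform_moment_le[OF fu' mu(1) tm tb] Cu[OF that]])
        moreover have "\<bar>wform (truncate n m) (v' s) (v s)\<bar> \<le> Cv"
          by (rule order_trans[OF wform_moment_le[OF fv' mv(1) tm tb] Cv[OF that]])
        ultimately have "\<bar>2 * wform (truncate n m) (u' s) (u s)\<bar> \<le> 2 * Cu" "\<bar>\<sigma>\<bar> * \<bar>2 * wform (truncate n m) (v' s) (v s)\<bar> \<le> \<bar>\<sigma>\<bar> * (2 * Cv)"
          by (simp_all add: mult_left_mono)
        then show ?thesis unfolding D_def real_norm_def
          by (intro order_trans[OF abs_triangle_ineq] add_mono) (simp_all only: abs_mult)
      qed
      show "(\<lambda>n. D n s) \<longlonglongrightarrow> 0" for s by (rule Dlim)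
    qed
    then have "(\<lambda>n. Q n b - Q n a) \<longlonglongrightarrow> 0" using integral_unique[OF int] by simp
    moreover have "(\<lambda>n. Q n b - Q n a) \<longlonglongrightarrow> (wform m (u b) (u b) + \<sigma> * wform m (v b) (v b)) - (wform m (u a) (u a) + \<sigma> * wform m (v a) (v a))"
      by (intro tendsto_diff Qlim)
    ultimately show ?thesis using LIMSEQ_unique by fastforce
  qed
  show ?thesis using const[of 0 t] const[of t 0] by linarith
qed

subsection \<open>The instantaneous balance laws\<close>

lemma wform_imaginary:
  "wform m (fock_cmult (- \<i> * of_real c) g) u = c * (\<integral>z. m z * Im (fock_fun g z * cnj (fock_fun u z)) \<partial>lborel)"
proof -
  have "m z * inner (fock_fun (fock_cmult (- \<i> * of_real c) g) z) (fock_fun u z) = c * (m z * Im (fock_fun g z * cnj (fock_fun u z)))" for z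
    by (simp add: inner_complex_def algebra_simps)
  then show ?thesis unfolding wform_def by simp
qed

lemma finite_moment_cubic: "finite_moment u \<Longrightarrow> finite_moment (cubic v v u)"
proof -
  have "fock_cmult 1 (cubic v v u) = cubic v v u" by (rule fock_eqI) simp
  then show "finite_moment u \<Longrightarrow> finite_moment (cubic v v u)" using moment_cubic(1)[of u 1 v] by simp
qed

lemma norm_le_jbracket_square: "norm z \<le> (jbracket z)\<^sup>2"
  using zero_le_power2[of "norm z - 1"] unfolding jbracket_square power2_diff by (simp add: power2_eq_square) (use norm_ge_zero[of z] in linarith)

text \<open>By the first moment identity, both integrals in the complex sum are fluxes; the balance along
  the real and the imaginary translations says that the real and the imaginary part of their sum
  vanish.\<close>

lemma momentum_balance:
  assumes fm: "finite_moment u" "finite_moment v"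
  shows "(\<integral>z. Re z * Im (fock_fun (cubic v v u) z * cnj (fock_fun u z)) \<partial>lborel)
      + (\<integral>z. Re z * Im (fock_fun (cubic u u v) z * cnj (fock_fun v z)) \<partial>lborel) = 0"
    and "(\<integral>z. Im z * Im (fock_fun (cubic v v u) z * cnj (fock_fun u z)) \<partial>lborel)
      + (\<integral>z. Im z * Im (fock_fun (cubic u u v) z * cnj (fock_fun v z)) \<partial>lborel) = 0"
proof -
  define P where "P v u = (\<integral>z. z * of_real (Im (fock_fun (cubic v v u) z * cnj (fock_fun u z))) \<partial>lborel)" for u v
  define I where "I v u = (\<integral>z. of_real ((norm (fock_fun v z))\<^sup>2) * flux u z \<partial>lborel)" for u v
  have PI: "2 * \<i> * P v u = I v u" if "finite_moment u" for u v
  proof -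
    have "2 * \<i> * (z * of_real (Im (a * cnj b))) = z * (a * cnj b - cnj a * b)" for z a b :: complex
      by (simp add: complex_eq_iff algebra_simps)
    then show ?thesis
      using first_moment_cubic[OF that[unfolded finite_moment_def], of v]
      unfolding P_def I_def integral_mult_right_zero[symmetric] by (simp only:)
  qed
  have int: "integrable lborel (\<lambda>z. z * of_real (Im (fock_fun (cubic v v u) z * cnj (fock_fun u z))))" if "finite_moment u" for u v
  proof -
    let ?g = "cubic v v u"
    have "integrable lborel (\<lambda>z. z * (fock_fun ?g z * cnj (fock_fun u z)) - z * (fock_fun u z * cnj (fock_fun ?g z)))"
      using norm_le_jbracket_square
      by (intro Bochner_Integration.integrable_diff moment_integrable that finite_moment_cubic) simp_all
    then have "integrable lborel (\<lambda>z. (- \<i> / 2) * (z * (fock_fun ?g z * cnj (fock_fun u z)) - z * (fock_fun u z * cnj (fock_fun ?g z))))"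
      by (rule integrable_mult_right)
    moreover have "(- \<i> / 2) * (z * (a * cnj b) - z * (b * cnj a)) = z * of_real (Im (a * cnj b))" for z a b :: complex
      by (simp add: complex_eq_iff field_simps)
    ultimately show ?thesis by (simp only:)
  qed
  have cnjI: "(\<integral>z. of_real ((norm (fock_fun v z))\<^sup>2) * (e * cnj (flux u z)) \<partial>lborel) = e * cnj (I v u)" for e u v
  proof -
    have "(\<integral>z. of_real ((norm (fock_fun v z))\<^sup>2) * (e * cnj (flux u z)) \<partial>lborel)
        = (\<integral>z. e * cnj (of_real ((norm (fock_fun v z))\<^sup>2) * flux u z) \<partial>lborel)"
      by (intro Bochner_Integration.integral_cong refl) simp
    then show ?thesis unfolding I_def integral_mult_right_zero Bochner_Integration.integral_cnj .
  qed
  note bal = flux_balance_translation[OF fm[unfolded finite_moment_def], unfolded cnjI]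
  \<comment> \<open>Translation along \<open>1\<close> gives the real part, translation along
    \<open>\<i>\<close> the imaginary part.\<close>
  have "I v u + I u v = 0"
    using bal[of 1] bal[of \<i>] by (simp add: complex_eq_iff)
  then have "2 * \<i> * (P v u + P u v) = 0" by (simp only: distrib_left PI fm)
  then have P0: "P v u + P u v = 0" by simp
  have "(\<integral>z. Re z * Im (fock_fun (cubic v v u) z * cnj (fock_fun u z)) \<partial>lborel) = Re (P v u)"
    "(\<integral>z. Im z * Im (fock_fun (cubic v v u) z * cnj (fock_fun u z)) \<partial>lborel) = Im (P v u)" if "finite_moment u" for u v
    unfolding P_def integral_Re[OF int[OF that], symmetric] integral_Im[OF int[OF that], symmetric]
    by (intro Bochner_Integration.integral_cong refl, simp)+
  with P0 fm show "(\<integral>z. Re z * Im (fock_fun (cubic v v u) z * cnj (fock_fun u z)) \<partial>lborel)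
      + (\<integral>z. Re z * Im (fock_fun (cubic u u v) z * cnj (fock_fun v z)) \<partial>lborel) = 0"
    "(\<integral>z. Im z * Im (fock_fun (cubic v v u) z * cnj (fock_fun u z)) \<partial>lborel)
      + (\<integral>z. Im z * Im (fock_fun (cubic u u v) z * cnj (fock_fun v z)) \<partial>lborel) = 0"
    by (simp_all only: plus_complex.sel(1)[symmetric] plus_complex.sel(2)[symmetric] zero_complex.sel)
qed

text \<open>By the second moment identity each integral is the flux along the rotation field \<open>\<i>
  z\<close>: the term of the flux that does not contain a derivative is radial and drops out of
  the real part.\<close>

lemma angular_momentum_balance:
  assumes fm: "finite_moment u" "finite_moment v"
  shows "(\<integral>z. ((norm z)\<^sup>2 - 1) * Im (fock_fun (cubic v v u) z * cnj (fock_fun u z)) \<partial>lborel)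
      + (\<integral>z. ((norm z)\<^sup>2 - 1) * Im (fock_fun (cubic u u v) z * cnj (fock_fun v z)) \<partial>lborel) = 0"
proof -
  have eq: "(\<integral>z. ((norm z)\<^sup>2 - 1) * Im (fock_fun (cubic v v u) z * cnj (fock_fun u z)) \<partial>lborel)
      = Re (\<integral>z. of_real ((norm (fock_fun v z))\<^sup>2) * (\<i> * z * cnj (flux u z)) \<partial>lborel)" if "finite_moment u" for u v
  proof -
    let ?g = "cubic v v u"
    let ?W = "\<lambda>z. of_real ((norm (fock_fun v z))\<^sup>2) * (cnj z * fock_fun u z * cnj (dfock u z))"
    have zu: "(\<lambda>z. z * fock_fun u z) \<in> L2" using that by (simp add: finite_moment_def)
    have m: "norm (complex_of_real ((norm z)\<^sup>2 - 1)) \<le> (jbracket z)\<^sup>2" for z :: complex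
      unfolding norm_of_real jbracket_square by (simp add: abs_le_iff)
    have int1: "integrable lborel (\<lambda>z. of_real ((norm z)\<^sup>2 - 1) * (fock_fun ?g z * cnj (fock_fun u z)))"
      by (rule moment_integrable[OF finite_moment_cubic[OF that] that _ m]) measurable
    have int2: "integrable lborel (\<lambda>z. of_real ((norm (fock_fun v z))\<^sup>2) * (\<i> * z * cnj (flux u z)))"
      by (rule flux_integrable[OF zu]) (auto intro!: continuous_intros simp: norm_mult)
    have pointwise: "Re (of_real ((norm (fock_fun v z))\<^sup>2) * (\<i> * z * cnj (flux u z))) = Im (?W z)" for z
    proof -
      have "\<i> * z * cnj (flux u z) = \<i> * cnj (cnj z * fock_fun u z * cnj (dfock u z)) - \<i> * of_real ((norm z)\<^sup>2 * (norm (fock_fun u z))\<^sup>2)"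
        unfolding flux_def of_real_mult complex_norm_square[of z] by (simp add: algebra_simps)
      moreover have "Re (\<i> * cnj w - \<i> * of_real r) = Im w" for w r by simp
      ultimately have "Re (\<i> * z * cnj (flux u z)) = Im (cnj z * fock_fun u z * cnj (dfock u z))" by (simp only:)
      then show ?thesis by (simp only: Re_complex_of_real times_complex.sel Im_complex_of_real)
    qed
    have int3: "integrable lborel ?W"
    proof -
      have "integrable lborel (\<lambda>z. ((norm v)\<^sup>2 / pi) * (norm (z * fock_fun u z) * norm (dfock u z)))"
        by (intro integrable_mult_right L2_Cauchy_Schwarz zu dfock_L2)
      then show ?thesis
      proof (rule Bochner_Integration.integrable_bound)
        have [measurable]: "dfock u \<in> borel_measurable borel" by (intro borel_measurable_continuous_onI continuous_on_dfock)
        show "?W \<in> borel_measurable lborel" by measurable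
        have "norm (?W z) \<le> ((norm v)\<^sup>2 / pi) * (norm (z * fock_fun u z) * norm (dfock u z))" for z
        proof -
          have "(norm (fock_fun v z))\<^sup>2 * (norm (z * fock_fun u z) * norm (dfock u z)) \<le> ((norm v)\<^sup>2 / pi) * (norm (z * fock_fun u z) * norm (dfock u z))"
            by (intro mult_right_mono norm_fock_fun_square_le) auto
          then show ?thesis by (simp add: norm_mult norm_power mult.assoc)
        qed
        then show "AE z in lborel. norm (?W z) \<le> norm (((norm v)\<^sup>2 / pi) * (norm (z * fock_fun u z) * norm (dfock u z)))"
          by (intro AE_I2) (metis abs_ge_self order_trans real_norm_def)
      qed
    qed
    have "(\<integral>z. ((norm z)\<^sup>2 - 1) * Im (fock_fun ?g z * cnj (fock_fun u z)) \<partial>lborel)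
        = (\<integral>z. Im (of_real ((norm z)\<^sup>2 - 1) * (fock_fun ?g z * cnj (fock_fun u z))) \<partial>lborel)"
      by (intro Bochner_Integration.integral_cong refl) (simp add: algebra_simps)
    also have "\<dots> = Im (\<integral>z. ?W z \<partial>lborel)"
      unfolding integral_Im[OF int1] second_moment_cubic[OF zu] ..
    also have "\<dots> = (\<integral>z. Im (?W z) \<partial>lborel)" by (rule integral_Im[OF int3, symmetric])
    also have "\<dots> = Re (\<integral>z. of_real ((norm (fock_fun v z))\<^sup>2) * (\<i> * z * cnj (flux u z)) \<partial>lborel)"
      unfolding pointwise[symmetric] by (rule integral_Re[OF int2])
    finally show ?thesis .
  qed
  show ?thesis unfolding eq[OF fm(1)] eq[OF fm(2)]
    using flux_balance_rotation[OF fm[unfolded finite_moment_def]] by simp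
qed

section \<open>Existence, uniqueness and conservation laws\<close>

lemma solution_conservation:
  assumes \<sigma>: "\<sigma> \<in> {1, -1}" and sol: "is_solution \<sigma> u0 v0 u v"
  shows "(\<integral>z. (norm (fock_fun (u t) z))\<^sup>2 \<partial>lborel) = (\<integral>z. (norm (fock_fun u0 z))\<^sup>2 \<partial>lborel)"
    and "(\<integral>z. (norm (fock_fun (v t) z))\<^sup>2 \<partial>lborel) = (\<integral>z. (norm (fock_fun v0 z))\<^sup>2 \<partial>lborel)"
    and "(\<integral>z. (norm (fock_fun (u t) z))\<^sup>2 * (norm (fock_fun (v t) z))\<^sup>2 \<partial>lborel) =
            (\<integral>z. (norm (fock_fun u0 z))\<^sup>2 * (norm (fock_fun v0 z))\<^sup>2 \<partial>lborel)"
    and "s > 0 \<Longrightarrow> (\<lambda>z. of_real (jbracket z powr s) * fock_fun u0 z) \<in> L2 \<Longrightarrow>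
      (\<lambda>z. of_real (jbracket z powr s) * fock_fun (u t) z) \<in> L2"
    and "s > 0 \<Longrightarrow> (\<lambda>z. of_real (jbracket z powr s) * fock_fun v0 z) \<in> L2 \<Longrightarrow>
      (\<lambda>z. of_real (jbracket z powr s) * fock_fun (v t) z) \<in> L2"
proof -
  let ?k = "- \<i>" and ?l = "- \<i> * of_real \<sigma>"
  have u: "\<And>t. (u has_vector_derivative fock_cmult ?k (cubic (v t) (v t) (u t))) (at t)"
    and v: "\<And>t. (v has_vector_derivative fock_cmult ?l (cubic (u t) (u t) (v t))) (at t)"
    and init: "u 0 = u0" "v 0 = v0"
    using sol unfolding is_solution_iff by auto
  have kl: "Re ?k = 0" "Re ?l = 0" "norm ?k \<le> 1" "norm ?l \<le> 1" using \<sigma> by (auto simp: norm_mult)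
  have nu: "norm (u t) = norm u0" and nv: "norm (v t) = norm v0" for t
    using mass_conservation[OF u kl(1)] mass_conservation[OF v kl(2)] init by blast+
  show "(\<integral>z. (norm (fock_fun (u t) z))\<^sup>2 \<partial>lborel) = (\<integral>z. (norm (fock_fun u0 z))\<^sup>2 \<partial>lborel)"
    "(\<integral>z. (norm (fock_fun (v t) z))\<^sup>2 \<partial>lborel) = (\<integral>z. (norm (fock_fun v0 z))\<^sup>2 \<partial>lborel)"
    unfolding norm_fock_square[symmetric] nu nv by (rule refl)+
  show "(\<integral>z. (norm (fock_fun (u t) z))\<^sup>2 * (norm (fock_fun (v t) z))\<^sup>2 \<partial>lborel) =
            (\<integral>z. (norm (fock_fun u0 z))\<^sup>2 * (norm (fock_fun v0 z))\<^sup>2 \<partial>lborel)"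
    unfolding energy_eq using energy_conservation[OF u kl(1) v kl(2), of t] init by simp
  show "s > 0 \<Longrightarrow> (\<lambda>z. of_real (jbracket z powr s) * fock_fun u0 z) \<in> L2 \<Longrightarrow>
      (\<lambda>z. of_real (jbracket z powr s) * fock_fun (u t) z) \<in> L2"
    using weight_propagation(1)[OF _ u kl(3) nv] init by simp
  show "s > 0 \<Longrightarrow> (\<lambda>z. of_real (jbracket z powr s) * fock_fun v0 z) \<in> L2 \<Longrightarrow>
      (\<lambda>z. of_real (jbracket z powr s) * fock_fun (v t) z) \<in> L2"
    using weight_propagation(1)[OF _ v kl(4) nu] init by simp
qed

text \<open>Both components are driven by \<open>- \<i>\<close> times a projected cubic term, the second
  with an additional factor \<open>\<sigma>\<close>. Since \<open>\<sigma>\<^sup>2 = 1\<close>,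
  weighting its moment by \<open>\<sigma>\<close> restores the symmetry that the balance laws
  require.\<close>

lemma solution_moments:
  assumes \<sigma>: "\<sigma> \<in> {1, -1}" and sol: "is_solution \<sigma> u0 v0 u v" and fm: "finite_moment u0" "finite_moment v0"
  shows "finite_moment (u t)" "finite_moment (v t)"
    and "wform Re (u t) (u t) + \<sigma> * wform Re (v t) (v t) = wform Re u0 u0 + \<sigma> * wform Re v0 v0"
    and "wform Im (u t) (u t) + \<sigma> * wform Im (v t) (v t) = wform Im u0 u0 + \<sigma> * wform Im v0 v0"
    and "wform (\<lambda>z. (norm z)\<^sup>2 - 1) (u t) (u t) + \<sigma> * wform (\<lambda>z. (norm z)\<^sup>2 - 1) (v t) (v t)
      = wform (\<lambda>z. (norm z)\<^sup>2 - 1) u0 u0 + \<sigma> * wform (\<lambda>z. (norm z)\<^sup>2 - 1) v0 v0"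
proof -
  let ?k = "- \<i> * of_real 1" and ?l = "- \<i> * of_real \<sigma>"
  have u: "\<And>t. (u has_vector_derivative fock_cmult ?k (cubic (v t) (v t) (u t))) (at t)"
    and v: "\<And>t. (v has_vector_derivative fock_cmult ?l (cubic (u t) (u t) (v t))) (at t)"
    and init: "u 0 = u0" "v 0 = v0"
    using sol unfolding is_solution_iff by auto
  have kl: "Re ?k = 0" "Re ?l = 0" "norm ?k \<le> 1" "norm ?l \<le> 1" using \<sigma> by (auto simp: norm_mult)
  have \<sigma>2: "\<sigma> * (\<sigma> * c) = c" for c using \<sigma> by auto
  have nu: "norm (u t) = norm u0" and nv: "norm (v t) = norm v0" for t
    using mass_conservation[OF u kl(1)] mass_conservation[OF v kl(2)] init by blast+
  show fu: "finite_moment (u t)" and fv: "finite_moment (v t)" for t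
    using moment_growth(1)[OF u kl(3) nv] moment_growth(1)[OF v kl(4) nu] fm init by auto
  note cons = moment_conservation[OF u v kl, unfolded init, OF fm]
  show "wform Re (u t) (u t) + \<sigma> * wform Re (v t) (v t) = wform Re u0 u0 + \<sigma> * wform Re v0 v0"
  proof (rule cons)
    show "\<bar>Re z\<bar> \<le> (jbracket z)\<^sup>2" for z using abs_Re_le_cmod norm_le_jbracket_square order_trans by blast
    show "wform Re (fock_cmult ?k (cubic (v t) (v t) (u t))) (u t) + \<sigma> * wform Re (fock_cmult ?l (cubic (u t) (u t) (v t))) (v t) = 0" for t
      using momentum_balance(1)[OF fu fv, of t t] unfolding wform_imaginary \<sigma>2 by simp
  qed simp
  show "wform Im (u t) (u t) + \<sigma> * wform Im (v t) (v t) = wform Im u0 u0 + \<sigma> * wform Im v0 v0"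
  proof (rule cons)
    show "\<bar>Im z\<bar> \<le> (jbracket z)\<^sup>2" for z using abs_Im_le_cmod norm_le_jbracket_square order_trans by blast
    show "wform Im (fock_cmult ?k (cubic (v t) (v t) (u t))) (u t) + \<sigma> * wform Im (fock_cmult ?l (cubic (u t) (u t) (v t))) (v t) = 0" for t
      using momentum_balance(2)[OF fu fv, of t t] unfolding wform_imaginary \<sigma>2 by simp
  qed simp
  show "wform (\<lambda>z. (norm z)\<^sup>2 - 1) (u t) (u t) + \<sigma> * wform (\<lambda>z. (norm z)\<^sup>2 - 1) (v t) (v t)
      = wform (\<lambda>z. (norm z)\<^sup>2 - 1) u0 u0 + \<sigma> * wform (\<lambda>z. (norm z)\<^sup>2 - 1) v0 v0"
  proof (rule cons)
    show "\<bar>(norm z)\<^sup>2 - 1\<bar> \<le> (jbracket z)\<^sup>2" for z :: complex unfolding jbracket_square by (simp add: abs_le_iff)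
    show "wform (\<lambda>z. (norm z)\<^sup>2 - 1) (fock_cmult ?k (cubic (v t) (v t) (u t))) (u t)
        + \<sigma> * wform (\<lambda>z. (norm z)\<^sup>2 - 1) (fock_cmult ?l (cubic (u t) (u t) (v t))) (v t) = 0" for t
      using angular_momentum_balance[OF fu fv, of t t] unfolding wform_imaginary \<sigma>2 by simp
  qed simp
qed

lemma real_moment_eq_wform:
  assumes "finite_moment u" "finite_moment v" and [measurable]: "m \<in> borel_measurable borel" and "\<And>z. \<bar>m z\<bar> \<le> (jbracket z)\<^sup>2"
  shows "integrable lborel (\<lambda>z. m z * ((norm (fock_fun u z))\<^sup>2 + \<sigma> * (norm (fock_fun v z))\<^sup>2))"
    and "(\<integral>z. m z * ((norm (fock_fun u z))\<^sup>2 + \<sigma> * (norm (fock_fun v z))\<^sup>2) \<partial>lborel) = wform m u u + \<sigma> * wform m v v"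
proof -
  have eq: "m z * ((norm (fock_fun u z))\<^sup>2 + \<sigma> * (norm (fock_fun v z))\<^sup>2)
      = m z * inner (fock_fun u z) (fock_fun u z) + \<sigma> * (m z * inner (fock_fun v z) (fock_fun v z))" for z
    by (simp add: power2_norm_eq_inner algebra_simps)
  note iu = wform_moment_integrable[OF assms(1,1,3,4)] and iv = wform_moment_integrable[OF assms(2,2,3,4)]
  show "integrable lborel (\<lambda>z. m z * ((norm (fock_fun u z))\<^sup>2 + \<sigma> * (norm (fock_fun v z))\<^sup>2))"
    unfolding eq by (rule Bochner_Integration.integrable_add[OF iu integrable_mult_right[OF iv]])
  show "(\<integral>z. m z * ((norm (fock_fun u z))\<^sup>2 + \<sigma> * (norm (fock_fun v z))\<^sup>2) \<partial>lborel) = wform m u u + \<sigma> * wform m v v"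
    unfolding eq wform_def
    by (simp only: Bochner_Integration.integral_add[OF iu integrable_mult_right[OF iv]] integral_mult_right_zero)
qed

lemma complex_moment_eq_wform:
  assumes "finite_moment u" "finite_moment v"
  shows "(\<integral>z. z * of_real ((norm (fock_fun u z))\<^sup>2 + \<sigma> * (norm (fock_fun v z))\<^sup>2) \<partial>lborel)
    = Complex (wform Re u u + \<sigma> * wform Re v v) (wform Im u u + \<sigma> * wform Im v v)"
proof -
  let ?f = "\<lambda>z. (norm (fock_fun u z))\<^sup>2 + \<sigma> * (norm (fock_fun v z))\<^sup>2"
  have bd: "\<bar>Re z\<bar> \<le> (jbracket z)\<^sup>2" "\<bar>Im z\<bar> \<le> (jbracket z)\<^sup>2" for z
    using abs_Re_le_cmod abs_Im_le_cmod norm_le_jbracket_square order_trans by blast+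
  note R = real_moment_eq_wform[OF assms _ bd(1), of \<sigma>] and I = real_moment_eq_wform[OF assms _ bd(2), of \<sigma>]
  have eq: "z * of_real (?f z) = of_real (Re z * ?f z) + \<i> * of_real (Im z * ?f z)" for z
    by (simp add: complex_eq_iff)
  have iR: "integrable lborel (\<lambda>z. complex_of_real (Re z * ?f z))"
    and iI: "integrable lborel (\<lambda>z. \<i> * complex_of_real (Im z * ?f z))"
    using R(1) I(1) by (intro integrable_of_real integrable_mult_right; simp)+
  have "(\<integral>z. z * of_real (?f z) \<partial>lborel) = (\<integral>z. complex_of_real (Re z * ?f z) \<partial>lborel) + (\<integral>z. \<i> * complex_of_real (Im z * ?f z) \<partial>lborel)"
    unfolding eq by (rule Bochner_Integration.integral_add[OF iR iI])
  also have "\<dots> = of_real (\<integral>z. Re z * ?f z \<partial>lborel) + \<i> * of_real (\<integral>z. Im z * ?f z \<partial>lborel)"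
    by (simp only: integral_mult_right_zero integral_complex_of_real)
  finally show ?thesis using R(2) I(2) by (simp add: Complex_eq)
qed

lemma solution_exists_unique_smooth:
  obtains \<Phi> :: "real \<times> fock \<times> fock \<Rightarrow> fock \<times> fock" where "C_infinity \<Phi>"
    "\<And>u0 v0. is_solution \<sigma> u0 v0 (\<lambda>t. fst (\<Phi> (t, u0, v0))) (\<lambda>t. snd (\<Phi> (t, u0, v0)))"
    "\<And>u0 v0 u v t. is_solution \<sigma> u0 v0 u v \<Longrightarrow> (u t, v t) = \<Phi> (t, u0, v0)"
proof -
  obtain \<Phi> :: "real \<times> fock \<times> fock \<Rightarrow> fock \<times> fock" where \<Phi>: "C_infinity \<Phi>" "\<And>x. \<Phi> (0, x) = x"
    "\<And>x t. ((\<lambda>t. \<Phi> (t, x)) has_vector_derivative nls_form \<sigma> (\<Phi> (t, x)) (\<Phi> (t, x)) (\<Phi> (t, x))) (at t)"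
    "\<And>X t. (\<And>t. (X has_vector_derivative nls_form \<sigma> (X t) (X t) (X t)) (at t)) \<Longrightarrow> X t = \<Phi> (t, X 0)"
    using nls_flow[of \<sigma>] by blast
  show thesis
  proof (rule that[OF \<Phi>(1)])
    fix u0 v0
    have "C_infinity (\<lambda>t. \<Phi> ((0, u0, v0) + (t, 0)))"
      by (rule C_infinity_affine[OF \<Phi>(1), of "\<lambda>t. (t, 0)"]) (auto intro!: linearI)
    then have smooth: "C_infinity (\<lambda>t. (fst (\<Phi> (t, u0, v0)), snd (\<Phi> (t, u0, v0))))" by (simp add: zero_prod_def)
    have "((\<lambda>t. (fst (\<Phi> (t, u0, v0)), snd (\<Phi> (t, u0, v0)))) has_vector_derivative
        nls_form \<sigma> (\<Phi> (t, u0, v0)) (\<Phi> (t, u0, v0)) (\<Phi> (t, u0, v0))) (at t)" for t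
      using \<Phi>(3)[of "(u0, v0)" t] by simp
    then show "is_solution \<sigma> u0 v0 (\<lambda>t. fst (\<Phi> (t, u0, v0))) (\<lambda>t. snd (\<Phi> (t, u0, v0)))"
      unfolding is_solution_iff nls_form_def has_vector_derivative_Pair_iff using smooth \<Phi>(2) by simp
  next
    fix u0 v0 u v t
    assume "is_solution \<sigma> u0 v0 u v"
    then have "((\<lambda>t. (u t, v t)) has_vector_derivative nls_form \<sigma> (u t, v t) (u t, v t) (u t, v t)) (at t)"
      and "u 0 = u0" "v 0 = v0" for t
      unfolding is_solution_iff nls_form_def has_vector_derivative_Pair_iff by simp_all
    then show "(u t, v t) = \<Phi> (t, u0, v0)" using \<Phi>(4)[of "\<lambda>t. (u t, v t)" t] by simp
  qed
qed

theorem theorem1p1: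
  fixes \<sigma> :: real
  assumes "\<sigma> \<in> {1, -1}"
  shows
    "(\<forall>u0 v0. \<exists>!p. is_solution \<sigma> u0 v0 (fst p) (snd p)) \<and>
     (\<exists>\<Phi> :: real \<times> fock \<times> fock \<Rightarrow> fock \<times> fock. C_infinity \<Phi> \<and>
        (\<forall>u0 v0. is_solution \<sigma> u0 v0 (\<lambda>t. fst (\<Phi> (t, u0, v0))) (\<lambda>t. snd (\<Phi> (t, u0, v0))))) \<and>
     (\<forall>u0 v0 u v. is_solution \<sigma> u0 v0 u v \<longrightarrow>
        (\<forall>t.
          (\<integral>z. (norm (fock_fun (u t) z))\<^sup>2 \<partial>lborel) = (\<integral>z. (norm (fock_fun u0 z))\<^sup>2 \<partial>lborel) \<and>
          (\<integral>z. (norm (fock_fun (v t) z))\<^sup>2 \<partial>lborel) = (\<integral>z. (norm (fock_fun v0 z))\<^sup>2 \<partial>lborel) \<and>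
          (\<integral>z. (norm (fock_fun (u t) z))\<^sup>2 * (norm (fock_fun (v t) z))\<^sup>2 \<partial>lborel) =
            (\<integral>z. (norm (fock_fun u0 z))\<^sup>2 * (norm (fock_fun v0 z))\<^sup>2 \<partial>lborel)) \<and>
        ((\<lambda>z. z * fock_fun u0 z) \<in> L2 \<and> (\<lambda>z. z * fock_fun v0 z) \<in> L2 \<longrightarrow>
         (\<forall>t.
          (\<lambda>z. z * fock_fun (u t) z) \<in> L2 \<and> (\<lambda>z. z * fock_fun (v t) z) \<in> L2 \<and>
          (\<integral>z. ((norm z)\<^sup>2 - 1) *
              ((norm (fock_fun (u t) z))\<^sup>2 + \<sigma> * (norm (fock_fun (v t) z))\<^sup>2) \<partial>lborel) =
            (\<integral>z. ((norm z)\<^sup>2 - 1) *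
              ((norm (fock_fun u0 z))\<^sup>2 + \<sigma> * (norm (fock_fun v0 z))\<^sup>2) \<partial>lborel) \<and>
          (\<integral>z. z * of_real
              ((norm (fock_fun (u t) z))\<^sup>2 + \<sigma> * (norm (fock_fun (v t) z))\<^sup>2) \<partial>lborel) =
            (\<integral>z. z * of_real
              ((norm (fock_fun u0 z))\<^sup>2 + \<sigma> * (norm (fock_fun v0 z))\<^sup>2) \<partial>lborel))) \<and>
        (\<forall>s>0.
          (\<lambda>z. of_real (jbracket z powr s) * fock_fun u0 z) \<in> L2 \<and>
          (\<lambda>z. of_real (jbracket z powr s) * fock_fun v0 z) \<in> L2 \<longrightarrow>
          (\<forall>t.
            (\<lambda>z. of_real (jbracket z powr s) * fock_fun (u t) z) \<in> L2 \<and>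
            (\<lambda>z. of_real (jbracket z powr s) * fock_fun (v t) z) \<in> L2)))"
proof -
  obtain \<Phi> :: "real \<times> fock \<times> fock \<Rightarrow> fock \<times> fock" where \<Phi>: "C_infinity \<Phi>"
    "\<And>u0 v0. is_solution \<sigma> u0 v0 (\<lambda>t. fst (\<Phi> (t, u0, v0))) (\<lambda>t. snd (\<Phi> (t, u0, v0)))"
    "\<And>u0 v0 u v t. is_solution \<sigma> u0 v0 u v \<Longrightarrow> (u t, v t) = \<Phi> (t, u0, v0)"
    using solution_exists_unique_smooth[of \<sigma>] by blast
  have m: "\<bar>(norm z)\<^sup>2 - 1\<bar> \<le> (jbracket z)\<^sup>2" for z :: complex
    unfolding jbracket_square by (simp add: abs_le_iff)
  have unique: "\<exists>!p. is_solution \<sigma> u0 v0 (fst p) (snd p)" for u0 v0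
  proof (rule ex1I[of _ "(\<lambda>t. fst (\<Phi> (t, u0, v0)), \<lambda>t. snd (\<Phi> (t, u0, v0)))"])
    show "is_solution \<sigma> u0 v0 (fst (\<lambda>t. fst (\<Phi> (t, u0, v0)), \<lambda>t. snd (\<Phi> (t, u0, v0))))
        (snd (\<lambda>t. fst (\<Phi> (t, u0, v0)), \<lambda>t. snd (\<Phi> (t, u0, v0))))" using \<Phi>(2) by simp
    fix p assume "is_solution \<sigma> u0 v0 (fst p) (snd p)"
    from \<Phi>(3)[OF this, symmetric] show "p = (\<lambda>t. fst (\<Phi> (t, u0, v0)), \<lambda>t. snd (\<Phi> (t, u0, v0)))"
      by (simp add: prod_eq_iff)
  qed
  have moments: "(\<lambda>z. z * fock_fun (u t) z) \<in> L2 \<and> (\<lambda>z. z * fock_fun (v t) z) \<in> L2 \<and>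
      (\<integral>z. ((norm z)\<^sup>2 - 1) * ((norm (fock_fun (u t) z))\<^sup>2 + \<sigma> * (norm (fock_fun (v t) z))\<^sup>2) \<partial>lborel) =
        (\<integral>z. ((norm z)\<^sup>2 - 1) * ((norm (fock_fun u0 z))\<^sup>2 + \<sigma> * (norm (fock_fun v0 z))\<^sup>2) \<partial>lborel) \<and>
      (\<integral>z. z * of_real ((norm (fock_fun (u t) z))\<^sup>2 + \<sigma> * (norm (fock_fun (v t) z))\<^sup>2) \<partial>lborel) =
        (\<integral>z. z * of_real ((norm (fock_fun u0 z))\<^sup>2 + \<sigma> * (norm (fock_fun v0 z))\<^sup>2) \<partial>lborel)"
    if sol: "is_solution \<sigma> u0 v0 u v" and "(\<lambda>z. z * fock_fun u0 z) \<in> L2" "(\<lambda>z. z * fock_fun v0 z) \<in> L2" for u0 v0 u v t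
  proof -
    have fm: "finite_moment u0" "finite_moment v0" using that by (simp_all add: finite_moment_def)
    note sm = solution_moments[OF assms sol fm, of t]
    have meas: "(\<lambda>z::complex. (norm z)\<^sup>2 - 1) \<in> borel_measurable borel" by measurable
    show ?thesis
      unfolding real_moment_eq_wform(2)[OF sm(1,2) meas m] real_moment_eq_wform(2)[OF fm meas m]
        complex_moment_eq_wform[OF sm(1,2)] complex_moment_eq_wform[OF fm] sm(3,4,5)
      using sm(1,2) by (simp add: finite_moment_def)
  qed
  show ?thesis
  proof (intro conjI allI exI[of _ \<Phi>] impI unique \<Phi>(1,2), goal_cases)
    case 1 then show ?case by (blast intro: solution_conservation(1)[OF assms])
  next
    case 2 then show ?case by (blast intro: solution_conservation(2)[OF assms])
  next
    case 3 then show ?case by (blast intro: solution_conservation(3)[OF assms])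
  next
    case 4 then show ?case by (blast dest: moments)
  next
    case 5 then show ?case by (blast dest: moments)
  next
    case 6 then show ?case by (elim conjE) (rule moments[THEN conjunct2, THEN conjunct2, THEN conjunct1])
  next
    case 7 then show ?case by (elim conjE) (rule moments[THEN conjunct2, THEN conjunct2, THEN conjunct2])
  next
    case 8 then show ?case by (elim conjE) (rule solution_conservation(4)[OF assms])
  next
    case 9 then show ?case by (elim conjE) (rule solution_conservation(5)[OF assms])
  qed
qed

end
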